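(* Let $p$ be a prime and let $f_1,\dots,f_r\in x\overline{\mathbb{F}}_p[x]$ be nonzero. Assume that one of the following two conditions holds: (1) the primitive parts $f_1^{*},\dots,f_r^{*}$ are linearly independent over $\mathbb{F}_p$; (2) the $f_i^{*}$ are not all zero, and whenever integers $n_1,\dots,n_r$ are such that $f_1^{n_1}\cdots f_r^{n_r}\in\mathbb{F}_p(x)^p$, we have $n_1,\dots,n_r\in p\mathbb{Z}$. Then $\overline{E}_p(f_1),\dots,\overline{E}_p(f_r)$ are algebraically independent over $\mathbb{F}_p[x]$.
   Context: $\overline{E}_p(x)\in\mathbb{F}_p[[x]]$ denotes the reduction modulo $p$ of the Artin–Hasse exponential $E_p(x)=\exp\left(\sum_{n\ge0}x^{p^n}/p^n\right)\in\mathbb{Z}_{(p)}[[x]]$; for $f\in x\overline{\mathbb{F}}_p[x]$, $\overline{E}_p(f)\in\overline{\mathbb{F}}_p[[x]]$ is the series obtained by substituting $f$ for $x$. For $f(x)=\sum_i c_ix^i\in\overline{\mathbb{F}}_p[x]$, its primitive part is $f^{*}(x)=\sum_{i\ge0,\ p\nmid i} c_i^{*}(f)x^i$, where $c_i^{*}(f)=\sum_{k\ge0} c_{ip^k}^{1/p^k}$ (with $c^{1/p^k}$ the unique $p^k$-th root in $\overline{\mathbb{F}}_p$). *)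

theory Defs
  imports
    "Berlekamp_Zassenhaus.Finite_Field"
    "HOL-Algebra.Algebraic_Closure_Type"
    "HOL-Computational_Algebra.Computational_Algebra"
    "HOL-Library.Poly_Mapping"
begin

text \<open>
  A type \<open>'p :: prime_card\<close> stands for the prime $p = $ \<open>CARD('p)\<close>; \<open>'p mod_ring\<close> is
  $\mathbb{F}_p$ and \<open>'p mod_ring alg_closure\<close> is $\overline{\mathbb{F}}_p$, with embedding
  \<open>to_ac\<close>.
\<close>

type_synonym 'p Fpbar = "'p mod_ring alg_closure"

definition artin_hasse :: "nat \<Rightarrow> rat fps" where
  "artin_hasse p =
     fps_compose (fps_exp 1) (Abs_fps (\<lambda>m. if \<exists>n. m = p ^ n then 1 / of_nat m else 0))"

text \<open>
  The reduction map $\mathbb{Z}_{(p)} \to \mathbb{F}_p$, applied to a fraction in lowest terms.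
  Its value is meaningless on rationals outside $\mathbb{Z}_{(p)}$, but the coefficients of
  $E_p$ lie in $\mathbb{Z}_{(p)}$.
\<close>

definition reduce_rat :: "rat \<Rightarrow> 'p :: prime_card mod_ring" where
  "reduce_rat q = (case quotient_of q of (a, b) \<Rightarrow> of_int a / of_int b)"

definition artin_hasse_mod :: "'p :: prime_card mod_ring fps" where
  "artin_hasse_mod = Abs_fps (\<lambda>n. reduce_rat (fps_nth (artin_hasse CARD('p)) n))"

definition artin_hasse_subst :: "'p :: prime_card Fpbar poly \<Rightarrow> 'p Fpbar fps" where
  "artin_hasse_subst f =
     fps_compose (Abs_fps (\<lambda>n. to_ac (fps_nth artin_hasse_mod n))) (fps_of_poly f)"

definition frob_root :: "nat \<Rightarrow> 'p :: prime_card Fpbar \<Rightarrow> 'p Fpbar" where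
  "frob_root k c = (THE y. y ^ (CARD('p) ^ k) = c)"

lemma frob_root_ex1:
  fixes c :: "'p :: prime_card Fpbar"
  shows "\<exists>!y. y ^ (CARD('p) ^ k) = c"
proof (rule ex_ex1I)
  have pos: "CARD('p) ^ k > 0"
    using prime_card[where 'a = 'p] by (simp add: prime_gt_0_nat)
  let ?q = "Polynomial.monom 1 (CARD('p) ^ k) - [:c:] :: 'p Fpbar poly"
  have "Polynomial.coeff ?q (CARD('p) ^ k) = 1"
    using pos by (simp add: coeff_pCons split: nat.splits)
  hence "Polynomial.degree ?q \<ge> CARD('p) ^ k"
    by (intro le_degree) simp
  with pos have "Polynomial.degree ?q > 0" by linarith
  then obtain y where "poly ?q y = 0"
    using alg_closed_imp_poly_has_root by blast
  thus "\<exists>y. y ^ (CARD('p) ^ k) = c"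
    by (auto simp: poly_monom)
next
  fix y z :: "'p Fpbar"
  assume *: "y ^ (CARD('p) ^ k) = c" "z ^ (CARD('p) ^ k) = c"
  have ch: "CHAR('p Fpbar) = CARD('p)" by simp
  have "((y - z) + z) ^ (CARD('p) ^ k) = (y - z) ^ (CARD('p) ^ k) + z ^ (CARD('p) ^ k)"
    by (rule freshmans_dream') (simp_all add: prime_card)
  with * have "(y - z) ^ (CARD('p) ^ k) = 0" by simp
  thus "y = z" by simp
qed

lemma frob_root_power:
  fixes c :: "'p :: prime_card Fpbar"
  shows "frob_root k c ^ (CARD('p) ^ k) = c"
  unfolding frob_root_def by (rule theI'[OF frob_root_ex1])

text \<open>
  The sum over all $k \ge 0$ may be truncated at the degree $d$ of $f$: for $i \ge 1$ and $k > d$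
  one has $i p^k > d$.
\<close>

definition frob_primitive_coeff :: "'p :: prime_card Fpbar poly \<Rightarrow> nat \<Rightarrow> 'p Fpbar" where
  "frob_primitive_coeff f i =
     (\<Sum>k\<le>Polynomial.degree f. frob_root k (Polynomial.coeff f (i * CARD('p) ^ k)))"

definition frob_primitive_part :: "'p :: prime_card Fpbar poly \<Rightarrow> 'p Fpbar poly" where
  "frob_primitive_part f =
     (\<Sum>i | i \<le> Polynomial.degree f \<and> \<not> CARD('p) dvd i.
        Polynomial.monom (frob_primitive_coeff f i) i)"

global_interpretation Fp: vector_space
  "\<lambda>(a :: 'p :: prime_card mod_ring) (g :: 'p Fpbar poly). Polynomial.smult (to_ac a) g"
  by unfold_locales (simp_all add: smult_add_right smult_add_left)

text \<open>
  Linear independence of a family, in which repetitions are not allowed.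
\<close>

definition Fp_lin_independent :: "nat \<Rightarrow> (nat \<Rightarrow> 'p :: prime_card Fpbar poly) \<Rightarrow> bool" where
  "Fp_lin_independent r g \<longleftrightarrow> inj_on g {..<r} \<and> Fp.independent (g ` {..<r})"

lemma Fp_lin_independent_iff:
  fixes g :: "nat \<Rightarrow> 'p :: prime_card Fpbar poly"
  shows "Fp_lin_independent r g \<longleftrightarrow>
     (\<forall>a. (\<Sum>i<r. Polynomial.smult (to_ac (a i)) (g i)) = 0 \<longrightarrow> (\<forall>i<r. a i = 0))"
  (is "_ \<longleftrightarrow> ?R")
proof
  assume L: "Fp_lin_independent r g"
  show ?R
  proof (intro allI impI)
    fix a i assume s: "(\<Sum>i<r. Polynomial.smult (to_ac (a i)) (g i)) = 0" and "i < r"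
    let ?b = "\<lambda>v. a (the_inv_into {..<r} g v)"
    have inj: "inj_on g {..<r}" and ind: "Fp.independent (g ` {..<r})"
      using L by (auto simp: Fp_lin_independent_def)
    have "(\<Sum>v\<in>g ` {..<r}. Polynomial.smult (to_ac (?b v)) v) = 0"
      using s inj by (subst sum.reindex) (auto simp: the_inv_into_f_f intro!: sum.cong)
    hence "?b (g i) = 0"
      using ind \<open>i < r\<close> by (auto simp: Fp.dependent_finite)
    thus "a i = 0" using inj \<open>i < r\<close> by (simp add: the_inv_into_f_f)
  qed
next
  assume R: ?R
  have inj: "inj_on g {..<r}"
  proof (rule inj_onI, rule ccontr)
    fix i j assume ij: "i \<in> {..<r}" "j \<in> {..<r}" "g i = g j" "i \<noteq> j"
    let ?a = "\<lambda>k. if k = i then 1 else if k = j then - 1 else 0 :: 'p mod_ring"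
    have "(\<Sum>k<r. Polynomial.smult (to_ac (?a k)) (g k))
        = (\<Sum>k\<in>{i, j}. Polynomial.smult (to_ac (?a k)) (g k))"
      using ij by (intro sum.mono_neutral_right) auto
    also have "\<dots> = 0" using ij by simp
    finally have "\<forall>k<r. ?a k = 0" using R by (elim allE[where x = ?a]) (rule mp)
    with ij(1) have "?a i = 0" by blast
    thus False by simp
  qed
  moreover have "Fp.independent (g ` {..<r})"
  proof
    assume "Fp.dependent (g ` {..<r})"
    then obtain b where b: "\<exists>v\<in>g ` {..<r}. b v \<noteq> 0"
      and s: "(\<Sum>v\<in>g ` {..<r}. Polynomial.smult (to_ac (b v)) v) = 0"
      by (auto simp: Fp.dependent_finite)
    have "(\<Sum>i<r. Polynomial.smult (to_ac (b (g i))) (g i)) = 0"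
      using s inj by (subst (asm) sum.reindex) auto
    with R have "\<forall>i<r. b (g i) = 0" by (elim allE[where x = "\<lambda>i. b (g i)"]) simp
    with b show False by auto
  qed
  ultimately show "Fp_lin_independent r g" by (simp add: Fp_lin_independent_def)
qed

text \<open>$\mathbb{F}_p(x)$ as a subset of $\overline{\mathbb{F}}_p(x)$.\<close>

definition Fp_ratfuns :: "'p :: prime_card Fpbar poly fract set" where
  "Fp_ratfuns =
     {Fraction_Field.Fract (map_poly to_ac a) (map_poly to_ac b) | a b. b \<noteq> 0}"

text \<open>
  Algebraic independence of \<open>y 0, \<dots>, y (r - 1)\<close> over a ring acting through the ring homomorphism
  \<open>h\<close>. A polynomial is a finitely supported map from exponent vectors to coefficients.
\<close>

definition alg_independent ::
    "('c :: comm_ring_1 \<Rightarrow> 'b :: comm_ring_1) \<Rightarrow> nat \<Rightarrow> (nat \<Rightarrow> 'b) \<Rightarrow> bool" where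
  "alg_independent h r y \<longleftrightarrow>
     (\<forall>Q :: (nat \<Rightarrow>\<^sub>0 nat) \<Rightarrow>\<^sub>0 'c.
        (\<forall>m\<in>Poly_Mapping.keys Q. Poly_Mapping.keys m \<subseteq> {..<r}) \<longrightarrow>
        (\<Sum>m\<in>Poly_Mapping.keys Q. h (Poly_Mapping.lookup Q m) *
           (\<Prod>i<r. y i ^ Poly_Mapping.lookup m i)) = 0 \<longrightarrow>
        Q = 0)"

end

theory Submission
  imports Defs
begin

text \<open>
  The substitution $x \mapsto x(1+v)$ multiplies $y_i = E(f_i)$ by a series in $v$ whose coefficients are
  algebraic over $k(x)$, where $k = \overline{\mathbb{F}}_p$. Kolchin's argument therefore turns an algebraic
  relation into a monomial $\prod y_i^{n_i}$, with not all $n_i$ zero, that is algebraic over $k(x)$. Up to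
  factors with coefficients in $k(x)$, the quotients $E(Fc)/E(F)$ are multiplicative in $c$ and do not change
  when $F$ is replaced by $F^p$, because the Artin--Hasse coefficients satisfy $p$-adic congruences.
  Hence a root $\alpha$ of $f_i$ of multiplicity $m_{i\alpha}$ contributes
  $\beta_i(\tau_\alpha v)^{m_{i\alpha}}$ with $\beta_i(v) = E(f_i(1+v))/E(f_i)$ and
  $\tau_\alpha = x/(x-\alpha)$, and comparing all Frobenius twists separates the roots: the series
  $\prod_i \beta_i^{n_i m_{i\alpha}}$ has coefficients in $k(x)$ for every $\alpha$. The coefficient of $v$ in
  $\beta_i$ is a solution of $G - G^p = f_i$. Under condition (1), $\alpha = 0$ gives an Artin--Schreier
  relation between the $f_i$, which forces all $n_i$ to vanish. Under condition (2) the multiplicity vectors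
  are independent, so some $\beta_i$ has coefficients in $k(x)$; by Frobenius descent to $k(f_i)$ the
  equation $R - R^p = X^{p^e}$ is then solvable in $k(X)$, which is absurd.
\<close>

text \<open>In characteristic p a derivation kills all p-th powers, so the substitution is kept
  whole, as a series in v: quotients that it fixes are constants of k, and its coefficients do not
  leave a finite extension of k(x). The congruences come from E(Xc)/E(X) = exp(sum of X^(p^i)
  (c^(p^i) - 1)/p^i) over the rationals, where (c^(p^i) - 1)/p^i tends p-adically to log c. In
  E(Xcd)E(X)/(E(Xc)E(Xd)) and in E(Xc)E(X^p)/(E(X)E(X^p c)) these limits cancel, so in each bounded
  degree in c - 1 and d - 1 the coefficient of X^n is divisible by p for large n. Modulo p such a
  product is, degree by degree, a polynomial in X and can be evaluated at a rational function
  without leaving k(x). A further obstacle: under condition (2) a single f_i may have primitive part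
  0, and then the first coefficient of \<beta>_i may well lie in k(x). The contradiction has to be
  sought in the smaller field k(f_i), over which f_i is a free variable.\<close>

hide_const (open) Divisibility.prime Divisibility.irreducible Polynomials.degree Polynomials.lead_coeff

section \<open>Rational numbers integral at a prime\<close>

text \<open>The localisation Z_(p). Any fraction with denominator prime to p is accepted as a
  witness, so closure under sums and products is cross-multiplication; \<open>reduce_rat\<close>
  insists on lowest terms and is matched with this by \<open>reduce_rat_of_frac\<close>.\<close>

definition p_integral :: "nat \<Rightarrow> rat \<Rightarrow> bool" where
  "p_integral p q \<longleftrightarrow> (\<exists>a b :: int. \<not> int p dvd b \<and> q = of_int a / of_int b)"

lemma p_integral_of_int [simp]: "p \<noteq> 1 \<Longrightarrow> p_integral p (of_int a)"
  unfolding p_integral_def by (rule exI[of _ a], rule exI[of _ 1]) auto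

lemma p_integral_of_nat [simp]: "p \<noteq> 1 \<Longrightarrow> p_integral p (of_nat a)"
  using p_integral_of_int[of p "int a"] by simp

lemma p_integral_0 [simp]: "p \<noteq> 1 \<Longrightarrow> p_integral p 0"
  using p_integral_of_int[of p 0] by simp

lemma p_integral_1 [simp]: "p \<noteq> 1 \<Longrightarrow> p_integral p 1"
  using p_integral_of_int[of p 1] by simp

lemma p_integral_add:
  assumes p: "prime p" and "p_integral p x" "p_integral p y"
  shows "p_integral p (x + y)"
proof -
  obtain a b c d :: int where *: "\<not> int p dvd b" "x = of_int a / of_int b"
    "\<not> int p dvd d" "y = of_int c / of_int d"
    using assms unfolding p_integral_def by blast
  have "b \<noteq> 0" "d \<noteq> 0" using * by auto
  hence "x + y = of_int (a * d + c * b) / of_int (b * d)"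
    using * by (simp add: field_simps)
  moreover have "\<not> int p dvd b * d"
    using * p by (metis prime_dvd_multD prime_nat_int_transfer)
  ultimately show ?thesis unfolding p_integral_def by blast
qed

lemma p_integral_mult:
  assumes p: "prime p" and "p_integral p x" "p_integral p y"
  shows "p_integral p (x * y)"
proof -
  obtain a b c d :: int where *: "\<not> int p dvd b" "x = of_int a / of_int b"
    "\<not> int p dvd d" "y = of_int c / of_int d"
    using assms unfolding p_integral_def by blast
  have "x * y = of_int (a * c) / of_int (b * d)" using * by simp
  moreover have "\<not> int p dvd b * d"
    using * p by (metis prime_dvd_multD prime_nat_int_transfer)
  ultimately show ?thesis unfolding p_integral_def by blast
qed

lemma p_integral_uminus: "p_integral p x \<Longrightarrow> p_integral p (- x)"
  unfolding p_integral_def by (metis minus_divide_left of_int_minus)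

lemma p_integral_diff: "prime p \<Longrightarrow> p_integral p x \<Longrightarrow> p_integral p y \<Longrightarrow> p_integral p (x - y)"
  using p_integral_add[of p x "- y"] p_integral_uminus[of p y] by simp

lemma p_integral_sum: "prime p \<Longrightarrow> (\<And>i. i \<in> A \<Longrightarrow> p_integral p (f i)) \<Longrightarrow> p_integral p (sum f A)"
  by (induction A rule: infinite_finite_induct) (auto simp: p_integral_add prime_nat_iff)

lemma p_integral_divide_of_nat:
  assumes "prime p" "p_integral p x" "\<not> p dvd n"
  shows "p_integral p (x / of_nat n)"
proof -
  have "p_integral p (1 / of_nat n)"
    unfolding p_integral_def using assms(3)
    by (intro exI[of _ 1] exI[of _ "int n"]) auto
  from p_integral_mult[OF assms(1,2) this] show ?thesis by simp
qed

text \<open>If p^k divides n exactly, then k < p^k \<le> n, so p^n outweighs the p-part of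
  n.\<close>

lemma p_integral_power_div:
  assumes p: "prime p" and "n > 0"
  shows "p_integral p (of_nat (p ^ n) / of_nat n)"
proof -
  obtain k m where km: "n = p ^ k * m" "\<not> p dvd m"
    using prime_power_canonical[OF assms] by (auto simp: mult.commute)
  have "k \<le> n"
  proof -
    have "k < p ^ k" using power_gt_expt[of p k] prime_gt_1_nat[OF p] by simp
    also have "\<dots> \<le> n" using km \<open>n > 0\<close> by (cases m) auto
    finally show ?thesis by simp
  qed
  hence "of_nat (p ^ n) / of_nat n = (of_nat (p ^ (n - k)) :: rat) / of_nat m"
  proof -
    have "of_nat p \<noteq> (0 :: rat)" "of_nat m \<noteq> (0 :: rat)" using km p \<open>n > 0\<close> by auto
    moreover have "p ^ n = p ^ (n - k) * p ^ k" using \<open>k \<le> n\<close> by (simp flip: power_add)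
    ultimately show ?thesis by (subst (2) km(1)) simp
  qed
  moreover have "p \<noteq> 1" using p by auto
  ultimately show ?thesis using p_integral_divide_of_nat[OF p _ km(2)] p_integral_of_nat by metis
qed

text \<open>A deliberately crude bound on valuations: the exponent k only has to reach n itself. It
  disposes of denominators such as s * t or k! below, at the price of thresholds such as
  \<open>fact J\<close>.\<close>

lemma p_integral_power_div_le:
  assumes p: "prime p" and "n > 0" "n \<le> k"
  shows "p_integral p (of_nat (p ^ k) / of_nat n)"
proof -
  have "of_nat (p ^ k) / of_nat n = of_nat (p ^ (k - n)) * (of_nat (p ^ n) / of_nat n :: rat)"
    using assms(3) by (simp add: power_add [symmetric] flip: of_nat_mult)
  thus ?thesis using p_integral_mult[OF p _ p_integral_power_div[OF p assms(2)]] p prime_gt_1_nat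
    by (metis less_irrefl p_integral_of_nat)
qed

text \<open>Legendre's estimate v_p((n+1)!) \<le> n, by peeling off the multiples of p: (n+1)! = u
  p^m m! with m = (n+1) div p and u prime to p, and m + (m - 1) \<le> n when m > 0. It makes
  (exp(pX) - 1)/p integral.\<close>

lemma p_integral_power_div_fact:
  assumes p: "prime p"
  shows "p_integral p (of_nat p ^ n / fact (Suc n))"
proof (induction n rule: less_induct)
  case (less n)
  define m where "m = Suc n div p"
  have p2: "p \<ge> 2" "p \<noteq> 1" using p prime_ge_2_nat prime_gt_1_nat by fastforce+
  \<comment> \<open>The multiples of p up to N contribute p^(N div p) (N div p)!, the other factors
    the unit u.\<close>
  have unit: "\<exists>u. \<not> p dvd u \<and> fact N = u * p ^ (N div p) * fact (N div p)" for N
  proof (induction N)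
    case 0
    show ?case by (intro exI[of _ 1]) (use p2 in auto)
  next
    case (Suc N)
    then obtain u where u: "\<not> p dvd u" "fact N = u * p ^ (N div p) * fact (N div p)" by blast
    show ?case
    proof (cases "p dvd Suc N")
      case True
      then obtain k where k: "Suc N = p * k" by blast
      hence "k > 0" by (cases k) auto
      have "Suc N div p = k" using p2 by (simp only: k) simp
      moreover have "N div p = k - 1"
        using \<open>Suc N div p = k\<close> True by (simp add: div_Suc dvd_eq_mod_eq_0)
      have eqs: "Suc N div p = k" "N div p = k - 1" by fact+
      obtain k' where k': "k = Suc k'" using \<open>k > 0\<close> by (cases k) auto
      have "fact N = u * p ^ k' * fact k'" using u(2) by (simp only: eqs k' diff_Suc_1)
      moreover have "fact (Suc N) = (p * k) * (fact N :: nat)"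
        by (simp only: fact_Suc of_nat_id) (simp only: k)
      ultimately have "fact (Suc N) = p * k * (u * p ^ k' * fact k')" by (simp only:)
      also have "p * k * (u * p ^ k' * fact k') = u * p ^ k * fact k"
        by (simp add: k' algebra_simps)
      finally have "fact (Suc N) = u * p ^ (Suc N div p) * fact (Suc N div p)"
        by (simp only: eqs)
      with u(1) show ?thesis by blast
    next
      case False
      hence "Suc N div p = N div p"
        by (simp add: div_Suc dvd_eq_mod_eq_0)
      moreover have "\<not> p dvd u * Suc N" using False u(1) p by (metis prime_dvd_multD)
      ultimately show ?thesis using u(2) by (intro exI[of _ "u * Suc N"]) (auto simp: algebra_simps)
    qed
  qed
  obtain u where u: "\<not> p dvd u" "fact (Suc n) = u * p ^ m * fact m"
    using unit[of "Suc n"] unfolding m_def by blast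
  have f: "(fact (Suc n) :: rat) = of_nat u * of_nat p ^ m * fact m"
    using arg_cong[OF u(2), of "of_nat :: nat \<Rightarrow> rat"] by (simp del: fact_Suc)
  show ?case
  proof (cases m)
    case 0
    thus ?thesis using f p_integral_divide_of_nat[OF p p_integral_of_nat[OF p2(2)] u(1), of "p ^ n"]
      by (simp del: fact_Suc)
  next
    case (Suc m')
    have "m \<le> Suc n div 2" unfolding m_def using p2(1) by (intro div_le_mono2) auto
    hence "2 * m \<le> Suc n" by linarith
    hence lt: "m' < n" and le: "m + m' \<le> n" using Suc by auto
    have "of_nat p ^ n / fact (Suc n) =
      of_nat (p ^ (n - m - m')) * (of_nat p ^ m' / fact (Suc m')) / (of_nat u :: rat)"
    proof -
      have "(of_nat p :: rat) ^ n = of_nat p ^ (n - m - m') * of_nat p ^ m' * of_nat p ^ m"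
        using le by (simp flip: power_add)
      moreover have "of_nat p \<noteq> (0 :: rat)" using p2 by simp
      ultimately show ?thesis using f Suc by (simp del: fact_Suc)
    qed
    moreover have "p_integral p (of_nat (p ^ (n - m - m')) * (of_nat p ^ m' / fact (Suc m')) / of_nat u)"
      by (intro p_integral_divide_of_nat p_integral_mult p p_integral_of_nat p2 less.IH lt u)
    ultimately show ?thesis by (simp del: fact_Suc)
  qed
qed

text \<open>The denominator in lowest terms divides b, so it is prime to p as well, and
  cross-multiplication survives in F_p.\<close>

lemma reduce_rat_of_frac:
  assumes "\<not> int CARD('p :: prime_card) dvd b"
  shows "(reduce_rat (of_int a / of_int b) :: 'p mod_ring) = of_int a / of_int b"
proof -
  obtain c d where cd: "quotient_of (of_int a / of_int b) = (c, d)" by force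
  hence "d > 0" "coprime c d" and eq: "(of_int a / of_int b :: rat) = of_int c / of_int d"
    using quotient_of_denom_pos quotient_of_coprime quotient_of_div by blast+
  have b0: "b \<noteq> 0" using assms by auto
  have "(of_int (a * d) :: rat) = of_int (c * b)"
    using eq b0 \<open>d > 0\<close> by (simp add: field_simps)
  hence *: "a * d = c * b" by (simp only: of_int_eq_iff)
  have ch: "(of_int x = (0 :: 'p mod_ring)) \<longleftrightarrow> int CARD('p) dvd x" for x
    using of_int_eq_0_iff_char_dvd[where 'a = "'p mod_ring", of x] by simp
  have "d dvd b" using * \<open>coprime c d\<close>
    by (metis coprime_commute coprime_dvd_mult_right_iff dvd_triv_right)
  hence "\<not> int CARD('p) dvd d" using assms dvd_trans by blast
  moreover have "of_int a * of_int d = (of_int c * of_int b :: 'p mod_ring)"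
    using arg_cong[OF *, of "of_int :: int \<Rightarrow> 'p mod_ring"] by simp
  ultimately have "of_int c / of_int d = (of_int a / of_int b :: 'p mod_ring)"
    using assms ch by (simp add: field_simps)
  thus ?thesis by (simp add: reduce_rat_def cd)
qed

lemma reduce_rat_of_int [simp]: "(reduce_rat (of_int a) :: 'p :: prime_card mod_ring) = of_int a"
  using reduce_rat_of_frac[where 'p = 'p, of 1 a] prime_card[where 'a = 'p] by (auto simp: prime_nat_iff)

lemma reduce_rat_0 [simp]: "(reduce_rat 0 :: 'p :: prime_card mod_ring) = 0"
  and reduce_rat_1 [simp]: "(reduce_rat 1 :: 'p :: prime_card mod_ring) = 1"
  and reduce_rat_of_nat [simp]: "(reduce_rat (of_nat n) :: 'p :: prime_card mod_ring) = of_nat n"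
  using reduce_rat_of_int[where 'p = 'p, of 0] reduce_rat_of_int[where 'p = 'p, of 1]
    reduce_rat_of_int[where 'p = 'p, of "int n"] by simp_all

lemma
  assumes "p_integral CARD('p :: prime_card) x" "p_integral CARD('p) y"
  shows reduce_rat_add: "(reduce_rat (x + y) :: 'p mod_ring) = reduce_rat x + reduce_rat y"
    and reduce_rat_mult: "(reduce_rat (x * y) :: 'p mod_ring) = reduce_rat x * reduce_rat y"
proof -
  have p: "prime (int CARD('p))" using prime_card by simp
  obtain a b c d :: int where *: "\<not> int CARD('p) dvd b" "x = of_int a / of_int b"
    "\<not> int CARD('p) dvd d" "y = of_int c / of_int d"
    using assms unfolding p_integral_def by blast
  have bd: "\<not> int CARD('p) dvd b * d" using * p by (metis prime_dvd_multD)
  have ch: "(of_int x = (0 :: 'p mod_ring)) \<longleftrightarrow> int CARD('p) dvd x" for x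
    using of_int_eq_0_iff_char_dvd[where 'a = "'p mod_ring", of x] by simp
  have nz: "b \<noteq> 0" "d \<noteq> 0" "of_int b \<noteq> (0 :: 'p mod_ring)" "of_int d \<noteq> (0 :: 'p mod_ring)"
    using * ch by auto
  have "x + y = of_int (a * d + c * b) / of_int (b * d)"
    using * nz by (simp add: field_simps)
  hence "(reduce_rat (x + y) :: 'p mod_ring) = of_int (a * d + c * b) / of_int (b * d)"
    using reduce_rat_of_frac[OF bd] by metis
  also have "\<dots> = of_int a / of_int b + of_int c / of_int d"
    using nz by (simp add: add_frac_eq)
  also have "\<dots> = reduce_rat x + reduce_rat y"
    using * by (simp add: reduce_rat_of_frac)
  finally show "(reduce_rat (x + y) :: 'p mod_ring) = reduce_rat x + reduce_rat y" .
  have "x * y = of_int (a * c) / of_int (b * d)" using * by simp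
  hence "(reduce_rat (x * y) :: 'p mod_ring) = of_int (a * c) / of_int (b * d)"
    using reduce_rat_of_frac[OF bd] by metis
  also have "\<dots> = reduce_rat x * reduce_rat y"
    using * nz by (simp add: reduce_rat_of_frac)
  finally show "(reduce_rat (x * y) :: 'p mod_ring) = reduce_rat x * reduce_rat y" .
qed

lemma reduce_rat_sum:
  assumes "\<And>i. i \<in> A \<Longrightarrow> p_integral CARD('p :: prime_card) (f i)"
  shows "(reduce_rat (sum f A) :: 'p mod_ring) = (\<Sum>i\<in>A. reduce_rat (f i))"
  using assms
proof (induction A rule: infinite_finite_induct)
  case (insert x F)
  thus ?case using p_integral_sum[OF prime_card[where 'a = 'p], of F f]
    by (simp add: reduce_rat_add)
qed auto

lemma reduce_rat_eq_0:
  assumes "p_integral CARD('p :: prime_card) (x / of_nat CARD('p))"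
  shows "(reduce_rat x :: 'p mod_ring) = 0"
proof -
  have "x = of_nat CARD('p) * (x / of_nat CARD('p))" by simp
  also have "(reduce_rat \<dots> :: 'p mod_ring) = of_nat CARD('p) * reduce_rat (x / of_nat CARD('p))"
    using assms prime_card[where 'a = 'p] prime_gt_1_nat
    by (subst reduce_rat_mult) (auto simp: prime_nat_iff)
  also have "of_nat CARD('p) = (0 :: 'p mod_ring)"
    using of_nat_CHAR[where 'a = "'p mod_ring"] by simp
  finally show ?thesis by simp
qed

text \<open>Bridge between divisibility by p inside the rationals and vanishing in F_p.\<close>

lemma p_integral_div_p_iff:
  assumes "p_integral CARD('p :: prime_card) x"
  shows "p_integral CARD('p) (x / of_nat CARD('p)) \<longleftrightarrow> (reduce_rat x :: 'p mod_ring) = 0"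
proof
  assume r: "(reduce_rat x :: 'p mod_ring) = 0"
  obtain a b :: int where *: "\<not> int CARD('p) dvd b" "x = of_int a / of_int b"
    using assms unfolding p_integral_def by blast
  have ch: "(of_int x = (0 :: 'p mod_ring)) \<longleftrightarrow> int CARD('p) dvd x" for x
    using of_int_eq_0_iff_char_dvd[where 'a = "'p mod_ring", of x] by simp
  have "int CARD('p) dvd a" using r * ch reduce_rat_of_frac[OF *(1), of a] by auto
  then obtain k where "a = int CARD('p) * k" by blast
  hence "x / of_nat CARD('p) = of_int k / of_int b" using *(2) by simp
  thus "p_integral CARD('p) (x / of_nat CARD('p))" using *(1) unfolding p_integral_def by blast
qed (rule reduce_rat_eq_0)

section \<open>Frobenius\<close>

lemma of_nat_power_CHAR:
  assumes "prime CHAR('a :: comm_ring_1)"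
  shows "(of_nat n :: 'a) ^ CHAR('a) = of_nat n"
proof (induction n)
  case 0
  show ?case using prime_gt_0_nat[OF assms] by (simp add: power_0_left)
next
  case (Suc n)
  have "(of_nat n + 1 :: 'a) ^ CHAR('a) = of_nat n ^ CHAR('a) + 1"
    using freshmans_dream[OF assms refl, of "of_nat n" 1] by simp
  thus ?case using Suc by (simp add: add.commute)
qed

text \<open>Additivity of Frobenius covers finite sums only, hence the split of g into its part up
  to degree n and a tail whose p-th power starts beyond degree n.\<close>

lemma fps_power_CHAR_nth:
  fixes g :: "'a :: comm_ring_1 fps"
  assumes "prime CHAR('a)"
  shows "(g ^ CHAR('a)) $ n = (if CHAR('a) dvd n then (g $ (n div CHAR('a))) ^ CHAR('a) else 0)"
proof -
  define p where "p = CHAR('a)"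
  have p: "prime p" "p > 0" using assms by (auto simp: p_def prime_gt_0_nat)
  have pc: "prime CHAR('a fps)" "p = CHAR('a fps)" using assms by (simp_all add: p_def)
  define P where "P = (\<Sum>i\<le>n. fps_const (g $ i) * fps_X ^ i)"
  have "g = P + fps_X ^ Suc n * fps_shift (Suc n) g"
  proof (rule fps_ext)
    fix m
    have "P $ m = (\<Sum>i\<le>n. if i = m then g $ i else 0)"
      unfolding P_def fps_sum_nth by (intro sum.cong) auto
    thus "g $ m = (P + fps_X ^ Suc n * fps_shift (Suc n) g) $ m"
      by (auto simp: fps_X_power_mult_nth simp del: power_Suc)
  qed
  hence "g ^ p = P ^ p + fps_X ^ (Suc n * p) * fps_shift (Suc n) g ^ p"
    using freshmans_dream[OF pc(1) pc(2), of P "fps_X ^ Suc n * fps_shift (Suc n) g"]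
    by (simp only: power_mult_distrib power_mult)
  moreover have "n < Suc n * p" using p(2) by (cases p) auto
  ultimately have "(g ^ p) $ n = (P ^ p) $ n" by (simp add: fps_X_power_mult_nth del: mult_Suc)
  also have "P ^ p = (\<Sum>i\<le>n. fps_const ((g $ i) ^ p) * fps_X ^ (i * p))"
    unfolding P_def using freshmans_dream_sum[OF pc(1) pc(2), of _ "{..n}"]
    by (simp add: power_mult_distrib power_mult)
  also have "\<dots> $ n = (\<Sum>i\<le>n. if i * p = n then (g $ i) ^ p else 0)"
    unfolding fps_sum_nth by (intro sum.cong) auto
  also have "\<dots> = (if p dvd n then (g $ (n div p)) ^ p else 0)"
  proof (cases "p dvd n")
    case True
    then obtain k where k: "n = p * k" by blast
    have "(\<Sum>i\<le>n. if i * p = n then (g $ i) ^ p else 0) = (\<Sum>i\<le>n. if i = k then (g $ i) ^ p else 0)"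
      using k p by (intro sum.cong) auto
    thus ?thesis using k p by auto
  next
    case False
    thus ?thesis by (auto intro!: sum.neutral)
  qed
  finally show ?thesis by (simp add: p_def)
qed

text \<open>The top coefficient \<open>E $ n\<close> enters linearly, with factor m; everything else
  depends on lower coefficients. For m = p this drives the integrality of the Artin-Hasse series,
  for m prime to p the extraction of m-th roots in \<open>fps_over_root\<close>.\<close>

lemma fps_power_nth_cutoff:
  fixes E :: "'a :: comm_ring_1 fps"
  assumes E0: "E $ 0 = 1" and "n > 0"
  shows "(E ^ m) $ n = (fps_cutoff n E ^ m) $ n + of_nat m * E $ n"
proof (induction m)
  case 0
  show ?case by simp
next
  case (Suc m)
  define P where "P = fps_cutoff n E"
  have cut: "(E ^ m) $ j = (P ^ m) $ j" if "j < n" for m j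
    using that
  proof (induction m arbitrary: j)
    case (Suc m)
    thus ?case by (auto simp: fps_mult_nth P_def intro!: sum.cong)
  qed auto
  have Em0: "(E ^ m) $ 0 = 1" for m by (induction m) (auto simp: E0)
  have split: "{0..n} = insert 0 (insert n {1..<n})" using \<open>n > 0\<close> by auto
  have "(E * E ^ m) $ n = (\<Sum>i=0..n. E $ i * (E ^ m) $ (n - i))" by (simp add: fps_mult_nth)
  also have "\<dots> = (\<Sum>i\<in>{1..<n}. E $ i * (E ^ m) $ (n - i)) + (E ^ m) $ n + E $ n"
    using \<open>n > 0\<close> by (simp add: split E0 Em0)
  also have "(\<Sum>i\<in>{1..<n}. E $ i * (E ^ m) $ (n - i)) = (\<Sum>i\<in>{1..<n}. P $ i * (P ^ m) $ (n - i))"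
    by (intro sum.cong) (auto simp: cut P_def)
  also have "\<dots> + (E ^ m) $ n + E $ n = (\<Sum>i\<in>{1..<n}. P $ i * (P ^ m) $ (n - i)) + (P ^ m) $ n + of_nat (Suc m) * E $ n"
    by (simp add: Suc P_def algebra_simps)
  also have "(\<Sum>i\<in>{1..<n}. P $ i * (P ^ m) $ (n - i)) + (P ^ m) $ n = (P * P ^ m) $ n"
    using \<open>n > 0\<close> by (simp add: split fps_mult_nth P_def E0)
  finally show ?case by (simp add: P_def)
qed

section \<open>Logarithmic derivatives\<close>

text \<open>The derivative of the sum of \<open>g i\<close> X^(p^i) / p^i, written without
  denominators so that it exists in every ring. The cut at i \<le> n loses nothing for p \<ge> 2
  because i < p^i.\<close>

definition lam :: "nat \<Rightarrow> (nat \<Rightarrow> 'r) \<Rightarrow> 'r :: comm_ring_1 fps" where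
  "lam p g = Abs_fps (\<lambda>n. \<Sum>i\<le>n. if p ^ i = Suc n then g i else 0)"

text \<open>\<open>has_log_deriv p \<Psi> g\<close> says that \<open>\<Psi>\<close> behaves like
  $\exp(\sum_i g_i X^{p^i}/p^i)$.\<close>

definition has_log_deriv :: "nat \<Rightarrow> 'r :: comm_ring_1 fps \<Rightarrow> (nat \<Rightarrow> 'r) \<Rightarrow> bool" where
  "has_log_deriv p \<Psi> g \<longleftrightarrow> \<Psi> $ 0 = 1 \<and> fps_deriv \<Psi> = \<Psi> * lam p g"

lemma lam_add: "lam p (\<lambda>i. g i + h i) = lam p g + lam p h"
  by (rule fps_ext) (auto simp: lam_def sum.distrib [symmetric] intro!: sum.cong)

lemma lam_zero [simp]: "lam p (\<lambda>_. 0) = 0"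
  by (rule fps_ext) (simp add: lam_def)

lemma lam_uminus: "lam p (\<lambda>i. - g i) = - lam p g"
  by (rule fps_ext) (auto simp: lam_def sum_negf [symmetric] intro!: sum.cong)

lemma lam_nth_power:
  assumes "p \<ge> 2" "p ^ i = Suc n"
  shows "lam p g $ n = g i"
proof -
  have "i < p ^ i" using assms(1) power_gt_expt[of p i] by simp
  hence "i \<le> n" using assms(2) by simp
  moreover have "p ^ j = Suc n \<longleftrightarrow> j = i" for j
    using assms by (metis Suc_1 Suc_le_lessD power_inject_exp)
  ultimately show ?thesis by (simp add: lam_def)
qed

lemma lam_nth_eq_0: "(\<And>i. p ^ i \<noteq> Suc n) \<Longrightarrow> lam p g $ n = 0"
  by (simp add: lam_def)

lemma has_log_deriv_1 [simp]: "has_log_deriv p 1 (\<lambda>_. 0)"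
  by (simp add: has_log_deriv_def)

lemma has_log_deriv_mult:
  "has_log_deriv p \<Psi> g \<Longrightarrow> has_log_deriv p \<Phi> h \<Longrightarrow> has_log_deriv p (\<Psi> * \<Phi>) (\<lambda>i. g i + h i)"
  by (simp add: has_log_deriv_def lam_add algebra_simps)

lemma has_log_deriv_power:
  "has_log_deriv p \<Psi> g \<Longrightarrow> has_log_deriv p (\<Psi> ^ n) (\<lambda>i. of_nat n * g i)"
  by (induction n) (auto simp: algebra_simps dest: has_log_deriv_mult)

lemma has_log_deriv_prod:
  assumes "finite A" "\<And>j. j \<in> A \<Longrightarrow> has_log_deriv p (\<Psi> j) (g j)"
  shows "has_log_deriv p (prod \<Psi> A) (\<lambda>i. \<Sum>j\<in>A. g j i)"
  using assms by (induction A rule: finite_induct) (auto intro: has_log_deriv_mult)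

text \<open>In characteristic 0 the equation \<Psi>' = \<Psi> * \<open>lam p g\<close> determines
  the coefficients recursively, and degrees up to N see only the \<open>g i\<close> with p^i \<le>
  N. This locality allows infinite products to be handled through finitely many factors.\<close>

lemma has_log_deriv_unique:
  fixes \<Psi> \<Phi> :: "'r :: {idom, semiring_char_0} fps"
  assumes "has_log_deriv p \<Psi> g" "has_log_deriv p \<Phi> h"
    and eq: "\<And>i. p ^ i \<le> N \<Longrightarrow> g i = h i" and "n \<le> N"
  shows "\<Psi> $ n = \<Phi> $ n"
  using \<open>n \<le> N\<close>
proof (induction n rule: less_induct)
  case (less n)
  show ?case
  proof (cases n)
    case 0
    thus ?thesis using assms by (simp add: has_log_deriv_def)
  next
    case (Suc m)
    have l: "lam p g $ k = lam p h $ k" if "k \<le> m" for k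
      unfolding lam_def using that less.prems Suc eq by (auto intro!: sum.cong)
    have "of_nat (Suc m) * \<Psi> $ Suc m = (\<Psi> * lam p g) $ m"
      using assms(1) fps_deriv_nth[of \<Psi> m] by (simp add: has_log_deriv_def)
    also have "\<dots> = (\<Phi> * lam p h) $ m"
      unfolding fps_mult_nth using less Suc l by (intro sum.cong) auto
    also have "\<dots> = of_nat (Suc m) * \<Phi> $ Suc m"
      using assms(2) fps_deriv_nth[of \<Phi> m] by (simp add: has_log_deriv_def)
    finally show ?thesis using Suc by (simp del: of_nat_Suc)
  qed
qed

lemma has_log_deriv_inverse:
  fixes \<Psi> \<Phi> :: "'r :: idom fps"
  assumes "has_log_deriv p \<Psi> g" "\<Psi> * \<Phi> = 1"
  shows "has_log_deriv p \<Phi> (\<lambda>i. - g i)"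
proof -
  have "\<Phi> $ 0 = 1"
    using arg_cong[OF assms(2), of "\<lambda>f. f $ 0"] assms(1) by (simp add: has_log_deriv_def)
  moreover have "fps_deriv \<Psi> * \<Phi> + \<Psi> * fps_deriv \<Phi> = 0"
    using arg_cong[OF assms(2), of fps_deriv] by (simp add: add.commute)
  hence "\<Psi> * (fps_deriv \<Phi> + \<Phi> * lam p g) = 0"
    using assms(1) by (simp add: has_log_deriv_def algebra_simps)
  moreover have "\<Psi> \<noteq> 0" using assms(2) by auto
  ultimately show ?thesis
    by (simp add: has_log_deriv_def lam_uminus eq_neg_iff_add_eq_0)
qed

text \<open>X^(p^i) / p^i becomes X^(p^(i+1)) / p^i, which is p times the standard term of index i +
  1.\<close>

lemma has_log_deriv_compose_power:
  fixes \<Psi> :: "'r :: idom fps"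
  assumes "has_log_deriv p \<Psi> g" "p \<ge> 2"
  shows "has_log_deriv p (\<Psi> oo fps_X ^ p) (\<lambda>i. if i = 0 then 0 else of_nat p * g (i - 1))"
    (is "has_log_deriv p _ ?g'")
proof -
  have X0: "(fps_X ^ p :: 'r fps) $ 0 = 0" using assms(2) by simp
  have "(lam p g oo fps_X ^ p) * fps_deriv (fps_X ^ p) = lam p ?g'"
  proof (rule fps_ext)
    fix n
    have "fps_deriv (fps_X ^ p :: 'r fps) = fps_const (of_nat p) * fps_X ^ (p - 1)"
      by (simp add: fps_deriv_power' fps_of_nat)
    hence "((lam p g oo fps_X ^ p) * fps_deriv (fps_X ^ p)) $ n =
      (fps_const (of_nat p) * ((lam p g oo fps_X ^ p) * fps_X ^ (p - 1))) $ n"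
      by (simp only: mult_ac)
    also have "\<dots> = (if n < p - 1 then 0 else of_nat p * (lam p g oo fps_X ^ p) $ (n - (p - 1)))"
      by (simp only: fps_mult_left_const_nth fps_X_power_mult_right_nth) simp
    also have "\<dots> = (if n < p - 1 then 0 else if p dvd Suc n then of_nat p * lam p g $ (Suc n div p - 1) else 0)"
    proof (cases "n < p - 1")
      case False
      have *: "n - (p - 1) = Suc n - p" using False assms(2) by auto
      have ge: "p \<le> Suc n" using False by auto
      have "p dvd Suc n - p \<longleftrightarrow> p dvd Suc n" using dvd_minus_self[of p "Suc n"] ge by simp
      moreover have "(Suc n - p) div p = Suc n div p - 1"
        using le_div_geq[of p "Suc n"] ge assms(2) by simp
      ultimately show ?thesis using False assms(2)
        unfolding * by (simp only: fps_nth_compose_X_power) simp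
    qed simp
    finally have L: "((lam p g oo fps_X ^ p) * fps_deriv (fps_X ^ p)) $ n =
      (if n < p - 1 then 0 else if p dvd Suc n then of_nat p * lam p g $ (Suc n div p - 1) else 0)" .
    show "((lam p g oo fps_X ^ p) * fps_deriv (fps_X ^ p)) $ n = lam p ?g' $ n"
    proof (cases "\<exists>i. p ^ i = Suc n")
      case True
      then obtain i where i: "p ^ i = Suc n" by blast
      show ?thesis
      proof (cases i)
        case 0
        hence "n = 0" using i by simp
        thus ?thesis unfolding L using lam_nth_power[OF assms(2) i, of ?g'] 0 assms(2) by simp
      next
        case (Suc j)
        have e: "Suc n = p * p ^ j" using i Suc by simp
        have "p ^ j > 0" using assms(2) by simp
        hence "\<not> n < p - 1" using e assms(2) by (cases "p ^ j") auto
        moreover have "Suc n div p - 1 = p ^ j - 1" using e assms(2) by simp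
        moreover have "lam p g $ (p ^ j - 1) = g j"
          using \<open>p ^ j > 0\<close> by (intro lam_nth_power[OF assms(2)]) simp
        ultimately show ?thesis unfolding L using lam_nth_power[OF assms(2) i, of ?g'] Suc e by simp
      qed
    next
      case False
      have "lam p g $ (Suc n div p - 1) = 0" if "p dvd Suc n"
      proof (rule lam_nth_eq_0)
        fix i
        show "p ^ i \<noteq> Suc (Suc n div p - 1)"
        proof
          assume a: "p ^ i = Suc (Suc n div p - 1)"
          have "Suc n div p > 0" using dvd_imp_le[OF that] assms(2) by (simp add: div_greater_zero_iff)
          hence "p ^ Suc i = Suc n" using a that by simp
          thus False using False by blast
        qed
      qed
      thus ?thesis unfolding L using False lam_nth_eq_0[of p n ?g'] by auto
    qed
  qed
  moreover have "fps_deriv (\<Psi> oo fps_X ^ p) = (\<Psi> oo fps_X ^ p) * ((lam p g oo fps_X ^ p) * fps_deriv (fps_X ^ p))"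
    using assms(1) X0 by (simp add: fps_compose_deriv has_log_deriv_def fps_compose_mult_distrib mult.assoc)
  ultimately show ?thesis using assms(1) by (simp add: has_log_deriv_def)
qed

section \<open>The Artin--Hasse series\<close>

lemma artin_hasse_nth_0 [simp]: "artin_hasse p $ 0 = 1"
  by (simp add: artin_hasse_def)

lemma artin_hasse_log_deriv:
  assumes "p \<ge> 2"
  shows "has_log_deriv p (artin_hasse p) (\<lambda>_. 1)"
proof -
  define L :: "rat fps" where "L = Abs_fps (\<lambda>m. if \<exists>n. m = p ^ n then 1 / of_nat m else 0)"
  have "L $ 0 = 0" using assms by (auto simp: L_def)
  hence "fps_deriv (artin_hasse p) = artin_hasse p * fps_deriv L"
    by (simp add: artin_hasse_def L_def [symmetric] fps_compose_deriv)
  also have "fps_deriv L = lam p (\<lambda>_. 1)"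
  proof (rule fps_ext)
    fix n
    show "fps_deriv L $ n = lam p (\<lambda>_. 1) $ n"
    proof (cases "\<exists>i. p ^ i = Suc n")
      case True
      then obtain i where i: "p ^ i = Suc n" by blast
      have "L $ Suc n = 1 / of_nat (Suc n)" using True by (auto simp: L_def intro: sym)
      thus ?thesis using lam_nth_power[OF assms i, of "\<lambda>_. 1 :: rat"] by (simp del: of_nat_Suc)
    next
      case False
      hence "L $ Suc n = 0" by (auto simp: L_def)
      thus ?thesis using lam_nth_eq_0[of p n] False by simp
    qed
  qed
  finally show ?thesis by (simp add: has_log_deriv_def)
qed

text \<open>Dwork's argument by strong induction on n: in degree n the functional equation E(X)^p =
  E(X^p) exp(pX) leaves p \<open>E $ n\<close> plus terms already known to be integral. These known
  terms cancel modulo p, because P^p is congruent to E(X^p) in degree n for the truncation P of E,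
  and because exp(pX) is congruent to 1.\<close>

lemma p_integral_artin_hasse: "p_integral CARD('p :: prime_card) (artin_hasse CARD('p) $ n)"
proof (induction n rule: less_induct)
  case (less n)
  define p where "p = CARD('p)"
  have p: "prime p" "p \<ge> 2" "p \<noteq> 1" "p > 0"
    using prime_card[where 'a = 'p] prime_ge_2_nat[of p] by (auto simp: p_def)
  define E where "E = artin_hasse p"
  note p_int = p_integral_of_int[OF p(3)]
  have dlE: "has_log_deriv p E (\<lambda>_. 1)" unfolding E_def by (rule artin_hasse_log_deriv[OF p(2)])
  \<comment> \<open>Both sides have the logarithmic data p at every index: on the right, index 0
    comes from exp(pX) and the indices i > 0 from E(X^p).\<close>
  have "E ^ p = (E oo fps_X ^ p) * fps_exp (of_nat p)"
  proof (rule fps_ext)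
    fix m
    have dlexp: "has_log_deriv p (fps_exp (of_nat p :: rat)) (\<lambda>i. if i = 0 then of_nat p else 0)"
    proof -
      have "lam p (\<lambda>i. if i = 0 then of_nat p else 0 :: rat) = fps_const (of_nat p)"
      proof (rule fps_ext)
        fix m
        show "lam p (\<lambda>i. if i = 0 then of_nat p else 0 :: rat) $ m = fps_const (of_nat p) $ m"
        proof (cases "\<exists>i. p ^ i = Suc m")
          case True
          then obtain i where i: "p ^ i = Suc m" by blast
          moreover have "p ^ i = 1 \<longleftrightarrow> i = 0" using p by (simp add: power_eq_1_iff)
          ultimately have "i = 0 \<longleftrightarrow> m = 0" by auto
          thus ?thesis using lam_nth_power[OF p(2) i, of "\<lambda>i. if i = 0 then of_nat p else 0 :: rat"] by auto
        next
          case False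
          hence "m \<noteq> 0" by (metis power_0 One_nat_def)
          thus ?thesis using False lam_nth_eq_0[of p m] by auto
        qed
      qed
      thus ?thesis by (simp add: has_log_deriv_def mult.commute)
    qed
    show "(E ^ p) $ m = ((E oo fps_X ^ p) * fps_exp (of_nat p)) $ m"
      by (rule has_log_deriv_unique[OF has_log_deriv_power[OF dlE]
            has_log_deriv_mult[OF has_log_deriv_compose_power[OF dlE p(2)] dlexp] _ order_refl]) auto
  qed
  note Ep = this
  show ?case
  proof (cases "n = 0")
    case True
    thus ?thesis using p by (simp add: p_def)
  next
    case False
    define P where "P = fps_cutoff n E"
    have Pint: "p_integral p (P $ i)" for i
      using less.IH[of i] p by (auto simp: P_def E_def p_def)
    have E0: "E $ 0 = 1" by (simp add: E_def)
    have cutn: "(E ^ m) $ n = (P ^ m) $ n + of_nat m * E $ n" for m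
      unfolding P_def by (rule fps_power_nth_cutoff[OF E0]) (use False in simp)
    have Pmint: "p_integral p ((P ^ m) $ j)" for m j
    proof (induction m arbitrary: j)
      case (Suc m)
      thus ?case by (auto simp: fps_mult_nth intro!: p_integral_sum p_integral_mult p Pint)
    qed (use p in auto)
    define rP :: "'p mod_ring fps" where "rP = Abs_fps (\<lambda>i. reduce_rat (P $ i))"
    have rPm: "reduce_rat ((P ^ m) $ j) = (rP ^ m) $ j" for m j
    proof (induction m arbitrary: j)
      case (Suc m)
      have "reduce_rat ((P * P ^ m) $ j) = (\<Sum>i=0..j. reduce_rat (P $ i * (P ^ m) $ (j - i)) :: 'p mod_ring)"
        unfolding fps_mult_nth
        by (rule reduce_rat_sum) (use Pint Pmint p_integral_mult p in \<open>auto simp: p_def\<close>)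
      also have "\<dots> = (\<Sum>i=0..j. rP $ i * (rP ^ m) $ (j - i))"
        using Pint Pmint Suc by (intro sum.cong) (auto simp: reduce_rat_mult p_def rP_def)
      finally show ?case by (simp add: fps_mult_nth)
    qed auto
    have EX: "(E oo fps_X ^ p) $ j = (if p dvd j then E $ (j div p) else 0)" for j
      using p by (simp add: fps_nth_compose_X_power)
    have small: "j div p < n" if "j \<le> n" for j
    proof (cases "j = 0")
      case False
      hence "j div p < j" using p by (intro div_less_dividend) auto
      thus ?thesis using that by simp
    qed (use False in simp)
    have EXint: "p_integral p ((E oo fps_X ^ p) $ j)" if "j \<le> n" for j
      using small[OF that] less.IH[of "j div p"] p unfolding EX by (auto simp: p_def E_def)
    have "p_integral p ((P ^ p) $ n - (E oo fps_X ^ p) $ n)"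
      by (intro p_integral_diff Pmint EXint p) simp
    \<comment> \<open>Over F_p the p-th power of P is P(X^p), as coefficients are fixed by
      Frobenius; in degree n this is E(X^p) since n div p < n.\<close>
    moreover have "(reduce_rat ((P ^ p) $ n - (E oo fps_X ^ p) $ n) :: 'p mod_ring) = 0"
    proof -
      have "(reduce_rat ((P ^ p) $ n) :: 'p mod_ring) = (if p dvd n then (rP $ (n div p)) ^ p else 0)"
        unfolding rPm using fps_power_CHAR_nth[of rP n] p by (simp add: p_def)
      also have "\<dots> = (if p dvd n then reduce_rat (P $ (n div p)) else 0)"
      proof -
        have "x ^ p = x" for x :: "'p mod_ring"
          using surj_of_nat_mod_ring[of x] of_nat_power_CHAR[where 'a = "'p mod_ring"] p by (auto simp: p_def)
        thus ?thesis by (simp add: rP_def)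
      qed
      also have "\<dots> = reduce_rat ((E oo fps_X ^ p) $ n)"
        unfolding EX using small[of n] by (auto simp: P_def)
      finally have eq: "(reduce_rat ((P ^ p) $ n) :: 'p mod_ring) = reduce_rat ((E oo fps_X ^ p) $ n)" .
      have "reduce_rat ((P ^ p) $ n) = (reduce_rat ((P ^ p) $ n - (E oo fps_X ^ p) $ n) + reduce_rat ((E oo fps_X ^ p) $ n) :: 'p mod_ring)"
        using Pmint EXint[of n] p_integral_diff[OF p(1), of "(P ^ p) $ n" "(E oo fps_X ^ p) $ n"]
        by (subst reduce_rat_add [symmetric]) (auto simp: p_def)
      with eq show ?thesis by simp
    qed
    ultimately have d1: "p_integral p (((P ^ p) $ n - (E oo fps_X ^ p) $ n) / of_nat p)"
      using p_integral_div_p_iff[where 'p = 'p] by (simp add: p_def)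
    have "(E ^ p) $ n = (\<Sum>i=0..n. (E oo fps_X ^ p) $ i * fps_exp (of_nat p) $ (n - i))"
      unfolding Ep by (simp add: fps_mult_nth)
    also have "\<dots> = (E oo fps_X ^ p) $ n + (\<Sum>i\<in>{0..<n}. (E oo fps_X ^ p) $ i * fps_exp (of_nat p) $ (n - i))"
    proof -
      have "{0..n} = insert n {0..<n}" by auto
      thus ?thesis by simp
    qed
    finally have "of_nat p * E $ n = (\<Sum>i\<in>{0..<n}. (E oo fps_X ^ p) $ i * fps_exp (of_nat p) $ (n - i))
        - ((P ^ p) $ n - (E oo fps_X ^ p) $ n)"
      using cutn[of p] by simp
    hence "E $ n = (\<Sum>i\<in>{0..<n}. (E oo fps_X ^ p) $ i * fps_exp (of_nat p) $ (n - i)) / of_nat p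
        - ((P ^ p) $ n - (E oo fps_X ^ p) $ n) / of_nat p"
      using p(4) by (simp add: field_simps)
    \<comment> \<open>exp(pX) has coefficients p^k / k!; dividing by p leaves p^(k-1) / k! with k =
      n - i \<ge> 1, which \<open>p_integral_power_div_fact\<close> covers.\<close>
    also have "(\<Sum>i\<in>{0..<n}. (E oo fps_X ^ p) $ i * fps_exp (of_nat p) $ (n - i)) / of_nat p
      = (\<Sum>i\<in>{0..<n}. (E oo fps_X ^ p) $ i * (of_nat p ^ (n - i - 1) / fact (Suc (n - i - 1))))"
      unfolding sum_divide_distrib
    proof (intro sum.cong refl)
      fix i assume "i \<in> {0..<n}"
      then obtain k where "n - i = Suc k" by (metis atLeastLessThan_iff Suc_diff_Suc)
      thus "(E oo fps_X ^ p) $ i * fps_exp (of_nat p) $ (n - i) / of_nat p =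
        (E oo fps_X ^ p) $ i * (of_nat p ^ (n - i - 1) / fact (Suc (n - i - 1)))"
        using p(4) by (simp del: fact_Suc)
    qed
    finally have "E $ n = (\<Sum>i\<in>{0..<n}. (E oo fps_X ^ p) $ i * (of_nat p ^ (n - i - 1) / fact (Suc (n - i - 1))))
      - ((P ^ p) $ n - (E oo fps_X ^ p) $ n) / of_nat p" .
    moreover have "p_integral p \<dots>"
      by (intro p_integral_diff p d1 p_integral_sum p_integral_mult EXint p_integral_power_div_fact) auto
    ultimately have "p_integral p (E $ n)" by simp
    thus ?thesis by (simp add: E_def p_def)
  qed
qed

lemma p_integral_inverse_artin_hasse:
  "p_integral CARD('p :: prime_card) (inverse (artin_hasse CARD('p)) $ n)"
proof (induction n rule: less_induct)
  case (less n)
  have p: "prime CARD('p)" by (rule prime_card)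
  hence p1: "CARD('p) \<noteq> 1" by (auto simp: prime_nat_iff)
  define E where "E = artin_hasse CARD('p)"
  have "inverse E * E = 1" by (rule inverse_mult_eq_1) (simp add: E_def)
  show ?case
  proof (cases "n = 0")
    case True
    thus ?thesis using p1 by simp
  next
    case False
    have "0 = (inverse E * E) $ n" using \<open>inverse E * E = 1\<close> False by simp
    also have "\<dots> = inverse E $ n + (\<Sum>i\<in>{0..<n}. inverse E $ i * E $ (n - i))"
    proof -
      have "{0..n} = insert n {0..<n}" by auto
      thus ?thesis by (simp add: fps_mult_nth E_def)
    qed
    finally have "inverse E $ n = - (\<Sum>i\<in>{0..<n}. inverse E $ i * E $ (n - i))"
      by (simp add: eq_neg_iff_add_eq_0)
    moreover have "p_integral CARD('p) \<dots>"
      by (intro p_integral_uminus p_integral_sum p_integral_mult p)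
        (use less.IH p_integral_artin_hasse in \<open>auto simp: E_def\<close>)
    ultimately show ?thesis by (simp add: E_def)
  qed
qed

section \<open>Exponentials with $p$-adically small tails\<close>

text \<open>Scalars in the ring of double power series. Triple series have X outermost, then the
  variable of index t, then that of index s; the inner variables stand for d - 1 and c - 1.\<close>

definition rat2 :: "rat \<Rightarrow> rat fps fps" where "rat2 q = fps_const (fps_const q)"

lemma rat2_simps [simp]: "rat2 0 = 0" "rat2 1 = 1" "rat2 x + rat2 y = rat2 (x + y)"
  "rat2 x * rat2 y = rat2 (x * y)" "- rat2 x = rat2 (- x)" "rat2 x ^ n = rat2 (x ^ n)"
  by (simp_all add: rat2_def)

lemma rat2_mult_nth [simp]: "(rat2 q * f) $ t $ s = q * f $ t $ s"
  by (simp add: rat2_def)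

lemma of_nat_rat2: "of_nat n = rat2 (of_nat n)"
  by (simp add: rat2_def fps_of_nat)

text \<open>\<open>R\<close> is meant as a condition closed under addition, such as vanishing or
  divisibility by p; only the products of coefficients that really occur have to be checked.\<close>

lemma fps3_mult_nth_closed:
  fixes g h :: "'a :: comm_ring_1 fps fps fps"
  assumes "R 0" "\<And>x y. R x \<Longrightarrow> R y \<Longrightarrow> R (x + y)"
    and "\<And>i t' s'. i \<le> n \<Longrightarrow> t' \<le> t \<Longrightarrow> s' \<le> s \<Longrightarrow>
      R (g $ i $ t' $ s' * h $ (n - i) $ (t - t') $ (s - s'))"
  shows "R ((g * h) $ n $ t $ s)"
proof -
  have sumR: "R (sum f A)" if "\<And>i. i \<in> A \<Longrightarrow> R (f i)" for f :: "nat \<Rightarrow> 'a" and A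
    using that by (induction A rule: infinite_finite_induct) (auto intro: assms(1,2))
  show ?thesis unfolding fps_mult_nth fps_sum_nth
    by (intro sumR assms(3)) auto
qed

lemma fps2_mult_nth_closed:
  fixes g h :: "'a :: comm_ring_1 fps fps"
  assumes "R 0" "\<And>x y. R x \<Longrightarrow> R y \<Longrightarrow> R (x + y)"
    and "\<And>t' s'. t' \<le> t \<Longrightarrow> s' \<le> s \<Longrightarrow> R (g $ t' $ s' * h $ (t - t') $ (s - s'))"
  shows "R ((g * h) $ t $ s)"
proof -
  have sumR: "R (sum f A)" if "\<And>i. i \<in> A \<Longrightarrow> R (f i)" for f :: "nat \<Rightarrow> 'a" and A
    using that by (induction A rule: infinite_finite_induct) (auto intro: assms(1,2))
  show ?thesis unfolding fps_mult_nth fps_sum_nth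
    by (intro sumR assms(3)) auto
qed

text \<open>The series exp(l X^(p^i)), where l is a double power series.\<close>

definition exp_factor :: "nat \<Rightarrow> nat \<Rightarrow> rat fps fps \<Rightarrow> rat fps fps fps" where
  "exp_factor p i l = Abs_fps (\<lambda>n. if p ^ i dvd n
     then rat2 (1 / fact (n div p ^ i)) * l ^ (n div p ^ i) else 0)"

lemma exp_factor_log_deriv:
  assumes p: "p \<ge> 2"
  shows "has_log_deriv p (exp_factor p i l) (\<lambda>j. if j = i then of_nat (p ^ i) * l else 0)"
    (is "has_log_deriv p _ ?g")
  unfolding has_log_deriv_def
proof
  show "exp_factor p i l $ 0 = 1" by (simp add: exp_factor_def)
  define q where "q = p ^ i"
  have q: "q > 0" using p by (simp add: q_def)
  have lam: "lam p ?g $ n = (if n = q - 1 then of_nat q * l else 0)" for n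
  proof (cases "\<exists>j. p ^ j = Suc n")
    case True
    then obtain j where j: "p ^ j = Suc n" by blast
    have "j = i \<longleftrightarrow> p ^ j = p ^ i" using p by (simp add: power_inject_exp)
    also have "\<dots> \<longleftrightarrow> n = q - 1" using j q by (auto simp: q_def)
    finally show ?thesis using lam_nth_power[OF p j, of ?g] by (auto simp: q_def)
  next
    case False
    hence "n \<noteq> q - 1" using q by (metis Suc_diff_1 q_def)
    thus ?thesis using lam_nth_eq_0[of p n ?g] False by auto
  qed
  have E: "exp_factor p i l $ n = (if q dvd n then rat2 (1 / fact (n div q)) * l ^ (n div q) else 0)" for n
    by (simp add: exp_factor_def q_def)
  show "fps_deriv (exp_factor p i l) = exp_factor p i l * lam p ?g"
  proof (rule fps_ext)
    fix n
    have "(exp_factor p i l * lam p ?g) $ n =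
      (\<Sum>k=0..n. if k = n - (q - 1) \<and> q - 1 \<le> n then exp_factor p i l $ k * (of_nat q * l) else 0)"
      unfolding fps_mult_nth by (intro sum.cong) (auto simp: lam)
    also have "\<dots> = (if q - 1 \<le> n then exp_factor p i l $ (n - (q - 1)) * (of_nat q * l) else 0)"
      by auto
    also have "\<dots> = of_nat (Suc n) * exp_factor p i l $ Suc n"
    proof (cases "q dvd Suc n")
      case False
      have "\<not> q dvd n - (q - 1)" if "q - 1 \<le> n"
      proof -
        have "n - (q - 1) = Suc n - q" "q \<le> Suc n" using that q by auto
        thus ?thesis using False dvd_minus_self[of q "Suc n"] by auto
      qed
      thus ?thesis using False by (auto simp: E)
    next
      case True
      then obtain m where m: "Suc n = q * m" by blast
      then obtain k where k: "m = Suc k" by (cases m) auto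
      have n: "n - (q - 1) = q * k" "q - 1 \<le> n" using m k q by auto
      have "exp_factor p i l $ (q * k) * (of_nat q * l) = rat2 (of_nat q / fact k) * l ^ m"
        using q by (simp add: E k of_nat_rat2 mult_ac)
      also have "of_nat q / fact k = (of_nat (q * m) / fact m :: rat)"
        unfolding k by (simp del: of_nat_Suc mult_Suc_right)
      also have "rat2 \<dots> * l ^ m = of_nat (Suc n) * exp_factor p i l $ Suc n"
        unfolding m E using q by (simp add: of_nat_rat2)
      finally show ?thesis using n by simp
    qed
    finally show "fps_deriv (exp_factor p i l) $ n = (exp_factor p i l * lam p ?g) $ n" by simp
  qed
qed

text \<open>Without constant term, l^k has total order at least k. In bounded degree this bounds the
  denominators k! of an exponential.\<close>

lemma power_nth_eq_0_fps2:
  fixes l :: "'a :: comm_ring_1 fps fps"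
  assumes "l $ 0 $ 0 = 0" "t + s < k"
  shows "(l ^ k) $ t $ s = 0"
  using assms(2)
proof (induction k arbitrary: t s)
  case (Suc k)
  show ?case unfolding power_Suc
  proof (rule fps2_mult_nth_closed[where R = "\<lambda>x. x = 0"])
    fix t' s' assume le: "t' \<le> t" "s' \<le> s"
    show "l $ t' $ s' * (l ^ k) $ (t - t') $ (s - s') = 0"
    proof (cases "t' = 0 \<and> s' = 0")
      case False
      hence "t - t' + (s - s') < k" using le Suc.prems by auto
      thus ?thesis by (simp add: Suc.IH)
    qed (simp add: assms(1))
  qed auto
qed auto

lemma p_integral_power_fps2:
  assumes p: "prime p" and l: "\<And>t s. t \<le> J \<Longrightarrow> s \<le> J \<Longrightarrow> p_integral p (l $ t $ s)"
    and "t \<le> J" "s \<le> J"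
  shows "p_integral p ((l ^ k) $ t $ s)"
  using assms(3,4)
proof (induction k arbitrary: t s)
  case 0
  thus ?case using p by (auto simp: prime_nat_iff)
next
  case (Suc k)
  show ?case unfolding power_Suc
    by (rule fps2_mult_nth_closed)
      (use p Suc in \<open>auto intro!: p_integral_add p_integral_mult l simp: prime_nat_iff\<close>)
qed

text \<open>The factors with large \<open>i\<close> are congruent to 1 modulo \<open>p\<close> in low order, and the product
  of the remaining ones has coefficients of unbounded order.\<close>

lemma log_deriv_coeffs_tend_to_0:
  fixes \<Psi> :: "rat fps fps fps"
  assumes p: "prime p"
    and dl: "has_log_deriv p \<Psi> (\<lambda>i. of_nat (p ^ i) * l i)"
    and int: "\<And>n t s. p_integral p (\<Psi> $ n $ t $ s)"
    and l0: "\<And>i. l i $ 0 $ 0 = 0"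
    and small: "\<And>J Q. \<exists>i0. \<forall>i\<ge>i0. \<forall>t\<le>J. \<forall>s\<le>J. p_integral p (l i $ t $ s / of_nat (p ^ Q))"
  shows "\<exists>n1. \<forall>n\<ge>n1. \<forall>t s. t + s \<le> J \<longrightarrow> p_integral p (\<Psi> $ n $ t $ s / of_nat p)"
proof -
  have p2: "p \<ge> 2" "p \<noteq> 1" "p > 0" "(of_nat p :: rat) \<noteq> 0"
    using p prime_ge_2_nat[OF p] by auto
  \<comment> \<open>Chosen so that Q k - 1 \<ge> J! \<ge> k! for 1 \<le> k \<le> J: then (p^Q)^k /
    (p k!) is integral by the crude bound.\<close>
  define Q where "Q = Suc (fact J)"
  obtain i0 where i0: "\<And>i t s. i \<ge> i0 \<Longrightarrow> t \<le> J \<Longrightarrow> s \<le> J \<Longrightarrow>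
      p_integral p (l i $ t $ s / of_nat (p ^ Q))" using small[of J Q] by blast
  \<comment> \<open>A factor exp(l_i X^(p^i)) of the head spends at least one degree in the inner
    variables on every p^i \<le> \<open>D\<close> degrees in X.\<close>
  define D where "D = p ^ i0"
  define Head where "Head = (\<Prod>i<i0. exp_factor p i (l i))"
  define Tail where "Tail n = (\<Prod>i\<in>{i0..n}. exp_factor p i (- l i))" for n
  \<comment> \<open>Since p^i \<le> n forces i \<le> n, a tail cut at n suffices for the coefficient
    of X^n; its negative signs cancel the factors with i \<ge> i0.\<close>
  have eq: "(\<Psi> * Tail n) $ n = Head $ n" for n
  proof (rule has_log_deriv_unique[OF has_log_deriv_mult[OF dl]])
    show "has_log_deriv p (Tail n) (\<lambda>i. \<Sum>j\<in>{i0..n}. if i = j then of_nat (p ^ j) * (- l j) else 0)"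
      unfolding Tail_def by (rule has_log_deriv_prod) (auto intro: exp_factor_log_deriv p2)
    show "has_log_deriv p Head (\<lambda>i. \<Sum>j\<in>{..<i0}. if i = j then of_nat (p ^ j) * l j else 0)"
      unfolding Head_def by (rule has_log_deriv_prod) (auto intro: exp_factor_log_deriv p2)
    fix i assume "p ^ i \<le> n"
    hence "i \<le> n" using power_gt_expt[of p i] p2 by simp
    thus "of_nat (p ^ i) * l i + (\<Sum>j\<in>{i0..n}. if i = j then of_nat (p ^ j) * (- l j) else 0)
      = (\<Sum>j\<in>{..<i0}. if i = j then of_nat (p ^ j) * l j else 0)"
      by auto
  qed simp
  have Head0: "Head $ n $ t $ s = 0" if "(t + s) * D < n" for n t s
  proof -
    have "\<forall>n t s. (t + s) * D < n \<longrightarrow> (\<Prod>i<m. exp_factor p i (l i)) $ n $ t $ s = 0" if "m \<le> i0" for m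
      using that
    proof (induction m)
      case 0
      show ?case by auto
    next
      case (Suc m)
      have ex: "exp_factor p m (l m) $ n $ t $ s = 0" if "(t + s) * D < n" for n t s
      proof (cases "p ^ m dvd n")
        case True
        then obtain k where k: "n = p ^ m * k" by blast
        have "p ^ m \<le> D" unfolding D_def using Suc.prems p2 by (intro power_increasing) auto
        hence "(t + s) * p ^ m \<le> (t + s) * D" by simp
        hence "(t + s) * p ^ m < k * p ^ m"
          using that unfolding k by (simp only: mult.commute[of k])
        hence "t + s < k" by (simp only: mult_less_cancel2)
        hence "(l m ^ k) $ t $ s = 0" by (intro power_nth_eq_0_fps2 l0)
        thus ?thesis using k p2 by (simp add: exp_factor_def)
      qed (simp add: exp_factor_def)
      show ?case
      proof (intro allI impI)
        fix n t s assume lt: "(t + s) * D < n"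
        show "(\<Prod>i<Suc m. exp_factor p i (l i)) $ n $ t $ s = 0"
          unfolding prod.lessThan_Suc
        proof (rule fps3_mult_nth_closed[where R = "\<lambda>x. x = 0"])
          fix i t' s' assume le: "i \<le> n" "t' \<le> t" "s' \<le> s"
          have "(t' + s') * D < i \<or> (t - t' + (s - s')) * D < n - i"
          proof (rule ccontr)
            assume "\<not> ?thesis"
            hence "i + (n - i) \<le> (t' + s') * D + (t - t' + (s - s')) * D" by linarith
            also have "\<dots> = (t' + s' + (t - t' + (s - s'))) * D" by (simp only: add_mult_distrib)
            also have "t' + s' + (t - t' + (s - s')) = t + s" using le by simp
            finally show False using lt le by simp
          qed
          thus "(\<Prod>i<m. exp_factor p i (l i)) $ i $ t' $ s' *
            exp_factor p m (l m) $ (n - i) $ (t - t') $ (s - s') = 0"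
            using ex Suc by auto
        qed auto
      qed
    qed
    thus ?thesis using that by (auto simp: Head_def)
  qed
  define tok where "tok g \<longleftrightarrow> (\<forall>n t s. t + s \<le> J \<longrightarrow> p_integral p ((g - 1) $ n $ t $ s / of_nat p))"
    for g :: "rat fps fps fps"
  have tokD: "p_integral p ((g - 1) $ n $ t $ s / of_nat p)" if "tok g" "t + s \<le> J" for g n t s
    using that unfolding tok_def by blast
  \<comment> \<open>From g h - 1 = (g - 1)(h - 1) + (g - 1) + (h - 1), where the first summand is
    even divisible by p twice.\<close>
  have tok_mult: "tok (g * h)" if "tok g" "tok h" for g h
    unfolding tok_def
  proof (intro allI impI)
    fix n t s assume ts: "t + s \<le> J"
    have "p_integral p (((g - 1) * (h - 1)) $ n $ t $ s / of_nat p)"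
    proof (rule fps3_mult_nth_closed[where R = "\<lambda>x. p_integral p (x / of_nat p)"])
      fix i t' s' assume le: "i \<le> n" "t' \<le> t" "s' \<le> s"
      have "p_integral p (((g - 1) $ i $ t' $ s' / of_nat p) *
        (((h - 1) $ (n - i) $ (t - t') $ (s - s') / of_nat p) * of_nat p))"
        using ts le p2 by (intro p_integral_mult p tokD that) auto
      thus "p_integral p ((g - 1) $ i $ t' $ s' * (h - 1) $ (n - i) $ (t - t') $ (s - s') / of_nat p)"
        using p2 by simp
    qed (use p2 p p_integral_add in \<open>auto simp: add_divide_distrib\<close>)
    moreover have "p_integral p ((g - 1) $ n $ t $ s / of_nat p)" "p_integral p ((h - 1) $ n $ t $ s / of_nat p)"
      by (rule tokD[OF that(1) ts] tokD[OF that(2) ts])+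
    moreover have "g * h - 1 = (g - 1) * (h - 1) + (g - 1) + (h - 1)" by (simp add: algebra_simps)
    hence "(g * h - 1) $ n $ t $ s / of_nat p = ((g - 1) * (h - 1)) $ n $ t $ s / of_nat p
      + (g - 1) $ n $ t $ s / of_nat p + (h - 1) $ n $ t $ s / of_nat p"
      by (simp only: fps_add_nth add_divide_distrib)
    ultimately show "p_integral p ((g * h - 1) $ n $ t $ s / of_nat p)"
      using p by (simp only: p_integral_add)
  qed
  have tok1: "tok 1" using p2 by (simp add: tok_def)
  have tok_exp: "tok (exp_factor p i (- l i))" if "i \<ge> i0" for i
    unfolding tok_def
  proof (intro allI impI)
    fix n t s assume ts: "t + s \<le> J"
    show "p_integral p ((exp_factor p i (- l i) - 1) $ n $ t $ s / of_nat p)"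
    proof (cases "p ^ i dvd n \<and> n \<noteq> 0")
      case True
      then obtain k where k: "n = p ^ i * k" "k > 0" by (auto elim!: dvdE)
      have e: "(exp_factor p i (- l i) - 1) $ n $ t $ s = (1 / fact k) * ((- l i) ^ k) $ t $ s"
        using k p2 by (simp add: exp_factor_def)
      show ?thesis
      \<comment> \<open>For k > J the power of l vanishes in total degree \<le> J. Otherwise p^Q
        divides l in this range and beats the denominator k! together with one further p.\<close>
      proof (cases "k \<le> J")
        case False
        thus ?thesis using p2 ts power_nth_eq_0_fps2[of "- l i" t s k] l0 unfolding e by simp
      next
        case kJ: True
        define l' where "l' = rat2 (1 / of_nat (p ^ Q)) * (- l i)"
        have "- l i = rat2 (of_nat (p ^ Q)) * l'"
          using p2 by (simp add: l'_def mult.assoc [symmetric] del: rat2_mult_nth)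
        hence "(- l i) ^ k = rat2 (of_nat (p ^ (Q * k))) * l' ^ k"
          by (simp add: power_mult_distrib power_mult)
        hence "(exp_factor p i (- l i) - 1) $ n $ t $ s / of_nat p
          = (of_nat (p ^ (Q * k - 1)) / of_nat (fact k)) * (l' ^ k) $ t $ s"
        proof -
          have "Q * k = Suc (Q * k - 1)" using k by (simp add: Q_def)
          hence "p ^ (Q * k) = p * p ^ (Q * k - 1)" by (metis power_Suc)
          thus ?thesis using p2 \<open>(- l i) ^ k = _\<close> unfolding e by simp
        qed
        moreover have "p_integral p ((l' ^ k) $ t $ s)"
        proof (rule p_integral_power_fps2[OF p])
          fix t s assume "t \<le> J" "s \<le> J"
          thus "p_integral p (l' $ t $ s)"
            using p_integral_uminus[OF i0[OF that, of t s]] by (simp add: l'_def)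
        qed (use ts in auto)
        moreover have "p_integral p (of_nat (p ^ (Q * k - 1)) / of_nat (fact k))"
        proof (rule p_integral_power_div_le[OF p])
          have "fact k \<le> (fact J :: nat)" using kJ by (rule fact_mono_nat)
          also have "\<dots> \<le> Q * k - 1" using k by (cases k) (auto simp: Q_def)
          finally show "fact k \<le> Q * k - 1" .
        qed simp
        ultimately show ?thesis using p_integral_mult[OF p] by metis
      qed
    next
      case False
      hence "(exp_factor p i (- l i) - 1) $ n $ t $ s = 0"
        by (cases "n = 0") (auto simp: exp_factor_def)
      thus ?thesis using p2 by simp
    qed
  qed
  have tokT: "tok (Tail n)" for n
  proof -
    have "tok (prod (\<lambda>i. exp_factor p i (- l i)) A)" if "A \<subseteq> {i0..}" for A
      using that
      by (induction A rule: infinite_finite_induct) (auto intro: tok1 tok_mult tok_exp)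
    thus ?thesis unfolding Tail_def by auto
  qed
  show ?thesis
  \<comment> \<open>Beyond X-degree J D the head vanishes in total degree \<le> J; what is left of
    \<Psi> is -\<Psi> (Tail - 1), a multiple of p.\<close>
  proof (rule exI[of _ "Suc (J * D)"], intro allI impI)
    fix n t s assume n: "Suc (J * D) \<le> n" and ts: "t + s \<le> J"
    have "(t + s) * D \<le> J * D" using ts by simp
    hence "Head $ n $ t $ s = 0" using n by (intro Head0) linarith
    moreover have "\<Psi> = \<Psi> * Tail n - \<Psi> * (Tail n - 1)" by (simp add: algebra_simps)
    hence "\<Psi> $ n $ t $ s = (\<Psi> * Tail n) $ n $ t $ s - (\<Psi> * (Tail n - 1)) $ n $ t $ s"
      by (metis fps_sub_nth)
    ultimately have "\<Psi> $ n $ t $ s / of_nat p = - ((\<Psi> * (Tail n - 1)) $ n $ t $ s / of_nat p)"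
      by (simp add: eq)
    moreover have "p_integral p ((\<Psi> * (Tail n - 1)) $ n $ t $ s / of_nat p)"
    proof (rule fps3_mult_nth_closed[where R = "\<lambda>x. p_integral p (x / of_nat p)"])
      fix i t' s' assume le: "i \<le> n" "t' \<le> t" "s' \<le> s"
      have "p_integral p (\<Psi> $ i $ t' $ s' * ((Tail n - 1) $ (n - i) $ (t - t') $ (s - s') / of_nat p))"
        using ts le by (intro p_integral_mult p int tokD tokT) auto
      thus "p_integral p (\<Psi> $ i $ t' $ s' * (Tail n - 1) $ (n - i) $ (t - t') $ (s - s') / of_nat p)"
        by simp
    qed (use p2 p p_integral_add in \<open>auto simp: add_divide_distrib\<close>)
    ultimately show "p_integral p (\<Psi> $ n $ t $ s / of_nat p)"
      using p_integral_uminus by metis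
  qed
qed

section \<open>Quotients of shifted Artin--Hasse series\<close>

definition quads :: "nat \<Rightarrow> (nat \<times> nat \<times> nat \<times> nat) set" where
  "quads n = {(i, j, k, l). i + j + k + l = n}"

lemma fps_mult4_nth:
  fixes f g h w :: "'a :: comm_ring_1 fps"
  shows "(f * g * h * w) $ n = (\<Sum>(i, j, k, l)\<in>quads n. f $ i * g $ j * h $ k * w $ l)"
proof -
  have "(f * g * h * w) $ n =
    (\<Sum>c=0..n. \<Sum>b=0..c. \<Sum>i=0..b. f $ i * g $ (b - i) * h $ (c - b) * w $ (n - c))"
    by (simp add: fps_mult_nth sum_distrib_right)
  also have "\<dots> = (\<Sum>(c, b, i)\<in>(SIGMA c:{0..n}. SIGMA b:{0..c}. {0..b}).
      f $ i * g $ (b - i) * h $ (c - b) * w $ (n - c))"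
    by (simp add: sum.Sigma case_prod_unfold)
  also have "\<dots> = (\<Sum>(i, j, k, l)\<in>quads n. f $ i * g $ j * h $ k * w $ l)"
    by (rule sum.reindex_bij_witness[where j = "\<lambda>(c, b, i). (i, b - i, c - b, n - c)"
          and i = "\<lambda>(i, j, k, l). (i + j + k, i + j, i)"]) (auto simp: quads_def)
  finally show ?thesis .
qed

text \<open>The coefficient of X^n x^s y^t in a product of four series with terms
  \<open>u q n\<close> (1+x)^(a q n) (1+y)^(b q n) X^n. It is a universal polynomial in
  \<open>u\<close>, so a divisibility proved over the rationals passes to F_p and then holds for
  arbitrary x and y.\<close>

definition quad_coeff ::
    "(nat \<Rightarrow> nat \<Rightarrow> 'a :: comm_ring_1) \<Rightarrow> (nat \<Rightarrow> nat \<Rightarrow> nat) \<Rightarrow> (nat \<Rightarrow> nat \<Rightarrow> nat) \<Rightarrow> nat \<Rightarrow> nat \<Rightarrow> nat \<Rightarrow> 'a"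
where
  "quad_coeff u a b n s t = (\<Sum>(i, j, k, l)\<in>quads n. u 0 i * u 1 j * u 2 k * u 3 l *
     of_nat (((a 0 i + a 1 j + a 2 k + a 3 l) choose s) * ((b 0 i + b 1 j + b 2 k + b 3 l) choose t)))"

definition exp_series :: "('a \<Rightarrow> 'r :: comm_ring_1) \<Rightarrow> (nat \<Rightarrow> nat \<Rightarrow> 'a) \<Rightarrow> (nat \<Rightarrow> nat \<Rightarrow> nat) \<Rightarrow>
    (nat \<Rightarrow> nat \<Rightarrow> nat) \<Rightarrow> 'r \<Rightarrow> 'r \<Rightarrow> nat \<Rightarrow> 'r fps" where
  "exp_series \<iota> u a b c d q = Abs_fps (\<lambda>n. \<iota> (u q n) * c ^ a q n * d ^ b q n)"

definition exp_series4 where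
  "exp_series4 \<iota> u a b c d = exp_series \<iota> u a b c d 0 * exp_series \<iota> u a b c d 1 *
     exp_series \<iota> u a b c d 2 * exp_series \<iota> u a b c d 3"

lemma one_plus_power_expand:
  fixes x :: "'r :: comm_ring_1"
  assumes "m \<le> N"
  shows "(1 + x) ^ m = (\<Sum>s\<le>N. of_nat (m choose s) * x ^ s)"
proof -
  have "(1 + x) ^ m = (\<Sum>s\<le>m. of_nat (m choose s) * x ^ s)"
    using binomial_ring[of x 1 m] by (simp add: add.commute)
  also have "\<dots> = (\<Sum>s\<le>N. of_nat (m choose s) * x ^ s)"
    using assms by (intro sum.mono_neutral_left) (auto simp: binomial_eq_0)
  finally show ?thesis .
qed

text \<open>The binomial theorem separates the universal coefficients from x and y. The exponents in
  the coefficient of X^n are at most n, so any \<open>N\<close> \<ge> n bounds both sums.\<close>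

lemma exp_series4_nth:
  fixes \<iota> :: "'a :: comm_ring_1 \<Rightarrow> 'r :: comm_ring_1"
  assumes hom: "\<iota> 0 = 0" "\<iota> 1 = 1" "\<And>x y. \<iota> (x + y) = \<iota> x + \<iota> y" "\<And>x y. \<iota> (x * y) = \<iota> x * \<iota> y"
    and ab: "\<And>q n. a q n \<le> n" "\<And>q n. b q n \<le> n" and "n \<le> N"
  shows "exp_series4 \<iota> u a b (1 + x) (1 + y) $ n =
    (\<Sum>s\<le>N. \<Sum>t\<le>N. \<iota> (quad_coeff u a b n s t) * x ^ s * y ^ t)"
proof -
  have isum: "\<iota> (sum f A) = (\<Sum>i\<in>A. \<iota> (f i))" for f :: "nat \<times> nat \<times> nat \<times> nat \<Rightarrow> 'a" and A
    by (induction A rule: infinite_finite_induct) (auto simp: hom)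
  have inat: "\<iota> (of_nat m) = of_nat m" for m by (induction m) (auto simp: hom)
  define A where "A = (\<lambda>(i, j, k, l). a 0 i + a 1 j + a 2 k + a 3 l)"
  define B where "B = (\<lambda>(i, j, k, l). b 0 i + b 1 j + b 2 k + b 3 l)"
  define U where "U = (\<lambda>(i, j, k, l). u 0 i * u 1 j * u 2 k * u 3 l)"
  have AB: "A z \<le> N" "B z \<le> N" if "z \<in> quads n" for z
  proof -
    obtain i j k l where z: "z = (i, j, k, l)" by (cases z)
    have *: "i + j + k + l \<le> N" using that \<open>n \<le> N\<close> by (simp add: z quads_def)
    show "A z \<le> N" using * ab(1)[of 0 i] ab(1)[of 1 j] ab(1)[of 2 k] ab(1)[of 3 l]
      by (simp add: A_def z)
    show "B z \<le> N" using * ab(2)[of 0 i] ab(2)[of 1 j] ab(2)[of 2 k] ab(2)[of 3 l]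
      by (simp add: B_def z)
  qed
  have "exp_series4 \<iota> u a b (1 + x) (1 + y) $ n = (\<Sum>z\<in>quads n. \<iota> (U z) * (1 + x) ^ A z * (1 + y) ^ B z)"
    unfolding exp_series4_def fps_mult4_nth
    by (intro sum.cong) (auto simp: exp_series_def U_def A_def B_def hom power_add mult_ac)
  also have "\<dots> = (\<Sum>z\<in>quads n. \<iota> (U z) * (\<Sum>s\<le>N. of_nat (A z choose s) * x ^ s) *
      (\<Sum>t\<le>N. of_nat (B z choose t) * y ^ t))"
    by (intro sum.cong) (auto simp: one_plus_power_expand[OF AB(1)] one_plus_power_expand[OF AB(2)])
  also have "\<dots> = (\<Sum>z\<in>quads n. \<Sum>s\<le>N. \<Sum>t\<le>N. \<iota> (U z) * of_nat (A z choose s) * of_nat (B z choose t) * x ^ s * y ^ t)"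
    by (simp add: sum_distrib_left sum_distrib_right mult_ac)
  also have "\<dots> = (\<Sum>s\<le>N. \<Sum>z\<in>quads n. \<Sum>t\<le>N. \<iota> (U z) * of_nat (A z choose s) * of_nat (B z choose t) * x ^ s * y ^ t)"
    by (rule sum.swap)
  also have "\<dots> = (\<Sum>s\<le>N. \<Sum>t\<le>N. \<Sum>z\<in>quads n. \<iota> (U z) * of_nat (A z choose s) * of_nat (B z choose t) * x ^ s * y ^ t)"
    by (intro sum.cong refl sum.swap)
  also have "\<dots> = (\<Sum>s\<le>N. \<Sum>t\<le>N. \<iota> (quad_coeff u a b n s t) * x ^ s * y ^ t)"
  proof (intro sum.cong refl)
    fix s t
    have "quad_coeff u a b n s t = (\<Sum>z\<in>quads n. U z * of_nat (A z choose s) * of_nat (B z choose t))"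
      unfolding quad_coeff_def by (intro sum.cong) (auto simp: U_def A_def B_def mult_ac)
    thus "(\<Sum>z\<in>quads n. \<iota> (U z) * of_nat (A z choose s) * of_nat (B z choose t) * x ^ s * y ^ t) =
      \<iota> (quad_coeff u a b n s t) * x ^ s * y ^ t"
      by (simp add: isum hom inat sum_distrib_right)
  qed
  finally show ?thesis .
qed

text \<open>With the two inner variables in place of x and y the universal coefficient is literally
  a coefficient, so \<open>log_deriv_coeffs_tend_to_0\<close> becomes a statement about
  \<open>quad_coeff\<close>.\<close>

lemma rat_exp_series4_nth:
  assumes ab: "\<And>q n. a q n \<le> n" "\<And>q n. b q n \<le> n"
  shows "exp_series4 rat2 u a b (1 + fps_const fps_X) (1 + fps_X) $ n $ t $ s = quad_coeff u a b n s t"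
proof -
  define N where "N = n + s + t"
  have "exp_series4 rat2 u a b (1 + fps_const fps_X) (1 + fps_X) $ n $ t $ s =
    (\<Sum>s'\<le>N. \<Sum>t'\<le>N. (rat2 (quad_coeff u a b n s' t') * fps_const fps_X ^ s' * fps_X ^ t') $ t $ s)"
    by (subst exp_series4_nth[where N = N]) (use ab in \<open>auto simp: fps_sum_nth N_def simp flip: fps_const_power\<close>)
  also have "\<dots> = (\<Sum>s'\<le>N. \<Sum>t'\<le>N. if t' = t then if s' = s then quad_coeff u a b n s' t' else 0 else 0)"
    by (intro sum.cong refl) (auto simp: mult.assoc fps_X_power_mult_right_nth)
  also have "\<dots> = quad_coeff u a b n s t"
    by (simp add: N_def)
  finally show ?thesis .
qed

lemma quad_coeff_integral:
  assumes p: "prime p" and u: "\<And>q n. p_integral p (u q n)"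
  shows "p_integral p (quad_coeff u a b n s t)"
  unfolding quad_coeff_def using p
  by (auto intro!: p_integral_sum p_integral_mult u p_integral_of_nat simp: prime_nat_iff simp del: of_nat_mult)

lemma quad_coeff_reduce:
  fixes u :: "nat \<Rightarrow> nat \<Rightarrow> rat"
  assumes u: "\<And>q n. p_integral CARD('p :: prime_card) (u q n)"
  shows "quad_coeff (\<lambda>q n. to_ac (reduce_rat (u q n) :: 'p mod_ring)) a b n s t =
    to_ac (reduce_rat (quad_coeff u a b n s t))"
proof -
  have p: "prime CARD('p)" "CARD('p) \<noteq> 1" using prime_card[where 'a = 'p] by (auto simp: prime_nat_iff)
  note ints = p_integral_mult[OF p(1)] u p_integral_of_nat[OF p(2)]
  have "(reduce_rat (quad_coeff u a b n s t) :: 'p mod_ring) =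
    (\<Sum>(i, j, k, l)\<in>quads n. reduce_rat (u 0 i * u 1 j * u 2 k * u 3 l *
      of_nat (((a 0 i + a 1 j + a 2 k + a 3 l) choose s) * ((b 0 i + b 1 j + b 2 k + b 3 l) choose t))))"
    unfolding quad_coeff_def
    by (subst reduce_rat_sum) (auto intro!: ints sum.cong simp del: of_nat_mult)
  also have "\<dots> = (\<Sum>(i, j, k, l)\<in>quads n. reduce_rat (u 0 i) * reduce_rat (u 1 j) * reduce_rat (u 2 k) * reduce_rat (u 3 l) *
      of_nat (((a 0 i + a 1 j + a 2 k + a 3 l) choose s) * ((b 0 i + b 1 j + b 2 k + b 3 l) choose t)))"
    by (intro sum.cong refl) (auto simp: reduce_rat_mult ints simp del: of_nat_mult)
  finally show ?thesis
    unfolding quad_coeff_def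
    by (simp add: to_ac_sum case_prod_unfold)
qed

text \<open>Substituting cX for X multiplies the term X^(p^i) of the logarithm by c^(p^i).\<close>

lemma has_log_deriv_scale:
  fixes E :: "rat fps"
  assumes "has_log_deriv p E g"
  shows "has_log_deriv p (Abs_fps (\<lambda>n. rat2 (E $ n) * c ^ n)) (\<lambda>i. rat2 (g i) * c ^ (p ^ i))"
proof -
  have r2sum: "rat2 (sum f A) = (\<Sum>i\<in>A. rat2 (f i))" for f :: "nat \<Rightarrow> rat" and A
    by (induction A rule: infinite_finite_induct) (auto simp flip: rat2_simps(3))
  have "fps_deriv (Abs_fps (\<lambda>n. rat2 (E $ n) * c ^ n)) $ m =
    (Abs_fps (\<lambda>n. rat2 (E $ n) * c ^ n) * lam p (\<lambda>i. rat2 (g i) * c ^ (p ^ i))) $ m" for m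
  proof -
    have l: "lam p (\<lambda>i. rat2 (g i) * c ^ (p ^ i)) $ k = rat2 (lam p g $ k) * c ^ Suc k" for k
      unfolding lam_def by (auto simp: r2sum sum_distrib_right intro!: sum.cong)
    have "of_nat (Suc m) * E $ Suc m = (E * lam p g) $ m"
      using assms fps_deriv_nth[of E m] by (simp add: has_log_deriv_def)
    hence e: "rat2 (of_nat (Suc m) * E $ Suc m) = (\<Sum>k=0..m. rat2 (E $ k) * rat2 (lam p g $ (m - k)))"
      by (simp add: fps_mult_nth r2sum)
    have "fps_deriv (Abs_fps (\<lambda>n. rat2 (E $ n) * c ^ n)) $ m = rat2 (of_nat (Suc m) * E $ Suc m) * c ^ Suc m"
      unfolding rat2_simps(4) [symmetric] of_nat_rat2 [symmetric] by (simp add: mult_ac)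
    also have "\<dots> = (\<Sum>k=0..m. rat2 (E $ k) * rat2 (lam p g $ (m - k)) * c ^ Suc m)"
      unfolding e by (simp only: sum_distrib_right)
    also have "\<dots> = (\<Sum>k=0..m. (rat2 (E $ k) * c ^ k) * (rat2 (lam p g $ (m - k)) * c ^ Suc (m - k)))"
    proof (intro sum.cong refl)
      fix k assume "k \<in> {0..m}"
      hence "c ^ Suc m = c ^ k * c ^ Suc (m - k)" by (simp flip: power_add)
      thus "rat2 (E $ k) * rat2 (lam p g $ (m - k)) * c ^ Suc m =
        (rat2 (E $ k) * c ^ k) * (rat2 (lam p g $ (m - k)) * c ^ Suc (m - k))"
        by (simp only: mult_ac)
    qed
    finally show ?thesis by (simp only: fps_mult_nth l fps_nth_Abs_fps)
  qed
  thus ?thesis using assms by (auto simp: has_log_deriv_def intro: fps_ext)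
qed

section \<open>Powers of 1 + X and the p-adic size of binomial coefficients of p^i\<close>

lemma one_plus_X_power_nth: "(1 + fps_X :: rat fps) ^ m $ s = of_nat (m choose s)"
  using arg_cong[OF fps_binomial_of_nat[where 'a = rat, of m], of "\<lambda>f. f $ s"]
  by (simp add: binomial_gbinomial)

lemma one_plus_const_X_power_nth:
  "((1 + fps_const fps_X :: rat fps fps) ^ m) $ t $ s = (if t = 0 then of_nat (m choose s) else 0)"
proof -
  have "(1 + fps_const fps_X :: rat fps fps) ^ m = fps_const ((1 + fps_X) ^ m)"
    by (metis fps_const_1_eq_1 fps_const_add fps_const_power)
  hence "((1 + fps_const fps_X :: rat fps fps) ^ m) $ t = fps_const ((1 + fps_X) ^ m) $ t"
    by (rule arg_cong)
  thus ?thesis by (cases "t = 0") (simp_all add: one_plus_X_power_nth)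
qed

lemma one_plus_X_power_nth2:
  "((1 + fps_X :: rat fps fps) ^ m) $ t $ s = (if s = 0 then of_nat (m choose t) else 0)"
proof -
  have "((1 + fps_X :: rat fps fps) ^ m) $ t = (\<Sum>i\<le>m. (of_nat (m choose i) * fps_X ^ i) $ t)"
    using one_plus_power_expand[of m m "fps_X :: rat fps fps"] by (simp add: fps_sum_nth)
  also have "\<dots> = (\<Sum>i\<le>m. if i = t then of_nat (m choose i) else 0)"
    by (intro sum.cong) auto
  finally show ?thesis by (auto simp: binomial_eq_0)
qed

text \<open>Both binom(p^i, s) / p^i and binom(p^(i-1), s) / p^(i-1) approximate the s-th
  coefficient of log(1 + x); this measures their difference. With binom(N, s) = N P(N) / s! and
  P(pm) congruent to P(m) modulo m, a multiple of m / s! remains, where m = p^(i-1).\<close>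

lemma binomial_p_power_diff:
  assumes p: "prime p" and "1 \<le> s" "s \<le> J" "Suc (Q + fact J) \<le> i"
  shows "p_integral p ((of_nat (p ^ i choose s) - of_nat p * of_nat (p ^ (i - 1) choose s)) / of_nat (p ^ i) / of_nat (p ^ Q))"
proof -
  define m where "m = p ^ (i - 1)"
  obtain s' where s: "s = Suc s'" using assms(2) by (cases s) auto
  have pm: "p ^ i = p * m" using assms(4) unfolding m_def by (cases i) auto
  have p0: "p > 0" "(of_nat p :: rat) \<noteq> 0" using prime_gt_0_nat[OF p] by auto
  have m0: "(of_nat m :: rat) \<noteq> 0" using p0 by (simp add: m_def)
  \<comment> \<open>The falling factorial (N - 1) ... (N - s + 1), without the factor N.\<close>
  define P where "P N = (\<Prod>j<s'. int N - 1 - int j)" for N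
  have ch: "of_nat (N choose s) = of_nat N * of_int (P N) / (fact s :: rat)" for N
  proof -
    have "of_nat (N choose s) = (\<Prod>j=0..<s. of_nat N - of_nat j) / (fact s :: rat)"
      by (simp add: binomial_gbinomial gbinomial_prod_rev)
    also have "(\<Prod>j=0..<s. of_nat N - of_nat j) = (of_nat N * of_int (P N) :: rat)"
      unfolding s prod.atLeast0_lessThan_Suc_shift P_def lessThan_atLeast0
      by (simp add: diff_diff_eq)
    finally show ?thesis .
  qed
  have "int m dvd (\<Prod>j\<in>A. int (p * m) - 1 - int j) - (\<Prod>j\<in>A. int m - 1 - int j)" for A :: "nat set"
  proof (induction A rule: infinite_finite_induct)
    case (insert x F)
    let ?f = "\<lambda>j. int (p * m) - 1 - int j" and ?g = "\<lambda>j. int m - 1 - int j"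
    have "prod ?f (insert x F) - prod ?g (insert x F) =
      ?f x * (prod ?f F - prod ?g F) + int m * ((int p - 1) * prod ?g F)"
      using insert by (simp add: algebra_simps)
    thus ?case using insert.IH by (metis dvd_add dvd_mult dvd_triv_left)
  qed auto
  then obtain z where z: "P (p * m) - P m = int m * z" unfolding P_def by blast
  have "of_nat (p ^ i choose s) - of_nat p * of_nat (m choose s)
    = of_nat p * of_nat m * of_int (P (p * m) - P m) / (fact s :: rat)"
    by (simp add: ch pm field_simps)
  hence "(of_nat (p ^ i choose s) - of_nat p * of_nat (m choose s)) / of_nat (p ^ i) =
    of_nat m * of_int z / (fact s :: rat)"
    using p0 m0 by (simp add: z pm)
  hence "(of_nat (p ^ i choose s) - of_nat p * of_nat (m choose s)) / of_nat (p ^ i) / of_nat (p ^ Q) =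
    of_int z * (of_nat (p ^ (i - 1 - Q)) / of_nat (fact s) :: rat)"
  proof -
    have "p ^ (i - 1) = p ^ (i - 1 - Q) * p ^ Q" using assms(4) by (simp flip: power_add)
    hence "of_nat m = (of_nat (p ^ (i - 1 - Q)) * of_nat (p ^ Q) :: rat)" unfolding m_def by (metis of_nat_mult)
    thus ?thesis using \<open>_ = of_nat m * of_int z / fact s\<close> p0 by (simp add: field_simps)
  qed
  moreover have "p_integral p (of_nat (p ^ (i - 1 - Q)) / of_nat (fact s))"
  proof (rule p_integral_power_div_le[OF p])
    have "fact s \<le> (fact J :: nat)" using assms(3) by (rule fact_mono_nat)
    thus "fact s \<le> i - 1 - Q" using assms(4) by simp
  qed simp
  moreover have "p \<noteq> 1" using p by auto
  ultimately show ?thesis using p_integral_mult[OF p p_integral_of_int] unfolding m_def by metis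
qed

text \<open>From binom(N, s) = (N / s) binom(N - 1, s - 1), two factors N = p^i appear and only one
  is divided out, so a multiple of N / (s t) remains.\<close>

lemma binomial_p_power_mult:
  assumes p: "prime p" and "1 \<le> s" "s \<le> J" "1 \<le> t" "t \<le> J" "Q + J * J \<le> i"
  shows "p_integral p (of_nat (p ^ i choose s) * of_nat (p ^ i choose t) / of_nat (p ^ i) / of_nat (p ^ Q))"
proof -
  define N where "N = p ^ i"
  have p0: "p > 0" "(of_nat p :: rat) \<noteq> 0" using prime_gt_0_nat[OF p] by auto
  have N0: "(of_nat N :: rat) \<noteq> 0" using p0 by (simp add: N_def)
  have ch: "of_nat (N choose r) = (of_nat N * of_nat ((N - 1) choose (r - 1)) / of_nat r :: rat)" if "1 \<le> r" for r
  proof -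
    have "r * (N choose r) = N * ((N - 1) choose (r - 1))"
      using that times_binomial_minus1_eq[of r N] by simp
    hence "of_nat r * of_nat (N choose r) = (of_nat N * of_nat ((N - 1) choose (r - 1)) :: rat)"
      by (metis of_nat_mult)
    thus ?thesis using that by (simp add: field_simps)
  qed
  have "of_nat (N choose s) * of_nat (N choose t) / of_nat N / of_nat (p ^ Q) =
    of_nat (((N - 1) choose (s - 1)) * ((N - 1) choose (t - 1))) * (of_nat (p ^ (i - Q)) / of_nat (s * t) :: rat)"
  proof -
    have "p ^ i = p ^ (i - Q) * p ^ Q" using assms(6) by (simp flip: power_add)
    hence "of_nat N = (of_nat (p ^ (i - Q)) * of_nat (p ^ Q) :: rat)" unfolding N_def by (metis of_nat_mult)
    moreover have "of_nat (N choose s) * of_nat (N choose t) / of_nat N =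
      of_nat (((N - 1) choose (s - 1)) * ((N - 1) choose (t - 1))) * (of_nat N / of_nat (s * t) :: rat)"
      using N0 assms(2,4) by (simp add: ch)
    ultimately show ?thesis using p0 by simp
  qed
  moreover have "p_integral p (of_nat (p ^ (i - Q)) / of_nat (s * t))"
  proof (rule p_integral_power_div_le[OF p])
    have "s * t \<le> J * J" using assms(3,5) by (rule mult_le_mono)
    thus "s * t \<le> i - Q" using assms(6) by simp
  qed (use assms in simp)
  moreover have "p \<noteq> 1" using p by auto
  ultimately show ?thesis using p_integral_mult[OF p p_integral_of_nat] unfolding N_def by metis
qed

text \<open>\<open>E(Xc) E(X)\<inverse> (E(X) E(Xc)\<inverse>)(X\<^sup>p)\<close>, where \<open>ei\<close> are the coefficients of \<open>E\<inverse>\<close>\<close>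

definition frob_u :: "nat \<Rightarrow> (nat \<Rightarrow> 'a) \<Rightarrow> (nat \<Rightarrow> 'a) \<Rightarrow> nat \<Rightarrow> nat \<Rightarrow> 'a :: zero" where
  "frob_u p e ei q n = (if q = 0 then e n else if q = 1 then ei n
     else if q = 2 then (if p dvd n then e (n div p) else 0)
     else (if p dvd n then ei (n div p) else 0))"

text \<open>Exponents of c: only the first and the last factor contain c, and in the last one X^(pk)
  carries c^k, not c^(pk).\<close>

definition frob_a :: "nat \<Rightarrow> nat \<Rightarrow> nat \<Rightarrow> nat" where
  "frob_a p q n = (if q = 0 then n else if q = 3 then n div p else 0)"

text \<open>\<open>E(Xcd) E(X) E(Xc)\<inverse> E(Xd)\<inverse>\<close>\<close>

definition mult_u :: "(nat \<Rightarrow> 'a) \<Rightarrow> (nat \<Rightarrow> 'a) \<Rightarrow> nat \<Rightarrow> nat \<Rightarrow> 'a" where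
  "mult_u e ei q n = (if q \<le> 1 then e n else ei n)"

definition mult_a :: "nat \<Rightarrow> nat \<Rightarrow> nat" where
  "mult_a q n = (if q = 0 \<or> q = 2 then n else 0)"

definition mult_b :: "nat \<Rightarrow> nat \<Rightarrow> nat" where
  "mult_b q n = (if q = 0 \<or> q = 3 then n else 0)"

lemma frob_a_le: "frob_a p q n \<le> n" by (simp add: frob_a_def)
lemma mult_a_le: "mult_a q n \<le> n" by (simp add: mult_a_def)
lemma mult_b_le: "mult_b q n \<le> n" by (simp add: mult_b_def)

text \<open>For i > 0, \<open>l i\<close> is (c^(p^i) - 1)/p^i - (c^(p^(i-1)) - 1)/p^(i-1), a
  difference of two approximations of log c. The factors in X^p are there to produce the second one;
  E(Xc)/E(X) alone would give the limit log c instead of 0.\<close>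

lemma frob_coeffs_tend_to_0:
  fixes J :: nat
  defines "p \<equiv> CARD('p :: prime_card)"
  defines "E \<equiv> artin_hasse p"
  shows "\<exists>n1. \<forall>n\<ge>n1. \<forall>s t. s + t \<le> J \<longrightarrow>
    p_integral p (quad_coeff (frob_u p (fps_nth E) (fps_nth (inverse E))) (frob_a p) (\<lambda>_ _. 0) n s t / of_nat p)"
proof -
  have p: "prime p" "p \<ge> 2" "p \<noteq> 1" "p > 0" "(of_nat p :: rat) \<noteq> 0"
    using prime_card[where 'a = 'p] prime_ge_2_nat[of p] by (auto simp: p_def)
  define u where "u = frob_u p (fps_nth E) (fps_nth (inverse E))"
  define c :: "rat fps fps" where "c = 1 + fps_const fps_X"
  define \<Psi> where "\<Psi> = exp_series4 rat2 u (frob_a p) (\<lambda>_ _. 0) c (1 + fps_X)"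
  have nth: "\<Psi> $ n $ t $ s = quad_coeff u (frob_a p) (\<lambda>_ _. 0) n s t" for n s t
    unfolding \<Psi>_def c_def by (rule rat_exp_series4_nth) (auto simp: frob_a_le)
  have uint: "p_integral p (u q n)" for q n
    using p_integral_artin_hasse[where 'p = 'p] p_integral_inverse_artin_hasse[where 'p = 'p] p
    by (auto simp: u_def frob_u_def E_def p_def)
  define l where "l i = rat2 (1 / of_nat (p ^ i)) * (c ^ (p ^ i) - 1 +
    (if i = 0 then 0 else of_nat p * (1 - c ^ (p ^ (i - 1)))))" for i
  have E0: "inverse E * E = 1" by (rule inverse_mult_eq_1) (simp add: E_def)
  have dlE: "has_log_deriv p E (\<lambda>_. 1)" unfolding E_def by (rule artin_hasse_log_deriv[OF p(2)])
  have dlI: "has_log_deriv p (inverse E) (\<lambda>_. - 1)"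
    by (rule has_log_deriv_inverse[OF dlE]) (use E0 in \<open>simp add: mult.commute\<close>)
  have "has_log_deriv p \<Psi> (\<lambda>i. of_nat (p ^ i) * l i)"
  proof -
    define S1 where "S1 = Abs_fps (\<lambda>n. rat2 (E $ n) * c ^ n)"
    define S2 where "S2 = Abs_fps (\<lambda>n. rat2 (inverse E $ n) * 1 ^ n)"
    define S3 where "S3 = Abs_fps (\<lambda>n. rat2 (E $ n) * 1 ^ n)"
    define S4 where "S4 = Abs_fps (\<lambda>n. rat2 (inverse E $ n) * c ^ n)"
    have "\<Psi> = S1 * S2 * (S3 oo fps_X ^ p) * (S4 oo fps_X ^ p)"
    proof -
      have "exp_series rat2 u (frob_a p) (\<lambda>_ _. 0) c (1 + fps_X) 0 = S1"
        "exp_series rat2 u (frob_a p) (\<lambda>_ _. 0) c (1 + fps_X) 1 = S2"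
        by (rule fps_ext, simp add: exp_series_def S1_def S2_def u_def frob_u_def frob_a_def)+
      moreover have "exp_series rat2 u (frob_a p) (\<lambda>_ _. 0) c (1 + fps_X) 2 = S3 oo fps_X ^ p"
        "exp_series rat2 u (frob_a p) (\<lambda>_ _. 0) c (1 + fps_X) 3 = S4 oo fps_X ^ p"
        using p by (auto intro!: fps_ext simp: fps_nth_compose_X_power exp_series_def S3_def S4_def u_def frob_u_def frob_a_def)
      ultimately show ?thesis by (simp add: \<Psi>_def exp_series4_def)
    qed
    moreover have "has_log_deriv p (S1 * S2 * (S3 oo fps_X ^ p) * (S4 oo fps_X ^ p))
      (\<lambda>i. rat2 1 * c ^ (p ^ i) + rat2 (- 1) * 1 ^ (p ^ i)
        + (if i = 0 then 0 else of_nat p * (rat2 1 * 1 ^ (p ^ (i - 1))))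
        + (if i = 0 then 0 else of_nat p * (rat2 (- 1) * c ^ (p ^ (i - 1)))))"
      unfolding S1_def S2_def S3_def S4_def
      by (intro has_log_deriv_mult has_log_deriv_compose_power p has_log_deriv_scale dlE dlI)
    moreover have "rat2 1 * c ^ (p ^ i) + rat2 (- 1) * 1 ^ (p ^ i)
        + (if i = 0 then 0 else of_nat p * (rat2 1 * 1 ^ (p ^ (i - 1))))
        + (if i = 0 then 0 else of_nat p * (rat2 (- 1) * c ^ (p ^ (i - 1)))) = of_nat (p ^ i) * l i" for i
    proof -
      have "rat2 (- 1) = - 1" by (simp flip: rat2_simps(5))
      moreover have "of_nat (p ^ i) * rat2 (1 / of_nat (p ^ i)) = 1"
        unfolding of_nat_rat2 using p by simp
      ultimately show ?thesis unfolding l_def mult.assoc [symmetric] by (simp add: algebra_simps)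
    qed
    ultimately show ?thesis by simp
  qed
  moreover have lnth: "l i $ t $ s = (if t = 0 \<and> s \<noteq> 0 then (of_nat (p ^ i choose s) -
      (if i = 0 then 0 else of_nat p * of_nat (p ^ (i - 1) choose s))) / of_nat (p ^ i) else 0)" for i t s
  proof -
    have "(of_nat p * (1 - c ^ (p ^ (i - 1)))) $ t $ s = of_nat p * (1 - c ^ (p ^ (i - 1))) $ t $ s"
      unfolding of_nat_rat2 by simp
    moreover have cn: "(c ^ n) $ t $ s = (if t = 0 then of_nat (n choose s) else 0)" for n
      unfolding c_def by (rule one_plus_const_X_power_nth)
    moreover note cn[of 1, unfolded power_one_right]
    ultimately show ?thesis unfolding l_def rat2_mult_nth
      by (cases "t = 0"; cases "s = 0"; cases "i = 0") (simp_all del: of_nat_power)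
  qed
  moreover have "\<exists>i0. \<forall>i\<ge>i0. \<forall>t\<le>J. \<forall>s\<le>J. p_integral p (l i $ t $ s / of_nat (p ^ Q))" for J Q
  proof (intro exI[of _ "Suc (Q + fact J)"] allI impI)
    fix i t s assume *: "i \<ge> Suc (Q + fact J)" "t \<le> J" "s \<le> J"
    show "p_integral p (l i $ t $ s / of_nat (p ^ Q))"
    proof (cases "t = 0 \<and> s \<noteq> 0")
      case True
      thus ?thesis using binomial_p_power_diff[OF p(1), of s J Q i] * by (simp add: lnth)
    qed (use p in \<open>auto simp: lnth\<close>)
  qed
  moreover have "p_integral p (\<Psi> $ n $ t $ s)" for n t s
    unfolding nth by (rule quad_coeff_integral[OF p(1) uint])
  ultimately have "\<exists>n1. \<forall>n\<ge>n1. \<forall>t s. t + s \<le> J \<longrightarrow> p_integral p (\<Psi> $ n $ t $ s / of_nat p)"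
    by (intro log_deriv_coeffs_tend_to_0[OF p(1), where l = l]) auto
  thus ?thesis unfolding nth u_def by (metis add.commute)
qed

text \<open>Here \<open>l i\<close> = (c^(p^i) - 1)(d^(p^i) - 1)/p^i. Each factor is about p^i times
  a logarithm, so \<open>l i\<close> tends to 0.\<close>

lemma mult_coeffs_tend_to_0:
  fixes J :: nat
  defines "p \<equiv> CARD('p :: prime_card)"
  defines "E \<equiv> artin_hasse p"
  shows "\<exists>n1. \<forall>n\<ge>n1. \<forall>s t. s + t \<le> J \<longrightarrow>
    p_integral p (quad_coeff (mult_u (fps_nth E) (fps_nth (inverse E))) mult_a mult_b n s t / of_nat p)"
proof -
  have p: "prime p" "p \<ge> 2" "p \<noteq> 1" "p > 0" "(of_nat p :: rat) \<noteq> 0"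
    using prime_card[where 'a = 'p] prime_ge_2_nat[of p] by (auto simp: p_def)
  define u where "u = mult_u (fps_nth E) (fps_nth (inverse E))"
  define c d :: "rat fps fps" where "c = 1 + fps_const fps_X" and "d = 1 + fps_X"
  define \<Psi> where "\<Psi> = exp_series4 rat2 u mult_a mult_b c d"
  have nth: "\<Psi> $ n $ t $ s = quad_coeff u mult_a mult_b n s t" for n s t
    unfolding \<Psi>_def c_def d_def by (rule rat_exp_series4_nth) (auto simp: mult_a_le mult_b_le)
  have uint: "p_integral p (u q n)" for q n
    using p_integral_artin_hasse[where 'p = 'p] p_integral_inverse_artin_hasse[where 'p = 'p] p
    by (auto simp: u_def mult_u_def E_def p_def)
  define l where "l i = rat2 (1 / of_nat (p ^ i)) * ((c ^ (p ^ i) - 1) * (d ^ (p ^ i) - 1))" for i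
  have E0: "inverse E * E = 1" by (rule inverse_mult_eq_1) (simp add: E_def)
  have dlE: "has_log_deriv p E (\<lambda>_. 1)" unfolding E_def by (rule artin_hasse_log_deriv[OF p(2)])
  have dlI: "has_log_deriv p (inverse E) (\<lambda>_. - 1)"
    by (rule has_log_deriv_inverse[OF dlE]) (use E0 in \<open>simp add: mult.commute\<close>)
  have "has_log_deriv p \<Psi> (\<lambda>i. of_nat (p ^ i) * l i)"
  proof -
    have "\<Psi> = Abs_fps (\<lambda>n. rat2 (E $ n) * (c * d) ^ n) * Abs_fps (\<lambda>n. rat2 (E $ n) * 1 ^ n) *
      Abs_fps (\<lambda>n. rat2 (inverse E $ n) * c ^ n) * Abs_fps (\<lambda>n. rat2 (inverse E $ n) * d ^ n)"
      unfolding \<Psi>_def exp_series4_def exp_series_def u_def mult_u_def mult_a_def mult_b_def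
      by (simp add: power_mult_distrib mult.assoc)
    moreover have "has_log_deriv p (Abs_fps (\<lambda>n. rat2 (E $ n) * (c * d) ^ n) * Abs_fps (\<lambda>n. rat2 (E $ n) * 1 ^ n) *
      Abs_fps (\<lambda>n. rat2 (inverse E $ n) * c ^ n) * Abs_fps (\<lambda>n. rat2 (inverse E $ n) * d ^ n))
      (\<lambda>i. rat2 1 * (c * d) ^ (p ^ i) + rat2 1 * 1 ^ (p ^ i) + rat2 (- 1) * c ^ (p ^ i) + rat2 (- 1) * d ^ (p ^ i))"
      by (intro has_log_deriv_mult has_log_deriv_scale dlE dlI)
    moreover have "rat2 1 * (c * d) ^ (p ^ i) + rat2 1 * 1 ^ (p ^ i) + rat2 (- 1) * c ^ (p ^ i) + rat2 (- 1) * d ^ (p ^ i)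
      = of_nat (p ^ i) * l i" for i
    proof -
      have "rat2 (- 1) = - 1" by (simp flip: rat2_simps(5))
      moreover have "of_nat (p ^ i) * rat2 (1 / of_nat (p ^ i)) = 1"
        unfolding of_nat_rat2 using p by simp
      ultimately show ?thesis unfolding l_def mult.assoc [symmetric]
        by (simp add: algebra_simps power_mult_distrib)
    qed
    ultimately show ?thesis by simp
  qed
  moreover have lnth: "l i $ t $ s = (if t \<noteq> 0 \<and> s \<noteq> 0 then
     of_nat (p ^ i choose s) * of_nat (p ^ i choose t) / of_nat (p ^ i) else 0)" for i t s
  proof -
    have "c ^ (p ^ i) - 1 = fps_const ((1 + fps_X) ^ (p ^ i) - 1)"
      unfolding c_def by (metis fps_const_1_eq_1 fps_const_add fps_const_power fps_const_sub)
    hence "((c ^ (p ^ i) - 1) * (d ^ (p ^ i) - 1)) $ t = ((1 + fps_X) ^ (p ^ i) - 1) * (d ^ (p ^ i) - 1) $ t"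
      by simp
    also have "(d ^ (p ^ i) - 1) $ t = fps_const (if t = 0 then 0 else of_nat (p ^ i choose t))"
      by (rule fps_ext) (auto simp: d_def one_plus_X_power_nth2)
    finally show ?thesis unfolding l_def
      by (auto simp: one_plus_X_power_nth)
  qed
  moreover have "\<exists>i0. \<forall>i\<ge>i0. \<forall>t\<le>J. \<forall>s\<le>J. p_integral p (l i $ t $ s / of_nat (p ^ Q))" for J Q
  proof (intro exI[of _ "Q + J * J"] allI impI)
    fix i t s assume *: "i \<ge> Q + J * J" "t \<le> J" "s \<le> J"
    show "p_integral p (l i $ t $ s / of_nat (p ^ Q))"
    proof (cases "t \<noteq> 0 \<and> s \<noteq> 0")
      case True
      thus ?thesis using binomial_p_power_mult[OF p(1), of s J t Q i] * by (simp add: lnth)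
    qed (use p in \<open>auto simp: lnth\<close>)
  qed
  moreover have "p_integral p (\<Psi> $ n $ t $ s)" for n t s
    unfolding nth by (rule quad_coeff_integral[OF p(1) uint])
  ultimately have "\<exists>n1. \<forall>n\<ge>n1. \<forall>t s. t + s \<le> J \<longrightarrow> p_integral p (\<Psi> $ n $ t $ s / of_nat p)"
    by (intro log_deriv_coeffs_tend_to_0[OF p(1), where l = l]) auto
  thus ?thesis unfolding nth u_def by (metis add.commute)
qed

section \<open>Subrings and finite extensions\<close>

definition is_subring :: "'a :: comm_ring_1 set \<Rightarrow> bool" where
  "is_subring M \<longleftrightarrow> 1 \<in> M \<and> (\<forall>x\<in>M. \<forall>y\<in>M. x - y \<in> M \<and> x * y \<in> M)"

definition is_subfield :: "'a :: field set \<Rightarrow> bool" where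
  "is_subfield K \<longleftrightarrow> is_subring K \<and> (\<forall>x\<in>K. inverse x \<in> K)"

lemma is_subfield_is_subring [dest]: "is_subfield K \<Longrightarrow> is_subring K"
  by (simp add: is_subfield_def)

context
  fixes M :: "'a :: comm_ring_1 set"
  assumes M: "is_subring M"
begin

lemma subring_1: "1 \<in> M"
  and subring_diff: "x \<in> M \<Longrightarrow> y \<in> M \<Longrightarrow> x - y \<in> M"
  and subring_mult: "x \<in> M \<Longrightarrow> y \<in> M \<Longrightarrow> x * y \<in> M"
  using M by (auto simp: is_subring_def)

lemma subring_0: "0 \<in> M"
  using subring_diff[OF subring_1 subring_1] by simp

lemma subring_uminus: "x \<in> M \<Longrightarrow> - x \<in> M"
  using subring_diff[OF subring_0] by fastforce

lemma subring_add: "x \<in> M \<Longrightarrow> y \<in> M \<Longrightarrow> x + y \<in> M"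
  using subring_diff[of x "- y"] subring_uminus by fastforce

lemma subring_power: "x \<in> M \<Longrightarrow> x ^ n \<in> M"
  by (induction n) (auto intro: subring_1 subring_mult)

lemma subring_sum: "(\<And>i. i \<in> A \<Longrightarrow> f i \<in> M) \<Longrightarrow> sum f A \<in> M"
  by (induction A rule: infinite_finite_induct) (auto intro: subring_0 subring_add)

lemma subring_prod: "(\<And>i. i \<in> A \<Longrightarrow> f i \<in> M) \<Longrightarrow> prod f A \<in> M"
  by (induction A rule: infinite_finite_induct) (auto intro: subring_1 subring_mult)

lemma subring_of_nat: "of_nat n \<in> M"
  by (induction n) (auto intro: subring_0 subring_1 subring_add)

lemmas subring_closed = subring_0 subring_1 subring_add subring_diff subring_uminus subring_mult
  subring_power subring_of_nat

end

lemma subfield_inverse: "is_subfield K \<Longrightarrow> x \<in> K \<Longrightarrow> inverse x \<in> K"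
  by (simp add: is_subfield_def)

lemma subfield_divide: "is_subfield K \<Longrightarrow> x \<in> K \<Longrightarrow> y \<in> K \<Longrightarrow> x / y \<in> K"
  using subring_mult[OF is_subfield_is_subring] subfield_inverse by (metis divide_inverse)

section \<open>Power series with coefficients in a subring or subfield\<close>

definition fps_over :: "'a :: comm_ring_1 set \<Rightarrow> 'a fps set" where
  "fps_over M = {g. \<forall>j. g $ j \<in> M}"

lemma fps_overI: "(\<And>j. g $ j \<in> M) \<Longrightarrow> g \<in> fps_over M"
  and fps_overD: "g \<in> fps_over M \<Longrightarrow> g $ j \<in> M"
  by (auto simp: fps_over_def)

lemma is_subring_fps_over: "is_subring M \<Longrightarrow> is_subring (fps_over M)"
  unfolding is_subring_def[of "fps_over M"]
  by (auto simp: fps_over_def fps_mult_nth subring_closed intro!: subring_sum)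

lemma fps_over_mono: "M \<subseteq> N \<Longrightarrow> fps_over M \<subseteq> fps_over N"
  by (auto simp: fps_over_def)

lemma fps_over_inverse:
  fixes K :: "'a :: field set"
  assumes K: "is_subfield K" and g: "g \<in> fps_over K" and "g $ 0 \<noteq> 0"
  shows "inverse g \<in> fps_over K"
proof (rule fps_overI)
  note sr = is_subfield_is_subring[OF K]
  fix j
  have eq: "inverse g * g = 1" using inverse_mult_eq_1[OF assms(3)] .
  show "inverse g $ j \<in> K"
  proof (induction j rule: less_induct)
    case (less n)
    show ?case
    proof (cases "n = 0")
      case True
      thus ?thesis using subfield_inverse[OF K fps_overD[OF g, of 0]] by simp
    next
      case False
      have "0 = (inverse g * g) $ n" using eq False by simp
      also have "\<dots> = inverse g $ n * g $ 0 + (\<Sum>i\<in>{0..<n}. inverse g $ i * g $ (n - i))"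
      proof -
        have "{0..n} = insert n {0..<n}" by auto
        thus ?thesis by (simp add: fps_mult_nth)
      qed
      finally have "inverse g $ n = - (\<Sum>i\<in>{0..<n}. inverse g $ i * g $ (n - i)) / g $ 0"
        using assms(3) by (simp add: field_simps eq_neg_iff_add_eq_0)
      moreover have "\<dots> \<in> K"
        by (intro subfield_divide[OF K] subring_uminus[OF sr] subring_sum[OF sr] subring_mult[OF sr]
            fps_overD[OF g]) (use less in auto)
      ultimately show ?thesis by simp
    qed
  qed
qed

text \<open>More unknowns than equations, solved by elimination without division:
  \<open>frobenius_descent\<close> needs it over the ring K[[v]], not only over fields. The pivot
  \<open>A l q0\<close> multiplies the other rows instead of being inverted.\<close>

lemma linear_relation:
  fixes A :: "'i \<Rightarrow> 'q \<Rightarrow> 'r :: idom"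
  assumes R: "is_subring R" and "finite Q" "finite I" "card Q < card I"
    and "\<And>i q. i \<in> I \<Longrightarrow> q \<in> Q \<Longrightarrow> A i q \<in> R"
  shows "\<exists>a. (\<forall>i\<in>I. a i \<in> R) \<and> (\<exists>i\<in>I. a i \<noteq> 0) \<and> (\<forall>q\<in>Q. (\<Sum>i\<in>I. a i * A i q) = 0)"
  using assms(2-)
proof (induction Q arbitrary: I A rule: finite_induct)
  case empty
  thus ?case using subring_1[OF R] by (intro exI[of _ "\<lambda>_. 1"]) (auto simp: card_gt_0_iff)
next
  case (insert q0 Q)
  show ?case
  proof (cases "\<exists>l\<in>I. A l q0 \<noteq> 0")
    case False
    obtain a where a: "\<forall>i\<in>I. a i \<in> R" "\<exists>i\<in>I. a i \<noteq> 0" "\<forall>q\<in>Q. (\<Sum>i\<in>I. a i * A i q) = 0"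
      using insert.IH[of I A] insert.prems insert.hyps by auto
    moreover have "(\<Sum>i\<in>I. a i * A i q0) = 0" using False by (intro sum.neutral) auto
    ultimately show ?thesis by (intro exI[of _ a]) auto
  next
    case True
    then obtain l where l: "l \<in> I" "A l q0 \<noteq> 0" by blast
    define A' where "A' i q = A l q0 * A i q - A i q0 * A l q" for i q
    have "card Q < card (I - {l})" using insert l by simp
    moreover have "A' i q \<in> R" if "i \<in> I - {l}" "q \<in> Q" for i q
      unfolding A'_def using that l insert.prems by (intro subring_diff[OF R] subring_mult[OF R]) auto
    ultimately obtain a where a: "\<forall>i\<in>I-{l}. a i \<in> R" "\<exists>i\<in>I-{l}. a i \<noteq> 0"
      "\<forall>q\<in>Q. (\<Sum>i\<in>I-{l}. a i * A' i q) = 0"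
      using insert.IH[of "I - {l}" A'] insert.prems by auto
    define b where "b i = (if i = l then - (\<Sum>j\<in>I-{l}. a j * A j q0) else A l q0 * a i)" for i
    have "b i \<in> R" if "i \<in> I" for i
      unfolding b_def using that l insert.prems a(1)
      by (auto intro!: subring_uminus[OF R] subring_mult[OF R] subring_sum[OF R])
    moreover have "\<exists>i\<in>I. b i \<noteq> 0" using a(2) l by (auto simp: b_def)
    moreover have "(\<Sum>i\<in>I. b i * A i q) = 0" if q: "q \<in> insert q0 Q" for q
    proof -
      have "(\<Sum>i\<in>I. b i * A i q) = b l * A l q + (\<Sum>i\<in>I-{l}. b i * A i q)"
        using l insert.prems by (subst sum.remove[of _ l]) auto
      also have "(\<Sum>i\<in>I-{l}. b i * A i q) = (\<Sum>i\<in>I-{l}. a i * (A l q0 * A i q))"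
        by (intro sum.cong) (auto simp: b_def)
      also have "b l * A l q = - (\<Sum>i\<in>I-{l}. a i * (A i q0 * A l q))"
        by (simp add: b_def sum_distrib_right mult.assoc)
      also have "\<dots> + (\<Sum>i\<in>I-{l}. a i * (A l q0 * A i q)) = (\<Sum>i\<in>I-{l}. a i * A' i q)"
        by (simp add: A'_def right_diff_distrib sum_subtractf)
      also have "\<dots> = 0" using q a(3) by (auto simp: A'_def mult.commute)
      finally show ?thesis .
    qed
    ultimately show ?thesis by (intro exI[of _ b]) auto
  qed
qed

section \<open>Finite extensions as finitely spanned modules\<close>

definition mspan :: "'a :: comm_ring_1 set \<Rightarrow> 'a set \<Rightarrow> 'a set" where
  "mspan M B = {z. \<exists>c. (\<forall>b\<in>B. c b \<in> M) \<and> z = (\<Sum>b\<in>B. c b * b)}"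

lemma mspanE:
  assumes "z \<in> mspan M B"
  obtains c where "\<forall>b\<in>B. c b \<in> M" "z = (\<Sum>b\<in>B. c b * b)"
  using assms unfolding mspan_def by blast

lemma mspan_subset:
  assumes "is_subring N" "M \<subseteq> N" "B \<subseteq> N"
  shows "mspan M B \<subseteq> N"
  using assms by (auto simp: mspan_def intro!: subring_sum subring_mult)

context
  fixes M B :: "'a :: comm_ring_1 set"
  assumes M: "is_subring M" and B: "finite B"
begin

lemma mspan_diff:
  assumes "x \<in> mspan M B" "y \<in> mspan M B"
  shows "x - y \<in> mspan M B"
proof -
  obtain c where c: "\<forall>b\<in>B. c b \<in> M" "x = (\<Sum>b\<in>B. c b * b)" by (rule mspanE[OF assms(1)])
  obtain d where d: "\<forall>b\<in>B. d b \<in> M" "y = (\<Sum>b\<in>B. d b * b)" by (rule mspanE[OF assms(2)])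
  show ?thesis using subring_diff[OF M] c d unfolding mspan_def
    by (intro CollectI exI[of _ "\<lambda>b. c b - d b"]) (auto simp: sum_subtractf left_diff_distrib)
qed

lemma mspan_scale: "m \<in> M \<Longrightarrow> x \<in> mspan M B \<Longrightarrow> m * x \<in> mspan M B"
proof -
  assume m: "m \<in> M" and "x \<in> mspan M B"
  then obtain c where "\<forall>b\<in>B. c b \<in> M" "x = (\<Sum>b\<in>B. c b * b)"
    unfolding mspan_def by blast
  thus ?thesis using subring_mult[OF M m] unfolding mspan_def
    by (intro CollectI exI[of _ "\<lambda>b. m * c b"]) (auto simp: sum_distrib_left mult.assoc)
qed

lemma mspan_base: "b \<in> B \<Longrightarrow> b \<in> mspan M B"
  unfolding mspan_def using B subring_0[OF M] subring_1[OF M]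
  by (intro CollectI exI[of _ "\<lambda>b'. if b' = b then 1 else 0"]) (auto simp: if_distrib[where f = "\<lambda>x. x * _"] sum.delta cong: if_cong)

lemma mspan_0: "0 \<in> mspan M B"
  unfolding mspan_def using subring_0[OF M] by (intro CollectI exI[of _ "\<lambda>_. 0"]) auto

lemma mspan_add: "x \<in> mspan M B \<Longrightarrow> y \<in> mspan M B \<Longrightarrow> x + y \<in> mspan M B"
  using mspan_diff[of x "0 - y"] mspan_diff[OF mspan_0, of y] by simp

lemma mspan_sum: "(\<And>i. i \<in> I \<Longrightarrow> f i \<in> mspan M B) \<Longrightarrow> sum f I \<in> mspan M B"
  by (induction I rule: infinite_finite_induct) (auto intro: mspan_0 mspan_add)

end

text \<open>Over a field K this is a finite extension. Only the module structure is recorded;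
  \<open>fin_over_subfield\<close> recovers inverses.\<close>

definition fin_over :: "'a :: comm_ring_1 set \<Rightarrow> 'a set \<Rightarrow> bool" where
  "fin_over K M \<longleftrightarrow> is_subring M \<and> K \<subseteq> M \<and> (\<exists>B. finite B \<and> B \<subseteq> M \<and> M = mspan K B)"

lemma fin_over_mspan:
  assumes M: "is_subring M" and B: "finite B" and one: "1 \<in> mspan M B"
    and mult: "\<And>b b'. b \<in> B \<Longrightarrow> b' \<in> B \<Longrightarrow> b * b' \<in> mspan M B"
  shows "fin_over M (mspan M B)"
  unfolding fin_over_def
proof (intro conjI exI[of _ B])
  have mult': "x * y \<in> mspan M B" if x: "x \<in> mspan M B" and y: "y \<in> mspan M B" for x y
  proof -
    obtain c where c: "\<forall>b\<in>B. c b \<in> M" "x = (\<Sum>b\<in>B. c b * b)" by (rule mspanE[OF x])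
    obtain d where d: "\<forall>b\<in>B. d b \<in> M" "y = (\<Sum>b\<in>B. d b * b)" by (rule mspanE[OF y])
    have "x * y = (\<Sum>b\<in>B. \<Sum>b'\<in>B. (c b * d b') * (b * b'))"
      unfolding c(2) d(2) by (simp add: sum_product mult_ac)
    also have "\<dots> \<in> mspan M B"
      using c(1) d(1) by (intro mspan_sum[OF M B] mspan_scale[OF M B] mult subring_mult[OF M]) auto
    finally show ?thesis .
  qed
  show "is_subring (mspan M B)"
    unfolding is_subring_def using one mspan_diff[OF M B] mult' by blast
  show "M \<subseteq> mspan M B"
    using mspan_scale[OF M B _ one] by auto
  show "B \<subseteq> mspan M B" using mspan_base[OF M B] by auto
qed (use B in auto)

lemma fin_over_refl: "is_subring M \<Longrightarrow> fin_over M M"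
proof -
  assume M: "is_subring M"
  have "mspan M {1} = M" by (force simp: mspan_def)
  thus ?thesis unfolding fin_over_def using M subring_1[OF M]
    by (intro conjI exI[of _ "{1}"]) auto
qed

lemma fin_over_trans:
  assumes K: "is_subring K" and "fin_over K M" "fin_over M N"
  shows "fin_over K N"
proof -
  obtain B where B: "finite B" "B \<subseteq> M" "M = mspan K B" using assms(2) by (auto simp: fin_over_def)
  obtain C where C: "finite C" "C \<subseteq> N" "N = mspan M C" using assms(3) by (auto simp: fin_over_def)
  have sub: "K \<subseteq> M" "M \<subseteq> N" "is_subring M" "is_subring N" using assms by (auto simp: fin_over_def)
  define D where "D = (\<lambda>(b, c). b * c) ` (B \<times> C)"
  have D: "finite D" using B C by (simp add: D_def)
  have DN: "D \<subseteq> N" using B(2) C(2) sub(2) unfolding D_def by (auto intro!: subring_mult[OF sub(4)])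
  have "N \<subseteq> mspan K D"
  proof
    fix z assume "z \<in> N"
    then obtain m where m: "\<forall>c\<in>C. m c \<in> M" "z = (\<Sum>c\<in>C. m c * c)" using C(3) by (auto simp: mspan_def)
    have "m c * c \<in> mspan K D" if c: "c \<in> C" for c
    proof -
      obtain k where k: "\<forall>b\<in>B. k b \<in> K" "m c = (\<Sum>b\<in>B. k b * b)"
        using m(1) c B(3) by (auto simp: mspan_def)
      have "m c * c = (\<Sum>b\<in>B. k b * (b * c))" by (simp add: k(2) sum_distrib_right mult.assoc)
      also have "\<dots> \<in> mspan K D"
        using k(1) c by (intro mspan_sum[OF K D] mspan_scale[OF K D] mspan_base[OF K D]) (auto simp: D_def)
      finally show ?thesis .
    qed
    thus "z \<in> mspan K D" unfolding m(2) by (intro mspan_sum[OF K D]) auto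
  qed
  moreover have "mspan K D \<subseteq> N" using sub DN by (intro mspan_subset) auto
  ultimately show ?thesis unfolding fin_over_def using sub D DN by (intro conjI exI[of _ D]) auto
qed

text \<open>The generators of N span the compositum over M, and finiteness is transitive.\<close>

lemma fin_over_union:
  assumes K: "is_subring K" and M: "fin_over K M" and N: "fin_over K N"
  shows "\<exists>P. fin_over K P \<and> M \<subseteq> P \<and> N \<subseteq> P"
proof -
  obtain B where B: "finite B" "B \<subseteq> N" "N = mspan K B" using N by (auto simp: fin_over_def)
  have sub: "K \<subseteq> M" "is_subring M" "is_subring N" using assms by (auto simp: fin_over_def)
  have le: "N \<subseteq> mspan M B" unfolding B(3) mspan_def using sub(1) by blast
  have "fin_over M (mspan M B)"
  proof (rule fin_over_mspan[OF sub(2) B(1)])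
    show "1 \<in> mspan M B" using le subring_1[OF sub(3)] by auto
    show "b * b' \<in> mspan M B" if "b \<in> B" "b' \<in> B" for b b'
      using le subring_mult[OF sub(3)] B(2) that by blast
  qed
  moreover from this have "M \<subseteq> mspan M B" by (simp add: fin_over_def)
  ultimately show ?thesis using fin_over_trans[OF K M] le by blast
qed

text \<open>The monic equation reduces every power of z to powers below d.\<close>

lemma fin_over_adjoin:
  assumes M: "is_subring M" and c: "\<And>l. l < d \<Longrightarrow> c l \<in> M" and eq: "z ^ d = (\<Sum>l<d. c l * z ^ l)"
  shows "\<exists>N. fin_over M N \<and> z \<in> N"
proof -
  define B where "B = (\<lambda>l. z ^ l) ` {..<d}"
  have B: "finite B" by (simp add: B_def)
  have pow: "z ^ n \<in> mspan M B" for n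
  proof (induction n rule: less_induct)
    case (less n)
    show ?case
    proof (cases "n < d")
      case True
      thus ?thesis by (intro mspan_base[OF M B]) (auto simp: B_def)
    next
      case False
      hence "z ^ n = z ^ (n - d) * z ^ d" by (simp flip: power_add)
      also have "\<dots> = (\<Sum>l<d. c l * z ^ (n - d + l))"
        unfolding eq by (simp add: sum_distrib_left power_add mult_ac)
      also have "\<dots> \<in> mspan M B"
        using False c by (intro mspan_sum[OF M B] mspan_scale[OF M B] less) auto
      finally show ?thesis .
    qed
  qed
  have "fin_over M (mspan M B)"
    by (rule fin_over_mspan[OF M B]) (use pow[of 0] pow in \<open>auto simp: B_def simp flip: power_add\<close>)
  thus ?thesis using pow[of 1] by auto
qed

text \<open>Division by the last nonzero coefficient makes the equation monic.\<close>

lemma fin_over_algebraic: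
  fixes K :: "'a :: field set"
  assumes K: "is_subfield K" and c: "\<And>l. l \<le> d \<Longrightarrow> c l \<in> K" and nz: "\<exists>l\<le>d. c l \<noteq> 0"
    and eq: "(\<Sum>l\<le>d. c l * z ^ l) = 0"
  shows "\<exists>M. fin_over K M \<and> z \<in> M"
proof -
  note sr = is_subfield_is_subring[OF K]
  define e where "e = Max {l. l \<le> d \<and> c l \<noteq> 0}"
  have fin: "finite {l. l \<le> d \<and> c l \<noteq> 0}" by (rule finite_subset[of _ "{..d}"]) auto
  hence e: "e \<le> d" "c e \<noteq> 0" using Max_in[OF fin] nz by (auto simp: e_def)
  have max: "c l = 0" if "e < l" "l \<le> d" for l
    using that Max_ge[OF fin, of l] unfolding e_def by fastforce
  have "(\<Sum>l\<le>d. c l * z ^ l) = (\<Sum>l\<le>e. c l * z ^ l)"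
    using e max by (intro sum.mono_neutral_right) auto
  also have "\<dots> = (\<Sum>l<e. c l * z ^ l) + c e * z ^ e"
    by (simp add: lessThan_Suc_atMost [symmetric])
  finally have "c e * z ^ e = - (\<Sum>l<e. c l * z ^ l)"
    using eq by (simp add: eq_neg_iff_add_eq_0 add.commute)
  hence "z ^ e = - (\<Sum>l<e. c l * z ^ l) / c e" using e(2) by (simp add: field_simps)
  also have "\<dots> = (\<Sum>l<e. (- c l / c e) * z ^ l)"
    by (simp add: sum_divide_distrib flip: sum_negf)
  finally have "z ^ e = (\<Sum>l<e. (- c l / c e) * z ^ l)" .
  thus ?thesis
    using e by (intro fin_over_adjoin[OF sr, of e "\<lambda>l. - c l / c e"]) (auto intro!: subfield_divide[OF K] subring_uminus[OF sr] c)
qed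

lemma fin_over_relation:
  fixes K :: "'a :: field set"
  assumes K: "is_subfield K" and M: "M = mspan K B" "finite B" and I: "finite I" "card B < card I"
    and v: "\<And>i. i \<in> I \<Longrightarrow> v i \<in> M"
  shows "\<exists>a. (\<forall>i\<in>I. a i \<in> K) \<and> (\<exists>i\<in>I. a i \<noteq> 0) \<and> (\<Sum>i\<in>I. a i * v i) = 0"
proof -
  have "\<forall>i\<in>I. \<exists>c. (\<forall>b\<in>B. c b \<in> K) \<and> v i = (\<Sum>b\<in>B. c b * b)"
    using v unfolding M mspan_def by blast
  then obtain A where A: "\<forall>i\<in>I. (\<forall>b\<in>B. A i b \<in> K) \<and> v i = (\<Sum>b\<in>B. A i b * b)" by metis
  obtain a where a: "\<forall>i\<in>I. a i \<in> K" "\<exists>i\<in>I. a i \<noteq> 0" "\<forall>b\<in>B. (\<Sum>i\<in>I. a i * A i b) = 0"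
    using linear_relation[OF is_subfield_is_subring[OF K] M(2) I, of A] A by blast
  have "(\<Sum>i\<in>I. a i * v i) = (\<Sum>i\<in>I. \<Sum>b\<in>B. a i * A i b * b)"
    using A by (intro sum.cong) (auto simp: sum_distrib_left mult.assoc)
  also have "\<dots> = (\<Sum>b\<in>B. \<Sum>i\<in>I. a i * A i b * b)" by (rule sum.swap)
  also have "\<dots> = 0" using a(3) by (simp flip: sum_distrib_right)
  finally show ?thesis using a by blast
qed

text \<open>A nonzero z satisfies a polynomial relation over K. Cancelling its lowest power of z
  leaves the nonzero constant term \<open>a m\<close>, which expresses the inverse of z as a
  polynomial in z.\<close>

lemma fin_over_subfield:
  fixes K :: "'a :: field set"
  assumes K: "is_subfield K" and M: "fin_over K M"
  shows "is_subfield M"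
  unfolding is_subfield_def
proof (intro conjI ballI)
  show sr: "is_subring M" using M by (simp add: fin_over_def)
  have KM: "K \<subseteq> M" using M by (simp add: fin_over_def)
  obtain B where B: "finite B" "M = mspan K B" using M by (auto simp: fin_over_def)
  fix z assume z: "z \<in> M"
  show "inverse z \<in> M"
  proof (cases "z = 0")
    case True
    thus ?thesis using subring_0[OF sr] by simp
  next
    case False
    obtain a where a: "\<forall>i\<le>card B. a i \<in> K" "\<exists>i\<le>card B. a i \<noteq> 0" "(\<Sum>i\<le>card B. a i * z ^ i) = 0"
      using fin_over_relation[OF K B(2,1), of "{..card B}" "\<lambda>i. z ^ i"] subring_power[OF sr z] by auto
    define m where "m = (LEAST i. i \<le> card B \<and> a i \<noteq> 0)"
    have m: "m \<le> card B" "a m \<noteq> 0" using LeastI_ex[of "\<lambda>i. i \<le> card B \<and> a i \<noteq> 0"] a(2) by (auto simp: m_def)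
    have less: "a i = 0" if "i < m" for i using not_less_Least[of i "\<lambda>i. i \<le> card B \<and> a i \<noteq> 0"] that m by (auto simp: m_def)
    define w where "w = (\<Sum>i\<in>{Suc m..card B}. a i * z ^ (i - Suc m))"
    have "(\<Sum>i\<le>card B. a i * z ^ i) = (\<Sum>i\<in>{m..card B}. a i * z ^ i)"
      using less by (intro sum.mono_neutral_right) auto
    also have "{m..card B} = insert m {Suc m..card B}" using m by auto
    also have "(\<Sum>i\<in>insert m {Suc m..card B}. a i * z ^ i) = a m * z ^ m + (\<Sum>i\<in>{Suc m..card B}. a i * z ^ i)" by simp
    also have "(\<Sum>i\<in>{Suc m..card B}. a i * z ^ i) = z ^ m * (z * w)"
      unfolding w_def sum_distrib_left
    proof (intro sum.cong refl)
      fix i assume "i \<in> {Suc m..card B}"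
      hence "z ^ i = z ^ m * (z * z ^ (i - Suc m))" by (simp flip: power_add power_Suc)
      thus "a i * z ^ i = z ^ m * (z * (a i * z ^ (i - Suc m)))" by simp
    qed
    finally have "z ^ m * (a m + z * w) = 0" using a(3) by (simp add: algebra_simps)
    hence "z * w = - a m" using False by (simp add: eq_neg_iff_add_eq_0 add.commute)
    hence "inverse z = - w / a m" using False m(2) by (simp add: field_simps)
    also have "\<dots> = inverse (a m) * (- w)" by (simp add: field_simps)
    also have "\<dots> \<in> M"
      using a(1) KM z m subfield_inverse[OF K] unfolding w_def
      by (intro subring_mult[OF sr] subring_uminus[OF sr] subring_sum[OF sr] subring_power[OF sr]) auto
    finally show ?thesis .
  qed
qed

section \<open>Frobenius descent\<close>

text \<open>X^p - X has at most p roots, and the prime field already supplies p of them.\<close>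

lemma frobenius_fixed:
  fixes x :: "'a :: idom"
  assumes p: "prime CHAR('a)" and x: "x ^ CHAR('a) = x"
  shows "\<exists>i. x = of_nat i"
proof (rule ccontr)
  assume no: "\<not> ?thesis"
  define q :: "'a poly" where "q = Polynomial.monom 1 CHAR('a) - [:0, 1:]"
  have p1: "CHAR('a) > 1" using p by (rule prime_gt_1_nat)
  have "Polynomial.coeff q CHAR('a) = 1"
    using p1 by (auto simp: q_def coeff_pCons split: nat.splits)
  hence q0: "q \<noteq> 0" by auto
  have "Polynomial.degree q \<le> CHAR('a)"
    unfolding q_def using p1 by (intro degree_diff_le) (auto simp: degree_monom_le)
  moreover have "card {y. poly q y = 0} \<le> Polynomial.degree q" by (rule card_poly_roots_bound[OF q0])
  moreover have "insert x (of_nat ` {..<CHAR('a)}) \<subseteq> {y. poly q y = 0}"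
    using x of_nat_power_CHAR[OF p] by (auto simp: q_def poly_monom)
  hence "card (insert x (of_nat ` {..<CHAR('a)})) \<le> card {y. poly q y = 0}"
    by (intro card_mono poly_roots_finite q0)
  moreover have "inj_on (of_nat :: nat \<Rightarrow> 'a) {..<CHAR('a)}"
  proof (rule inj_onI)
    fix i j assume "i \<in> {..<CHAR('a)}" "j \<in> {..<CHAR('a)}" "of_nat i = (of_nat j :: 'a)"
    thus "i = j" by (simp add: of_nat_eq_iff_cong_CHAR cong_def)
  qed
  hence "card (insert x (of_nat ` {..<CHAR('a)} :: 'a set)) = Suc CHAR('a)"
    using no by (subst card_insert_disjoint) (auto simp: card_image)
  ultimately show False by simp
qed

text \<open>Frobenius on the coefficients with the variable v fixed; the ordinary p-th power of g is
  the value of this series at v^p.\<close>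

definition fps_frob :: "'a :: comm_ring_1 fps \<Rightarrow> 'a fps" where
  "fps_frob g = Abs_fps (\<lambda>j. (g $ j) ^ CHAR('a))"

lemma fps_frob_nth [simp]: "fps_frob (g :: 'a :: comm_ring_1 fps) $ j = (g $ j) ^ CHAR('a)"
  by (simp add: fps_frob_def)

context
  assumes p: "prime CHAR('a :: comm_ring_1)"
begin

lemma fps_frob_add: "fps_frob (g + h) = fps_frob g + fps_frob (h :: 'a fps)"
  by (rule fps_ext) (simp add: freshmans_dream[OF p refl])

lemma fps_frob_0 [simp]: "fps_frob 0 = (0 :: 'a fps)"
  using prime_gt_0_nat[OF p] by (auto intro!: fps_ext simp: power_0_left)

lemma fps_frob_1 [simp]: "fps_frob 1 = (1 :: 'a fps)"
  using prime_gt_0_nat[OF p] by (auto intro!: fps_ext simp: power_0_left)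

lemma fps_frob_mult: "fps_frob (g * h) = fps_frob g * fps_frob (h :: 'a fps)"
  by (rule fps_ext) (simp add: fps_mult_nth freshmans_dream_sum[OF p refl] power_mult_distrib)

lemma fps_frob_power: "fps_frob (g ^ n) = fps_frob (g :: 'a fps) ^ n"
  by (induction n) (auto simp: fps_frob_mult)

lemma fps_frob_prod: "fps_frob (prod f A) = (\<Prod>i\<in>A. fps_frob (f i :: 'a fps))"
  by (induction A rule: infinite_finite_induct) (auto simp: fps_frob_mult)

lemma fps_frob_sum: "fps_frob (sum f A) = (\<Sum>i\<in>A. fps_frob (f i :: 'a fps))"
  by (induction A rule: infinite_finite_induct) (auto simp: fps_frob_add)

lemma fps_frob_X [simp]: "fps_frob fps_X = (fps_X :: 'a fps)"
  using prime_gt_0_nat[OF p] by (auto intro!: fps_ext simp: power_0_left)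

end

lemma fps_frob_over: "is_subring M \<Longrightarrow> g \<in> fps_over M \<Longrightarrow> fps_frob g \<in> fps_over M"
  by (auto simp: fps_over_def intro: subring_power)

lemma fps_frob_inverse:
  fixes g :: "'a :: field fps"
  assumes "prime CHAR('a)" "g $ 0 \<noteq> 0"
  shows "fps_frob (inverse g) = inverse (fps_frob g)"
proof -
  have "fps_frob (inverse g) * fps_frob g = 1"
    using inverse_mult_eq_1[OF assms(2)] assms(1) by (simp flip: fps_frob_mult)
  moreover have "inverse (fps_frob g) * fps_frob g = 1"
    using assms by (intro inverse_mult_eq_1) simp
  ultimately have "(fps_frob (inverse g) - inverse (fps_frob g)) * fps_frob g = 0"
    by (simp add: left_diff_distrib)
  moreover have "fps_frob g \<noteq> 0" using assms(2) by (auto simp: fps_eq_iff intro: exI[of _ 0])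
  ultimately show ?thesis by simp
qed

text \<open>As m is invertible, \<open>\<zeta> $ n\<close> can be solved for in terms of the n-th
  coefficient of \<zeta>^m and lower coefficients of \<zeta>.\<close>

lemma fps_over_root:
  fixes K :: "'a :: field set"
  assumes K: "is_subfield K" and "\<zeta> $ 0 = 1" "\<zeta> ^ m \<in> fps_over K" "of_nat m \<noteq> (0 :: 'a)"
  shows "\<zeta> \<in> fps_over K"
proof (rule fps_overI)
  note sr = is_subfield_is_subring[OF K]
  fix n
  show "\<zeta> $ n \<in> K"
  proof (induction n rule: less_induct)
    case (less n)
    show ?case
    proof (cases "n = 0")
      case False
      have "fps_cutoff n \<zeta> \<in> fps_over K" using less subring_0[OF sr] by (auto intro!: fps_overI)
      hence "(fps_cutoff n \<zeta> ^ m) $ n \<in> K"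
        using subring_power[OF is_subring_fps_over[OF sr]] fps_overD by blast
      hence "((\<zeta> ^ m) $ n - (fps_cutoff n \<zeta> ^ m) $ n) / of_nat m \<in> K"
        using fps_overD[OF assms(3)] by (intro subfield_divide[OF K] subring_diff[OF sr] subring_of_nat[OF sr])
      thus ?thesis using fps_power_nth_cutoff[of \<zeta> n m] False assms(2,4) by simp
    qed (use assms subring_1[OF sr] in auto)
  qed
qed

lemma fps_power_CHAR_power_nth:
  fixes g :: "'a :: comm_ring_1 fps"
  assumes p: "prime CHAR('a)"
  shows "(g ^ (CHAR('a) ^ e)) $ n =
    (if CHAR('a) ^ e dvd n then (g $ (n div CHAR('a) ^ e)) ^ (CHAR('a) ^ e) else 0)"
proof (induction e arbitrary: n)
  case (Suc e)
  define P where "P = CHAR('a)"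
  have P: "P > 0" using prime_gt_0_nat[OF p] by (simp add: P_def)
  have "(g ^ (P ^ Suc e)) $ n = ((g ^ (P ^ e)) ^ P) $ n"
    by (simp add: mult.commute flip: power_mult)
  also have "\<dots> = (if P dvd n then ((g ^ (P ^ e)) $ (n div P)) ^ P else 0)"
    unfolding P_def by (rule fps_power_CHAR_nth[OF p])
  also have "\<dots> = (if P ^ Suc e dvd n then (g $ (n div P ^ Suc e)) ^ (P ^ Suc e) else 0)"
  proof (cases "P dvd n")
    case True
    then obtain k where k: "n = P * k" by blast
    show ?thesis using P Suc[of k] by (auto simp: k P_def power_0_left mult.commute simp flip: power_mult)
  next
    case False
    thus ?thesis using dvd_trans[of P "P ^ Suc e" n] by auto
  qed
  finally show ?case by (simp add: P_def)
qed simp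

text \<open>A power series satisfying a multiplicative Artin--Schreier equation over \<open>K\<close> with coefficients
  in a finite extension is, up to a power, defined over \<open>K\<close>: comparing a shortest linear relation
  between its powers with its Frobenius twist shows that the quotient of two of its terms
  is Frobenius invariant.\<close>

lemma frobenius_descent:
  fixes K :: "'a :: field set"
  assumes p: "prime CHAR('a)" and K: "is_subfield K" and M: "fin_over K M"
    and \<eta>: "\<eta> \<in> fps_over M" "\<eta> $ 0 = 1" and H: "H \<in> fps_over K" "H $ 0 = 1"
    and eq: "\<eta> = H * fps_frob \<eta>"
  shows "\<exists>m>0. \<eta> ^ m \<in> fps_over K"
proof -
  note sr = is_subfield_is_subring[OF K]
  note srf = is_subring_fps_over[OF sr]
  have H0: "H \<noteq> 0" using H(2) by auto
  obtain B where B: "finite B" "M = mspan K B" using M by (auto simp: fin_over_def)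
  have Msr: "is_subring M" using M by (simp add: fin_over_def)
  \<comment> \<open>Relations between powers of \<eta> over K[[v]]. No zero coefficients are
    allowed, so the support measures the length.\<close>
  define rel where "rel F c \<longleftrightarrow> finite F \<and> F \<noteq> {} \<and> (\<forall>l\<in>F. c l \<in> fps_over K \<and> c l \<noteq> 0) \<and>
    (\<Sum>l\<in>F. c l * \<eta> ^ l) = 0" for F :: "nat set" and c
  \<comment> \<open>card B + 1 powers of \<eta>, decomposed coefficientwise along the spanning set
    B, are dependent over K[[v]].\<close>
  have "\<exists>F c. rel F c"
  proof -
    have "\<forall>l j. \<exists>c. (\<forall>b\<in>B. c b \<in> K) \<and> (\<eta> ^ l) $ j = (\<Sum>b\<in>B. c b * b)"
      using subring_power[OF is_subring_fps_over[OF Msr] \<eta>(1)] fps_overD unfolding B(2) mspan_def by blast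
    then obtain A where A: "\<forall>l j. (\<forall>b\<in>B. A l j b \<in> K) \<and> (\<eta> ^ l) $ j = (\<Sum>b\<in>B. A l j b * b)" by metis
    define A' where "A' l b = Abs_fps (\<lambda>j. A l j b)" for l b
    have A': "\<eta> ^ l = (\<Sum>b\<in>B. A' l b * fps_const b)" for l
      using A by (auto intro!: fps_ext simp: A'_def fps_sum_nth)
    have "\<exists>a. (\<forall>l\<in>{..card B}. a l \<in> fps_over K) \<and> (\<exists>l\<in>{..card B}. a l \<noteq> 0) \<and>
      (\<forall>b\<in>B. (\<Sum>l\<in>{..card B}. a l * A' l b) = 0)"
      by (rule linear_relation[OF srf B(1)]) (use A in \<open>auto simp: A'_def fps_over_def\<close>)
    then obtain a where a: "\<forall>l\<le>card B. a l \<in> fps_over K" "\<exists>l\<le>card B. a l \<noteq> 0"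
      "\<forall>b\<in>B. (\<Sum>l\<le>card B. a l * A' l b) = 0" by auto
    have "(\<Sum>l\<le>card B. a l * \<eta> ^ l) = (\<Sum>l\<le>card B. \<Sum>b\<in>B. a l * A' l b * fps_const b)"
      by (simp add: A' sum_distrib_left mult.assoc)
    also have "\<dots> = (\<Sum>b\<in>B. \<Sum>l\<le>card B. a l * A' l b * fps_const b)" by (rule sum.swap)
    also have "\<dots> = 0" using a(3) by (simp flip: sum_distrib_right)
    finally have 0: "(\<Sum>l\<le>card B. a l * \<eta> ^ l) = 0" .
    have "(\<Sum>l\<in>{l. l \<le> card B \<and> a l \<noteq> 0}. a l * \<eta> ^ l) = (\<Sum>l\<le>card B. a l * \<eta> ^ l)"
      by (intro sum.mono_neutral_left) auto
    hence "rel {l. l \<le> card B \<and> a l \<noteq> 0} a" using a 0 by (auto simp: rel_def)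
    thus ?thesis by blast
  qed
  then obtain F c where Fc: "rel F c" and min: "\<And>F' c'. rel F' c' \<Longrightarrow> card F \<le> card F'"
    using ex_has_least_nat[of "\<lambda>F. \<exists>c. rel F c" _ card] by metis
  have F: "finite F" "F \<noteq> {}" "\<And>l. l \<in> F \<Longrightarrow> c l \<in> fps_over K" "\<And>l. l \<in> F \<Longrightarrow> c l \<noteq> 0"
    "(\<Sum>l\<in>F. c l * \<eta> ^ l) = 0" using Fc by (auto simp: rel_def)
  have \<eta>0: "\<eta> \<noteq> 0" using \<eta>(2) by auto
  obtain l0 where l0: "l0 \<in> F" "\<And>l. l \<in> F \<Longrightarrow> l0 \<le> l"
    using F(1,2) Min_in Min_le by metis
  have "F \<noteq> {l0}" using F(4,5) \<eta>0 l0(1) by auto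
  then obtain l where l: "l \<in> F" "l \<noteq> l0" using l0(1) by auto
  hence lt: "l0 < l" using l0(2)[of l] by simp
  \<comment> \<open>Multiplication by H^E turns the twist of \<eta>^j into H^(E - j) \<eta>^j,
    without inverses of H.\<close>
  define E where "E = Max F"
  have E: "j \<le> E" if "j \<in> F" for j using that F(1) by (simp add: E_def)
  have rel2: "(\<Sum>j\<in>F. fps_frob (c j) * H ^ (E - j) * \<eta> ^ j) = 0"
  proof -
    have "0 = fps_frob (\<Sum>j\<in>F. c j * \<eta> ^ j) * H ^ E" using F(5) p by simp
    also have "\<dots> = (\<Sum>j\<in>F. fps_frob (c j) * fps_frob \<eta> ^ j * H ^ E)"
      using p by (simp add: fps_frob_sum fps_frob_mult fps_frob_power sum_distrib_right)
    also have "\<dots> = (\<Sum>j\<in>F. fps_frob (c j) * H ^ (E - j) * \<eta> ^ j)"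
    proof (intro sum.cong refl)
      fix j assume "j \<in> F"
      hence "H ^ E = H ^ (E - j) * H ^ j" using E by (simp flip: power_add)
      moreover have "\<eta> ^ j = H ^ j * fps_frob \<eta> ^ j" by (subst eq) (simp add: power_mult_distrib)
      ultimately show "fps_frob (c j) * fps_frob \<eta> ^ j * H ^ E = fps_frob (c j) * H ^ (E - j) * \<eta> ^ j"
        by (simp only: mult_ac)
    qed
    finally show ?thesis by simp
  qed
  \<comment> \<open>Eliminates \<open>l0\<close> between the relation and its twist; by minimality
    nothing may be left over.\<close>
  define d where "d j = fps_frob (c l0) * H ^ (E - l0) * c j - c l0 * (fps_frob (c j) * H ^ (E - j))" for j
  have dl: "d l = 0"
  proof (rule ccontr)
    assume "d l \<noteq> 0"
    have "(\<Sum>j\<in>F. d j * \<eta> ^ j) = fps_frob (c l0) * H ^ (E - l0) * (\<Sum>j\<in>F. c j * \<eta> ^ j) -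
      c l0 * (\<Sum>j\<in>F. fps_frob (c j) * H ^ (E - j) * \<eta> ^ j)"
      by (simp add: d_def sum_distrib_left left_diff_distrib right_diff_distrib sum_subtractf mult_ac)
    also have "\<dots> = 0" by (simp add: F(5) rel2)
    finally have "(\<Sum>j\<in>F. d j * \<eta> ^ j) = 0" .
    moreover have "(\<Sum>j\<in>F. d j * \<eta> ^ j) = (\<Sum>j\<in>{j\<in>F. d j \<noteq> 0}. d j * \<eta> ^ j)"
      using F(1) by (intro sum.mono_neutral_right) auto
    moreover have "d j \<in> fps_over K" if "j \<in> F" for j
      unfolding d_def using that l0 F(3) H
      by (intro subring_diff[OF srf] subring_mult[OF srf] subring_power[OF srf] fps_frob_over[OF sr]) auto
    ultimately have "rel {j\<in>F. d j \<noteq> 0} d" using F(1) \<open>d l \<noteq> 0\<close> l by (auto simp: rel_def)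
    hence "card F \<le> card {j\<in>F. d j \<noteq> 0}" by (rule min)
    moreover have "{j\<in>F. d j \<noteq> 0} \<subset> F" using l0(1) by (auto simp: d_def mult_ac)
    hence "card {j\<in>F. d j \<noteq> 0} < card F" using F(1) by (rule psubset_card_mono[rotated])
    ultimately show False by simp
  qed
  define \<delta> where "\<delta> = \<eta> ^ (l - l0)"
  have \<delta>eq: "\<delta> = H ^ (l - l0) * fps_frob \<delta>"
    unfolding \<delta>_def by (subst (1) eq) (simp add: power_mult_distrib fps_frob_power[OF p])
  have key: "fps_frob (c l0) * (H ^ (l - l0) * c l) = c l0 * fps_frob (c l)"
  proof -
    have "H ^ (E - l0) = H ^ (E - l) * H ^ (l - l0)" using lt E[OF l(1)] by (simp flip: power_add)
    hence "H ^ (E - l) * (fps_frob (c l0) * (H ^ (l - l0) * c l) - c l0 * fps_frob (c l)) = 0"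
      using dl by (simp add: d_def algebra_simps)
    thus ?thesis using H0 by simp
  qed
  \<comment> \<open>\<open>c l\<close> and \<open>c l0\<close> need not be invertible in K[[v]];
    their powers of v are split off, which is harmless as Frobenius fixes v.\<close>
  define a b where "a = subdegree (c l)" and "b = subdegree (c l0)"
  define c' c'' where "c' = fps_shift a (c l)" and "c'' = fps_shift b (c l0)"
  have cc: "c l = fps_X ^ a * c'" "c l0 = fps_X ^ b * c''"
    unfolding a_def b_def c'_def c''_def
    by (metis subdegree_decompose mult.commute)+
  have c0: "c' $ 0 \<noteq> 0" "c'' $ 0 \<noteq> 0"
    using F(4)[OF l(1)] F(4)[OF l0(1)] by (simp_all add: c'_def c''_def a_def b_def)
  have cK: "c' \<in> fps_over K" "c'' \<in> fps_over K"
    using F(3)[OF l(1)] F(3)[OF l0(1)] by (auto simp: c'_def c''_def fps_over_def)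
  have "fps_X ^ (a + b) * (fps_frob (c' * \<delta>) * c'') = fps_X ^ (a + b) * (c' * \<delta> * fps_frob c'')"
  proof -
    have "fps_frob (c l) * fps_frob \<delta> * c l0 = c l * \<delta> * fps_frob (c l0)"
    proof -
      have "fps_frob (c l) * fps_frob \<delta> * c l0 = (c l0 * fps_frob (c l)) * fps_frob \<delta>" by (simp only: mult_ac)
      also have "\<dots> = fps_frob (c l0) * c l * (H ^ (l - l0) * fps_frob \<delta>)" unfolding key [symmetric] by (simp only: mult_ac)
      also have "\<dots> = c l * \<delta> * fps_frob (c l0)" unfolding \<delta>eq [symmetric] by (simp only: mult_ac)
      finally show ?thesis .
    qed
    thus ?thesis
      unfolding cc using p by (simp add: fps_frob_mult fps_frob_power power_add mult_ac)
  qed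
  hence fr: "fps_frob (c' * \<delta>) * c'' = c' * \<delta> * fps_frob c''" by simp
  \<comment> \<open>\<theta> is \<eta>^(l - l0) times a quotient of units over K. Being fixed by
    Frobenius, it has coefficients in the prime field.\<close>
  define \<theta> where "\<theta> = c' * \<delta> * inverse c''"
  have inv: "c'' * inverse c'' = 1" "c' * inverse c' = 1"
    using inverse_mult_eq_1[OF c0(1)] inverse_mult_eq_1[OF c0(2)] by (simp_all add: mult.commute)
  have "fps_frob \<theta> * c'' * fps_frob c'' = \<theta> * c'' * fps_frob c''"
  proof -
    have 1: "\<theta> * c'' = c' * \<delta>"
    proof -
      have "\<theta> * c'' = c' * \<delta> * (c'' * inverse c'')" unfolding \<theta>_def by (simp only: mult_ac)
      thus ?thesis using inv by simp
    qed
    have 2: "fps_frob \<theta> * fps_frob c'' = fps_frob (c' * \<delta>)"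
      by (simp only: fps_frob_mult[OF p, symmetric] 1)
    have "fps_frob \<theta> * c'' * fps_frob c'' = fps_frob (c' * \<delta>) * c''"
      unfolding 2 [symmetric] by (simp only: mult_ac)
    also have "\<dots> = \<theta> * c'' * fps_frob c''" by (simp only: fr 1)
    finally show ?thesis .
  qed
  moreover have "c'' \<noteq> 0" "fps_frob c'' \<noteq> 0" using c0(2) by (auto simp: fps_eq_iff intro: exI[of _ 0])
  ultimately have "fps_frob \<theta> = \<theta>" by (simp add: mult.assoc)
  hence "(\<theta> $ j) ^ CHAR('a) = \<theta> $ j" for j by (metis fps_frob_nth)
  hence "\<theta> \<in> fps_over K"
    using frobenius_fixed[OF p] subring_of_nat[OF sr] by (metis fps_overI)
  hence "\<theta> * c'' * inverse c' \<in> fps_over K"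
    using cK fps_over_inverse[OF K cK(1) c0(1)] by (intro subring_mult[OF srf])
  moreover have "\<theta> * c'' * inverse c' = \<delta> * (c' * inverse c') * (c'' * inverse c'')"
    by (simp add: \<theta>_def mult_ac)
  ultimately have "\<delta> \<in> fps_over K" by (simp add: inv)
  thus ?thesis using lt by (auto simp: \<delta>_def intro: exI[of _ "l - l0"])
qed

text \<open>Write m = p^e m' with m' prime to p. The m'-th root is taken over K; what remains is
  \<eta>^(p^e), whose coefficient at v^(j p^e) is the p^e-th power of
  \<open>\<eta> $ j\<close>.\<close>

lemma frobenius_descent':
  fixes K :: "'a :: field set"
  assumes p: "prime CHAR('a)" and K: "is_subfield K" and \<eta>: "\<eta> $ 0 = 1" and m: "m > 0" "\<eta> ^ m \<in> fps_over K"
  shows "\<exists>e. \<forall>j. (\<eta> $ j) ^ (CHAR('a) ^ e) \<in> K"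
proof -
  obtain e m' where em: "m = CHAR('a) ^ e * m'" "\<not> CHAR('a) dvd m'"
    using prime_power_canonical[OF p m(1)] by (auto simp: mult.commute)
  define \<zeta> where "\<zeta> = \<eta> ^ (CHAR('a) ^ e)"
  have "\<zeta> \<in> fps_over K"
  proof (rule fps_over_root[OF K])
    show "\<zeta> ^ m' \<in> fps_over K" using m(2) by (simp add: \<zeta>_def em power_mult)
    show "of_nat m' \<noteq> (0 :: 'a)" using em(2) by (simp add: of_nat_eq_0_iff_char_dvd)
  qed (simp add: \<zeta>_def \<eta> fps_power_zeroth)
  hence "(\<eta> ^ (CHAR('a) ^ e)) $ (j * CHAR('a) ^ e) \<in> K" for j
    unfolding \<zeta>_def by (rule fps_overD)
  moreover have "CHAR('a) > 0" using prime_gt_0_nat[OF p] .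
  ultimately have "(\<eta> $ j) ^ (CHAR('a) ^ e) \<in> K" for j
    using fps_power_CHAR_power_nth[OF p, of \<eta> e "j * CHAR('a) ^ e"]
    by (metis dvd_triv_right nonzero_mult_div_cancel_right not_gr_zero power_not_zero)
  thus ?thesis by blast
qed

text \<open>Invertibility of the Moore matrix of elements independent over F_p, in the form of an
  elimination: one element t0 is removed by the additive polynomial x^p - t0^(p-1) x, whose kernel
  is F_p t0.\<close>

lemma moore_lemma:
  fixes M :: "'a :: field set"
  assumes p: "prime CHAR('a)" and M: "is_subfield M" and "finite A"
    and "\<And>\<alpha>. \<alpha> \<in> A \<Longrightarrow> t \<alpha> \<in> M"
    and "\<And>a. (\<Sum>\<alpha>\<in>A. of_nat (a \<alpha>) * t \<alpha>) = 0 \<Longrightarrow> \<forall>\<alpha>\<in>A. of_nat (a \<alpha>) = (0 :: 'a)"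
    and "\<And>N. (\<Sum>\<alpha>\<in>A. \<eta> \<alpha> * t \<alpha> ^ (CHAR('a) ^ N)) \<in> M"
  shows "\<forall>\<alpha>\<in>A. \<eta> \<alpha> \<in> M"
  using assms(3-)
proof (induction A arbitrary: t rule: finite_induct)
  case empty
  show ?case by simp
next
  case (insert \<alpha>0 F)
  note sr = is_subfield_is_subring[OF M]
  define P where "P = CHAR('a)"
  have P: "prime P" "P > 1" "P - 1 + 1 = P" using p prime_gt_1_nat[of P] by (auto simp: P_def)
  define t0 where "t0 = t \<alpha>0"
  have t0: "t0 \<noteq> 0"
  proof
    assume "t0 = 0"
    hence "(\<Sum>\<alpha>\<in>insert \<alpha>0 F. of_nat (if \<alpha> = \<alpha>0 then 1 else 0) * t \<alpha>) = 0"
      by (intro sum.neutral) (auto simp: t0_def)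
    hence "\<forall>\<alpha>\<in>insert \<alpha>0 F. of_nat (if \<alpha> = \<alpha>0 then 1 else 0) = (0 :: 'a)" by (rule insert.prems(2))
    thus False by auto
  qed
  define t' where "t' \<alpha> = t \<alpha> ^ P - t0 ^ (P - 1) * t \<alpha>" for \<alpha>
  have t0M: "t0 \<in> M" using insert.prems(1) by (simp add: t0_def)
  have sub: "(x - y) ^ (P ^ N) = x ^ (P ^ N) - y ^ (P ^ N)" for x y :: 'a and N
  proof -
    have "((x - y) + y) ^ (P ^ N) = (x - y) ^ (P ^ N) + y ^ (P ^ N)"
      by (rule freshmans_dream'[OF p]) (simp add: P_def)
    thus ?thesis by simp
  qed
  have "\<forall>\<alpha>\<in>F. \<eta> \<alpha> \<in> M"
  proof (rule insert.IH)
    show "t' \<alpha> \<in> M" if "\<alpha> \<in> F" for \<alpha>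
      unfolding t'_def using that insert.prems(1) t0M
      by (intro subring_diff[OF sr] subring_mult[OF sr] subring_power[OF sr]) auto
  next
    fix a :: "_ \<Rightarrow> nat" assume a: "(\<Sum>\<alpha>\<in>F. of_nat (a \<alpha>) * t' \<alpha>) = 0"
    \<comment> \<open>A relation between the \<open>t' \<alpha>\<close> puts w into the kernel F_p
      t0, hence gives a relation between the original elements.\<close>
    define w where "w = (\<Sum>\<alpha>\<in>F. of_nat (a \<alpha>) * t \<alpha>)"
    have "w ^ P = (\<Sum>\<alpha>\<in>F. of_nat (a \<alpha>) * t \<alpha> ^ P)"
      unfolding w_def P_def
      by (simp add: freshmans_dream_sum[OF p refl] power_mult_distrib of_nat_power_CHAR[OF p])
    hence "w ^ P - t0 ^ (P - 1) * w = (\<Sum>\<alpha>\<in>F. of_nat (a \<alpha>) * t' \<alpha>)"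
      by (simp add: w_def t'_def right_diff_distrib sum_subtractf sum_distrib_left mult_ac)
    hence "w ^ P = t0 ^ (P - 1) * w" using a by simp
    moreover have "t0 ^ P = t0 ^ (P - 1) * t0" using P(3) by (metis power_add power_one_right)
    ultimately have "(w / t0) ^ P = w / t0" using t0 by (simp add: power_divide)
    then obtain i where "w / t0 = of_nat i" using frobenius_fixed[OF p, of "w / t0"] by (auto simp: P_def)
    hence wi: "w = of_nat i * t0" using t0 by (simp add: field_simps)
    \<comment> \<open>Coefficients are natural numbers, so i (P - 1) represents -i.\<close>
    define b where "b \<alpha> = (if \<alpha> = \<alpha>0 then i * (P - 1) else a \<alpha>)" for \<alpha>
    have "(\<Sum>\<alpha>\<in>insert \<alpha>0 F. of_nat (b \<alpha>) * t \<alpha>) = of_nat (i * (P - 1)) * t0 + (\<Sum>\<alpha>\<in>F. of_nat (b \<alpha>) * t \<alpha>)"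
      using insert.hyps by (simp add: b_def t0_def)
    also have "(\<Sum>\<alpha>\<in>F. of_nat (b \<alpha>) * t \<alpha>) = w"
      unfolding w_def using insert.hyps by (intro sum.cong) (auto simp: b_def)
    also have "of_nat (i * (P - 1)) * t0 + w = of_nat i * (of_nat (P - 1 + 1) :: 'a) * t0"
      unfolding wi of_nat_mult of_nat_add by (simp add: distrib_left distrib_right)
    also have "of_nat (P - 1 + 1) = (0 :: 'a)" unfolding P(3) by (simp add: P_def)
    finally have "(\<Sum>\<alpha>\<in>insert \<alpha>0 F. of_nat (b \<alpha>) * t \<alpha>) = 0" by simp
    hence "\<forall>\<alpha>\<in>insert \<alpha>0 F. of_nat (b \<alpha>) = (0 :: 'a)" by (rule insert.prems(2))
    thus "\<forall>\<alpha>\<in>F. of_nat (a \<alpha>) = (0 :: 'a)" using insert.hyps by (auto simp: b_def split: if_splits)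
  next
    fix N
    \<comment> \<open>The sums for \<open>t'\<close> are the combinations S(N+1) - t0^((P-1) P^N)
      S(N) of the old ones, with coefficients in M.\<close>
    define S where "S N = (\<Sum>\<alpha>\<in>insert \<alpha>0 F. \<eta> \<alpha> * t \<alpha> ^ (P ^ N))" for N
    have "S (Suc N) - (t0 ^ (P - 1)) ^ (P ^ N) * S N = (\<Sum>\<alpha>\<in>insert \<alpha>0 F. \<eta> \<alpha> * t' \<alpha> ^ (P ^ N))"
      unfolding S_def t'_def sub
      by (simp add: sum_distrib_left sum_subtractf [symmetric] right_diff_distrib power_mult_distrib
          mult_ac flip: power_mult del: sum.insert)
    also have "t' \<alpha>0 = 0"
      unfolding t'_def t0_def using P(3) by (metis power_add power_one_right right_minus_eq)
    hence "(\<Sum>\<alpha>\<in>insert \<alpha>0 F. \<eta> \<alpha> * t' \<alpha> ^ (P ^ N)) = (\<Sum>\<alpha>\<in>F. \<eta> \<alpha> * t' \<alpha> ^ (P ^ N))"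
      using insert.hyps P by (simp add: power_0_left)
    finally have "S (Suc N) - (t0 ^ (P - 1)) ^ (P ^ N) * S N = (\<Sum>\<alpha>\<in>F. \<eta> \<alpha> * t' \<alpha> ^ (P ^ N))" .
    moreover have "S n \<in> M" for n unfolding S_def P_def by (rule insert.prems(3))
    hence "S (Suc N) - (t0 ^ (P - 1)) ^ (P ^ N) * S N \<in> M"
      by (intro subring_diff[OF sr] subring_mult[OF sr] subring_power[OF sr] t0M)
    ultimately show "(\<Sum>\<alpha>\<in>F. \<eta> \<alpha> * t' \<alpha> ^ (CHAR('a) ^ N)) \<in> M" by (simp add: P_def)
  qed
  moreover have "\<eta> \<alpha>0 \<in> M"
  proof -
    have "\<eta> \<alpha>0 * t0 + (\<Sum>\<alpha>\<in>F. \<eta> \<alpha> * t \<alpha>) \<in> M"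
      using insert.prems(3)[of 0] insert.hyps by (simp add: t0_def)
    moreover have "(\<Sum>\<alpha>\<in>F. \<eta> \<alpha> * t \<alpha>) \<in> M"
      using \<open>\<forall>\<alpha>\<in>F. \<eta> \<alpha> \<in> M\<close> insert.prems(1) by (intro subring_sum[OF sr] subring_mult[OF sr]) auto
    ultimately have "\<eta> \<alpha>0 * t0 \<in> M" using subring_diff[OF sr] by fastforce
    thus ?thesis using subfield_divide[OF M _ t0M] t0 by force
  qed
  ultimately show ?case by simp
qed

section \<open>Rational functions among Laurent series\<close>

definition poly_fls :: "'a :: field poly \<Rightarrow> 'a fls" where
  "poly_fls a = fps_to_fls (fps_of_poly a)"

lemma poly_fls_simps [simp]:
  "poly_fls 0 = 0" "poly_fls 1 = 1" "poly_fls (a + b) = poly_fls a + poly_fls b"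
  "poly_fls (a - b) = poly_fls a - poly_fls b" "poly_fls (a * b) = poly_fls a * poly_fls b"
  "poly_fls (a ^ n) = poly_fls a ^ n" "poly_fls [:0, 1:] = fls_X"
  by (simp_all add: poly_fls_def fps_of_poly_add fps_of_poly_diff fps_of_poly_mult
      fps_of_poly_power fls_times_fps_to_fls fps_to_fls_power fps_of_poly_linear)

lemma poly_fls_eq_iff [simp]: "poly_fls a = poly_fls b \<longleftrightarrow> a = b"
  by (simp add: poly_fls_def)

lemma poly_fls_eq_0_iff [simp]: "poly_fls a = 0 \<longleftrightarrow> a = 0"
  using poly_fls_eq_iff[of a 0] by simp

lemma poly_fls_sum: "poly_fls (sum f A) = (\<Sum>i\<in>A. poly_fls (f i))"
  by (induction A rule: infinite_finite_induct) auto

text \<open>The field k(f) inside k((x)). A general f is used for the descent to k(f) in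
  \<open>bet_not_over_ratfun\<close>; the identity polynomial gives k(x).\<close>

definition ratfun_in :: "'a :: field poly \<Rightarrow> 'a fls set" where
  "ratfun_in f = {poly_fls (pcompose a f) / poly_fls (pcompose b f) | a b. b \<noteq> 0}"

abbreviation ratfun :: "'a :: field fls set" where
  "ratfun \<equiv> ratfun_in [:0, 1:]"

lemma is_subfield_ratfun_in:
  assumes f: "Polynomial.degree f > 0"
  shows "is_subfield (ratfun_in f)"
proof -
  have nz: "pcompose b f \<noteq> 0" if "b \<noteq> 0" for b using that f by (simp add: pcompose_eq_0_iff)
  show ?thesis unfolding is_subfield_def is_subring_def
  proof (intro conjI ballI)
    show "1 \<in> ratfun_in f" unfolding ratfun_in_def
      by (intro CollectI exI[of _ 1]) (auto simp: pcompose_1)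
  next
    fix x y assume "x \<in> ratfun_in f" "y \<in> ratfun_in f"
    then obtain a b c d where *: "x = poly_fls (pcompose a f) / poly_fls (pcompose b f)" "b \<noteq> 0"
      "y = poly_fls (pcompose c f) / poly_fls (pcompose d f)" "d \<noteq> 0" unfolding ratfun_in_def by blast
    have "x - y = poly_fls (pcompose (a * d - c * b) f) / poly_fls (pcompose (b * d) f)"
      using * nz by (simp add: pcompose_mult pcompose_diff diff_frac_eq)
    thus "x - y \<in> ratfun_in f" unfolding ratfun_in_def using * by (metis (mono_tags, lifting) mem_Collect_eq mult_eq_0_iff)
    have "x * y = poly_fls (pcompose (a * c) f) / poly_fls (pcompose (b * d) f)"
      using * nz by (simp add: pcompose_mult)
    thus "x * y \<in> ratfun_in f" unfolding ratfun_in_def using * by (metis (mono_tags, lifting) mem_Collect_eq mult_eq_0_iff)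
  next
    fix x assume "x \<in> ratfun_in f"
    then obtain a b where *: "x = poly_fls (pcompose a f) / poly_fls (pcompose b f)" "b \<noteq> 0"
      unfolding ratfun_in_def by blast
    show "inverse x \<in> ratfun_in f"
    proof (cases "a = 0")
      case True
      hence "inverse x = poly_fls (pcompose 0 f) / poly_fls (pcompose 1 f)" using * by simp
      thus ?thesis unfolding ratfun_in_def by (metis (mono_tags, lifting) mem_Collect_eq one_neq_zero)
    next
      case False
      have "inverse x = poly_fls (pcompose b f) / poly_fls (pcompose a f)" using * by simp
      thus ?thesis unfolding ratfun_in_def using False by blast
    qed
  qed
qed

lemma poly_fls_in_ratfun_in: "poly_fls (pcompose a f) \<in> ratfun_in f"
  unfolding ratfun_in_def by (intro CollectI exI[of _ a] exI[of _ 1]) (auto simp: pcompose_1)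

lemma ratfun_eq: "ratfun = {poly_fls a / poly_fls b | a b. b \<noteq> 0}"
  by (simp add: ratfun_in_def pcompose_idR)

lemma is_subfield_ratfun: "is_subfield (ratfun :: 'a :: field fls set)"
  by (rule is_subfield_ratfun_in) simp

lemma poly_fls_in_ratfun: "poly_fls a \<in> ratfun"
  using poly_fls_in_ratfun_in[of a "[:0, 1:]"] by (simp add: pcompose_idR)

lemma ratfunE:
  assumes "x \<in> ratfun"
  obtains a b where "b \<noteq> 0" "x = poly_fls a / poly_fls b"
  using assms unfolding ratfun_eq by blast

lemma fls_const_in_ratfun: "fls_const c \<in> ratfun"
proof -
  have "fls_const c = poly_fls [:c:]" by (simp add: poly_fls_def fps_of_poly_const)
  thus ?thesis using poly_fls_in_ratfun by metis
qed

lemma fls_X_power_times_regular: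
  "\<exists>s. \<forall>n\<ge>s. \<exists>g. fls_X ^ n * l = fps_to_fls (g :: 'a :: field fps)"
proof (intro exI[of _ "nat (- fls_subdegree l)"] allI impI)
  fix n assume n: "n \<ge> nat (- fls_subdegree l)"
  have "fls_X ^ n * l = fls_shift (- int n) l" by (simp add: fls_X_power_times_conv_shift)
  moreover have "fls_subdegree (fls_shift (- int n) l) \<ge> 0"
    using n by (cases "l = 0") auto
  ultimately show "\<exists>g. fls_X ^ n * l = fps_to_fls g" by (metis fls_regpart_to_fls_trivial)
qed

lemma common_fls_X_power:
  assumes "finite B"
  shows "\<exists>s. \<forall>l\<in>B. \<exists>g. fls_X ^ s * l = fps_to_fls (g :: 'a :: field fps)"
proof -
  obtain s where s: "\<And>l n. n \<ge> s l \<Longrightarrow> \<exists>g. fls_X ^ n * l = fps_to_fls (g :: 'a fps)"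
    using fls_X_power_times_regular by metis
  have "\<exists>g. fls_X ^ Max (s ` B) * l = fps_to_fls (g :: 'a fps)" if "l \<in> B" for l
    using assms that by (intro s) auto
  thus ?thesis by blast
qed

section \<open>p-bases, and separability of k((x)) over k(x)\<close>

context
  assumes p: "prime CHAR('a :: field)" and perf: "\<And>x :: 'a. \<exists>y. y ^ CHAR('a) = x"
begin

text \<open>The summand of index j occupies only degrees congruent to j modulo p.\<close>

lemma fps_p_basis:
  fixes g :: "nat \<Rightarrow> 'a fps"
  assumes "(\<Sum>j<CHAR('a). fps_X ^ j * g j ^ CHAR('a)) = 0" "j < CHAR('a)"
  shows "g j = 0"
proof (rule fps_ext)
  fix m
  define P where "P = CHAR('a)"
  have P: "P > 0" using prime_gt_0_nat[OF p] by (simp add: P_def)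
  have "0 = (\<Sum>i<P. fps_X ^ i * g i ^ P) $ (P * m + j)" using assms(1) by (simp add: P_def)
  also have "\<dots> = (\<Sum>i<P. if i = j then (g j $ m) ^ P else 0)"
    unfolding fps_sum_nth
  proof (intro sum.cong refl)
    fix i assume i: "i \<in> {..<P}"
    show "(fps_X ^ i * g i ^ P) $ (P * m + j) = (if i = j then (g j $ m) ^ P else 0)"
    proof (cases "i = j")
      case True
      thus ?thesis using P by (simp add: fps_X_power_mult_nth P_def fps_power_CHAR_nth[OF p])
    next
      case False
      have "\<not> P dvd P * m + j - i" if "i \<le> P * m + j"
      proof
        assume "P dvd P * m + j - i"
        hence "[P * m + j = i] (mod P)" using that by (simp add: cong_altdef_nat)
        hence "j mod P = i mod P" by (simp add: cong_def)
        thus False using False i assms(2) by (simp add: P_def)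
      qed
      thus ?thesis using False
        by (auto simp: fps_X_power_mult_nth P_def fps_power_CHAR_nth[OF p])
    qed
  qed
  also have "\<dots> = (g j $ m) ^ P" using assms(2) by (simp add: P_def)
  finally show "g j $ m = 0 $ m" using P by simp
qed

lemma fls_p_basis:
  fixes l :: "nat \<Rightarrow> 'a fls"
  assumes "(\<Sum>j<CHAR('a). fls_X ^ j * l j ^ CHAR('a)) = 0" "j < CHAR('a)"
  shows "l j = 0"
proof -
  obtain s where s: "\<And>j. j < CHAR('a) \<Longrightarrow> \<exists>g. fls_X ^ s * l j = fps_to_fls (g :: 'a fps)"
    using common_fls_X_power[of "l ` {..<CHAR('a)}"] by auto
  then obtain g where g: "\<And>j. j < CHAR('a) \<Longrightarrow> fls_X ^ s * l j = fps_to_fls (g j :: 'a fps)" by metis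
  have "fps_to_fls (\<Sum>j<CHAR('a). fps_X ^ j * g j ^ CHAR('a)) = (\<Sum>j<CHAR('a). fls_X ^ j * (fls_X ^ s * l j) ^ CHAR('a))"
  proof -
    have hom: "fps_to_fls (sum h A) = (\<Sum>i\<in>A. fps_to_fls (h i))" for h :: "nat \<Rightarrow> 'a fps" and A
      by (induction A rule: infinite_finite_induct) auto
    show ?thesis unfolding hom
      by (intro sum.cong refl) (simp add: g fls_times_fps_to_fls fps_to_fls_power)
  qed
  also have "\<dots> = (fls_X ^ s) ^ CHAR('a) * (\<Sum>j<CHAR('a). fls_X ^ j * l j ^ CHAR('a))"
    by (simp add: sum_distrib_left power_mult_distrib mult_ac)
  finally have "(\<Sum>j<CHAR('a). fps_X ^ j * g j ^ CHAR('a)) = 0" using assms(1) by simp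
  hence "g j = 0" using fps_p_basis assms(2) by blast
  thus ?thesis using g[OF assms(2)] by simp
qed

text \<open>Exponents are sorted by their residue modulo p, and perfectness provides the p-th roots
  of the coefficients.\<close>

lemma poly_p_basis: "\<exists>b :: nat \<Rightarrow> 'a poly. a = (\<Sum>j<CHAR('a). [:0, 1:] ^ j * b j ^ CHAR('a))"
proof -
  define P where "P = CHAR('a)"
  have P: "P > 0" using prime_gt_0_nat[OF p] by (simp add: P_def)
  obtain rt where rt: "\<And>x :: 'a. rt x ^ P = x" using perf unfolding P_def by metis
  define d where "d = Polynomial.degree a"
  define b where "b j = (\<Sum>m\<le>d. Polynomial.monom (rt (Polynomial.coeff a (P * m + j))) m)" for j
  have "b j ^ P = (\<Sum>m\<le>d. Polynomial.monom (Polynomial.coeff a (P * m + j)) (P * m))" for j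
  proof -
    have "b j ^ P = (\<Sum>m\<le>d. Polynomial.monom (rt (Polynomial.coeff a (P * m + j))) m ^ P)"
      unfolding b_def P_def by (rule freshmans_dream_sum) (use p in simp_all)
    thus ?thesis by (simp add: monom_power rt mult.commute)
  qed
  hence eq: "[:0, 1:] ^ j * b j ^ P = (\<Sum>m\<le>d. Polynomial.monom (Polynomial.coeff a (P * m + j)) (P * m + j))" for j
    by (simp add: sum_distrib_left mult_monom add.commute flip: monom_altdef[of 1, simplified])
  have "a = (\<Sum>j<P. [:0, 1:] ^ j * b j ^ P)"
  proof (rule poly_eqI)
    fix n
    have "Polynomial.coeff (\<Sum>j<P. [:0, 1:] ^ j * b j ^ P) n =
      (\<Sum>j<P. \<Sum>m\<le>d. if j = n mod P \<and> m = n div P then Polynomial.coeff a n else 0)"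
      unfolding eq coeff_sum
    proof (intro sum.cong refl)
      fix j m assume "j \<in> {..<P}"
      hence "P * m + j = n \<longleftrightarrow> j = n mod P \<and> m = n div P" using P by auto
      thus "Polynomial.coeff (Polynomial.monom (Polynomial.coeff a (P * m + j)) (P * m + j)) n =
        (if j = n mod P \<and> m = n div P then Polynomial.coeff a n else 0)"
        by (auto simp: coeff_monom)
    qed
    also have "\<dots> = (\<Sum>j<P. if j = n mod P then \<Sum>m\<le>d. if m = n div P then Polynomial.coeff a n else 0 else 0)"
      by (intro sum.cong refl) auto
    also have "\<dots> = (if n div P \<le> d then Polynomial.coeff a n else 0)" using P by simp
    also have "\<dots> = Polynomial.coeff a n"
    proof (cases "n div P \<le> d")
      case False
      have "n div P \<le> n" by simp
      hence "n > d" using False by linarith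
      thus ?thesis by (simp add: d_def coeff_eq_0)
    qed simp
    finally show "Polynomial.coeff a n = Polynomial.coeff (\<Sum>j<P. [:0, 1:] ^ j * b j ^ P) n" by simp
  qed
  thus ?thesis by (auto simp: P_def)
qed

text \<open>a / b = a b^(p-1) / b^p: with a p-th power as denominator only the numerator has to be
  expanded.\<close>

lemma ratfun_p_basis:
  assumes "x \<in> (ratfun :: 'a fls set)"
  shows "\<exists>c. (\<forall>j. c j \<in> ratfun) \<and> x = (\<Sum>j<CHAR('a). fls_X ^ j * c j ^ CHAR('a))"
proof -
  obtain a b where ab: "b \<noteq> 0" "x = poly_fls a / poly_fls b" using assms by (rule ratfunE)
  define P where "P = CHAR('a)"
  have P: "P > 0" using prime_gt_0_nat[OF p] by (simp add: P_def)
  obtain d where d: "a * b ^ (P - 1) = (\<Sum>j<P. [:0, 1:] ^ j * d j ^ P)"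
    using poly_p_basis unfolding P_def by blast
  define c where "c j = poly_fls (d j) / poly_fls b" for j
  have "x = poly_fls (a * b ^ (P - 1)) / poly_fls b ^ P"
    using ab P by (cases P) (simp_all add: field_simps)
  also have "\<dots> = (\<Sum>j<P. fls_X ^ j * c j ^ P)"
    unfolding d by (simp add: poly_fls_sum sum_divide_distrib c_def power_divide)
  finally have "x = (\<Sum>j<P. fls_X ^ j * c j ^ P)" .
  moreover have "c j \<in> ratfun" for j using ab by (auto simp: c_def ratfun_eq)
  ultimately show ?thesis by (auto simp: P_def)
qed

text \<open>In the p-basis, x^p has the single component x over the Laurent series, and it has
  components \<open>c j\<close> over the rational functions. Uniqueness gives x =
  \<open>c 0\<close>.\<close>

lemma ratfun_p_closed:
  fixes x :: "'a fls"
  assumes "x ^ CHAR('a) \<in> ratfun"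
  shows "x \<in> ratfun"
proof -
  define P where "P = CHAR('a)"
  have P: "P > 0" "prime P" using prime_gt_0_nat[OF p] p by (simp_all add: P_def)
  obtain c where c: "\<And>j. c j \<in> ratfun" "x ^ P = (\<Sum>j<P. fls_X ^ j * c j ^ P)"
    using ratfun_p_basis[OF assms] unfolding P_def by blast
  define l where "l j = (if j = 0 then c 0 - x else c j)" for j :: nat
  have sub: "(c 0 - x) ^ P = c 0 ^ P - x ^ P"
  proof -
    have "((c 0 - x) + x) ^ P = (c 0 - x) ^ P + x ^ P"
      by (rule freshmans_dream) (use p in \<open>simp_all add: P_def\<close>)
    thus ?thesis by simp
  qed
  have "{..<P} = insert 0 {1..<P}" using P by auto
  hence split: "(\<Sum>j<P. h j) = h 0 + (\<Sum>j\<in>{1..<P}. h j)" for h :: "nat \<Rightarrow> 'a fls" by simp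
  have "(\<Sum>j<P. fls_X ^ j * l j ^ P) = (\<Sum>j<P. fls_X ^ j * c j ^ P) - x ^ P"
    unfolding split by (simp add: l_def sub)
  also have "\<dots> = 0" using c(2) by simp
  finally have "l 0 = 0" using fls_p_basis[of l 0] P by (simp add: P_def)
  thus ?thesis using c(1)[of 0] by (simp add: l_def)
qed

lemma ratfun_p_power_closed: "(x :: 'a fls) ^ (CHAR('a) ^ e) \<in> ratfun \<Longrightarrow> x \<in> ratfun"
proof (induction e arbitrary: x)
  case (Suc e)
  have "(x ^ CHAR('a)) ^ (CHAR('a) ^ e) \<in> ratfun" using Suc.prems by (simp flip: power_mult)
  thus ?case using Suc.IH ratfun_p_closed by blast
qed simp

text \<open>Finite extensions of the field of rational functions inside the Laurent series are separable:
  they are spanned by \<open>p\<close>-th powers.\<close>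

lemma fin_over_ratfun_spanning_powers:
  assumes M: "fin_over (ratfun :: 'a fls set) M"
  shows "\<exists>B. finite B \<and> fps_to_fls ` B \<subseteq> M \<and> M = mspan ratfun ((\<lambda>b. fps_to_fls (b ^ (CHAR('a) ^ N))) ` B)"
proof -
  define P where "P = CHAR('a)"
  define K where "K = (ratfun :: 'a fls set)"
  have K: "is_subfield K" unfolding K_def by (rule is_subfield_ratfun)
  note Ksr = is_subfield_is_subring[OF K]
  have Msr: "is_subring M" "K \<subseteq> M" using M by (auto simp: fin_over_def K_def)
  define spans where "spans B \<longleftrightarrow> finite B \<and> B \<subseteq> M \<and> M = mspan K B" for B
  have "\<exists>B. spans B" using M by (auto simp: fin_over_def spans_def K_def)
  \<comment> \<open>A spanning set of minimal size replaces a basis.\<close>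
  then obtain B where B: "spans B" and min: "\<And>B'. spans B' \<Longrightarrow> card B \<le> card B'"
    using ex_has_least_nat[of spans _ card] by metis
  \<comment> \<open>A power of the variable clears the poles, so that the spanning set consists of
    power series, on which \<open>shift_x\<close> acts.\<close>
  obtain s where s: "\<forall>l\<in>B. \<exists>g. fls_X ^ s * l = fps_to_fls (g :: 'a fps)"
    using common_fls_X_power[of B] B by (auto simp: spans_def)
  then obtain g where g: "\<And>l. l \<in> B \<Longrightarrow> fls_X ^ s * l = fps_to_fls (g l :: 'a fps)" by metis
  define B0 where "B0 = g ` B"
  have Xs: "fls_X ^ s \<in> K" "fls_X ^ s \<in> M"
    using poly_fls_in_ratfun[of "[:0, 1:] ^ s"] Msr(2) by (auto simp: K_def)
  have spanB0: "spans (fps_to_fls ` B0)"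
    unfolding spans_def
  proof (intro conjI)
    show fin: "finite (fps_to_fls ` B0)" using B by (auto simp: B0_def spans_def)
    show sub: "fps_to_fls ` B0 \<subseteq> M"
      using B Xs subring_mult[OF Msr(1)] by (auto simp: B0_def g [symmetric] spans_def)
    show "M = mspan K (fps_to_fls ` B0)"
    proof
      show "mspan K (fps_to_fls ` B0) \<subseteq> M" by (rule mspan_subset[OF Msr sub])
      show "M \<subseteq> mspan K (fps_to_fls ` B0)"
      proof
        fix z assume "z \<in> M"
        then obtain c where c: "\<forall>b\<in>B. c b \<in> K" "z = (\<Sum>b\<in>B. c b * b)"
          using B by (auto simp: spans_def elim!: mspanE)
        have "z = (\<Sum>b\<in>B. (c b / fls_X ^ s) * fps_to_fls (g b))"
          unfolding c(2)
        proof (intro sum.cong refl)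
          fix b assume "b \<in> B"
          have aux: "t \<noteq> 0 \<Longrightarrow> c b * b = (c b / t) * (t * b)" for t by simp
          show "c b * b = (c b / fls_X ^ s) * fps_to_fls (g b)"
            unfolding g[OF \<open>b \<in> B\<close>, symmetric] by (rule aux) simp
        qed
        also have "\<dots> \<in> mspan K (fps_to_fls ` B0)"
          using c(1) Xs
          by (intro mspan_sum[OF Ksr fin] mspan_scale[OF Ksr fin] mspan_base[OF Ksr fin]
              subfield_divide[OF K]) (auto simp: B0_def)
        finally show "z \<in> mspan K (fps_to_fls ` B0)" .
      qed
    qed
  qed
  \<comment> \<open>Frobenius preserves the span: the p-th powers stay independent, and an
    independent family of the size of a spanning set spans.\<close>
  have step: "spans ((\<lambda>b. b ^ P) ` B') \<and> card ((\<lambda>b. b ^ P) ` B') \<le> card B" if B': "spans B'" "card B' \<le> card B" for B'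
  proof -
    have fin: "finite B'" using B' by (simp add: spans_def)
    have fin': "finite ((\<lambda>b. b ^ P) ` B')" using fin by simp
    have sub: "(\<lambda>b. b ^ P) ` B' \<subseteq> M" using B' subring_power[OF Msr(1)] by (auto simp: spans_def)
    have indep: "\<forall>b\<in>B'. c b = 0" if c: "\<forall>b\<in>B'. c b \<in> K" "(\<Sum>b\<in>B'. c b * b) = 0" for c
    proof (rule ccontr)
      assume "\<not> ?thesis"
      then obtain b0 where b0: "b0 \<in> B'" "c b0 \<noteq> 0" by blast
      have fin0: "finite (B' - {b0})" using fin by simp
      have "c b0 * b0 = - (\<Sum>b\<in>B'-{b0}. c b * b)"
        using c(2) fin b0 by (simp add: sum.remove[of B' b0] eq_neg_iff_add_eq_0)
      hence "b0 = (\<Sum>b\<in>B'-{b0}. (- c b / c b0) * b)"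
      proof -
        assume "c b0 * b0 = - (\<Sum>b\<in>B'-{b0}. c b * b)"
        hence "b0 = - (\<Sum>b\<in>B'-{b0}. c b * b) / c b0" using b0(2) by (metis nonzero_mult_div_cancel_left)
        thus ?thesis by (simp add: sum_divide_distrib flip: sum_negf)
      qed
      also have "\<dots> \<in> mspan K (B' - {b0})"
        using c(1) b0 by (intro mspan_sum[OF Ksr fin0] mspan_scale[OF Ksr fin0] mspan_base[OF Ksr fin0]
            subfield_divide[OF K] subring_uminus[OF Ksr]) auto
      finally have b0in: "b0 \<in> mspan K (B' - {b0})" .
      have "M \<subseteq> mspan K (B' - {b0})"
      proof
        fix z assume "z \<in> M"
        then obtain d where d: "\<forall>b\<in>B'. d b \<in> K" "z = (\<Sum>b\<in>B'. d b * b)"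
          using B' by (auto simp: spans_def elim!: mspanE)
        have "b \<in> mspan K (B' - {b0})" if "b \<in> B'" for b
          using that b0in mspan_base[OF Ksr fin0] by (cases "b = b0") auto
        thus "z \<in> mspan K (B' - {b0})" unfolding d(2) using d(1)
          by (intro mspan_sum[OF Ksr fin0] mspan_scale[OF Ksr fin0]) auto
      qed
      moreover have "mspan K (B' - {b0}) \<subseteq> M"
        using B' by (intro mspan_subset[OF Msr]) (auto simp: spans_def)
      ultimately have "spans (B' - {b0})" using B' by (auto simp: spans_def)
      hence "card B \<le> card (B' - {b0})" by (rule min)
      moreover have "card (B' - {b0}) < card B'" using fin b0(1) by (rule card_Diff1_less)
      ultimately show False using B'(2) by simp
    qed
    \<comment> \<open>Expand the coefficients in the p-basis; each component is the p-th power of a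
      relation between the elements themselves.\<close>
    have indepP: "\<forall>b\<in>B'. c b = 0" if c: "\<forall>b\<in>B'. c b \<in> K" "(\<Sum>b\<in>B'. c b * b ^ P) = 0" for c
    proof -
      have "\<forall>b\<in>B'. \<exists>d. (\<forall>j. d j \<in> K) \<and> c b = (\<Sum>j<P. fls_X ^ j * d j ^ P)"
        using ratfun_p_basis c(1) unfolding K_def P_def by blast
      then obtain d where d: "\<forall>b\<in>B'. (\<forall>j. d b j \<in> K) \<and> c b = (\<Sum>j<P. fls_X ^ j * d b j ^ P)" by metis
      have "(\<Sum>j<P. fls_X ^ j * (\<Sum>b\<in>B'. d b j * b) ^ P) = (\<Sum>j<P. \<Sum>b\<in>B'. fls_X ^ j * d b j ^ P * b ^ P)"
      proof -
        have "(\<Sum>b\<in>B'. d b j * b) ^ P = (\<Sum>b\<in>B'. (d b j * b) ^ P)" for j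
          unfolding P_def by (rule freshmans_dream_sum) (use p in simp_all)
        thus ?thesis by (simp add: sum_distrib_left power_mult_distrib mult.assoc)
      qed
      also have "\<dots> = (\<Sum>b\<in>B'. \<Sum>j<P. fls_X ^ j * d b j ^ P * b ^ P)" by (rule sum.swap)
      also have "\<dots> = (\<Sum>b\<in>B'. c b * b ^ P)" using d by (simp flip: sum_distrib_right)
      finally have "(\<Sum>j<P. fls_X ^ j * (\<Sum>b\<in>B'. d b j * b) ^ P) = 0" using c(2) by simp
      hence "(\<Sum>b\<in>B'. d b j * b) = 0" if "j < P" for j
        using fls_p_basis[of "\<lambda>j. \<Sum>b\<in>B'. d b j * b" j] that by (simp add: P_def)
      hence "\<forall>b\<in>B'. d b j = 0" if "j < P" for j using indep[of "\<lambda>b. d b j"] d that by blast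
      thus ?thesis using d prime_gt_0_nat[OF p] by (auto simp: P_def power_0_left intro!: sum.neutral)
    qed
    have "M \<subseteq> mspan K ((\<lambda>b. b ^ P) ` B')"
    proof
      fix z assume z: "z \<in> M"
      \<comment> \<open>\<open>None\<close> stands for z and \<open>Some b\<close> for the p-th
        power of b: indexing keeps coinciding values apart.\<close>
      define I where "I = insert None (Some ` B')"
      define v where "v i = (case i of None \<Rightarrow> z | Some b \<Rightarrow> b ^ P)" for i
      have cardI: "card I = Suc (card B')" unfolding I_def using fin by (simp add: card_image)
      obtain a where a: "\<forall>i\<in>I. a i \<in> K" "\<exists>i\<in>I. a i \<noteq> 0" "(\<Sum>i\<in>I. a i * v i) = 0"
      proof (rule exE[OF fin_over_relation[OF K, of M B' I v]])
        show "M = mspan K B'" "finite B'" using B' by (auto simp: spans_def)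
        show "finite I" "card B' < card I" using fin cardI by (auto simp: I_def)
        show "v i \<in> M" if "i \<in> I" for i using that z sub by (auto simp: I_def v_def)
      qed blast
      have eq: "a None * z + (\<Sum>b\<in>B'. a (Some b) * b ^ P) = 0"
        using a(3) fin by (simp add: I_def v_def sum.reindex)
      have "a None \<noteq> 0"
      proof
        assume "a None = 0"
        hence "\<forall>b\<in>B'. a (Some b) = 0" using indepP[of "\<lambda>b. a (Some b)"] a(1) eq by (auto simp: I_def)
        thus False using a(2) \<open>a None = 0\<close> by (auto simp: I_def)
      qed
      hence "z = (\<Sum>b\<in>B'. (- a (Some b) / a None) * b ^ P)"
      proof -
        have "a None * z = - (\<Sum>b\<in>B'. a (Some b) * b ^ P)" using eq by (simp add: eq_neg_iff_add_eq_0)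
        hence "z = - (\<Sum>b\<in>B'. a (Some b) * b ^ P) / a None" using \<open>a None \<noteq> 0\<close> by (simp add: field_simps)
        thus ?thesis by (simp add: sum_divide_distrib flip: sum_negf)
      qed
      also have "\<dots> \<in> mspan K ((\<lambda>b. b ^ P) ` B')"
        using a(1) by (intro mspan_sum[OF Ksr fin'] mspan_scale[OF Ksr fin'] mspan_base[OF Ksr fin']
            subfield_divide[OF K] subring_uminus[OF Ksr]) (auto simp: I_def)
      finally show "z \<in> mspan K ((\<lambda>b. b ^ P) ` B')" .
    qed
    moreover have "mspan K ((\<lambda>b. b ^ P) ` B') \<subseteq> M" by (rule mspan_subset[OF Msr sub])
    moreover have "card ((\<lambda>b. b ^ P) ` B') \<le> card B" using card_image_le[OF fin] B'(2) le_trans by blast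
    ultimately show ?thesis using fin' sub by (auto simp: spans_def)
  qed
  have card0: "card (fps_to_fls ` B0) \<le> card B"
    using B card_image_le[of B g] card_image_le[of B0 fps_to_fls] by (auto simp: B0_def spans_def intro: le_trans)
  have "spans ((\<lambda>b. fps_to_fls (b ^ (P ^ N))) ` B0) \<and> card ((\<lambda>b. fps_to_fls (b ^ (P ^ N))) ` B0) \<le> card B"
  proof (induction N)
    case 0
    show ?case using spanB0 card0 by simp
  next
    case (Suc N)
    have "(\<lambda>b. b ^ P) ` ((\<lambda>b. fps_to_fls (b ^ (P ^ N))) ` B0) = (\<lambda>b. fps_to_fls (b ^ (P ^ Suc N))) ` B0"
      by (simp add: image_image mult.commute flip: fps_to_fls_power power_mult)
    thus ?case using step Suc by metis
  qed
  moreover have "finite B0" using B by (simp add: B0_def spans_def)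
  moreover have "fps_to_fls ` B0 \<subseteq> M" using spanB0 unfolding spans_def by blast
  ultimately show ?thesis by (auto simp: spans_def P_def K_def)
qed

end

section \<open>The substitution $x \mapsto x(1 + v)$\<close>

text \<open>x^n goes to x^n (1 + v)^n, with v as the outer variable. The coefficient of v^j is x^j
  times the j-th Hasse derivative, so p-th powers are not lost.\<close>

definition shift_x :: "'a :: comm_ring_1 fps \<Rightarrow> 'a fps fps" where
  "shift_x a = Abs_fps (\<lambda>j. Abs_fps (\<lambda>n. of_nat (n choose j) * a $ n))"

lemma shift_x_nth: "shift_x a $ j $ n = of_nat (n choose j) * a $ n"
  by (simp add: shift_x_def)

lemma shift_x_nth_0 [simp]: "shift_x a $ 0 = a"
  by (rule fps_ext) (simp add: shift_x_nth)

lemma shift_x_const [simp]: "shift_x (fps_const c) = fps_const (fps_const c)"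
proof (rule fps_ext, rule fps_ext)
  fix j n show "shift_x (fps_const c) $ j $ n = fps_const (fps_const c) $ j $ n"
    by (cases j; cases n) (auto simp: shift_x_nth)
qed

lemma shift_x_1 [simp]: "shift_x 1 = 1"
  using shift_x_const[of "1 :: 'a"] by simp

lemma shift_x_0 [simp]: "shift_x 0 = 0"
  using shift_x_const[of "0 :: 'a"] by simp

lemma shift_x_add: "shift_x (a + b) = shift_x a + shift_x b"
  by (rule fps_ext, rule fps_ext) (simp add: shift_x_nth algebra_simps)

lemma shift_x_uminus: "shift_x (- a) = - shift_x a"
  using shift_x_add[of a "- a"] by (simp add: eq_neg_iff_add_eq_0 add.commute)

lemma shift_x_diff: "shift_x (a - b) = shift_x a - shift_x b"
  using shift_x_add[of a "- b"] by (simp add: shift_x_uminus)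

lemma shift_x_sum: "shift_x (sum f A) = (\<Sum>i\<in>A. shift_x (f i))"
  by (induction A rule: infinite_finite_induct) (auto simp: shift_x_add)

lemma shift_x_X: "shift_x fps_X = fps_const fps_X * (1 + fps_X)"
proof (rule fps_ext, rule fps_ext)
  fix j n show "shift_x (fps_X :: 'a fps) $ j $ n = (fps_const fps_X * (1 + fps_X)) $ j $ n"
    by (cases j rule: nat.exhaust; cases "j - 1"; cases n) (auto simp: shift_x_nth distrib_left binomial_eq_0)
qed

text \<open>On coefficients, multiplicativity of the substitution is Vandermonde's identity.\<close>

lemma shift_x_mult: "shift_x (a * b) = shift_x a * shift_x b"
proof (rule fps_ext, rule fps_ext)
  fix j n
  have "(shift_x a * shift_x b) $ j $ n =
    (\<Sum>i=0..j. \<Sum>k=0..n. of_nat (k choose i) * a $ k * (of_nat ((n - k) choose (j - i)) * b $ (n - k)))"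
    by (simp add: fps_mult_nth fps_sum_nth shift_x_nth)
  also have "\<dots> = (\<Sum>k=0..n. \<Sum>i=0..j. of_nat (k choose i) * a $ k * (of_nat ((n - k) choose (j - i)) * b $ (n - k)))"
    by (rule sum.swap)
  also have "\<dots> = (\<Sum>k=0..n. of_nat (\<Sum>i=0..j. (k choose i) * ((n - k) choose (j - i))) * (a $ k * b $ (n - k)))"
    by (simp add: sum_distrib_right sum_distrib_left mult_ac)
  also have "\<dots> = (\<Sum>k=0..n. of_nat (n choose j) * (a $ k * b $ (n - k)))"
    using vandermonde by (intro sum.cong refl) (auto simp: atLeast0AtMost simp flip: of_nat_sum of_nat_mult)
  also have "\<dots> = shift_x (a * b) $ j $ n"
    by (simp add: shift_x_nth fps_mult_nth sum_distrib_left)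
  finally show "shift_x (a * b) $ j $ n = (shift_x a * shift_x b) $ j $ n" by simp
qed

lemma shift_x_power: "shift_x (a ^ n) = shift_x a ^ n"
  by (induction n) (auto simp: shift_x_mult)

lemma shift_x_prod: "shift_x (prod f A) = (\<Prod>i\<in>A. shift_x (f i))"
  by (induction A rule: infinite_finite_induct) (auto simp: shift_x_mult)

lemma shift_x_poly:
  fixes a :: "'a :: comm_ring_1 poly"
  shows "\<exists>b. shift_x (fps_of_poly a) $ j = fps_of_poly b"
proof -
  have "shift_x (fps_of_poly a) $ j = fps_of_poly (Poly (map (\<lambda>n. of_nat (n choose j) * Polynomial.coeff a n) [0..<Suc (Polynomial.degree a)]))"
    by (rule fps_ext) (auto simp: shift_x_nth nth_default_def coeff_eq_0 simp del: upt_Suc)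
  thus ?thesis by blast
qed

text \<open>By separability, D s is a sum of a_b g_b^q with polynomials D, a_b and q = p^N > j. The
  substitution sends g^q to a q-th power, which has no term v^i with 0 < i < q, so up to degree j in
  v only the polynomials are moved.\<close>

lemma shift_x_in_fin_over:
  assumes p: "prime CHAR('a :: field)" and perf: "\<And>x :: 'a. \<exists>y. y ^ CHAR('a) = x"
    and M: "fin_over (ratfun :: 'a fls set) M" and s: "fps_to_fls s \<in> M"
  shows "fps_to_fls (shift_x s $ j) \<in> M"
proof -
  define P where "P = CHAR('a)"
  have P: "P > 1" "prime P" using prime_gt_1_nat[OF p] p by (simp_all add: P_def)
  define K where "K = (ratfun :: 'a fls set)"
  have Mf: "is_subfield M" using fin_over_subfield[OF is_subfield_ratfun M] .
  note Msr = is_subfield_is_subring[OF Mf]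
  have KM: "K \<subseteq> M" using M by (auto simp: fin_over_def K_def)
  \<comment> \<open>Any N with p^N > j serves, and j < p^j.\<close>
  define N where "N = j"
  define q where "q = P ^ N"
  have q: "j < q" unfolding q_def N_def using power_gt_expt[of P j] P by simp
  obtain B where B: "finite B" "fps_to_fls ` B \<subseteq> M" "M = mspan K ((\<lambda>b. fps_to_fls (b ^ q)) ` B)"
    using fin_over_ratfun_spanning_powers[OF p perf M, of N] by (auto simp: q_def P_def K_def)
  define C where "C = (\<lambda>b. fps_to_fls (b ^ q)) ` B"
  have finC: "finite C" using B by (simp add: C_def)
  obtain c where c: "\<forall>b\<in>C. c b \<in> K" "fps_to_fls s = (\<Sum>b\<in>C. c b * b)"
    using s B(3) by (auto simp: C_def elim!: mspanE)
  define rep where "rep b nd \<longleftrightarrow> snd nd \<noteq> 0 \<and> c b = poly_fls (fst nd) / poly_fls (snd nd)"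
    for b and nd :: "'a poly \<times> 'a poly"
  have "\<forall>b\<in>C. \<exists>nd. rep b nd"
    using c(1) unfolding K_def ratfun_eq rep_def by fastforce
  then obtain nd' where nd': "\<forall>b\<in>C. rep b (nd' b)" by (rule bchoice[THEN exE])
  define nu de where "nu b = fst (nd' b)" and "de b = snd (nd' b)" for b
  have nd: "\<forall>b\<in>C. de b \<noteq> 0 \<and> c b = poly_fls (nu b) / poly_fls (de b)"
    using nd' by (auto simp: nu_def de_def rep_def)
  have "\<forall>b\<in>C. \<exists>g. b = fps_to_fls (g ^ q) \<and> fps_to_fls g \<in> M"
    using B(2) by (auto simp: C_def)
  then obtain gg where gg: "\<forall>b\<in>C. b = fps_to_fls (gg b ^ q) \<and> fps_to_fls (gg b) \<in> M"
    by (auto dest: bchoice)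
  define D where "D = (\<Prod>b\<in>C. de b)"
  have D0: "D \<noteq> 0" using nd finC by (auto simp: D_def)
  define a where "a b = nu b * (\<Prod>b'\<in>C-{b}. de b')" for b
  have ca: "poly_fls D * c b = poly_fls (a b)" if "b \<in> C" for b
  proof -
    have "D = de b * (\<Prod>b'\<in>C-{b}. de b')" unfolding D_def using finC that by (rule prod.remove)
    thus ?thesis using nd that by (simp add: a_def)
  qed
  have "poly_fls D * fps_to_fls s = (\<Sum>b\<in>C. poly_fls (a b) * fps_to_fls (gg b ^ q))"
    unfolding c(2) sum_distrib_left using gg ca by (intro sum.cong refl) (simp flip: mult.assoc)
  also have "\<dots> = fps_to_fls (\<Sum>b\<in>C. fps_of_poly (a b) * gg b ^ q)"
  proof -
    have hom: "fps_to_fls (sum h A) = (\<Sum>i\<in>A. fps_to_fls (h i))" for h :: "'a fls \<Rightarrow> 'a fps" and A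
      by (induction A rule: infinite_finite_induct) auto
    show ?thesis unfolding hom by (simp add: poly_fls_def fls_times_fps_to_fls)
  qed
  finally have "fps_of_poly D * s = (\<Sum>b\<in>C. fps_of_poly (a b) * gg b ^ q)"
    by (simp add: poly_fls_def flip: fls_times_fps_to_fls)
  hence eq: "shift_x (fps_of_poly D) * shift_x s = (\<Sum>b\<in>C. shift_x (fps_of_poly (a b)) * shift_x (gg b) ^ q)"
    by (simp add: shift_x_sum shift_x_power shift_x_mult flip: shift_x_mult[of "fps_of_poly D"])
  have low: "(shift_x g ^ q) $ i = (if i = 0 then g ^ q else 0)" if "i < q" for i and g :: "'a fps"
    using fps_power_CHAR_power_nth[of "shift_x g" N i] p that by (auto simp: q_def P_def dest: dvd_imp_le)
  have polyM: "fps_to_fls (shift_x (fps_of_poly d) $ i) \<in> M" for d i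
    using shift_x_poly[of d i] poly_fls_in_ratfun KM unfolding poly_fls_def K_def by (metis subsetD)
  \<comment> \<open>Solve the Cauchy product of the shifts of D and s for
    \<open>shift_x s $ i\<close>; its cofactor is D itself.\<close>
  have "fps_to_fls (shift_x s $ i) \<in> M" if "i < q" for i
    using that
  proof (induction i rule: less_induct)
    case (less i)
    have "(shift_x (fps_of_poly D) * shift_x s) $ i = (\<Sum>b\<in>C. (shift_x (fps_of_poly (a b)) * shift_x (gg b) ^ q) $ i)"
      unfolding eq fps_sum_nth ..
    also have "\<dots> = (\<Sum>b\<in>C. shift_x (fps_of_poly (a b)) $ i * gg b ^ q)"
    proof (intro sum.cong refl)
      fix b
      have "(shift_x (fps_of_poly (a b)) * shift_x (gg b) ^ q) $ i =
        (\<Sum>k=0..i. if k = i then shift_x (fps_of_poly (a b)) $ i * gg b ^ q else 0)"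
        unfolding fps_mult_nth using less.prems by (intro sum.cong refl) (auto simp: low)
      thus "(shift_x (fps_of_poly (a b)) * shift_x (gg b) ^ q) $ i = shift_x (fps_of_poly (a b)) $ i * gg b ^ q"
        by simp
    qed
    finally have e1: "(shift_x (fps_of_poly D) * shift_x s) $ i = (\<Sum>b\<in>C. shift_x (fps_of_poly (a b)) $ i * gg b ^ q)" .
    have "{0..i} = insert 0 {1..i}" by auto
    hence e2: "(shift_x (fps_of_poly D) * shift_x s) $ i =
      fps_of_poly D * shift_x s $ i + (\<Sum>k\<in>{1..i}. shift_x (fps_of_poly D) $ k * shift_x s $ (i - k))"
      by (simp add: fps_mult_nth)
    have hom: "fps_to_fls (sum h A) = (\<Sum>i\<in>A. fps_to_fls (h i))" for h :: "'b \<Rightarrow> 'a fps" and A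
      by (induction A rule: infinite_finite_induct) auto
    have "poly_fls D * fps_to_fls (shift_x s $ i) =
      (\<Sum>b\<in>C. fps_to_fls (shift_x (fps_of_poly (a b)) $ i) * fps_to_fls (gg b) ^ q) -
      (\<Sum>k\<in>{1..i}. fps_to_fls (shift_x (fps_of_poly D) $ k) * fps_to_fls (shift_x s $ (i - k)))"
      using arg_cong[OF e1[unfolded e2], of fps_to_fls]
      by (simp add: hom fls_times_fps_to_fls fps_to_fls_power poly_fls_def eq_diff_eq)
    also have "\<dots> \<in> M"
      using gg less by (intro subring_diff[OF Msr] subring_sum[OF Msr] subring_mult[OF Msr] subring_power[OF Msr] polyM) auto
    finally have "poly_fls D * fps_to_fls (shift_x s $ i) \<in> M" .
    hence "(poly_fls D * fps_to_fls (shift_x s $ i)) / poly_fls D \<in> M"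
      using KM poly_fls_in_ratfun by (intro subfield_divide[OF Mf]) (auto simp: K_def)
    thus ?case using D0 by simp
  qed
  thus ?thesis using q by blast
qed

section \<open>Algebraic Laurent series\<close>

text \<open>For a field K, the algebraic closure of K in the ambient ring, as the union of the
  finite extensions.\<close>

definition alg_over :: "'a :: comm_ring_1 set \<Rightarrow> 'a set" where
  "alg_over K = {z. \<exists>M. fin_over K M \<and> z \<in> M}"

lemma subset_alg_over: "is_subring K \<Longrightarrow> K \<subseteq> alg_over K"
  using fin_over_refl by (auto simp: alg_over_def)

lemma is_subfield_alg_over:
  fixes K :: "'a :: field set"
  assumes K: "is_subfield K"
  shows "is_subfield (alg_over K)"
  unfolding is_subfield_def is_subring_def
proof (intro conjI ballI)
  note Ksr = is_subfield_is_subring[OF K]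
  show "1 \<in> alg_over K" using subset_alg_over[OF Ksr] subring_1[OF Ksr] by blast
next
  fix x y assume "x \<in> alg_over K" "y \<in> alg_over K"
  then obtain M where M: "fin_over K M" "x \<in> M" "y \<in> M"
    using fin_over_union[OF is_subfield_is_subring[OF K]] unfolding alg_over_def by blast
  hence sr: "is_subring M" by (simp add: fin_over_def)
  show "x - y \<in> alg_over K" "x * y \<in> alg_over K"
    using M subring_diff[OF sr] subring_mult[OF sr] unfolding alg_over_def by blast+
next
  fix x assume "x \<in> alg_over K"
  then obtain M where M: "fin_over K M" "x \<in> M" unfolding alg_over_def by blast
  thus "inverse x \<in> alg_over K"
    using subfield_inverse[OF fin_over_subfield[OF K M(1)]] unfolding alg_over_def by blast
qed

text \<open>z^n = z - w with w = z - z^n is a monic equation for z over a finite extension that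
  contains w.\<close>

lemma alg_over_artin_schreier:
  fixes K :: "'a :: field set"
  assumes K: "is_subfield K" and "n \<ge> 2" and s: "z - z ^ n \<in> alg_over K"
  shows "z \<in> alg_over K"
proof -
  obtain M where M: "fin_over K M" "z - z ^ n \<in> M" using s unfolding alg_over_def by blast
  hence sr: "is_subring M" by (simp add: fin_over_def)
  define c where "c l = (if l = 0 then - (z - z ^ n) else if l = 1 then 1 else 0)" for l :: nat
  have "(\<Sum>l<n. c l * z ^ l) = (\<Sum>l\<in>{0, 1}. c l * z ^ l)"
    using assms(2) by (intro sum.mono_neutral_right) (auto simp: c_def)
  also have "\<dots> = z ^ n" by (simp add: c_def)
  finally have "z ^ n = (\<Sum>l<n. c l * z ^ l)" by simp
  then obtain N where "fin_over M N" "z \<in> N"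
  proof -
    have "c l \<in> M" for l unfolding c_def using M(2) subring_closed[OF sr] by presburger
    thus thesis using fin_over_adjoin[OF sr _ \<open>z ^ n = _\<close>] that by blast
  qed
  thus ?thesis using fin_over_trans[OF is_subfield_is_subring[OF K] M(1)] unfolding alg_over_def by blast
qed

section \<open>Evaluation of double power series\<close>

text \<open>Substitution of f for X. The argument is a series in X over k[[x]][[v]], the value a
  series in v over k[[x]]. For f without constant term, f^n has order at least n in x, so n \<le> m
  suffices in degree m.\<close>

definition xeval :: "'a :: comm_ring_1 fps \<Rightarrow> 'a fps fps fps \<Rightarrow> 'a fps fps" where
  "xeval f r = Abs_fps (\<lambda>j. Abs_fps (\<lambda>m. \<Sum>n\<le>m. (f ^ n * r $ n $ j) $ m))"

lemma power_mult_nth_eq_0: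
  fixes f :: "'a :: comm_ring_1 fps"
  assumes "f $ 0 = 0" "m < n"
  shows "(f ^ n * g) $ m = 0"
  unfolding fps_mult_nth using assms startsby_zero_power_prefix[OF assms(1), of n]
  by (intro sum.neutral) auto

lemma xeval_nth:
  assumes "f $ 0 = 0" "m \<le> N"
  shows "xeval f r $ j $ m = (\<Sum>n\<le>N. f ^ n * r $ n $ j) $ m"
proof -
  have "(\<Sum>n\<le>N. f ^ n * r $ n $ j) $ m = (\<Sum>n\<le>m. (f ^ n * r $ n $ j) $ m)"
    unfolding fps_sum_nth using assms by (intro sum.mono_neutral_right) (auto simp: power_mult_nth_eq_0)
  thus ?thesis by (simp add: xeval_def)
qed

lemma fps_mult_nth_cong:
  fixes A B :: "'a :: comm_ring_1 fps"
  assumes "\<And>i. i \<le> m \<Longrightarrow> A $ i = A' $ i" "\<And>i. i \<le> m \<Longrightarrow> B $ i = B' $ i"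
  shows "(A * B) $ m = (A' * B') $ m"
  unfolding fps_mult_nth using assms by (intro sum.cong refl) auto

lemma xeval_mult:
  fixes f :: "'a :: comm_ring_1 fps"
  assumes f: "f $ 0 = 0"
  shows "xeval f (r * s) = xeval f r * xeval f s"
proof (rule fps_ext, rule fps_ext)
  fix j m
  define R where "R a = (\<Sum>n\<le>m. f ^ n * r $ n $ a)" for a
  define S where "S a = (\<Sum>n\<le>m. f ^ n * s $ n $ a)" for a
  have "(xeval f r * xeval f s) $ j $ m = (\<Sum>a=0..j. (R a * S (j - a)) $ m)"
    unfolding fps_mult_nth[of "xeval f r"] fps_sum_nth R_def S_def
    by (intro sum.cong refl fps_mult_nth_cong) (simp_all add: xeval_nth[OF f])
  also have "\<dots> = (\<Sum>a=0..j. \<Sum>n\<le>m. \<Sum>k\<le>m. (f ^ (n + k) * (r $ n $ a * s $ k $ (j - a))) $ m)"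
    by (simp add: R_def S_def sum_product fps_sum_nth power_add mult_ac)
  also have "\<dots> = (\<Sum>a=0..j. \<Sum>(n, k)\<in>{..m} \<times> {..m}. (f ^ (n + k) * (r $ n $ a * s $ k $ (j - a))) $ m)"
    by (simp add: sum.cartesian_product)
  also have "\<dots> = (\<Sum>a=0..j. \<Sum>(n, k)\<in>(SIGMA l:{..m}. {..l}). (f ^ n * (r $ k $ a * s $ (n - k) $ (j - a))) $ m)"
  proof (rule sum.cong[OF refl])
    fix a
    have "(\<Sum>(n, k)\<in>{..m} \<times> {..m}. (f ^ (n + k) * (r $ n $ a * s $ k $ (j - a))) $ m) =
      (\<Sum>(n, k)\<in>{(n, k). n + k \<le> m}. (f ^ (n + k) * (r $ n $ a * s $ k $ (j - a))) $ m)"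
    proof (rule sum.mono_neutral_right)
      show "\<forall>i\<in>{..m} \<times> {..m} - {(n, k). n + k \<le> m}.
        (case i of (n, k) \<Rightarrow> (f ^ (n + k) * (r $ n $ a * s $ k $ (j - a))) $ m) = 0"
        by (auto simp: not_le intro!: power_mult_nth_eq_0[OF f])
    qed auto
    also have "\<dots> = (\<Sum>(n, k)\<in>(SIGMA l:{..m}. {..l}). (f ^ n * (r $ k $ a * s $ (n - k) $ (j - a))) $ m)"
      by (rule sum.reindex_bij_witness[where j = "\<lambda>(n, k). (n + k, n)" and i = "\<lambda>(n, k). (k, n - k)"]) auto
    finally show "(\<Sum>(n, k)\<in>{..m} \<times> {..m}. (f ^ (n + k) * (r $ n $ a * s $ k $ (j - a))) $ m) = \<dots>" .
  qed
  also have "\<dots> = (\<Sum>a=0..j. \<Sum>n\<le>m. \<Sum>k\<le>n. (f ^ n * (r $ k $ a * s $ (n - k) $ (j - a))) $ m)"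
    by (subst sum.Sigma) auto
  also have "\<dots> = (\<Sum>n\<le>m. \<Sum>a=0..j. \<Sum>k\<le>n. (f ^ n * (r $ k $ a * s $ (n - k) $ (j - a))) $ m)"
    by (rule sum.swap)
  also have "\<dots> = (\<Sum>n\<le>m. \<Sum>k\<le>n. \<Sum>a=0..j. (f ^ n * (r $ k $ a * s $ (n - k) $ (j - a))) $ m)"
    by (intro sum.cong refl sum.swap)
  also have "\<dots> = (\<Sum>n\<le>m. (f ^ n * (r * s) $ n $ j) $ m)"
  proof (rule sum.cong[OF refl])
    fix n
    have "(r * s) $ n $ j = (\<Sum>k\<le>n. \<Sum>a=0..j. r $ k $ a * s $ (n - k) $ (j - a))"
      by (simp add: fps_mult_nth fps_sum_nth atLeast0AtMost)
    thus "(\<Sum>k\<le>n. \<Sum>a=0..j. (f ^ n * (r $ k $ a * s $ (n - k) $ (j - a))) $ m) = (f ^ n * (r * s) $ n $ j) $ m"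
      by (simp add: sum_distrib_left fps_sum_nth)
  qed
  finally show "xeval f (r * s) $ j $ m = (xeval f r * xeval f s) $ j $ m" by (simp add: xeval_def)
qed

lemma xeval_1: "xeval f 1 = 1"
proof (rule fps_ext, rule fps_ext)
  fix j m
  have "xeval f 1 $ j $ m = (\<Sum>n\<le>m. if n = 0 then (if j = 0 \<and> m = 0 then 1 else 0) else 0)"
    unfolding xeval_def fps_nth_Abs_fps by (intro sum.cong refl) auto
  thus "xeval f 1 $ j $ m = 1 $ j $ m" by auto
qed

text \<open>Serves the factors in X^p of the Frobenius congruence, which become series in
  f^p.\<close>

lemma xeval_power_index:
  fixes f :: "'a :: comm_ring_1 fps"
  assumes f: "f $ 0 = 0" and p: "p > 0"
  shows "xeval f (Abs_fps (\<lambda>n. if p dvd n then r $ (n div p) else 0)) = xeval (f ^ p) r"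
proof (rule fps_ext, rule fps_ext)
  fix j m
  have fp: "(f ^ p) $ 0 = 0" using f p by (simp add: power_0_left fps_power_zeroth)
  have "xeval (f ^ p) r $ j $ m = (\<Sum>k\<le>m. ((f ^ p) ^ k * r $ k $ j) $ m)"
    by (simp add: xeval_def)
  also have "\<dots> = (\<Sum>k\<in>{k. p * k \<le> m}. (f ^ (p * k) * r $ k $ j) $ m)"
  proof (rule sum.mono_neutral_cong_right)
    show "{k. p * k \<le> m} \<subseteq> {..m}"
    proof
      fix k assume "k \<in> {k. p * k \<le> m}"
      hence "p * k \<le> m" by simp
      moreover have "1 * k \<le> p * k" using p by (intro mult_le_mono1) simp
      ultimately have "1 * k \<le> m" by (rule order.trans[rotated])
      thus "k \<in> {..m}" by simp
    qed
    show "\<forall>i\<in>{..m} - {k. p * k \<le> m}. ((f ^ p) ^ i * r $ i $ j) $ m = 0"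
      using power_mult_nth_eq_0[OF f, of m] by (auto simp flip: power_mult)
  qed (auto simp: power_mult)
  also have "\<dots> = (\<Sum>n\<in>{n. n \<le> m \<and> p dvd n}. (f ^ n * r $ (n div p) $ j) $ m)"
    by (rule sum.reindex_bij_witness[where j = "\<lambda>k. p * k" and i = "\<lambda>n. n div p"]) (use p in auto)
  also have "\<dots> = (\<Sum>n\<le>m. (f ^ n * Abs_fps (\<lambda>n. if p dvd n then r $ (n div p) else 0) $ n $ j) $ m)"
    by (rule sum.mono_neutral_cong_left) auto
  finally show "xeval f (Abs_fps (\<lambda>n. if p dvd n then r $ (n div p) else 0)) $ j $ m = xeval (f ^ p) r $ j $ m"
    by (simp add: xeval_def)
qed

definition cc :: "'a :: comm_ring_1 \<Rightarrow> 'a fps fps" where "cc x = fps_const (fps_const x)"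

lemma cc_hom: "cc 0 = 0" "cc 1 = 1" "cc (x + y) = cc x + cc y" "cc (x * y) = cc x * cc y"
  by (simp_all add: cc_def)

lemma cc_mult_nth: "(cc x * g) $ j = fps_const x * g $ j"
  by (simp add: cc_def)

text \<open>\<open>xser u f c\<close> is $\sum_n u_n f^n c^n$.\<close>

definition xser :: "(nat \<Rightarrow> 'a :: comm_ring_1) \<Rightarrow> 'a fps \<Rightarrow> 'a fps fps \<Rightarrow> 'a fps fps" where
  "xser u f c = xeval f (Abs_fps (\<lambda>n. cc (u n) * c ^ n))"

lemma xser_nth:
  assumes "f $ 0 = 0" "m \<le> N"
  shows "xser u f c $ j $ m = (\<Sum>n\<le>N. f ^ n * (fps_const (u n) * (c ^ n) $ j)) $ m"
  unfolding xser_def by (subst xeval_nth[OF assms]) (simp add: cc_mult_nth)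

lemma xser_nth_0:
  assumes "f $ 0 = 0" "c $ 0 = 1"
  shows "xser u f c $ 0 = Abs_fps u oo f"
proof (rule fps_ext)
  fix m
  have "(c ^ n) $ 0 = 1" for n using assms(2) by (simp add: fps_power_zeroth)
  thus "xser u f c $ 0 $ m = (Abs_fps u oo f) $ m"
    by (simp add: xser_nth[OF assms(1) order_refl] fps_compose_nth fps_sum_nth atLeast0AtMost mult.commute)
qed

lemma xser_1:
  assumes "f $ 0 = 0"
  shows "xser u f 1 = fps_const (Abs_fps u oo f)"
proof (rule fps_ext)
  fix j
  show "xser u f 1 $ j = fps_const (Abs_fps u oo f) $ j"
  proof (cases "j = 0")
    case False
    have "xser u f 1 $ j $ m = 0" for m
      using False by (simp add: xser_nth[OF assms order_refl])
    thus ?thesis using False by (auto intro: fps_ext)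
  qed (simp add: xser_nth_0[OF assms])
qed

lemma xser_inverse:
  fixes f :: "'a :: comm_ring_1 fps"
  assumes "f $ 0 = 0" "Abs_fps u * Abs_fps w = 1"
  shows "xser u f c * xser w f c = 1"
proof -
  have "Abs_fps (\<lambda>n. cc (u n) * c ^ n) * Abs_fps (\<lambda>n. cc (w n) * c ^ n) = 1"
  proof (rule fps_ext)
    fix n
    have ccsum: "cc (sum h A) = (\<Sum>i\<in>A. cc (h i))" for h :: "nat \<Rightarrow> 'a" and A
      by (induction A rule: infinite_finite_induct) (auto simp: cc_hom)
    have "(Abs_fps (\<lambda>n. cc (u n) * c ^ n) * Abs_fps (\<lambda>n. cc (w n) * c ^ n)) $ n =
      (\<Sum>i=0..n. cc (u i * w (n - i)) * c ^ n)"
      unfolding fps_mult_nth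
    proof (intro sum.cong refl)
      fix i assume "i \<in> {0..n}"
      hence "c ^ n = c ^ i * c ^ (n - i)" by (simp flip: power_add)
      thus "Abs_fps (\<lambda>n. cc (u n) * c ^ n) $ i * Abs_fps (\<lambda>n. cc (w n) * c ^ n) $ (n - i) = cc (u i * w (n - i)) * c ^ n"
        by (simp add: cc_hom mult_ac)
    qed
    also have "\<dots> = cc ((Abs_fps u * Abs_fps w) $ n) * c ^ n"
      by (simp add: fps_mult_nth ccsum sum_distrib_right)
    finally show "(Abs_fps (\<lambda>n. cc (u n) * c ^ n) * Abs_fps (\<lambda>n. cc (w n) * c ^ n)) $ n = 1 $ n"
      by (simp add: assms(2) cc_hom)
  qed
  moreover have "xser u f c * xser w f c =
    xeval f (Abs_fps (\<lambda>n. cc (u n) * c ^ n) * Abs_fps (\<lambda>n. cc (w n) * c ^ n))"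
    by (simp only: xser_def xeval_mult[OF assms(1)])
  ultimately show ?thesis by (simp add: xeval_1)
qed

text \<open>The substitution x \<mapsto> x(1 + v) is a ring homomorphism and takes f^n to f^n
  c^n.\<close>

lemma xser_shift:
  assumes "f $ 0 = 0" "shift_x f = fps_const f * c"
  shows "shift_x (Abs_fps u oo f) = xser u f c"
proof (rule fps_ext, rule fps_ext)
  fix j m
  have "shift_x (Abs_fps u oo f) $ j $ m = (\<Sum>n\<le>m. u n * (shift_x (f ^ n) $ j $ m))"
    by (simp add: shift_x_nth fps_compose_nth sum_distrib_left atLeast0AtMost mult_ac)
  also have "\<dots> = (\<Sum>n\<le>m. (f ^ n * (fps_const (u n) * (c ^ n) $ j)) $ m)"
  proof (intro sum.cong refl)
    fix n
    have "shift_x (f ^ n) $ j = f ^ n * (c ^ n) $ j"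
      by (simp add: shift_x_power assms(2) power_mult_distrib)
    thus "u n * (shift_x (f ^ n) $ j $ m) = (f ^ n * (fps_const (u n) * (c ^ n) $ j)) $ m"
      by (simp add: mult.left_commute[of "f ^ n"])
  qed
  finally show "shift_x (Abs_fps u oo f) $ j $ m = xser u f c $ j $ m"
    by (simp add: xser_nth[OF assms(1) order_refl] fps_sum_nth)
qed

lemma one_plus_const_X_power_nth':
  fixes \<tau> :: "'a :: comm_ring_1"
  shows "((1 + fps_const \<tau> * fps_X) ^ n) $ j = of_nat (n choose j) * \<tau> ^ j"
proof -
  have "((1 + fps_const \<tau> * fps_X) ^ n) $ j = (\<Sum>s\<le>n. (of_nat (n choose s) * (fps_const \<tau> * fps_X) ^ s) $ j)"
    by (subst one_plus_power_expand[OF order_refl]) (simp add: fps_sum_nth)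
  also have "\<dots> = (\<Sum>s\<le>n. if s = j then of_nat (n choose j) * \<tau> ^ j else 0)"
    by (intro sum.cong refl) (auto simp: power_mult_distrib)
  finally show ?thesis by (auto simp: binomial_eq_0)
qed

text \<open>The exponent of \<tau> records the degree in v: the left-hand side is the right-hand
  series with \<tau> v in place of v.\<close>

lemma xser_scale:
  assumes "f $ 0 = 0"
  shows "xser u f (1 + fps_const \<tau> * fps_X) $ j = \<tau> ^ j * xser u f (1 + fps_X) $ j"
proof (rule fps_ext)
  fix m
  have "(\<tau> ^ j * xser u f (1 + fps_X) $ j) $ m =
    (\<tau> ^ j * (\<Sum>n\<le>m. f ^ n * (fps_const (u n) * ((1 + fps_X) ^ n) $ j))) $ m"
    by (intro fps_mult_nth_cong refl) (simp add: xser_nth[OF assms])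
  also have "\<dots> = (\<Sum>n\<le>m. f ^ n * (fps_const (u n) * ((1 + fps_const \<tau> * fps_X) ^ n) $ j)) $ m"
  proof -
    have "((1 + fps_X :: 'a fps fps) ^ n) $ j = of_nat (n choose j)" for n
      using one_plus_const_X_power_nth'[of "1 :: 'a fps" n j] by simp
    thus ?thesis
      by (simp only: one_plus_const_X_power_nth') (simp add: sum_distrib_left mult_ac)
  qed
  finally show "xser u f (1 + fps_const \<tau> * fps_X) $ j $ m = (\<tau> ^ j * xser u f (1 + fps_X) $ j) $ m"
    by (simp add: xser_nth[OF assms order_refl])
qed

text \<open>Frobenius fixes v and the coefficients \<open>u\<close>, which lie in F_p; only f and c
  are affected.\<close>

lemma xser_frob:
  fixes f :: "'a :: comm_ring_1 fps"
  assumes p: "prime CHAR('a)" and f: "f $ 0 = 0" and u: "\<And>n. u n ^ CHAR('a) = u n"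
  shows "fps_frob (xser u f c) = xser u (f ^ CHAR('a)) (fps_frob c)"
proof (rule fps_ext, rule fps_ext)
  fix j m
  define P where "P = CHAR('a)"
  have P: "P > 0" "prime CHAR('a fps)" using prime_gt_0_nat[OF p] p by (simp_all add: P_def)
  have fp: "(f ^ P) $ 0 = 0" using f P by (simp add: power_0_left fps_power_zeroth)
  define S where "S = (\<Sum>n\<le>m. f ^ n * (fps_const (u n) * (c ^ n) $ j))"
  have "fps_frob (xser u f c) $ j $ m = (xser u f c $ j) ^ P $ m" by (simp add: P_def)
  also have "\<dots> = (S ^ P) $ m"
    using xser_nth[OF f, of "m div P" m u c j] by (simp add: P_def fps_power_CHAR_nth[OF p] S_def)
  also have "S ^ P = (\<Sum>n\<le>m. (f ^ n * (fps_const (u n) * (c ^ n) $ j)) ^ P)"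
    unfolding S_def P_def by (rule freshmans_dream_sum) (use P in simp_all)
  also have "\<dots> = (\<Sum>n\<le>m. (f ^ P) ^ n * (fps_const (u n) * (fps_frob c ^ n) $ j))"
  proof (intro sum.cong refl)
    fix n
    have "(fps_frob c ^ n) $ j = ((c ^ n) $ j) ^ P"
      using fps_frob_power[of c n] P by (metis fps_frob_nth semiring_char_fps P_def)
    moreover have "(f ^ P) ^ n = (f ^ n) ^ P" by (simp add: mult.commute flip: power_mult)
    ultimately show "(f ^ n * (fps_const (u n) * (c ^ n) $ j)) ^ P = (f ^ P) ^ n * (fps_const (u n) * (fps_frob c ^ n) $ j)"
      using u[of n] by (simp add: power_mult_distrib P_def)
  qed
  finally show "fps_frob (xser u f c) $ j $ m = xser u (f ^ CHAR('a)) (fps_frob c) $ j $ m"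
    using xser_nth[OF fp order_refl] by (simp add: P_def)
qed

lemma power_mult_power_nth_eq_0:
  fixes x y :: "'a :: comm_ring_1 fps"
  assumes "x $ 0 = 0" "y $ 0 = 0" "j < s + t"
  shows "(x ^ s * y ^ t) $ j = 0"
proof -
  have "x ^ s $ i * y ^ t $ (j - i) = 0" if "i \<le> j" for i
  proof (cases "i < s")
    case True
    thus ?thesis using startsby_zero_power_prefix[OF assms(1), of s] by simp
  next
    case False
    hence "j - i < t" using assms(3) that by simp
    thus ?thesis using startsby_zero_power_prefix[OF assms(2), of t] by simp
  qed
  thus ?thesis by (auto simp: fps_mult_nth intro!: sum.neutral)
qed

text \<open>Here the congruences take effect: in each degree of v only finitely many powers of f
  survive, so an infinite sum becomes a polynomial expression in elements of \<open>R\<close>. As x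
  = c - 1 and y = d - 1 have no constant term in v, x^s y^t reaches v^j only for s + t \<le>
  j.\<close>

lemma xeval_exp_series4_over:
  fixes f :: "'a :: comm_ring_1 fps"
  assumes f: "f $ 0 = 0" and R: "is_subring R" "f \<in> R" "\<And>z. fps_const z \<in> R"
    and ab: "\<And>q n. a q n \<le> n" "\<And>q n. b q n \<le> n"
    and c: "c \<in> fps_over R" "c $ 0 = 1" and d: "d \<in> fps_over R" "d $ 0 = 1"
    and tend: "\<And>J. \<exists>n1. \<forall>n\<ge>n1. \<forall>s t. s + t \<le> J \<longrightarrow> quad_coeff u a b n s t = 0"
  shows "xeval f (exp_series4 cc u a b c d) \<in> fps_over R"
proof (rule fps_overI)
  fix j
  note Rf = is_subring_fps_over[OF R(1)]
  define x y where "x = c - 1" and "y = d - 1"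
  have xy: "x $ 0 = 0" "y $ 0 = 0" "x \<in> fps_over R" "y \<in> fps_over R" "c = 1 + x" "d = 1 + y"
    using c d subring_1[OF Rf] by (auto simp: x_def y_def intro: subring_diff[OF Rf])
  obtain n1 where n1: "\<forall>n\<ge>n1. \<forall>s t. s + t \<le> j \<longrightarrow> quad_coeff u a b n s t = 0" using tend by blast
  define \<Psi> where "\<Psi> = exp_series4 cc u a b c d"
  have nth: "\<Psi> $ n = (\<Sum>s\<le>n. \<Sum>t\<le>n. cc (quad_coeff u a b n s t) * x ^ s * y ^ t)" for n
    unfolding \<Psi>_def xy(5,6) by (rule exp_series4_nth) (use ab in \<open>auto simp: cc_hom\<close>)
  have 0: "\<Psi> $ n $ j = 0" if "n \<ge> n1" for n
  proof -
    have "(cc (quad_coeff u a b n s t) * x ^ s * y ^ t) $ j = 0" for s t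
    proof (cases "s + t \<le> j")
      case True
      thus ?thesis using n1 that by (simp add: cc_hom)
    next
      case False
      thus ?thesis using power_mult_power_nth_eq_0[OF xy(1,2), of j s t] by (simp add: cc_mult_nth mult.assoc)
    qed
    thus ?thesis by (simp add: nth fps_sum_nth)
  qed
  have "xeval f \<Psi> $ j = (\<Sum>n<n1. f ^ n * \<Psi> $ n $ j)"
  proof (rule fps_ext)
    fix m
    have "xeval f \<Psi> $ j $ m = (\<Sum>n\<le>m + n1. (f ^ n * \<Psi> $ n $ j) $ m)"
      by (subst xeval_nth[OF f, of m "m + n1"]) (auto simp: fps_sum_nth)
    also have "\<dots> = (\<Sum>n<n1. (f ^ n * \<Psi> $ n $ j) $ m)"
      using 0 by (intro sum.mono_neutral_right) auto
    finally show "xeval f \<Psi> $ j $ m = (\<Sum>n<n1. f ^ n * \<Psi> $ n $ j) $ m" by (simp add: fps_sum_nth)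
  qed
  also have "\<dots> \<in> R"
  proof -
    have "cc z \<in> fps_over R" for z using R(3) subring_0[OF R(1)] by (auto simp: fps_over_def cc_def)
    hence "\<Psi> $ n \<in> fps_over R" for n
      unfolding nth by (intro subring_sum[OF Rf] subring_mult[OF Rf] subring_power[OF Rf] xy)
    thus ?thesis
      by (intro subring_sum[OF R(1)] subring_mult[OF R(1)] subring_power[OF R(1)] R(2)) (rule fps_overD)
  qed
  finally show "xeval f (exp_series4 cc u a b c d) $ j \<in> R" by (simp add: \<Psi>_def)
qed

section \<open>The Artin--Hasse series modulo $p$\<close>

definition red :: "rat \<Rightarrow> 'p :: prime_card Fpbar" where
  "red q = to_ac (reduce_rat q)"

definition ah :: "nat \<Rightarrow> 'p :: prime_card Fpbar" where
  "ah n = red (artin_hasse CARD('p) $ n)"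

text \<open>Reduced from the rational inverse, which is integral, so that products with both E and
  its inverse can be reduced as a whole.\<close>

definition ahi :: "nat \<Rightarrow> 'p :: prime_card Fpbar" where
  "ahi n = red (inverse (artin_hasse CARD('p)) $ n)"

lemma CHAR_Fpbar: "CHAR('p :: prime_card Fpbar) = CARD('p)"
  by simp

lemma prime_CHAR_Fpbar: "prime CHAR('p :: prime_card Fpbar)"
  using prime_card[where 'a = 'p] by simp

lemma perfect_Fpbar: "\<exists>y. y ^ CHAR('p :: prime_card Fpbar) = (x :: 'p Fpbar)"
  using frob_root_power[of 1 x] by auto

lemma red_power_CARD: "(red q :: 'p :: prime_card Fpbar) ^ CARD('p) = red q"
proof -
  have "(x :: 'p mod_ring) ^ CARD('p) = x" for x
    using surj_of_nat_mod_ring[of x] of_nat_power_CHAR[where 'a = "'p mod_ring"] prime_card[where 'a = 'p]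
    by auto
  thus ?thesis by (simp add: red_def flip: to_ac_power)
qed

lemma red_fps_mult:
  assumes "\<And>n. p_integral CARD('p :: prime_card) (G $ n)" "\<And>n. p_integral CARD('p) (H $ n)"
  shows "Abs_fps (\<lambda>n. red ((G * H) $ n) :: 'p Fpbar) = Abs_fps (\<lambda>n. red (G $ n)) * Abs_fps (\<lambda>n. red (H $ n))"
proof (rule fps_ext)
  fix n
  have "(reduce_rat (\<Sum>i=0..n. G $ i * H $ (n - i)) :: 'p mod_ring) = (\<Sum>i=0..n. reduce_rat (G $ i) * reduce_rat (H $ (n - i)))"
    using assms by (subst reduce_rat_sum) (auto simp: reduce_rat_mult intro: p_integral_mult prime_card)
  thus "Abs_fps (\<lambda>n. red ((G * H) $ n) :: 'p Fpbar) $ n = (Abs_fps (\<lambda>n. red (G $ n)) * Abs_fps (\<lambda>n. red (H $ n))) $ n"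
    by (simp add: fps_mult_nth red_def to_ac_sum)
qed

lemma ah_mult_ahi: "Abs_fps ah * Abs_fps (ahi :: nat \<Rightarrow> 'p :: prime_card Fpbar) = 1"
proof -
  define E where "E = artin_hasse CARD('p)"
  have "Abs_fps (\<lambda>n. red (E $ n)) * Abs_fps (\<lambda>n. red (inverse E $ n)) = Abs_fps (\<lambda>n. red ((E * inverse E) $ n) :: 'p Fpbar)"
    unfolding E_def
    by (rule red_fps_mult [symmetric]) (rule p_integral_artin_hasse p_integral_inverse_artin_hasse)+
  also have "E * inverse E = 1"
    using inverse_mult_eq_1[of E] by (simp add: E_def mult.commute)
  also have "Abs_fps (\<lambda>n. red (1 $ n) :: 'p Fpbar) = 1" by (rule fps_ext) (simp add: red_def)
  finally show ?thesis by (simp add: ah_def[abs_def] ahi_def[abs_def] E_def)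
qed

lemma ah_0 [simp]: "ah 0 = 1"
  by (simp add: ah_def red_def)

text \<open>The logarithmic derivative $x E'/E = \sum_i x^{p^i}$.\<close>

definition ah_log :: "'p :: prime_card Fpbar fps" where
  "ah_log = fps_X * lam CARD('p) (\<lambda>_. 1)"

text \<open>The reduction of E' = E * \<open>lam\<close>, an identity between p-integral
  series.\<close>

lemma ah_XD: "fps_XD (Abs_fps (ah :: nat \<Rightarrow> 'p :: prime_card Fpbar)) = Abs_fps ah * ah_log"
proof -
  define p where "p = CARD('p)"
  have p: "p \<noteq> 1" "p \<ge> 2" "prime p"
    using prime_card[where 'a = 'p] prime_ge_2_nat[of p] by (auto simp: p_def prime_nat_iff)
  define E where "E = artin_hasse p"
  have lam01: "lam p (\<lambda>_. 1 :: 'b :: comm_ring_1) $ n = (if \<exists>i. p ^ i = Suc n then 1 else 0)" for n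
    using lam_nth_power[OF p(2), of _ n "\<lambda>_. 1 :: 'b"] lam_nth_eq_0[of p n "\<lambda>_. 1 :: 'b"] by auto
  have "fps_deriv E = E * lam p (\<lambda>_. 1)"
    using artin_hasse_log_deriv[OF p(2)] by (simp add: has_log_deriv_def E_def)
  hence "Abs_fps (\<lambda>n. red (fps_deriv E $ n) :: 'p Fpbar) = Abs_fps (\<lambda>n. red (E $ n)) * Abs_fps (\<lambda>n. red (lam p (\<lambda>_. 1) $ n))"
  proof -
    have "p_integral p (lam p (\<lambda>_. 1) $ n)" for n using p by (simp add: lam01)
    moreover have "p_integral p (E $ n)" for n
      using p_integral_artin_hasse[where 'p = 'p] by (simp add: E_def p_def)
    ultimately have "Abs_fps (\<lambda>n. red ((E * lam p (\<lambda>_. 1)) $ n) :: 'p Fpbar) =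
      Abs_fps (\<lambda>n. red (E $ n)) * Abs_fps (\<lambda>n. red (lam p (\<lambda>_. 1) $ n))"
      by (intro red_fps_mult) (simp_all add: p_def)
    moreover assume "fps_deriv E = E * lam p (\<lambda>_. 1)"
    ultimately show ?thesis by simp
  qed
  moreover have "Abs_fps (\<lambda>n. red (lam p (\<lambda>_. 1) $ n) :: 'p Fpbar) = lam p (\<lambda>_. 1)"
    by (rule fps_ext) (simp add: lam01 red_def)
  moreover have "Abs_fps (\<lambda>n. red (fps_deriv E $ n) :: 'p Fpbar) = fps_deriv (Abs_fps ah)"
  proof (rule fps_ext)
    fix n
    have "(reduce_rat (of_nat (Suc n) * E $ Suc n) :: 'p mod_ring) = of_nat (Suc n) * reduce_rat (E $ Suc n)"
      using p_integral_artin_hasse[where 'p = 'p] p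
      by (subst reduce_rat_mult) (simp_all add: E_def p_def del: of_nat_Suc)
    thus "Abs_fps (\<lambda>n. red (fps_deriv E $ n) :: 'p Fpbar) $ n = fps_deriv (Abs_fps ah) $ n"
      by (simp add: red_def ah_def E_def p_def del: of_nat_Suc)
  qed
  moreover have "Abs_fps (\<lambda>n. red (E $ n) :: 'p Fpbar) = Abs_fps ah"
    by (rule fps_ext) (simp add: ah_def E_def p_def)
  ultimately have "fps_deriv (Abs_fps (ah :: nat \<Rightarrow> 'p Fpbar)) = Abs_fps ah * lam p (\<lambda>_. 1)" by simp
  thus ?thesis by (simp add: fps_XD_def ah_log_def p_def mult_ac)
qed

text \<open>The sum of the x^(p^i) telescopes against its p-th power. This is the source of all
  Artin-Schreier equations below.\<close>

lemma ah_log_artin_schreier: "ah_log - ah_log ^ CARD('p) = (fps_X :: 'p :: prime_card Fpbar fps)"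
proof (rule fps_ext)
  fix n
  define p where "p = CARD('p)"
  have p: "p \<noteq> 1" "p \<ge> 2" "prime p"
    using prime_card[where 'a = 'p] prime_ge_2_nat[of p] by (auto simp: p_def prime_nat_iff)
  have nth: "(ah_log :: 'p Fpbar fps) $ n = (if \<exists>i. p ^ i = n then 1 else 0)" for n
  proof (cases n)
    case 0
    thus ?thesis using p by (auto simp: ah_log_def)
  next
    case (Suc m)
    thus ?thesis
      using lam_nth_power[OF p(2), of _ m "\<lambda>_. 1 :: 'p Fpbar"] lam_nth_eq_0[of p m "\<lambda>_. 1 :: 'p Fpbar"]
      by (auto simp: ah_log_def p_def)
  qed
  have "(ah_log ^ p :: 'p Fpbar fps) $ n = (if p dvd n then (if \<exists>i. p ^ i = n div p then 1 else 0) else 0)"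
    using fps_power_CHAR_nth[OF prime_CHAR_Fpbar, of "ah_log :: 'p Fpbar fps" n] p by (simp add: p_def [symmetric] nth power_0_left)
  also have "\<dots> = (if \<exists>i. p ^ Suc i = n then 1 else 0)"
  proof (cases "p dvd n")
    case True
    then obtain k where "n = p * k" by blast
    thus ?thesis using p by auto
  next
    case False
    thus ?thesis by auto
  qed
  finally have "(ah_log ^ p :: 'p Fpbar fps) $ n = (if \<exists>i. p ^ Suc i = n then 1 else 0)" .
  moreover have "(\<exists>i. p ^ i = n) \<longleftrightarrow> n = 1 \<or> (\<exists>i. p ^ Suc i = n)"
    by (metis power_0 not0_implies_Suc)
  moreover have "p ^ Suc i \<noteq> 1" for i using p by (simp add: power_eq_1_iff del: power_Suc)
  ultimately show "(ah_log - ah_log ^ CARD('p)) $ n = (fps_X :: 'p Fpbar fps) $ n"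
    unfolding p_def [symmetric] by (auto simp: nth)
qed

lemma red_quad_coeff_tends_to_0:
  assumes "\<And>q n. p_integral CARD('p :: prime_card) (u q n)"
    and "\<exists>n1. \<forall>n\<ge>n1. \<forall>s t. s + t \<le> J \<longrightarrow> p_integral CARD('p) (quad_coeff u a b n s t / of_nat CARD('p))"
  shows "\<exists>n1. \<forall>n\<ge>n1. \<forall>s t. s + t \<le> J \<longrightarrow> quad_coeff (\<lambda>q n. red (u q n) :: 'p Fpbar) a b n s t = 0"
  using assms(2) quad_coeff_reduce[where 'p = 'p, of u a b, OF assms(1)] reduce_rat_eq_0[where 'p = 'p]
  unfolding red_def by (metis to_ac_0)

lemma frob_ah_tends_to_0:
  "\<exists>n1. \<forall>n\<ge>n1. \<forall>s t. s + t \<le> J \<longrightarrow>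
     quad_coeff (frob_u CARD('p) ah ahi) (frob_a CARD('p)) (\<lambda>_ _. 0) n s t = (0 :: 'p :: prime_card Fpbar)"
proof -
  define E where "E = artin_hasse CARD('p)"
  have "CARD('p) \<noteq> 1" using prime_card[where 'a = 'p] by (auto simp: prime_nat_iff)
  hence "p_integral CARD('p) (frob_u CARD('p) (fps_nth E) (fps_nth (inverse E)) q n)" for q n
    using p_integral_artin_hasse[where 'p = 'p] p_integral_inverse_artin_hasse[where 'p = 'p]
    by (auto simp: frob_u_def E_def)
  note * = red_quad_coeff_tends_to_0[OF this frob_coeffs_tend_to_0[where 'p = 'p, folded E_def]]
  have "(\<lambda>q n. red (frob_u CARD('p) (fps_nth E) (fps_nth (inverse E)) q n) :: 'p Fpbar) = frob_u CARD('p) ah ahi"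
    by (intro ext) (auto simp: frob_u_def ah_def ahi_def E_def red_def)
  thus ?thesis using * by simp
qed

lemma mult_ah_tends_to_0:
  "\<exists>n1. \<forall>n\<ge>n1. \<forall>s t. s + t \<le> J \<longrightarrow>
     quad_coeff (mult_u ah ahi) mult_a mult_b n s t = (0 :: 'p :: prime_card Fpbar)"
proof -
  define E where "E = artin_hasse CARD('p)"
  have "p_integral CARD('p) (mult_u (fps_nth E) (fps_nth (inverse E)) q n)" for q n
    using p_integral_artin_hasse[where 'p = 'p] p_integral_inverse_artin_hasse[where 'p = 'p]
    by (auto simp: mult_u_def E_def)
  note * = red_quad_coeff_tends_to_0[OF this mult_coeffs_tend_to_0[where 'p = 'p, folded E_def]]
  have "(\<lambda>q n. red (mult_u (fps_nth E) (fps_nth (inverse E)) q n) :: 'p Fpbar) = mult_u ah ahi"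
    by (intro ext) (auto simp: mult_u_def ah_def ahi_def E_def red_def)
  thus ?thesis using * by simp
qed

text \<open>The quotient E(f c) / E(f); the second factor is the inverse of E(f).\<close>

definition ah_quot :: "'p :: prime_card Fpbar fps \<Rightarrow> 'p Fpbar fps fps \<Rightarrow> 'p Fpbar fps fps" where
  "ah_quot f c = xser ah f c * xser ahi f 1"

lemma ah_compose_mult: "f $ 0 = 0 \<Longrightarrow> (Abs_fps ah oo f) * (Abs_fps ahi oo f) = (1 :: 'p :: prime_card Fpbar fps)"
  by (simp add: ah_mult_ahi flip: fps_compose_mult_distrib)

lemma ah_quot_nth_0: "f $ 0 = 0 \<Longrightarrow> c $ 0 = 1 \<Longrightarrow> ah_quot f c $ 0 = 1"
  by (simp add: ah_quot_def xser_nth_0 xser_1 ah_compose_mult)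

lemma ah_quot_shift:
  assumes "f $ 0 = 0" "shift_x f = fps_const f * c"
  shows "shift_x (Abs_fps ah oo f) = fps_const (Abs_fps ah oo f) * ah_quot f c"
proof -
  have "fps_const (Abs_fps ah oo f) * ah_quot f c = xser ah f c * fps_const ((Abs_fps ah oo f) * (Abs_fps ahi oo f))"
    by (simp add: ah_quot_def xser_1[OF assms(1)] mult_ac flip: fps_const_mult)
  thus ?thesis by (simp add: ah_compose_mult[OF assms(1)] xser_shift[OF assms])
qed

lemma ah_quot_scale:
  assumes "f $ 0 = 0"
  shows "ah_quot f (1 + fps_const \<tau> * fps_X) $ j = \<tau> ^ j * ah_quot f (1 + fps_X) $ j"
  unfolding ah_quot_def xser_1[OF assms]
  by (simp only: fps_mult_right_const_nth xser_scale[OF assms] mult.assoc)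

lemma ah_quot_frob:
  fixes f :: "'p :: prime_card Fpbar fps"
  assumes "f $ 0 = 0"
  shows "fps_frob (ah_quot f c) = ah_quot (f ^ CARD('p)) (fps_frob c)"
proof -
  have p: "prime CHAR('p Fpbar fps)" using prime_CHAR_Fpbar[where 'p = 'p] by simp
  have "fps_frob (1 :: 'p Fpbar fps fps) = 1" by (rule fps_frob_1[OF p])
  thus ?thesis
    unfolding ah_quot_def fps_frob_mult[OF p]
    using xser_frob[OF prime_CHAR_Fpbar assms, of ah] xser_frob[OF prime_CHAR_Fpbar assms, of ahi]
    by (simp add: ah_def ahi_def red_power_CARD)
qed

text \<open>The coefficient of v in (1 + v)^n is n, so E(f (1 + v)) / E(f) starts with the
  logarithmic derivative f E'(f) / E(f).\<close>

lemma ah_quot_first: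
  assumes "f $ 0 = 0"
  shows "ah_quot f (1 + fps_X) $ 1 = ah_log oo f"
proof -
  have "xser ah f (1 + fps_X) $ 1 = fps_XD (Abs_fps ah) oo f"
  proof (rule fps_ext)
    fix m
    have "((1 + fps_X :: 'a Fpbar fps fps) ^ n) $ 1 = of_nat n" for n
      using one_plus_const_X_power_nth'[of "1 :: 'a Fpbar fps" n 1] by simp
    thus "xser ah f (1 + fps_X) $ 1 $ m = (fps_XD (Abs_fps ah) oo f) $ m"
      by (simp add: xser_nth[OF assms order_refl] fps_compose_nth fps_sum_nth atLeast0AtMost mult_ac)
  qed
  also have "\<dots> = (Abs_fps ah oo f) * (ah_log oo f)"
    using assms by (simp add: ah_XD fps_compose_mult_distrib)
  finally have "ah_quot f (1 + fps_X) $ 1 = (ah_log oo f) * ((Abs_fps ah oo f) * (Abs_fps ahi oo f))"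
    by (simp add: ah_quot_def xser_1[OF assms] mult_ac)
  thus ?thesis by (simp add: ah_compose_mult[OF assms])
qed

lemma ah_log_compose_artin_schreier:
  fixes f :: "'p :: prime_card Fpbar fps"
  assumes "f $ 0 = 0"
  shows "(ah_log oo f) - (ah_log oo f) ^ CARD('p) = f"
proof -
  have "(ah_log oo f) - (ah_log oo f) ^ CARD('p) = (ah_log - ah_log ^ CARD('p)) oo f"
    using assms by (simp add: fps_compose_sub_distrib fps_compose_power)
  thus ?thesis using assms by (simp add: ah_log_artin_schreier)
qed

text \<open>\<kappa> = E(f c) E(f^p) / (E(f) E(f^p c)) is the four-factor product of
  \<open>frob_u\<close> evaluated at f. The series c is not twisted here; the twist enters through
  \<open>ah_quot_frob\<close>.\<close>

lemma ah_quot_frobenius_invariant: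
  fixes f :: "'p :: prime_card Fpbar fps"
  assumes f: "f $ 0 = 0" and R: "is_subring R" "f \<in> R" "\<And>z. fps_const z \<in> R"
    and c: "c \<in> fps_over R" "c $ 0 = 1"
  shows "\<exists>\<kappa>\<in>fps_over R. \<kappa> $ 0 = 1 \<and> ah_quot f c = \<kappa> * ah_quot (f ^ CARD('p)) c"
proof -
  define p where "p = CARD('p)"
  have p: "p > 0" using prime_gt_0_nat[OF prime_card[where 'a = 'p]] by (simp add: p_def)
  have fp: "(f ^ p) $ 0 = 0" using f p by (simp add: power_0_left fps_power_zeroth)
  define \<Psi> where "\<Psi> = exp_series4 cc (frob_u p ah ahi) (frob_a p) (\<lambda>_ _. 0) c 1"
  define \<kappa> where "\<kappa> = xeval f \<Psi>"
  have "\<kappa> \<in> fps_over R"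
    unfolding \<kappa>_def \<Psi>_def p_def
    by (rule xeval_exp_series4_over[OF f R _ _ c])
      (use subring_1[OF is_subring_fps_over[OF R(1)]] frob_ah_tends_to_0[where 'p = 'p] in \<open>auto simp: frob_a_le\<close>)
  moreover have \<kappa>: "\<kappa> = xser ah f c * xser ahi f 1 * xser ah (f ^ p) 1 * xser ahi (f ^ p) c"
  proof -
    let ?e = "exp_series cc (frob_u p ah ahi) (frob_a p) (\<lambda>_ _. 0) c 1"
    have "xeval f (?e 0) = xser ah f c" "xeval f (?e 1) = xser ahi f 1"
      by (simp_all add: xser_def exp_series_def frob_u_def frob_a_def)
    moreover have "?e 2 = Abs_fps (\<lambda>n. if p dvd n then Abs_fps (\<lambda>n. cc (ah n) * 1 ^ n) $ (n div p) else 0)"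
      "?e 3 = Abs_fps (\<lambda>n. if p dvd n then Abs_fps (\<lambda>n. cc (ahi n) * c ^ n) $ (n div p) else 0)"
      by (rule fps_ext, simp add: exp_series_def frob_u_def frob_a_def cc_hom)+
    hence "xeval f (?e 2) = xser ah (f ^ p) 1" "xeval f (?e 3) = xser ahi (f ^ p) c"
      by (simp_all only: xeval_power_index[OF f p] xser_def)
    ultimately show ?thesis
      by (simp only: \<kappa>_def \<Psi>_def exp_series4_def xeval_mult[OF f])
  qed
  moreover have "\<kappa> $ 0 = 1"
  proof -
    have "\<kappa> $ 0 = ((Abs_fps ah oo f) * (Abs_fps ahi oo f)) * ((Abs_fps ah oo f ^ p) * (Abs_fps ahi oo f ^ p))"
      using c(2) by (simp add: \<kappa> xser_nth_0[OF f] xser_nth_0[OF fp] mult.assoc)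
    thus ?thesis by (simp add: ah_compose_mult[OF f] ah_compose_mult[OF fp])
  qed
  moreover have "\<kappa> * ah_quot (f ^ p) c = ah_quot f c"
  proof -
    have "\<kappa> * ah_quot (f ^ p) c = ah_quot f c * (xser ah (f ^ p) 1 * xser ahi (f ^ p) 1) * (xser ah (f ^ p) c * xser ahi (f ^ p) c)"
      by (simp add: \<kappa> ah_quot_def mult_ac)
    thus ?thesis by (simp add: xser_inverse[OF fp ah_mult_ahi])
  qed
  ultimately show ?thesis by (intro bexI[of _ \<kappa>]) (auto simp: p_def)
qed

text \<open>\<kappa> = E(f c d) E(f) / (E(f c) E(f d)) is the four-factor product of
  \<open>mult_u\<close> evaluated at f.\<close>

lemma ah_quot_mult:
  fixes f :: "'p :: prime_card Fpbar fps"
  assumes f: "f $ 0 = 0" and R: "is_subring R" "f \<in> R" "\<And>z. fps_const z \<in> R"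
    and c: "c \<in> fps_over R" "c $ 0 = 1" and d: "d \<in> fps_over R" "d $ 0 = 1"
  shows "\<exists>\<kappa>\<in>fps_over R. \<kappa> $ 0 = 1 \<and> ah_quot f (c * d) = \<kappa> * (ah_quot f c * ah_quot f d)"
proof -
  define \<kappa> where "\<kappa> = xeval f (exp_series4 cc (mult_u ah ahi) mult_a mult_b c d)"
  have "\<kappa> \<in> fps_over R"
    unfolding \<kappa>_def
    by (rule xeval_exp_series4_over[OF f R _ _ c d])
      (use mult_ah_tends_to_0[where 'p = 'p] in \<open>auto simp: mult_a_le mult_b_le\<close>)
  moreover have \<kappa>: "\<kappa> = xser ah f (c * d) * xser ah f 1 * xser ahi f c * xser ahi f d"
  proof -
    let ?e = "exp_series cc (mult_u ah ahi) mult_a mult_b c d"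
    have "xeval f (?e 0) = xser ah f (c * d)" "xeval f (?e 1) = xser ah f 1"
      "xeval f (?e 2) = xser ahi f c" "xeval f (?e 3) = xser ahi f d"
      by (simp_all add: xser_def exp_series_def mult_u_def mult_a_def mult_b_def power_mult_distrib mult.assoc)
    thus ?thesis
      by (simp only: \<kappa>_def exp_series4_def xeval_mult[OF f])
  qed
  moreover have "\<kappa> $ 0 = 1"
  proof -
    have "\<kappa> $ 0 = ((Abs_fps ah oo f) * (Abs_fps ahi oo f)) * ((Abs_fps ah oo f) * (Abs_fps ahi oo f))"
      using c(2) d(2) by (simp add: \<kappa> xser_nth_0[OF f] mult_ac)
    thus ?thesis by (simp add: ah_compose_mult[OF f])
  qed
  moreover have "\<kappa> * (ah_quot f c * ah_quot f d) = ah_quot f (c * d)"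
  proof -
    have "\<kappa> * (ah_quot f c * ah_quot f d) = ah_quot f (c * d) * (xser ah f 1 * xser ahi f 1) *
      (xser ah f c * xser ahi f c) * (xser ah f d * xser ahi f d)"
      by (simp add: \<kappa> ah_quot_def mult_ac)
    thus ?thesis by (simp add: xser_inverse[OF f ah_mult_ahi])
  qed
  ultimately show ?thesis by (intro bexI[of _ \<kappa>]) auto
qed

section \<open>Series up to a factor over a subfield\<close>

definition emb :: "'a :: field fps fps \<Rightarrow> 'a fls fps" where
  "emb g = Abs_fps (\<lambda>j. fps_to_fls (g $ j))"

lemma emb_nth [simp]: "emb g $ j = fps_to_fls (g $ j)"
  by (simp add: emb_def)

lemma fps_to_fls_sum: "fps_to_fls (sum f A) = (\<Sum>i\<in>A. fps_to_fls (f i :: 'a :: comm_ring_1 fps))"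
  by (induction A rule: infinite_finite_induct) auto

lemma emb_mult: "emb (g * h) = emb g * emb h"
  by (rule fps_ext) (simp add: fps_mult_nth fps_to_fls_sum fls_times_fps_to_fls)

lemma emb_1 [simp]: "emb 1 = 1"
  by (rule fps_ext) simp

lemma emb_power: "emb (g ^ n) = emb g ^ n"
  by (induction n) (simp_all add: emb_mult)

lemma emb_prod: "emb (prod f A) = (\<Prod>i\<in>A. emb (f i))"
  by (induction A rule: infinite_finite_induct) (auto simp: emb_mult)

lemma emb_frob: "fps_frob (emb g) = emb (fps_frob g)"
  by (rule fps_ext) (simp add: fps_to_fls_power)

text \<open>Integer powers obey their laws in a field; power series with nonzero constant term
  inherit them through the embedding into Laurent series.\<close>

lemma fps_to_fls_power_int:
  fixes g :: "'a :: field fps"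
  assumes "g $ 0 \<noteq> 0"
  shows "fps_to_fls (g powi n) = fps_to_fls g powi n"
  using assms by (cases "n \<ge> 0") (auto simp: power_int_def fps_to_fls_power fls_inverse_fps_to_fls subdegree_eq_0)

context
  fixes g h :: "'a :: field fps"
  assumes g: "g $ 0 = 1"
begin

lemma fps_power_int_nth_0: "(g powi n) $ 0 = 1"
  using g by (auto simp: power_int_def fps_power_zeroth_eq_one)

lemma fps_power_int_add: "g powi (m + n) = g powi m * g powi n"
proof -
  have "fps_to_fls (g powi (m + n)) = fps_to_fls (g powi m * g powi n)"
  proof -
    have "fps_to_fls g \<noteq> 0" using g by auto
    thus ?thesis using g by (simp add: fps_to_fls_power_int fls_times_fps_to_fls power_int_add)
  qed
  thus ?thesis by simp
qed

lemma fps_power_int_mult: "g powi (m * n) = (g powi m) powi n"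
proof -
  have "fps_to_fls (g powi (m * n)) = fps_to_fls ((g powi m) powi n)"
    using g fps_power_int_nth_0[of m] by (simp add: fps_to_fls_power_int power_int_mult)
  thus ?thesis by simp
qed

lemma fps_power_int_mult_distrib:
  assumes h: "h $ 0 = 1"
  shows "(g * h) powi n = g powi n * h powi n"
proof -
  have "fps_to_fls ((g * h) powi n) = fps_to_fls (g powi n * h powi n)"
    using g h by (simp add: fps_to_fls_power_int fls_times_fps_to_fls power_int_mult_distrib)
  thus ?thesis by simp
qed

lemma fps_power_int_over: "is_subfield K \<Longrightarrow> g \<in> fps_over K \<Longrightarrow> g powi n \<in> fps_over K"
  using g fps_over_inverse[of K g] is_subring_fps_over[of K]
  by (auto simp: power_int_def intro!: subring_power)

lemma fps_frob_power_int: "prime CHAR('a) \<Longrightarrow> fps_frob (g powi n) = fps_frob g powi n"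
  using g by (auto simp: power_int_def fps_frob_power fps_frob_inverse)

lemma fps_compose_power_int: "h $ 0 = 0 \<Longrightarrow> (g powi n) oo h = (g oo h) powi n"
  using g by (auto simp: power_int_def fps_inverse_compose simp flip: fps_compose_power)

end

lemma fps_prod_nth_0: "(\<And>i. i \<in> A \<Longrightarrow> f i $ 0 = 1) \<Longrightarrow> (prod f A :: 'a :: comm_ring_1 fps) $ 0 = 1"
  by (induction A rule: infinite_finite_induct) auto

lemma fps_power_int_prod:
  assumes "\<And>i. i \<in> A \<Longrightarrow> f i $ 0 = 1"
  shows "(prod f A) powi n = (\<Prod>i\<in>A. f i powi n :: 'a :: field fps)"
  using assms
proof (induction A rule: infinite_finite_induct)
  case (insert x A)
  thus ?case using fps_prod_nth_0[of A f] by (simp add: fps_power_int_mult_distrib)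
qed (auto simp: power_int_def)

text \<open>The Artin-Hasse quotients obey their rules only up to such factors. Membership in
  \<open>fps_over M\<close> with K \<subseteq> M does not see them, by
  \<open>sim_over\<close>.\<close>

definition sim :: "'a :: field set \<Rightarrow> 'a fps \<Rightarrow> 'a fps \<Rightarrow> bool" where
  "sim K g h \<longleftrightarrow> (\<exists>\<kappa>\<in>fps_over K. \<kappa> $ 0 = 1 \<and> g = \<kappa> * h)"

context
  fixes K :: "'a :: field set"
  assumes K: "is_subfield K"
begin

lemma K_ring: "is_subring (fps_over K)"
  using K by (intro is_subring_fps_over) auto

lemma sim_refl: "sim K g g"
  unfolding sim_def using subring_1[OF K_ring] by (intro bexI[of _ 1]) auto

lemma sim_sym:
  assumes "sim K g h"
  shows "sim K h g"
proof -
  obtain \<kappa> where \<kappa>: "\<kappa> \<in> fps_over K" "\<kappa> $ 0 = 1" "g = \<kappa> * h" using assms by (auto simp: sim_def)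
  have "h = inverse \<kappa> * g" using \<kappa> by (simp add: inverse_mult_eq_1 flip: mult.assoc)
  thus ?thesis unfolding sim_def using \<kappa> fps_over_inverse[OF K \<kappa>(1)] by (intro bexI[of _ "inverse \<kappa>"]) auto
qed

lemma sim_trans: "sim K f g \<Longrightarrow> sim K g h \<Longrightarrow> sim K f h"
  unfolding sim_def
proof (elim bexE conjE)
  fix \<kappa> \<kappa>' assume "\<kappa> \<in> fps_over K" "\<kappa>' \<in> fps_over K" "\<kappa> $ 0 = 1" "\<kappa>' $ 0 = 1" "f = \<kappa> * g" "g = \<kappa>' * h"
  thus "\<exists>\<kappa>\<in>fps_over K. \<kappa> $ 0 = 1 \<and> f = \<kappa> * h"
    using subring_mult[OF K_ring] by (intro bexI[of _ "\<kappa> * \<kappa>'"]) (auto simp: mult.assoc)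
qed

lemma sim_mult: "sim K f g \<Longrightarrow> sim K f' g' \<Longrightarrow> sim K (f * f') (g * g')"
  unfolding sim_def
proof (elim bexE conjE)
  fix \<kappa> \<kappa>' assume "\<kappa> \<in> fps_over K" "\<kappa>' \<in> fps_over K" "\<kappa> $ 0 = 1" "\<kappa>' $ 0 = 1" "f = \<kappa> * g" "f' = \<kappa>' * g'"
  thus "\<exists>\<kappa>\<in>fps_over K. \<kappa> $ 0 = 1 \<and> f * f' = \<kappa> * (g * g')"
    using subring_mult[OF K_ring] by (intro bexI[of _ "\<kappa> * \<kappa>'"]) (auto simp: mult_ac)
qed

lemma sim_prod: "(\<And>i. i \<in> A \<Longrightarrow> sim K (f i) (g i)) \<Longrightarrow> sim K (prod f A) (prod g A)"
  by (induction A rule: infinite_finite_induct) (auto simp: sim_refl sim_mult)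

lemma sim_power_int:
  assumes "sim K f g" "g $ 0 = 1"
  shows "sim K (f powi n) (g powi n)"
proof -
  obtain \<kappa> where \<kappa>: "\<kappa> \<in> fps_over K" "\<kappa> $ 0 = 1" "f = \<kappa> * g" using assms(1) by (auto simp: sim_def)
  have "f powi n = (\<kappa> powi n) * (g powi n)" using \<kappa> assms(2) by (simp add: fps_power_int_mult_distrib)
  thus ?thesis unfolding sim_def
    using fps_power_int_over[OF \<kappa>(2) K \<kappa>(1)] fps_power_int_nth_0[OF \<kappa>(2)] by (intro bexI[of _ "\<kappa> powi n"]) auto
qed

lemma sim_over:
  assumes "sim K f g" "is_subring M" "K \<subseteq> M" "g \<in> fps_over M"
  shows "f \<in> fps_over M"
  using assms subring_mult[OF is_subring_fps_over[OF assms(2)]] fps_over_mono[OF assms(3)]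
  by (auto simp: sim_def)

lemma sim_frob: "prime CHAR('a) \<Longrightarrow> sim K f g \<Longrightarrow> sim K (fps_frob f) (fps_frob g)"
  unfolding sim_def
proof (elim bexE conjE)
  fix \<kappa> assume "prime CHAR('a)" "\<kappa> \<in> fps_over K" "\<kappa> $ 0 = 1" "f = \<kappa> * g"
  thus "\<exists>\<kappa>\<in>fps_over K. \<kappa> $ 0 = 1 \<and> fps_frob f = \<kappa> * fps_frob g"
    using fps_frob_over[OF is_subfield_is_subring[OF K]]
    by (intro bexI[of _ "fps_frob \<kappa>"]) (auto simp: fps_frob_mult)
qed

end

lemmas sim_trans' [trans] = sim_trans[rotated]

text \<open>With constant terms 1, the coefficients of degree j enter the product additively and the
  rest depends on lower ones. This linearises the products in \<open>separate_roots\<close>.\<close>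

lemma fps_prod_nth_cutoff:
  fixes g :: "'i \<Rightarrow> 'a :: comm_ring_1 fps"
  assumes "finite A" "\<And>i. i \<in> A \<Longrightarrow> g i $ 0 = 1" "j > 0"
  shows "(\<Prod>i\<in>A. g i) $ j = (\<Prod>i\<in>A. fps_cutoff j (g i)) $ j + (\<Sum>i\<in>A. g i $ j)"
    and "l < j \<Longrightarrow> (\<Prod>i\<in>A. g i) $ l = (\<Prod>i\<in>A. fps_cutoff j (g i)) $ l"
proof -
  have "(\<Prod>i\<in>A. g i) $ j = (\<Prod>i\<in>A. fps_cutoff j (g i)) $ j + (\<Sum>i\<in>A. g i $ j) \<and>
    (\<forall>l<j. (\<Prod>i\<in>A. g i) $ l = (\<Prod>i\<in>A. fps_cutoff j (g i)) $ l)"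
    using assms
  proof (induction A rule: finite_induct)
    case (insert x A)
    define P where "P = (\<Prod>i\<in>A. g i)"
    define Q where "Q = (\<Prod>i\<in>A. fps_cutoff j (g i))"
    have PQ: "P $ j = Q $ j + (\<Sum>i\<in>A. g i $ j)" "\<And>l. l < j \<Longrightarrow> P $ l = Q $ l"
      using insert by (auto simp: P_def Q_def)
    have P0: "P $ 0 = 1" unfolding P_def by (rule fps_prod_nth_0) (use insert in auto)
    have low: "(g x * P) $ l = (fps_cutoff j (g x) * Q) $ l" if "l < j" for l
      by (rule fps_mult_nth_cong) (use that PQ in auto)
    have split: "(u * v) $ j = u $ 0 * v $ j + u $ j * v $ 0 + (\<Sum>i=1..<j. u $ i * v $ (j - i))" for u v :: "'a fps"
    proof -
      have "{0..j} = insert 0 (insert j {1..<j})" using insert.prems(2) by auto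
      thus ?thesis using insert.prems(2) by (simp add: fps_mult_nth)
    qed
    have "(\<Sum>i=1..<j. g x $ i * P $ (j - i)) = (\<Sum>i=1..<j. fps_cutoff j (g x) $ i * Q $ (j - i))"
      by (rule sum.cong) (use PQ in auto)
    hence "(g x * P) $ j = (fps_cutoff j (g x) * Q) $ j + (g x $ j + (\<Sum>i\<in>A. g i $ j))"
      using insert.prems P0 PQ(1) by (simp add: split)
    thus ?case using insert.hyps low by (simp add: P_def Q_def)
  qed auto
  thus "(\<Prod>i\<in>A. g i) $ j = (\<Prod>i\<in>A. fps_cutoff j (g i)) $ j + (\<Sum>i\<in>A. g i $ j)"
    and "l < j \<Longrightarrow> (\<Prod>i\<in>A. g i) $ l = (\<Prod>i\<in>A. fps_cutoff j (g i)) $ l" by auto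
qed

section \<open>Logarithmic shifts of polynomials\<close>

text \<open>The value at \<alpha> = 0 is x / x = 1, set apart because x is not invertible as a power
  series.\<close>

definition tau :: "'a :: field \<Rightarrow> 'a fps" where
  "tau \<alpha> = (if \<alpha> = 0 then 1 else fps_X * inverse (fps_X - fps_const \<alpha>))"

lemma tau_mult: "tau \<alpha> * (fps_X - fps_const \<alpha>) = fps_X"
proof (cases "\<alpha> = 0")
  case False
  hence "inverse (fps_X - fps_const \<alpha>) * (fps_X - fps_const \<alpha>) = 1" by (intro inverse_mult_eq_1) simp
  thus ?thesis using False by (simp add: tau_def mult.assoc)
qed (simp add: tau_def)

lemma fps_of_poly_linear': "fps_of_poly [:- \<alpha>, 1:] = fps_X - fps_const (\<alpha> :: 'a :: comm_ring_1)"
  by (rule fps_ext) (auto simp: coeff_pCons split: nat.splits)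

lemma fps_to_fls_tau: "fps_to_fls (tau \<alpha>) = poly_fls [:0, 1:] / poly_fls [:- \<alpha>, 1:]"
proof -
  have "fps_to_fls (tau \<alpha>) * poly_fls [:- \<alpha>, 1:] = fps_to_fls (tau \<alpha> * (fps_X - fps_const \<alpha>))"
    by (simp add: poly_fls_def fls_times_fps_to_fls fps_of_poly_linear')
  also have "\<dots> = poly_fls [:0, 1:]" unfolding tau_mult poly_fls_def by simp
  finally show ?thesis by (subst eq_divide_eq) (simp flip: poly_fls_simps(1))
qed

lemma fps_to_fls_tau_in_ratfun: "fps_to_fls (tau \<alpha>) \<in> ratfun"
  unfolding fps_to_fls_tau by (intro subfield_divide is_subfield_ratfun poly_fls_in_ratfun)

text \<open>x(1 + v) - \<alpha> = (x - \<alpha>) + x v, and x = \<tau>_\<alpha> (x -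
  \<alpha>).\<close>

lemma shift_x_linear:
  "shift_x (fps_of_poly [:- \<alpha>, 1:]) = fps_const (fps_of_poly [:- \<alpha>, 1:]) * (1 + fps_const (tau \<alpha>) * fps_X)"
proof -
  have "fps_const (fps_of_poly [:- \<alpha>, 1:]) * (1 + fps_const (tau \<alpha>) * fps_X) =
     fps_const (fps_X - fps_const \<alpha>) + fps_const (tau \<alpha> * (fps_X - fps_const \<alpha>)) * fps_X"
    by (simp add: fps_of_poly_linear' algebra_simps flip: fps_const_mult)
  also have "\<dots> = shift_x (fps_of_poly [:- \<alpha>, 1:])"
    unfolding tau_mult by (simp add: fps_of_poly_linear' shift_x_diff shift_x_X algebra_simps flip: fps_const_sub)
  finally show ?thesis ..
qed

text \<open>Apart from the common factor x^j the summands have poles at distinct points: clear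
  denominators and evaluate at \<alpha>, where every other summand retains a factor x -
  \<alpha>.\<close>

lemma tau_powers_independent:
  fixes a :: "'a :: field \<Rightarrow> nat"
  assumes A: "finite A" and j: "j > 0"
    and eq: "(\<Sum>\<alpha>\<in>A. of_nat (a \<alpha>) * fps_to_fls (tau \<alpha>) ^ j) = 0" and \<alpha>: "\<alpha> \<in> A"
  shows "of_nat (a \<alpha>) = (0 :: 'a)"
proof -
  define L where "L = (\<lambda>\<alpha>::'a. [:- \<alpha>, 1:])"
  have L0: "L \<beta> \<noteq> 0" for \<beta> by (simp add: L_def)
  have "poly_fls (\<Sum>\<beta>\<in>A. of_nat (a \<beta>) * (\<Prod>\<gamma>\<in>A - {\<beta>}. L \<gamma>) ^ j) * poly_fls ([:0, 1:] ^ j) =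
     (\<Sum>\<beta>\<in>A. of_nat (a \<beta>) * (poly_fls [:0, 1:] / poly_fls (L \<beta>)) ^ j) * poly_fls ((\<Prod>\<gamma>\<in>A. L \<gamma>) ^ j)"
    unfolding poly_fls_sum sum_distrib_right
  proof (rule sum.cong[OF refl])
    fix \<beta> assume "\<beta> \<in> A"
    hence "(\<Prod>\<gamma>\<in>A. L \<gamma>) = L \<beta> * (\<Prod>\<gamma>\<in>A - {\<beta>}. L \<gamma>)" using A by (simp add: prod.remove)
    hence "poly_fls ((\<Prod>\<gamma>\<in>A. L \<gamma>) ^ j) = poly_fls (L \<beta>) ^ j * poly_fls ((\<Prod>\<gamma>\<in>A - {\<beta>}. L \<gamma>) ^ j)"
      by (simp only: power_mult_distrib poly_fls_simps)
    moreover have "poly_fls (of_nat n) = (of_nat n :: 'a fls)" for n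
      by (induction n) simp_all
    ultimately show "poly_fls (of_nat (a \<beta>) * (\<Prod>\<gamma>\<in>A - {\<beta>}. L \<gamma>) ^ j) * poly_fls ([:0, 1:] ^ j) =
      of_nat (a \<beta>) * (poly_fls [:0, 1:] / poly_fls (L \<beta>)) ^ j * poly_fls ((\<Prod>\<gamma>\<in>A. L \<gamma>) ^ j)"
      using L0[of \<beta>] by (simp add: power_divide del: poly_fls_simps(7))
  qed
  also have "\<dots> = 0" using eq by (simp add: fps_to_fls_tau L_def del: poly_fls_simps)
  finally have "(\<Sum>\<beta>\<in>A. of_nat (a \<beta>) * (\<Prod>\<gamma>\<in>A - {\<beta>}. L \<gamma>) ^ j) = 0"
    by (simp del: poly_fls_simps(3-))
  hence "poly (\<Sum>\<beta>\<in>A. of_nat (a \<beta>) * (\<Prod>\<gamma>\<in>A - {\<beta>}. L \<gamma>) ^ j) \<alpha> = 0" by (simp only: poly_0)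
  also have "poly (\<Sum>\<beta>\<in>A. of_nat (a \<beta>) * (\<Prod>\<gamma>\<in>A - {\<beta>}. L \<gamma>) ^ j) \<alpha> =
    (\<Sum>\<beta>\<in>A. if \<beta> = \<alpha> then of_nat (a \<alpha>) * (\<Prod>\<gamma>\<in>A - {\<alpha>}. \<alpha> - \<gamma>) ^ j else 0)"
    unfolding poly_sum
  proof (rule sum.cong[OF refl])
    fix \<beta> assume "\<beta> \<in> A"
    have "(\<Prod>\<gamma>\<in>A - {\<beta>}. \<alpha> - \<gamma>) = 0" if "\<beta> \<noteq> \<alpha>"
      using that A \<alpha> by (intro prod_zero) auto
    thus "poly (of_nat (a \<beta>) * (\<Prod>\<gamma>\<in>A - {\<beta>}. L \<gamma>) ^ j) \<alpha> =
      (if \<beta> = \<alpha> then of_nat (a \<alpha>) * (\<Prod>\<gamma>\<in>A - {\<alpha>}. \<alpha> - \<gamma>) ^ j else 0)"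
      using j by (auto simp: L_def poly_prod)
  qed
  also have "\<dots> = of_nat (a \<alpha>) * (\<Prod>\<gamma>\<in>A - {\<alpha>}. \<alpha> - \<gamma>) ^ j" using A \<alpha> by simp
  finally show ?thesis using A by auto
qed

section \<open>Primitive parts\<close>

lemma frob_root_eqI:
  fixes c :: "'p :: prime_card Fpbar"
  shows "y ^ (CARD('p) ^ k) = c \<Longrightarrow> frob_root k c = y"
  unfolding frob_root_def by (rule the1_equality[OF frob_root_ex1])

lemma frob_root_0 [simp]: "frob_root k 0 = (0 :: 'p :: prime_card Fpbar)"
  by (rule frob_root_eqI) (use prime_card[where 'a = 'p] in \<open>simp add: power_0_left prime_gt_0_nat\<close>)

lemma frob_root_add: "frob_root k (x + y) = frob_root k x + frob_root k (y :: 'p :: prime_card Fpbar)"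
proof (rule frob_root_eqI)
  have "(frob_root k x + frob_root k y) ^ (CARD('p) ^ k) = frob_root k x ^ (CARD('p) ^ k) + frob_root k y ^ (CARD('p) ^ k)"
    by (rule freshmans_dream') (simp_all add: prime_card)
  thus "(frob_root k x + frob_root k y) ^ (CARD('p) ^ k) = x + y" by (simp add: frob_root_power)
qed

lemma to_ac_power_CARD_power: "to_ac (a :: 'p :: prime_card mod_ring) ^ (CARD('p) ^ k) = to_ac a"
proof (induction k)
  case (Suc k)
  obtain i where "a = of_nat i" using surj_of_nat_mod_ring[of a] by blast
  hence "to_ac a ^ CARD('p) = to_ac a"
    using of_nat_power_CHAR[OF prime_CHAR_Fpbar[where 'p = 'p], of i] by simp
  thus ?case using Suc by (simp add: power_mult)
qed simp

lemma frob_root_scale: "frob_root k (to_ac a * x) = to_ac a * frob_root k (x :: 'p :: prime_card Fpbar)"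
  by (rule frob_root_eqI) (simp add: power_mult_distrib frob_root_power to_ac_power_CARD_power)

lemma frob_root_power_CARD:
  "frob_root (Suc k) (x ^ CARD('p)) = frob_root k (x :: 'p :: prime_card Fpbar)"
proof (rule frob_root_eqI)
  have "frob_root k x ^ CARD('p) ^ Suc k = (frob_root k x ^ CARD('p) ^ k) ^ CARD('p)"
    by (simp add: mult.commute flip: power_mult)
  thus "frob_root k x ^ CARD('p) ^ Suc k = x ^ CARD('p)" by (simp only: frob_root_power)
qed

text \<open>\<open>frob_primitive_coeff\<close> with a free cut-off d: additivity requires all
  summands to be cut at the same place.\<close>

definition prim_coeff :: "nat \<Rightarrow> 'p :: prime_card Fpbar poly \<Rightarrow> nat \<Rightarrow> 'p Fpbar" where
  "prim_coeff d f i = (\<Sum>k\<le>d. frob_root k (Polynomial.coeff f (i * CARD('p) ^ k)))"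

lemma prim_coeff_eq:
  fixes f :: "'p :: prime_card Fpbar poly"
  assumes "i > 0" "Polynomial.degree f \<le> d" "d \<le> d'"
  shows "prim_coeff d' f i = prim_coeff d f i"
  unfolding prim_coeff_def
proof (rule sum.mono_neutral_right)
  show "\<forall>k\<in>{..d'} - {..d}. frob_root k (Polynomial.coeff f (i * CARD('p) ^ k)) = 0"
  proof
    fix k assume "k \<in> {..d'} - {..d}"
    hence "Polynomial.degree f < k" using assms by auto
    also have "k < CARD('p) ^ k" using prime_gt_1_nat[OF prime_card[where 'a = 'p]] by (simp add: power_gt_expt)
    also have "\<dots> \<le> i * CARD('p) ^ k" using assms(1) by simp
    finally have "Polynomial.coeff f (i * CARD('p) ^ k) = 0" by (rule coeff_eq_0)
    thus "frob_root k (Polynomial.coeff f (i * CARD('p) ^ k)) = 0" by simp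
  qed
qed (use assms in auto)

lemma coeff_frob_primitive_part:
  fixes f :: "'p :: prime_card Fpbar poly"
  assumes "Polynomial.degree f \<le> d"
  shows "Polynomial.coeff (frob_primitive_part f) i = (if CARD('p) dvd i then 0 else prim_coeff d f i)"
proof -
  have "Polynomial.coeff (frob_primitive_part f) i =
    (\<Sum>j | j \<le> Polynomial.degree f \<and> \<not> CARD('p) dvd j. if j = i then frob_primitive_coeff f i else 0)"
    unfolding frob_primitive_part_def coeff_sum by (intro sum.cong refl) (auto simp: coeff_monom)
  also have "\<dots> = (if i \<le> Polynomial.degree f \<and> \<not> CARD('p) dvd i then frob_primitive_coeff f i else 0)"
    by simp
  also have "\<dots> = (if CARD('p) dvd i then 0 else prim_coeff d f i)"
  proof (cases "CARD('p) dvd i")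
    case False
    hence i: "i > 0" by (cases i) auto
    have "frob_primitive_coeff f i = prim_coeff d f i"
      using prim_coeff_eq[OF i order_refl assms] by (simp add: frob_primitive_coeff_def prim_coeff_def)
    moreover have "prim_coeff d f i = 0" if "i > Polynomial.degree f"
    proof -
      have "Polynomial.degree f < i * CARD('p) ^ k" for k
      proof -
        have "i * 1 \<le> i * CARD('p) ^ k"
          using prime_gt_0_nat[OF prime_card[where 'a = 'p]] by (intro mult_le_mono2) simp
        thus ?thesis using that by linarith
      qed
      hence "Polynomial.coeff f (i * CARD('p) ^ k) = 0" for k by (rule coeff_eq_0)
      thus ?thesis by (simp add: prim_coeff_def)
    qed
    ultimately show ?thesis using False by auto
  qed auto
  finally show ?thesis .
qed

lemma prim_coeff_add: "prim_coeff d (f + g) i = prim_coeff d f i + prim_coeff d g i"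
  by (simp add: prim_coeff_def frob_root_add sum.distrib)

lemma prim_coeff_0 [simp]: "prim_coeff d 0 i = 0"
  by (simp add: prim_coeff_def)

lemma prim_coeff_scale: "prim_coeff d (Polynomial.smult (to_ac a) f) i = to_ac a * prim_coeff d f i"
  by (simp add: prim_coeff_def frob_root_scale sum_distrib_left)

lemma prim_coeff_sum: "prim_coeff d (\<Sum>j\<in>A. f j) i = (\<Sum>j\<in>A. prim_coeff d (f j) i)"
  by (induction A rule: infinite_finite_induct) (auto simp: prim_coeff_add)

text \<open>Passing from q to q^p shifts the index k by one, and the term k = 0 of q^p vanishes
  because p does not divide i. So q and q^p have the same primitive coefficients.\<close>

lemma prim_coeff_artin_schreier:
  fixes q :: "'p :: prime_card Fpbar poly"
  assumes "\<not> CARD('p) dvd i" "Polynomial.degree q \<le> d"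
  shows "prim_coeff (Suc d) (q - q ^ CARD('p)) i = 0"
proof -
  define P where "P = CARD('p)"
  have P: "P > 0" "prime P" using prime_gt_0_nat[OF prime_card[where 'a = 'p]] prime_card[where 'a = 'p] by (simp_all add: P_def)
  have i: "i > 0" using assms(1) by (cases i) auto
  have coeffP: "Polynomial.coeff (q ^ P) n = (if P dvd n then Polynomial.coeff q (n div P) ^ P else 0)" for n
    using fps_power_CHAR_nth[OF prime_CHAR_Fpbar, of "fps_of_poly q" n]
    unfolding fps_of_poly_power[symmetric] fps_of_poly_nth CHAR_Fpbar P_def .
  have "prim_coeff (Suc d) (q ^ P) i = (\<Sum>k\<le>Suc d. frob_root k (Polynomial.coeff (q ^ P) (i * P ^ k)))"
    by (simp add: prim_coeff_def P_def)
  also have "\<dots> = frob_root 0 (Polynomial.coeff (q ^ P) i) + (\<Sum>k\<le>d. frob_root (Suc k) (Polynomial.coeff (q ^ P) (i * P ^ Suc k)))"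
    by (subst sum.atMost_Suc_shift) simp
  also have "frob_root 0 (Polynomial.coeff (q ^ P) i) = 0" using assms(1) unfolding coeffP by (simp add: P_def)
  also have "(\<Sum>k\<le>d. frob_root (Suc k) (Polynomial.coeff (q ^ P) (i * P ^ Suc k))) = (\<Sum>k\<le>d. frob_root k (Polynomial.coeff q (i * P ^ k)))"
  proof (intro sum.cong refl)
    fix k
    have "i * P ^ Suc k = P * (i * P ^ k)" by simp
    hence "Polynomial.coeff (q ^ P) (i * P ^ Suc k) = Polynomial.coeff q (i * P ^ k) ^ P"
      unfolding coeffP using P by (metis dvd_triv_left nonzero_mult_div_cancel_left less_numeral_extra(3))
    thus "frob_root (Suc k) (Polynomial.coeff (q ^ P) (i * P ^ Suc k)) = frob_root k (Polynomial.coeff q (i * P ^ k))"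
      using frob_root_power_CARD[of k "Polynomial.coeff q (i * P ^ k)"] by (simp only: P_def)
  qed
  also have "0 + \<dots> = prim_coeff d q i" by (simp add: prim_coeff_def P_def)
  also have "\<dots> = prim_coeff (Suc d) q i" by (rule prim_coeff_eq[OF i assms(2), symmetric]) simp
  finally have "prim_coeff (Suc d) (q ^ P) i = prim_coeff (Suc d) q i" .
  moreover have "prim_coeff (Suc d) q i = prim_coeff (Suc d) (q - q ^ P) i + prim_coeff (Suc d) (q ^ P) i"
    by (simp flip: prim_coeff_add)
  ultimately show ?thesis by (simp add: P_def)
qed

text \<open>The coefficient at i = 1 comes from the index k = e alone and equals 1.\<close>

lemma frob_primitive_part_X_power:
  "(frob_primitive_part ([:0, 1:] ^ (CARD('p) ^ e)) :: 'p :: prime_card Fpbar poly) \<noteq> 0"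
proof
  define P where "P = CARD('p)"
  have P: "P > 1" using prime_gt_1_nat[OF prime_card[where 'a = 'p]] by (simp add: P_def)
  define f :: "'p Fpbar poly" where "f = [:0, 1:] ^ (P ^ e)"
  have f: "f = Polynomial.monom 1 (P ^ e)" by (simp add: f_def monom_altdef)
  have deg: "Polynomial.degree f \<le> P ^ e" by (simp add: f degree_monom_le)
  assume "(frob_primitive_part ([:0, 1:] ^ (CARD('p) ^ e)) :: 'p Fpbar poly) = 0"
  hence "prim_coeff (P ^ e) f 1 = 0"
    using coeff_frob_primitive_part[OF deg, of 1] P by (simp add: f_def P_def)
  also have "prim_coeff (P ^ e) f 1 = (\<Sum>k\<le>P ^ e. if k = e then frob_root e 1 else 0)"
    unfolding prim_coeff_def using P by (intro sum.cong refl) (auto simp: f coeff_monom P_def)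
  also have "\<dots> = frob_root e 1" using power_gt_expt[of P e] P by simp
  also have "\<dots> = 1" by (rule frob_root_eqI) simp
  finally show False by simp
qed

text \<open>The hypothesis is z - z^p = g for z = a / b, multiplied by b^p. Every root of b is a
  root of a, so the fraction can be cancelled until b is constant: rational solutions are
  polynomials.\<close>

lemma artin_schreier_polynomial:
  fixes a b g :: "'p :: prime_card Fpbar poly"
  assumes "b \<noteq> 0" "a * b ^ (CARD('p) - 1) - a ^ CARD('p) = g * b ^ CARD('p)"
  shows "\<exists>q. g = q - q ^ CARD('p)"
  using assms
proof (induction "Polynomial.degree b" arbitrary: a b rule: less_induct)
  case less
  define P where "P = CARD('p)"
  have P: "P > 1" using prime_gt_1_nat[OF prime_card[where 'a = 'p]] by (simp add: P_def)
  obtain P' where P': "P = Suc P'" "P' > 0" using P by (cases P) auto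
  have eq: "a * b ^ P' - a ^ P = g * b ^ P" using less.prems P' by (simp add: P_def)
  show ?case
  proof (cases "Polynomial.degree b = 0")
    case True
    then obtain c where c: "b = [:c:]" by (rule degree_eq_zeroE)
    hence c0: "c \<noteq> 0" using less.prems by auto
    have "Polynomial.smult (c ^ P) (Polynomial.smult (inverse c) a - Polynomial.smult (inverse c) a ^ P) =
      Polynomial.smult (c ^ P * inverse c) a - Polynomial.smult (c ^ P * inverse c ^ P) (a ^ P)"
      by (simp add: smult_diff_right smult_power)
    also have "c ^ P * inverse c ^ P = 1" using c0 by (simp flip: power_mult_distrib)
    also have "c ^ P * inverse c = c ^ P'" using c0 by (simp add: P'(1))
    also have "Polynomial.smult (c ^ P') a - Polynomial.smult 1 (a ^ P) = a * b ^ P' - a ^ P"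
      by (simp add: c poly_const_pow)
    also have "\<dots> = Polynomial.smult (c ^ P) g" unfolding eq by (simp add: c poly_const_pow mult.commute)
    finally have "g = Polynomial.smult (inverse c) a - Polynomial.smult (inverse c) a ^ P"
      using c0 by (simp add: smult_eq_iff)
    thus ?thesis by (auto simp: P_def)
  next
    case False
    then obtain \<alpha> where \<alpha>: "poly b \<alpha> = 0" using alg_closed_imp_poly_has_root[of b] by blast
    have "poly (a * b ^ P' - a ^ P) \<alpha> = poly (g * b ^ P) \<alpha>" by (simp only: eq)
    hence "poly a \<alpha> = 0" using \<alpha> P P' by (simp add: power_0_left)
    then obtain a' where a': "a = [:-\<alpha>, 1:] * a'" using poly_eq_0_iff_dvd by blast
    obtain b' where b': "b = [:-\<alpha>, 1:] * b'" using \<alpha> poly_eq_0_iff_dvd by blast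
    have b'0: "b' \<noteq> 0" using b' less.prems by auto
    have "[:-\<alpha>, 1:] ^ P * (a' * b' ^ P' - a' ^ P) = [:-\<alpha>, 1:] ^ P * (g * b' ^ P)"
    proof -
      define L where "L = [:-\<alpha>, 1:]"
      have "L ^ P * (a' * b' ^ P' - a' ^ P) = a * b ^ P' - a ^ P"
        unfolding a' b' P'(1) L_def[symmetric] by (simp add: power_mult_distrib algebra_simps)
      also have "\<dots> = L ^ P * (g * b' ^ P)"
        unfolding eq unfolding b' P'(1) L_def[symmetric] by (simp add: power_mult_distrib algebra_simps)
      finally show ?thesis by (simp only: L_def)
    qed
    hence "a' * b' ^ P' - a' ^ P = g * b' ^ P" by simp
    moreover have "Polynomial.degree b' < Polynomial.degree b"
      using b'0 unfolding b' by (subst degree_mult_eq) auto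
    ultimately show ?thesis using less.hyps[of b' a'] b'0 P' by (simp add: P_def)
  qed
qed

section \<open>Frobenius twists of the quotients\<close>

lemma is_subring_fps_in:
  assumes K: "is_subfield (K :: 'a :: field fls set)"
  shows "is_subring {a. fps_to_fls a \<in> K}"
  using subring_closed[OF is_subfield_is_subring[OF K]]
  by (auto simp: is_subring_def fls_times_fps_to_fls)

lemma emb_over: "emb g \<in> fps_over K \<longleftrightarrow> g \<in> fps_over {a. fps_to_fls a \<in> K}"
  by (auto simp: fps_over_def)

definition lin :: "'a :: comm_ring_1 \<Rightarrow> 'a fps" where
  "lin t = 1 + fps_const t * fps_X"

lemma lin_nth_0 [simp]: "lin t $ 0 = 1"
  by (simp add: lin_def)

lemma lin_over:
  assumes M: "is_subring M" and "t \<in> M"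
  shows "lin t \<in> fps_over M"
proof (rule fps_overI)
  fix j
  have "lin t $ j = (if j = 0 then 1 else if j = 1 then t else 0)"
    by (auto simp: lin_def fps_X_def fps_one_def)
  thus "lin t $ j \<in> M" using assms by (simp add: subring_closed)
qed

lemma fps_frob_lin: "prime CHAR('a :: comm_ring_1) \<Longrightarrow> fps_frob (lin t) = lin (t ^ CHAR('a) :: 'a)"
  by (rule fps_ext) (auto simp: lin_def fps_one_def fps_X_def power_0_left prime_gt_0_nat)

context
  fixes K :: "'p :: prime_card Fpbar fls set" and F :: "'p Fpbar fps"
  assumes K: "is_subfield K" and const: "\<And>z. fls_const z \<in> K"
    and F0: "F $ 0 = 0" and F: "fps_to_fls F \<in> K"
begin

abbreviation (input) "R \<equiv> {a :: 'p Fpbar fps. fps_to_fls a \<in> K}"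

lemma quot_premises: "is_subring R" "F \<in> R" "\<And>z. fps_const z \<in> R"
  using is_subring_fps_in[OF K] F const by auto

lemma ah_quot_1: "ah_quot F 1 = 1"
  by (simp add: ah_quot_def xser_inverse[OF F0 ah_mult_ahi])

lemma sim_ah_quot_mult:
  assumes "c \<in> fps_over R" "c $ 0 = 1" "d \<in> fps_over R" "d $ 0 = 1"
  shows "sim K (emb (ah_quot F (c * d))) (emb (ah_quot F c) * emb (ah_quot F d))"
proof -
  obtain \<kappa> where "\<kappa> \<in> fps_over R" "\<kappa> $ 0 = 1" "ah_quot F (c * d) = \<kappa> * (ah_quot F c * ah_quot F d)"
    using ah_quot_mult[OF F0 quot_premises assms] by blast
  thus ?thesis unfolding sim_def by (intro bexI[of _ "emb \<kappa>"]) (auto simp: emb_over emb_mult)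
qed

lemma sim_ah_quot_power:
  assumes c: "c \<in> fps_over R" "c $ 0 = 1"
  shows "sim K (emb (ah_quot F (c ^ n))) (emb (ah_quot F c) ^ n)"
proof (induction n)
  case (Suc n)
  have "sim K (emb (ah_quot F (c * c ^ n))) (emb (ah_quot F c) * emb (ah_quot F (c ^ n)))"
    using c by (intro sim_ah_quot_mult subring_power is_subring_fps_over quot_premises)
      (auto simp: fps_power_zeroth_eq_one)
  also have "sim K \<dots> (emb (ah_quot F c) * emb (ah_quot F c) ^ n)"
    by (intro sim_mult K sim_refl Suc)
  finally show ?case by (simp add: K)
qed (simp add: ah_quot_1 sim_refl K)

lemma sim_ah_quot_prod:
  assumes "finite A" "\<And>\<alpha>. \<alpha> \<in> A \<Longrightarrow> c \<alpha> \<in> fps_over R" "\<And>\<alpha>. \<alpha> \<in> A \<Longrightarrow> c \<alpha> $ 0 = 1"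
  shows "sim K (emb (ah_quot F (\<Prod>\<alpha>\<in>A. c \<alpha> ^ m \<alpha>))) (\<Prod>\<alpha>\<in>A. emb (ah_quot F (c \<alpha>)) ^ m \<alpha>)"
  using assms
proof (induction A rule: finite_induct)
  case (insert x A)
  have "sim K (emb (ah_quot F (c x ^ m x * (\<Prod>\<alpha>\<in>A. c \<alpha> ^ m \<alpha>))))
     (emb (ah_quot F (c x ^ m x)) * emb (ah_quot F (\<Prod>\<alpha>\<in>A. c \<alpha> ^ m \<alpha>)))"
    using insert.prems
    by (intro sim_ah_quot_mult subring_power subring_prod is_subring_fps_over quot_premises fps_prod_nth_0)
      (auto simp: fps_power_zeroth_eq_one)
  also have "sim K \<dots> (emb (ah_quot F (c x)) ^ m x * (\<Prod>\<alpha>\<in>A. emb (ah_quot F (c \<alpha>)) ^ m \<alpha>))"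
    using insert by (intro sim_mult K sim_ah_quot_power) auto
  finally show ?case using insert.hyps by (simp add: K)
qed (simp add: ah_quot_1 sim_refl K)

text \<open>Frobenius yields the quotient for f^p and the twisted c; invariance then lets f replace
  f^p.\<close>

lemma sim_frob_ah_quot:
  assumes "c \<in> fps_over R" "c $ 0 = 1"
  shows "sim K (fps_frob (emb (ah_quot F c))) (emb (ah_quot F (fps_frob c)))"
proof -
  have "fps_frob c \<in> fps_over R" "fps_frob c $ 0 = 1"
    using fps_frob_over[OF quot_premises(1) assms(1)] assms(2) by auto
  then obtain \<kappa> where "\<kappa> \<in> fps_over R" "\<kappa> $ 0 = 1" "ah_quot F (fps_frob c) = \<kappa> * ah_quot (F ^ CARD('p)) (fps_frob c)"
    using ah_quot_frobenius_invariant[OF F0 quot_premises, of "fps_frob c"] by blast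
  hence "sim K (emb (ah_quot F (fps_frob c))) (emb (ah_quot (F ^ CARD('p)) (fps_frob c)))"
    unfolding sim_def by (intro bexI[of _ "emb \<kappa>"]) (auto simp: emb_over emb_mult)
  thus ?thesis unfolding emb_frob ah_quot_frob[OF F0] by (rule sim_sym[OF K])
qed

lemma prime_CHAR_fls: "prime CHAR('p Fpbar fls)"
  using prime_CHAR_Fpbar[where 'p = 'p] by simp

lemma sim_frob_power_ah_quot:
  assumes c: "c \<in> fps_over R" "c $ 0 = 1"
  shows "sim K ((fps_frob ^^ N) (emb (ah_quot F c))) (emb (ah_quot F ((fps_frob ^^ N) c)))"
proof -
  have c': "(fps_frob ^^ N) c \<in> fps_over R \<and> (fps_frob ^^ N) c $ 0 = 1" for N
    by (induction N) (use c fps_frob_over[OF quot_premises(1)] in auto)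
  show ?thesis
  proof (induction N)
    case (Suc N)
    have "sim K (fps_frob ((fps_frob ^^ N) (emb (ah_quot F c)))) (fps_frob (emb (ah_quot F ((fps_frob ^^ N) c))))"
      by (intro sim_frob K prime_CHAR_fls Suc)
    also have "sim K \<dots> (emb (ah_quot F (fps_frob ((fps_frob ^^ N) c))))"
      using c'[of N] by (intro sim_frob_ah_quot) auto
    finally show ?case by (simp add: K)
  qed (simp add: sim_refl K)
qed

text \<open>1 + v has coefficients in F_p and is its own twist.\<close>

lemma sim_ah_quot_shift_frob:
  "sim K (emb (ah_quot F (1 + fps_X))) (fps_frob (emb (ah_quot F (1 + fps_X))))"
proof -
  have c: "1 + fps_X = lin (1 :: 'p Fpbar fps)" by (simp add: lin_def)
  have "lin 1 \<in> fps_over R" by (intro lin_over quot_premises subring_1)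
  hence "sim K (fps_frob (emb (ah_quot F (lin 1)))) (emb (ah_quot F (fps_frob (lin 1))))"
    by (intro sim_frob_ah_quot) simp_all
  moreover have "fps_frob (lin 1) = lin (1 :: 'p Fpbar fps)"
    using prime_CHAR_Fpbar[where 'p = 'p] by (subst fps_frob_lin) simp_all
  ultimately show ?thesis unfolding c by (simp add: sim_sym[OF K])
qed

lemma emb_ah_quot_lin: "emb (ah_quot F (lin t)) = emb (ah_quot F (1 + fps_X)) oo (fps_const (fps_to_fls t) * fps_X)"
proof (rule fps_ext)
  fix j
  have "ah_quot F (lin t) $ j = t ^ j * ah_quot F (1 + fps_X) $ j"
    unfolding lin_def by (rule ah_quot_scale[OF F0])
  thus "emb (ah_quot F (lin t)) $ j = (emb (ah_quot F (1 + fps_X)) oo (fps_const (fps_to_fls t) * fps_X)) $ j"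
    by (simp add: fls_times_fps_to_fls fps_to_fls_power)
qed

text \<open>The Frobenius acts on \<open>c\<close>, hence each root $\alpha$ contributes with the argument $\tau_\alpha^{p^N} v$.\<close>

lemma sim_frob_power_roots:
  assumes "finite A" "\<And>\<alpha>. \<alpha> \<in> A \<Longrightarrow> fps_to_fls (t \<alpha>) \<in> K"
  shows "sim K ((fps_frob ^^ N) (emb (ah_quot F (\<Prod>\<alpha>\<in>A. lin (t \<alpha>) ^ m \<alpha>))))
    (\<Prod>\<alpha>\<in>A. (emb (ah_quot F (1 + fps_X)) oo (fps_const (fps_to_fls (t \<alpha>) ^ (CARD('p) ^ N)) * fps_X)) ^ m \<alpha>)"
proof -
  have ch: "prime CHAR('p Fpbar fps)" "CHAR('p Fpbar fps) = CARD('p)"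
    using prime_CHAR_Fpbar[where 'p = 'p] by simp_all
  have frob: "(fps_frob ^^ N) (\<Prod>\<alpha>\<in>A. lin (t \<alpha>) ^ m \<alpha>) = (\<Prod>\<alpha>\<in>A. lin (t \<alpha> ^ (CARD('p) ^ N)) ^ m \<alpha>)" for N
    by (induction N) (simp_all add: fps_frob_prod[OF ch(1)] fps_frob_power[OF ch(1)] fps_frob_lin[OF ch(1)] ch(2) mult.commute
      flip: power_mult)
  have t: "t \<alpha> ^ n \<in> R" if "\<alpha> \<in> A" for \<alpha> n
    using assms(2)[OF that] by (intro subring_power quot_premises) simp
  have "sim K ((fps_frob ^^ N) (emb (ah_quot F (\<Prod>\<alpha>\<in>A. lin (t \<alpha>) ^ m \<alpha>))))
     (emb (ah_quot F ((fps_frob ^^ N) (\<Prod>\<alpha>\<in>A. lin (t \<alpha>) ^ m \<alpha>))))"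
    using assms
    by (intro sim_frob_power_ah_quot subring_prod subring_power is_subring_fps_over quot_premises lin_over fps_prod_nth_0)
      (auto simp: fps_power_zeroth_eq_one)
  also have "sim K \<dots> (\<Prod>\<alpha>\<in>A. emb (ah_quot F (lin (t \<alpha> ^ (CARD('p) ^ N)))) ^ m \<alpha>)"
    unfolding frob using assms(1) t by (intro sim_ah_quot_prod lin_over quot_premises) auto
  finally show ?thesis by (simp only: emb_ah_quot_lin fps_to_fls_power K)
qed

end

text \<open>Comparing coefficients of v^j in \<beta> = \<kappa> * \<open>fps_frob \<beta>\<close>
  gives an Artin-Schreier equation for \<open>\<beta> $ j\<close> whose right-hand side involves
  lower coefficients only.\<close>

lemma ah_quot_in_alg_over:
  fixes F :: "'p :: prime_card Fpbar fps"
  assumes F0: "F $ 0 = 0" and F: "fps_to_fls F \<in> ratfun"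
  shows "emb (ah_quot F (1 + fps_X)) \<in> fps_over (alg_over ratfun)"
proof -
  define \<beta> where "\<beta> = emb (ah_quot F (1 + fps_X))"
  note K = is_subfield_ratfun[where 'a = "'p Fpbar"]
  note L = is_subfield_alg_over[OF K]
  have \<beta>0: "\<beta> $ 0 = 1" using F0 by (simp add: \<beta>_def ah_quot_nth_0)
  obtain \<kappa> where \<kappa>: "\<kappa> \<in> fps_over ratfun" "\<kappa> $ 0 = 1" "\<beta> = \<kappa> * fps_frob \<beta>"
    using sim_ah_quot_shift_frob[OF K fls_const_in_ratfun F0 F] by (auto simp: sim_def \<beta>_def)
  have "\<beta> $ j \<in> alg_over ratfun" for j
  proof (induction j rule: less_induct)
    case (less j)
    show ?case
    proof (cases "j = 0")
      case False
      have "\<beta> $ j = (\<kappa> * fps_frob \<beta>) $ j" by (rule arg_cong[OF \<kappa>(3)])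
      also have "\<dots> = (\<Sum>i=0..j. \<kappa> $ i * (\<beta> $ (j - i)) ^ CARD('p))" by (simp add: fps_mult_nth)
      also have "\<dots> = (\<beta> $ j) ^ CARD('p) + (\<Sum>i=1..j. \<kappa> $ i * (\<beta> $ (j - i)) ^ CARD('p))"
        using \<kappa>(2) by (simp add: sum.atLeast_Suc_atMost)
      finally have "\<beta> $ j - (\<beta> $ j) ^ CARD('p) = (\<Sum>i=1..j. \<kappa> $ i * (\<beta> $ (j - i)) ^ CARD('p))"
        by (simp only: diff_eq_eq add.commute)
      also have "\<dots> \<in> alg_over ratfun"
        using \<kappa>(1) subset_alg_over[OF is_subfield_is_subring[OF K]] less
        by (intro subring_sum subring_mult subring_power is_subfield_is_subring L) (auto simp: fps_over_def)
      finally show ?thesis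
        by (rule alg_over_artin_schreier[OF K prime_ge_2_nat[OF prime_card]])
    qed (simp add: \<beta>0 subring_1 is_subfield_is_subring L)
  qed
  thus ?thesis by (simp add: \<beta>_def fps_over_def)
qed

section \<open>Kolchin's argument\<close>

text \<open>The constants of the substitution. A multiple of Q is subtracted so that D has no term
  in the lowest degree b of Q. If D had lowest degree a, comparing lowest terms would give binom(a,
  j) = binom(b, j) in k for all j, hence a = b.\<close>

lemma shift_ratio_const:
  fixes P Q :: "'a :: field fps"
  assumes eq: "fps_const Q * shift_x P = fps_const P * shift_x Q" and Q: "Q \<noteq> 0"
  shows "\<exists>c. P = fps_const c * Q"
proof -
  define b where "b = subdegree Q"
  define c where "c = P $ b / Q $ b"
  define D where "D = P - fps_const c * Q"
  have Qb: "Q $ b \<noteq> 0" using Q by (simp add: b_def)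
  have "fps_const Q * shift_x D = fps_const Q * shift_x P - fps_const Q * fps_const (fps_const c) * shift_x Q"
    by (simp add: D_def shift_x_diff shift_x_mult algebra_simps)
  also have "\<dots> = fps_const D * shift_x Q"
    unfolding eq by (simp add: D_def algebra_simps flip: fps_const_mult fps_const_sub)
  finally have eqD: "Q * shift_x D $ j = D * shift_x Q $ j" for j
    by (metis fps_mult_left_const_nth)
  have "D = 0"
  proof (rule ccontr)
    assume D: "D \<noteq> 0"
    define a where "a = subdegree D"
    have Da: "D $ a \<noteq> 0" using D by (simp add: a_def)
    have bin: "of_nat (a choose j) = (of_nat (b choose j) :: 'a)" for j
    proof -
      have sub: "(G * H) $ (u + v) = G $ u * H $ v" if "\<And>i. i < u \<Longrightarrow> G $ i = 0" "\<And>i. i < v \<Longrightarrow> H $ i = 0"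
        for G H :: "'a fps" and u v
      proof -
        have "(G * H) $ (u + v) = (\<Sum>i=0..u + v. if i = u then G $ u * H $ v else 0)"
          unfolding fps_mult_nth
        proof (rule sum.cong[OF refl])
          fix i assume "i \<in> {0..u + v}"
          thus "G $ i * H $ (u + v - i) = (if i = u then G $ u * H $ v else 0)"
            using that by (cases i u rule: linorder_cases) auto
        qed
        thus ?thesis by simp
      qed
      have "(Q * shift_x D $ j) $ (b + a) = Q $ b * (of_nat (a choose j) * D $ a)"
        by (subst sub) (auto simp: a_def b_def shift_x_nth)
      moreover have "(D * shift_x Q $ j) $ (a + b) = D $ a * (of_nat (b choose j) * Q $ b)"
        by (subst sub) (auto simp: a_def b_def shift_x_nth)
      ultimately show ?thesis using eqD[of j] Da Qb by (simp add: add.commute mult_ac)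
    qed
    \<comment> \<open>The larger of a and b, taken as j, would give 1 = 0; this works in every
      characteristic.\<close>
    have "a = b"
    proof (cases a b rule: linorder_cases)
      case less thus ?thesis using bin[of b] by (simp add: binomial_eq_0)
    next
      case greater thus ?thesis using bin[of a] by (simp add: binomial_eq_0)
    qed
    hence "D $ b \<noteq> 0" using Da by simp
    thus False using Qb by (simp add: D_def c_def)
  qed
  thus ?thesis by (auto simp: D_def)
qed

text \<open>
  Kolchin's argument: applying the shift to a shortest relation and subtracting a multiple of the relation
  gives a shorter one, so all coefficients of the latter vanish.
\<close>

lemma exponential_relation:
  fixes s Y :: "'m \<Rightarrow> 'a :: field fps"
  assumes p: "prime CHAR('a)" and perf: "\<And>x :: 'a. \<exists>y. y ^ CHAR('a) = x"
    and "finite S" "S \<noteq> {}" "\<And>m. m \<in> S \<Longrightarrow> s m \<noteq> 0" "\<And>m. m \<in> S \<Longrightarrow> fps_to_fls (s m) \<in> alg_over ratfun"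
    and Y0: "\<And>m. m \<in> S \<Longrightarrow> Y m $ 0 = 1" and Y: "\<And>m. m \<in> S \<Longrightarrow> shift_x (Y m) = fps_const (Y m) * C m"
    and C: "\<And>m. m \<in> S \<Longrightarrow> emb (C m) \<in> fps_over (alg_over ratfun)" and "(\<Sum>m\<in>S. s m * Y m) = 0"
  shows "\<exists>m\<in>S. \<exists>m'\<in>S. m \<noteq> m' \<and> fps_to_fls (Y m) / fps_to_fls (Y m') \<in> alg_over ratfun"
  using assms(3-)
proof (induction "card S" arbitrary: S s rule: less_induct)
  case (less S s)
  note K = is_subfield_ratfun[where 'a = 'a]
  note L = is_subfield_alg_over[OF K]
  define R where "R = {a :: 'a fps. fps_to_fls a \<in> alg_over ratfun}"
  have R: "is_subring R" unfolding R_def by (rule is_subring_fps_in[OF L])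
  define d where "d m = shift_x (s m) * C m" for m
  have shiftR: "shift_x a \<in> fps_over R" if a: "a \<in> R" for a
  proof -
    obtain M where M: "fin_over ratfun M" "fps_to_fls a \<in> M" using a by (auto simp: R_def alg_over_def)
    hence "fps_to_fls (shift_x a $ j) \<in> alg_over ratfun" for j
      using shift_x_in_fin_over[OF p perf M] by (auto simp: alg_over_def)
    thus ?thesis by (auto simp: R_def fps_over_def)
  qed
  have sR: "s m \<in> R" and dR: "d m $ j \<in> R" if "m \<in> S" for m j
  proof -
    show "s m \<in> R" using less.prems that by (auto simp: R_def)
    hence "shift_x (s m) * C m \<in> fps_over R"
      using shiftR less.prems(7)[OF that] by (intro subring_mult is_subring_fps_over R) (auto simp: emb_over R_def)
    thus "d m $ j \<in> R" by (auto simp: d_def fps_over_def)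
  qed
  obtain m0 where m0: "m0 \<in> S" using less.prems by blast
  have "(\<Sum>m\<in>S. fps_const (Y m) * d m) = shift_x (\<Sum>m\<in>S. s m * Y m)"
    unfolding shift_x_sum by (rule sum.cong[OF refl]) (simp add: shift_x_mult less.prems(6) d_def mult_ac)
  also have "\<dots> = 0" using less.prems(8) by simp
  finally have "(\<Sum>m\<in>S. fps_const (Y m) * d m) $ j = 0" for j by simp
  hence rel: "(\<Sum>m\<in>S. Y m * d m $ j) = 0" for j by (simp add: fps_sum_nth)
  \<comment> \<open>The relation and the v^j-coefficient of its shift, cross-multiplied so that m0
    drops out.\<close>
  define c where "c j m = s m0 * d m $ j - d m0 $ j * s m" for j m
  have c: "(\<Sum>m\<in>S. c j m * Y m) = 0" for j
  proof -
    have "(\<Sum>m\<in>S. c j m * Y m) = s m0 * (\<Sum>m\<in>S. Y m * d m $ j) - d m0 $ j * (\<Sum>m\<in>S. s m * Y m)"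
      by (simp add: c_def algebra_simps sum_subtractf sum_distrib_left)
    thus ?thesis by (simp add: rel less.prems(8))
  qed
  show ?case
  proof (cases "\<exists>j. \<exists>m\<in>S. c j m \<noteq> 0")
    case True
    then obtain j where j: "\<exists>m\<in>S. c j m \<noteq> 0" by blast
    define S' where "S' = {m \<in> S. c j m \<noteq> 0}"
    have "m0 \<notin> S'" by (simp add: S'_def c_def)
    hence "S' \<subset> S" using m0 by (auto simp: S'_def)
    hence "card S' < card S" using less.prems(1) by (rule psubset_card_mono[rotated])
    moreover have "(\<Sum>m\<in>S'. c j m * Y m) = 0"
      using c[of j] sum.mono_neutral_left[of S S' "\<lambda>m. c j m * Y m"] less.prems(1) by (auto simp: S'_def)
    moreover have "c j m \<in> R" if "m \<in> S" for m
      unfolding c_def using sR dR that m0 by (intro subring_diff subring_mult R)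
    ultimately have "\<exists>m\<in>S'. \<exists>m'\<in>S'. m \<noteq> m' \<and> fps_to_fls (Y m) / fps_to_fls (Y m') \<in> alg_over ratfun"
      using less.prems j by (intro less.hyps[of S' "c j"]) (auto simp: S'_def R_def)
    thus ?thesis by (auto simp: S'_def)
  next
    case False
    have "S \<noteq> {m0}"
    proof
      assume "S = {m0}"
      hence "s m0 * Y m0 = 0" using less.prems(8) by simp
      thus False using less.prems(3)[OF m0] less.prems(5)[OF m0] by auto
    qed
    then obtain m where m: "m \<in> S" "m \<noteq> m0" using m0 by auto
    have nz: "Y m \<noteq> 0" "s m \<noteq> 0" "s m0 \<noteq> 0"
      using less.prems(3)[OF m0] less.prems(3)[OF m(1)] less.prems(5)[OF m(1)] by auto
    \<comment> \<open>As all \<open>c j m\<close> vanish, the terms of m and m0 are multiplied by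
      the same factor under the shift, so their quotient is constant.\<close>
    have eq: "fps_const (s m0) * d m = d m0 * fps_const (s m)"
      by (rule fps_ext) (use False m in \<open>auto simp: c_def\<close>)
    have "fps_const (s m * Y m) * shift_x (s m0 * Y m0) = fps_const (Y m * Y m0) * (d m0 * fps_const (s m))"
      by (simp add: shift_x_mult less.prems(6)[OF m0] d_def mult_ac flip: fps_const_mult)
    also have "\<dots> = fps_const (s m0 * Y m0) * shift_x (s m * Y m)"
      unfolding eq[symmetric] by (simp add: shift_x_mult less.prems(6)[OF m(1)] d_def mult_ac flip: fps_const_mult)
    finally obtain \<nu> where \<nu>: "s m0 * Y m0 = fps_const \<nu> * (s m * Y m)"
      using shift_ratio_const[of "s m * Y m" "s m0 * Y m0"] nz by auto
    hence "fps_to_fls (s m0 * Y m0) = fps_to_fls (fps_const \<nu> * (s m * Y m))" by (simp only:)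
    hence "fps_to_fls (Y m0) * fps_to_fls (s m0) = (fls_const \<nu> * fps_to_fls (s m)) * fps_to_fls (Y m)"
      by (simp add: fls_times_fps_to_fls mult_ac)
    hence "fps_to_fls (Y m0) / fps_to_fls (Y m) = fls_const \<nu> * fps_to_fls (s m) / fps_to_fls (s m0)"
      using nz by (subst frac_eq_eq) auto
    also have "\<dots> \<in> alg_over ratfun"
      using subset_alg_over[OF is_subfield_is_subring[OF K]] fls_const_in_ratfun sR[OF m(1)] sR[OF m0]
      by (intro subfield_divide[OF L] subring_mult[OF is_subfield_is_subring[OF L]]) (auto simp: R_def)
    finally show ?thesis using m m0 by metis
  qed
qed

section \<open>Separation of the roots\<close>

lemma fps_compose_scale_over:
  assumes "is_subring M" "g \<in> fps_over M" "t \<in> M"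
  shows "g oo (fps_const t * fps_X) \<in> fps_over M"
  using assms by (auto simp: fps_over_def intro!: subring_mult subring_power)

text \<open>
  The roots are separated coefficient by coefficient, using the linear independence of the powers of the
  \<open>t \<alpha>\<close> over the prime field in all Frobenius twists at once.
\<close>

lemma separate_roots:
  fixes \<eta> :: "'i \<Rightarrow> 'a :: field fps"
  assumes p: "prime CHAR('a)" and M: "is_subfield M" and A: "finite A" and t: "\<And>\<alpha>. \<alpha> \<in> A \<Longrightarrow> t \<alpha> \<in> M"
    and \<eta>0: "\<And>\<alpha>. \<alpha> \<in> A \<Longrightarrow> \<eta> \<alpha> $ 0 = 1"
    and indep: "\<And>a j. j > 0 \<Longrightarrow> (\<Sum>\<alpha>\<in>A. of_nat (a \<alpha>) * t \<alpha> ^ j) = 0 \<Longrightarrow> \<forall>\<alpha>\<in>A. of_nat (a \<alpha>) = (0 :: 'a)"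
    and prod: "\<And>N. (\<Prod>\<alpha>\<in>A. \<eta> \<alpha> oo (fps_const (t \<alpha> ^ (CHAR('a) ^ N)) * fps_X)) \<in> fps_over M"
  shows "\<forall>\<alpha>\<in>A. \<eta> \<alpha> \<in> fps_over M"
proof -
  note M' = is_subfield_is_subring[OF M]
  have "\<forall>\<alpha>\<in>A. \<eta> \<alpha> $ j \<in> M" for j
  proof (induction j rule: less_induct)
    case (less j)
    show ?case
    proof (cases "j = 0")
      case False
      \<comment> \<open>The coefficient of v^j in the N-th product is this sum plus an expression in
        lower coefficients, which lie in M by induction.\<close>
      have "(\<Sum>\<alpha>\<in>A. \<eta> \<alpha> $ j * (t \<alpha> ^ j) ^ (CHAR('a) ^ N)) \<in> M" for N
      proof -
        define \<theta> where "\<theta> \<alpha> = \<eta> \<alpha> oo (fps_const (t \<alpha> ^ (CHAR('a) ^ N)) * fps_X)" for \<alpha>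
        have "(\<Prod>\<alpha>\<in>A. \<theta> \<alpha>) $ j = (\<Prod>\<alpha>\<in>A. fps_cutoff j (\<theta> \<alpha>)) $ j + (\<Sum>\<alpha>\<in>A. \<theta> \<alpha> $ j)"
          by (rule fps_prod_nth_cutoff(1)) (use A \<eta>0 False in \<open>auto simp: \<theta>_def\<close>)
        hence "(\<Sum>\<alpha>\<in>A. \<theta> \<alpha> $ j) = (\<Prod>\<alpha>\<in>A. \<theta> \<alpha>) $ j - (\<Prod>\<alpha>\<in>A. fps_cutoff j (\<theta> \<alpha>)) $ j" by simp
        also have "\<dots> \<in> M"
        proof (rule subring_diff[OF M'])
          show "(\<Prod>\<alpha>\<in>A. \<theta> \<alpha>) $ j \<in> M" using prod[of N] by (simp add: \<theta>_def fps_over_def)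
          have "fps_cutoff j (\<theta> \<alpha>) \<in> fps_over M" if "\<alpha> \<in> A" for \<alpha>
            using less that t by (auto simp: fps_over_def \<theta>_def intro!: subring_mult subring_power subring_0 M')
          hence "(\<Prod>\<alpha>\<in>A. fps_cutoff j (\<theta> \<alpha>)) \<in> fps_over M" by (intro subring_prod is_subring_fps_over M')
          thus "(\<Prod>\<alpha>\<in>A. fps_cutoff j (\<theta> \<alpha>)) $ j \<in> M" by (simp add: fps_over_def)
        qed
        also have "(\<Sum>\<alpha>\<in>A. \<theta> \<alpha> $ j) = (\<Sum>\<alpha>\<in>A. \<eta> \<alpha> $ j * (t \<alpha> ^ j) ^ (CHAR('a) ^ N))"
          by (simp add: \<theta>_def mult.commute[of "\<eta> _ $ j"] mult.commute[of j] flip: power_mult)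
        finally show ?thesis .
      qed
      moreover have "t \<alpha> ^ j \<in> M" if "\<alpha> \<in> A" for \<alpha> using t[OF that] by (intro subring_power M')
      ultimately show ?thesis using moore_lemma[OF p M A, of "\<lambda>\<alpha>. t \<alpha> ^ j" "\<lambda>\<alpha>. \<eta> \<alpha> $ j"] indep[of j] False by blast
    qed (simp add: \<eta>0 subring_1[OF M'])
  qed
  thus ?thesis by (auto simp: fps_over_def)
qed

text \<open>Descent brings some p^e-th powers of the coefficients into k(x), and k(x) is closed
  under p-th roots inside k((x)).\<close>

lemma frobenius_invariant_over_ratfun:
  fixes \<eta> :: "'a :: field fls fps"
  assumes p: "prime CHAR('a)" and perf: "\<And>x :: 'a. \<exists>y. y ^ CHAR('a) = x"
    and M: "fin_over ratfun M" and \<eta>: "\<eta> \<in> fps_over M" "\<eta> $ 0 = 1" and sim: "sim ratfun \<eta> (fps_frob \<eta>)"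
  shows "\<eta> \<in> fps_over ratfun"
proof -
  note K = is_subfield_ratfun[where 'a = 'a]
  have p': "prime CHAR('a fls)" using p by simp
  obtain H where H: "H \<in> fps_over ratfun" "H $ 0 = 1" "\<eta> = H * fps_frob \<eta>" using sim by (auto simp: sim_def)
  obtain n where n: "n > 0" "\<eta> ^ n \<in> fps_over ratfun"
    using frobenius_descent[OF p' K M \<eta> H] by blast
  obtain e where "\<forall>j. (\<eta> $ j) ^ (CHAR('a fls) ^ e) \<in> ratfun"
    using frobenius_descent'[OF p' K \<eta>(2) n] by blast
  thus ?thesis using ratfun_p_power_closed[OF p perf] by (auto simp: fps_over_def)
qed

text \<open>Stated for every finite superset of the roots so that one set can serve a whole family;
  the extra elements have multiplicity 0.\<close>

lemma poly_linear_factors: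
  fixes f :: "'a :: alg_closed_field poly"
  assumes "f \<noteq> 0"
  shows "\<exists>m. finite {\<alpha>. m \<alpha> > 0} \<and> (poly f 0 = 0 \<longrightarrow> m 0 > 0) \<and>
    (\<forall>A. finite A \<longrightarrow> {\<alpha>. m \<alpha> > 0} \<subseteq> A \<longrightarrow>
      f = Polynomial.smult (Polynomial.lead_coeff f) (\<Prod>\<alpha>\<in>A. [:- \<alpha>, 1:] ^ m \<alpha>))"
proof -
  obtain B where B: "f = Polynomial.smult (Polynomial.lead_coeff f) (\<Prod>x\<in>#B. [:- x, 1:])"
    using alg_closed_imp_factorization[OF assms] by blast
  have "\<forall>A. finite A \<longrightarrow> {\<alpha>. count B \<alpha> > 0} \<subseteq> A \<longrightarrow>
      f = Polynomial.smult (Polynomial.lead_coeff f) (\<Prod>\<alpha>\<in>A. [:- \<alpha>, 1:] ^ count B \<alpha>)"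
  proof (intro allI impI)
    fix A assume A: "finite A" "{\<alpha>. count B \<alpha> > 0} \<subseteq> A"
    have "(\<Prod>x\<in>#B. [:- x, 1:]) = (\<Prod>\<alpha>\<in>set_mset B. [:- \<alpha>, 1:] ^ count B \<alpha>)"
      by (rule image_prod_mset_multiplicity)
    also have "\<dots> = (\<Prod>\<alpha>\<in>A. [:- \<alpha>, 1:] ^ count B \<alpha>)"
      by (rule prod.mono_neutral_left) (use A in \<open>auto simp: not_in_iff\<close>)
    finally show "f = Polynomial.smult (Polynomial.lead_coeff f) (\<Prod>\<alpha>\<in>A. [:- \<alpha>, 1:] ^ count B \<alpha>)"
      using B by simp
  qed
  moreover have "count B 0 > 0" if root: "poly f 0 = 0"
  proof -
    have "poly (Polynomial.smult (Polynomial.lead_coeff f) (\<Prod>x\<in>#B. [:- x, 1:])) 0 = 0"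
      using root unfolding B[symmetric] .
    hence "prod_mset (image_mset (\<lambda>x. - x) B) = 0"
      using assms by (simp add: poly_prod_mset image_mset.compositionality comp_def)
    thus ?thesis by auto
  qed
  ultimately show ?thesis by (intro exI[of _ "count B"]) (auto simp: count_greater_zero_iff)
qed

lemma shift_x_linear_factors:
  assumes "finite A" "f = Polynomial.smult l (\<Prod>\<alpha>\<in>A. [:- \<alpha>, 1:] ^ m \<alpha>)"
  shows "shift_x (fps_of_poly f) = fps_const (fps_of_poly f) * (\<Prod>\<alpha>\<in>A. lin (tau \<alpha>) ^ m \<alpha>)"
proof -
  have const: "fps_const (prod g A) = (\<Prod>\<alpha>\<in>A. fps_const (g \<alpha>))" for g :: "'a \<Rightarrow> 'a fps"
    by (induction A rule: infinite_finite_induct) (auto simp flip: fps_const_mult)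
  have pw: "fps_const (a ^ n) = fps_const a ^ n" for a :: "'a fps" and n
    by (induction n) (auto simp flip: fps_const_mult)
  have f: "fps_of_poly f = fps_const l * (\<Prod>\<alpha>\<in>A. fps_of_poly [:- \<alpha>, 1:] ^ m \<alpha>)"
    unfolding assms(2) by (simp only: fps_of_poly_smult fps_of_poly_prod fps_of_poly_power)
  have "shift_x (fps_of_poly f) = fps_const (fps_const l) * (\<Prod>\<alpha>\<in>A. (fps_const (fps_of_poly [:- \<alpha>, 1:]) * lin (tau \<alpha>)) ^ m \<alpha>)"
    unfolding f by (simp only: shift_x_mult shift_x_const shift_x_prod shift_x_power shift_x_linear lin_def)
  also have "\<dots> = fps_const (fps_of_poly f) * (\<Prod>\<alpha>\<in>A. lin (tau \<alpha>) ^ m \<alpha>)"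
    unfolding f by (simp only: power_mult_distrib prod.distrib pw const mult.assoc flip: fps_const_mult)
  finally show ?thesis .
qed

locale ah_family =
  fixes f :: "nat \<Rightarrow> 'p :: prime_card Fpbar poly" and r :: nat
    and A :: "'p Fpbar set" and m :: "nat \<Rightarrow> 'p Fpbar \<Rightarrow> nat"
  assumes finA: "finite A"
    and factors: "i < r \<Longrightarrow> f i = Polynomial.smult (Polynomial.lead_coeff (f i)) (\<Prod>\<alpha>\<in>A. [:- \<alpha>, 1:] ^ m i \<alpha>)"
    and nonzero: "i < r \<Longrightarrow> f i \<noteq> 0" and root: "i < r \<Longrightarrow> poly (f i) 0 = 0"
    and root_mult: "i < r \<Longrightarrow> 0 \<in> A \<and> m i 0 > 0"
begin

definition bet :: "nat \<Rightarrow> 'p Fpbar fls fps" where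
  "bet i = emb (ah_quot (fps_of_poly (f i)) (1 + fps_X))"

text \<open>The factor that y_i = E(f_i) acquires under the substitution, by
  \<open>shift_artin_hasse_subst\<close>; \<open>bet\<close> is the same quotient for the bare
  argument 1 + v.\<close>

definition quo :: "nat \<Rightarrow> 'p Fpbar fls fps" where
  "quo i = emb (ah_quot (fps_of_poly (f i)) (\<Prod>\<alpha>\<in>A. lin (tau \<alpha>) ^ m i \<alpha>))"

definition bet_prod :: "(nat \<Rightarrow> int) \<Rightarrow> 'p Fpbar fls fps" where
  "bet_prod e = (\<Prod>i<r. bet i powi e i)"

lemma f_nth_0: "i < r \<Longrightarrow> fps_of_poly (f i) $ 0 = 0"
  using root[of i] by (simp add: poly_0_coeff_0)

lemma f_in_ratfun: "fps_to_fls (fps_of_poly (f i)) \<in> ratfun"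
  using poly_fls_in_ratfun[of "f i"] by (simp add: poly_fls_def)

lemma lin_prod_nth_0: "(\<Prod>\<alpha>\<in>A. lin (tau \<alpha>) ^ m i \<alpha>) $ 0 = 1"
  by (intro fps_prod_nth_0) (simp add: fps_power_zeroth_eq_one)

lemma bet_nth_0: "i < r \<Longrightarrow> bet i $ 0 = 1"
  unfolding bet_def using ah_quot_nth_0[OF f_nth_0, of i "1 + fps_X"] by simp

lemma quo_nth_0: "i < r \<Longrightarrow> quo i $ 0 = 1"
  unfolding quo_def using ah_quot_nth_0[OF f_nth_0, of i] lin_prod_nth_0 by simp

lemma shift_artin_hasse_subst:
  assumes "i < r"
  shows "shift_x (artin_hasse_subst (f i)) =
    fps_const (artin_hasse_subst (f i)) * ah_quot (fps_of_poly (f i)) (\<Prod>\<alpha>\<in>A. lin (tau \<alpha>) ^ m i \<alpha>)"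
proof -
  have "artin_hasse_subst (f i) = Abs_fps ah oo fps_of_poly (f i)"
    by (simp add: artin_hasse_subst_def ah_def[abs_def] red_def artin_hasse_mod_def)
  thus ?thesis
    using ah_quot_shift[OF f_nth_0[OF assms] shift_x_linear_factors[OF finA factors[OF assms]]] by simp
qed

lemma artin_hasse_subst_nth_0: "i < r \<Longrightarrow> artin_hasse_subst (f i) $ 0 = 1"
proof -
  have "artin_hasse_subst (f i) $ 0 = (ah 0 :: 'p Fpbar)"
    by (simp add: artin_hasse_subst_def ah_def red_def artin_hasse_mod_def)
  thus ?thesis by simp
qed

lemma sim_frob_power_quo:
  assumes "i < r"
  shows "sim ratfun ((fps_frob ^^ N) (quo i))
    (\<Prod>\<alpha>\<in>A. (bet i oo (fps_const (fps_to_fls (tau \<alpha>) ^ (CARD('p) ^ N)) * fps_X)) ^ m i \<alpha>)"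
  unfolding quo_def bet_def
  by (rule sim_frob_power_roots[OF is_subfield_ratfun fls_const_in_ratfun f_nth_0[OF assms] f_in_ratfun finA fps_to_fls_tau_in_ratfun])

lemma sim_frob_bet: "i < r \<Longrightarrow> sim ratfun (bet i) (fps_frob (bet i))"
  unfolding bet_def
  by (rule sim_ah_quot_shift_frob[OF is_subfield_ratfun fls_const_in_ratfun f_nth_0 f_in_ratfun])

lemma bet_in_alg_over: "i < r \<Longrightarrow> bet i \<in> fps_over (alg_over ratfun)"
  unfolding bet_def by (rule ah_quot_in_alg_over[OF f_nth_0 f_in_ratfun])

lemma alg_over_ring: "is_subring (alg_over (ratfun :: 'p Fpbar fls set))"
  by (rule is_subfield_is_subring[OF is_subfield_alg_over[OF is_subfield_ratfun]])

lemma quo_in_alg_over: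
  assumes "i < r"
  shows "quo i \<in> fps_over (alg_over ratfun)"
proof -
  have sub: "ratfun \<subseteq> alg_over (ratfun :: 'p Fpbar fls set)"
    by (rule subset_alg_over[OF is_subfield_is_subring[OF is_subfield_ratfun]])
  have "(\<Prod>\<alpha>\<in>A. (bet i oo (fps_const (fps_to_fls (tau \<alpha>) ^ (CARD('p) ^ 0)) * fps_X)) ^ m i \<alpha>) \<in> fps_over (alg_over ratfun)"
    using sub fps_to_fls_tau_in_ratfun
    by (intro subring_prod subring_power is_subring_fps_over alg_over_ring fps_compose_scale_over bet_in_alg_over assms) auto
  thus ?thesis
    using sim_over[OF is_subfield_ratfun _ alg_over_ring sub] sim_frob_power_quo[OF assms, of 0] by simp
qed

lemma bet_prod_nth_0: "bet_prod e $ 0 = 1"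
  unfolding bet_prod_def by (intro fps_prod_nth_0) (simp add: bet_nth_0 fps_power_int_nth_0)

lemma sim_frob_bet_prod: "sim ratfun (bet_prod e) (fps_frob (bet_prod e))"
proof -
  have p: "prime CHAR('p Fpbar fls)" using prime_CHAR_Fpbar[where 'p = 'p] by simp
  have "sim ratfun (\<Prod>i<r. bet i powi e i) (\<Prod>i<r. fps_frob (bet i) powi e i)"
    using bet_nth_0 by (intro sim_prod sim_power_int is_subfield_ratfun sim_frob_bet) auto
  thus ?thesis
    using bet_nth_0 by (simp add: bet_prod_def fps_frob_prod[OF p] fps_frob_power_int[OF _ p])
qed

lemma bet_prod_add: "bet_prod (\<lambda>i. d i + e i) = bet_prod d * bet_prod e"
  by (simp add: bet_prod_def fps_power_int_add bet_nth_0 flip: prod.distrib)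

lemma bet_prod_scale: "bet_prod (\<lambda>i. e i * n) = bet_prod e powi n"
  unfolding bet_prod_def by (subst fps_power_int_prod) (auto simp: fps_power_int_mult bet_nth_0 fps_power_int_nth_0)

text \<open>M is stable under Frobenius, so every twist of the product stays over M. Up to factors
  over k(x), the N-th twist is the product of the \<eta>_\<alpha>(\<tau>_\<alpha>^(p^N) v).
  \<open>separate_roots\<close> isolates each \<eta>_\<alpha>, and Frobenius invariance brings it
  down from M to k(x).\<close>

lemma quo_relation:
  assumes M: "fin_over ratfun M" and B: "(\<Prod>i<r. quo i powi n i) \<in> fps_over M" and \<alpha>: "\<alpha> \<in> A"
  shows "bet_prod (\<lambda>i. n i * int (m i \<alpha>)) \<in> fps_over ratfun"
proof -
  have p: "prime CHAR('p Fpbar fls)" using prime_CHAR_Fpbar[where 'p = 'p] by simp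
  have ch: "CHAR('p Fpbar fls) = CARD('p)" by simp
  note K = is_subfield_ratfun[where 'a = "'p Fpbar"]
  have M': "is_subfield M" by (rule fin_over_subfield[OF K M])
  have KM: "ratfun \<subseteq> M" using M by (simp add: fin_over_def)
  define \<eta> where "\<eta> \<alpha> = bet_prod (\<lambda>i. n i * int (m i \<alpha>))" for \<alpha>
  have "(\<Prod>\<alpha>\<in>A. \<eta> \<alpha> oo (fps_const (fps_to_fls (tau \<alpha>) ^ (CHAR('p Fpbar fls) ^ N)) * fps_X)) \<in> fps_over M" for N
  proof -
    define h where "h \<alpha> = fps_const (fps_to_fls (tau \<alpha>) ^ (CARD('p) ^ N)) * fps_X" for \<alpha> :: "'p Fpbar"
    have h0: "h \<alpha> $ 0 = 0" for \<alpha> by (simp add: h_def)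
    have frob: "(fps_frob ^^ N) (\<Prod>i<r. quo i powi n i) = (\<Prod>i<r. (fps_frob ^^ N) (quo i) powi n i)"
    proof (induction N)
      case (Suc N)
      have "((fps_frob ^^ N) (quo i)) $ 0 = 1" if "i < r" for i
        by (induction N) (use quo_nth_0[OF that] in auto)
      thus ?case using Suc by (simp add: fps_frob_prod[OF p] fps_frob_power_int[OF _ p])
    qed simp
    have fr: "(fps_frob ^^ N) (\<Prod>i<r. quo i powi n i) \<in> fps_over M"
      by (induction N) (use B fps_frob_over[OF is_subfield_is_subring[OF M']] in auto)
    have c0: "(bet i oo h \<alpha>) $ 0 = 1" if "i < r" for i \<alpha> using bet_nth_0[OF that] by simp
    have "sim ratfun (\<Prod>i<r. (fps_frob ^^ N) (quo i) powi n i) (\<Prod>i<r. (\<Prod>\<alpha>\<in>A. (bet i oo h \<alpha>) ^ m i \<alpha>) powi n i)"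
    proof (rule sim_prod[OF K])
      fix i assume "i \<in> {..<r}"
      hence i: "i < r" by simp
      show "sim ratfun ((fps_frob ^^ N) (quo i) powi n i) ((\<Prod>\<alpha>\<in>A. (bet i oo h \<alpha>) ^ m i \<alpha>) powi n i)"
        by (rule sim_power_int[OF K sim_frob_power_quo[OF i, of N, folded h_def] fps_prod_nth_0])
          (simp add: bet_nth_0[OF i] fps_power_zeroth_eq_one)
    qed
    also have "(\<Prod>i<r. (\<Prod>\<alpha>\<in>A. (bet i oo h \<alpha>) ^ m i \<alpha>) powi n i) = (\<Prod>i<r. \<Prod>\<alpha>\<in>A. (bet i powi (n i * int (m i \<alpha>))) oo h \<alpha>)"
    proof (rule prod.cong[OF refl])
      fix i assume "i \<in> {..<r}"
      hence i: "i < r" by simp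
      have "(\<Prod>\<alpha>\<in>A. (bet i oo h \<alpha>) ^ m i \<alpha>) powi n i = (\<Prod>\<alpha>\<in>A. ((bet i oo h \<alpha>) powi int (m i \<alpha>)) powi n i)"
        by (subst fps_power_int_prod) (auto simp: bet_nth_0[OF i] fps_power_zeroth_eq_one)
      also have "\<dots> = (\<Prod>\<alpha>\<in>A. (bet i powi (n i * int (m i \<alpha>))) oo h \<alpha>)"
        by (simp only: fps_compose_power_int[OF bet_nth_0[OF i] h0] mult.commute[of "n i"] fps_power_int_mult[OF c0[OF i]])
      finally show "(\<Prod>\<alpha>\<in>A. (bet i oo h \<alpha>) ^ m i \<alpha>) powi n i = (\<Prod>\<alpha>\<in>A. (bet i powi (n i * int (m i \<alpha>))) oo h \<alpha>)" .
    qed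
    also have "\<dots> = (\<Prod>\<alpha>\<in>A. \<eta> \<alpha> oo h \<alpha>)"
      unfolding \<eta>_def bet_prod_def by (subst prod.swap) (simp add: fps_compose_prod_distrib h0)
    finally have "sim ratfun (\<Prod>\<alpha>\<in>A. \<eta> \<alpha> oo h \<alpha>) ((fps_frob ^^ N) (\<Prod>i<r. quo i powi n i))"
      unfolding frob by (rule sim_sym[OF K])
    thus ?thesis unfolding ch h_def[symmetric]
      by (rule sim_over[OF K _ is_subfield_is_subring[OF M'] KM fr])
  qed
  moreover have "\<forall>\<alpha>\<in>A. of_nat (a \<alpha>) = (0 :: 'p Fpbar fls)"
    if j: "j > 0" and eq: "(\<Sum>\<alpha>\<in>A. of_nat (a \<alpha>) * fps_to_fls (tau \<alpha>) ^ j) = (0 :: 'p Fpbar fls)" for a j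
    using tau_powers_independent[OF finA j eq] by (simp add: fls_of_nat)
  moreover have "fps_to_fls (tau \<beta>) \<in> M" for \<beta>
    using fps_to_fls_tau_in_ratfun KM by blast
  ultimately have "\<forall>\<alpha>\<in>A. \<eta> \<alpha> \<in> fps_over M"
    by (intro separate_roots[OF p M' finA, where t = "\<lambda>\<alpha>. fps_to_fls (tau \<alpha>)"]) (auto simp: \<eta>_def bet_prod_nth_0)
  thus ?thesis
    using frobenius_invariant_over_ratfun[OF prime_CHAR_Fpbar perfect_Fpbar M _ bet_prod_nth_0 sim_frob_bet_prod] \<alpha>
    by (simp add: \<eta>_def)
qed

end

context ah_family
begin

text \<open>Kolchin's argument yields two monomials whose quotient y is algebraic, lying in a finite
  extension M. The shift of y divided by y is again over M, and it is the product of the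
  \<open>quo i\<close> raised to the differences of the exponents.\<close>

lemma relation_exponents:
  fixes S :: "'m set" and s :: "'m \<Rightarrow> 'p Fpbar fps" and ex :: "'m \<Rightarrow> nat \<Rightarrow> nat"
  assumes S: "finite S" "S \<noteq> {}" and s: "\<And>l. l \<in> S \<Longrightarrow> s l \<noteq> 0" "\<And>l. l \<in> S \<Longrightarrow> fps_to_fls (s l) \<in> ratfun"
    and dist: "\<And>l l'. l \<in> S \<Longrightarrow> l' \<in> S \<Longrightarrow> l \<noteq> l' \<Longrightarrow> \<exists>i<r. ex l i \<noteq> ex l' i"
    and rel: "(\<Sum>l\<in>S. s l * (\<Prod>i<r. artin_hasse_subst (f i) ^ ex l i)) = 0"
  shows "\<exists>n. (\<exists>i<r. n i \<noteq> 0) \<and> (\<forall>\<alpha>\<in>A. bet_prod (\<lambda>i. n i * int (m i \<alpha>)) \<in> fps_over ratfun)"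
proof -
  note K = is_subfield_ratfun[where 'a = "'p Fpbar"]
  define Y where "Y l = (\<Prod>i<r. artin_hasse_subst (f i) ^ ex l i)" for l
  define C where "C l = (\<Prod>i<r. ah_quot (fps_of_poly (f i)) (\<Prod>\<alpha>\<in>A. lin (tau \<alpha>) ^ m i \<alpha>) ^ ex l i)" for l
  have Y0: "Y l $ 0 = 1" for l
    unfolding Y_def by (intro fps_prod_nth_0) (simp add: fps_power_zeroth_eq_one artin_hasse_subst_nth_0)
  have Y: "shift_x (Y l) = fps_const (Y l) * C l" for l
  proof -
    have const: "fps_const (prod g B) = (\<Prod>i\<in>B. fps_const (g i))" for g :: "nat \<Rightarrow> 'p Fpbar fps" and B
      by (induction B rule: infinite_finite_induct) (auto simp flip: fps_const_mult)
    have pw: "fps_const (a ^ n) = fps_const a ^ n" for a :: "'p Fpbar fps" and n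
      by (induction n) (auto simp flip: fps_const_mult)
    have "shift_x (Y l) = (\<Prod>i<r. shift_x (artin_hasse_subst (f i)) ^ ex l i)"
      by (simp add: Y_def shift_x_prod shift_x_power)
    also have "\<dots> = (\<Prod>i<r. fps_const (artin_hasse_subst (f i)) ^ ex l i *
        ah_quot (fps_of_poly (f i)) (\<Prod>\<alpha>\<in>A. lin (tau \<alpha>) ^ m i \<alpha>) ^ ex l i)"
      by (rule prod.cong[OF refl]) (simp add: shift_artin_hasse_subst power_mult_distrib)
    finally show ?thesis unfolding Y_def C_def prod.distrib const pw .
  qed
  have embC: "emb (C l) = (\<Prod>i<r. quo i ^ ex l i)" for l
    by (simp add: C_def quo_def emb_prod emb_power)
  have "emb (C l) \<in> fps_over (alg_over ratfun)" for l
    unfolding embC by (intro subring_prod subring_power is_subring_fps_over alg_over_ring quo_in_alg_over) auto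
  moreover have "fps_to_fls (s l) \<in> alg_over ratfun" if "l \<in> S" for l
    using s(2)[OF that] subset_alg_over[OF is_subfield_is_subring[OF K]] by blast
  ultimately have "\<exists>l\<in>S. \<exists>l'\<in>S. l \<noteq> l' \<and> fps_to_fls (Y l) / fps_to_fls (Y l') \<in> alg_over ratfun"
    by (intro exponential_relation[OF prime_CHAR_Fpbar perfect_Fpbar S, of s Y C] s(1) Y0 Y)
      (use rel in \<open>simp_all add: Y_def\<close>)
  then obtain l l' where l: "l \<in> S" "l' \<in> S" "l \<noteq> l'" and alg: "fps_to_fls (Y l) / fps_to_fls (Y l') \<in> alg_over ratfun"
    by blast
  then obtain M where M: "fin_over ratfun M" "fps_to_fls (Y l) / fps_to_fls (Y l') \<in> M" by (auto simp: alg_over_def)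
  have M': "is_subfield M" by (rule fin_over_subfield[OF K M(1)])
  define y where "y = Y l * inverse (Y l')"
  have yY: "y * Y l' = Y l" using Y0[of l'] by (simp add: y_def mult.assoc inverse_mult_eq_1)
  have y0: "y $ 0 = 1" using Y0 by (simp add: y_def)
  have yM: "fps_to_fls y \<in> M"
  proof -
    have "Y l' \<noteq> 0" using Y0[of l'] by auto
    moreover have "fps_to_fls y * fps_to_fls (Y l') = fps_to_fls (Y l)" by (simp flip: yY fls_times_fps_to_fls)
    ultimately have "fps_to_fls y = fps_to_fls (Y l) / fps_to_fls (Y l')" by (simp add: eq_divide_eq)
    thus ?thesis using M(2) by simp
  qed
  define B where "B = fps_const (inverse (fps_to_fls y)) * emb (shift_x y)"
  have BM: "B \<in> fps_over M"
  proof (rule fps_overI)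
    fix j
    show "B $ j \<in> M"
      using shift_x_in_fin_over[OF prime_CHAR_Fpbar perfect_Fpbar M(1) yM, of j] yM subfield_inverse[OF M']
      by (auto simp: B_def intro!: subring_mult is_subfield_is_subring M')
  qed
  \<comment> \<open>Shift both sides of y Y_l' = Y_l and cancel Y_l'.\<close>
  have BC: "B * emb (C l') = emb (C l)"
  proof -
    have "fps_const (Y l') * (shift_x y * C l') = shift_x y * shift_x (Y l')"
      unfolding Y by (simp only: mult_ac)
    also have "\<dots> = shift_x (Y l)" by (simp only: yY flip: shift_x_mult)
    also have "\<dots> = fps_const (y * Y l') * C l" unfolding yY by (rule Y)
    also have "\<dots> = fps_const (Y l') * (fps_const y * C l)" by (simp add: mult_ac flip: fps_const_mult)
    finally have "fps_const (Y l') * (shift_x y * C l') = fps_const (Y l') * (fps_const y * C l)" .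
    moreover have "fps_const (Y l') \<noteq> 0"
    proof
      assume "fps_const (Y l') = 0"
      hence "Y l' = 0" by simp
      thus False using Y0[of l'] by simp
    qed
    ultimately have "shift_x y * C l' = fps_const y * C l" by (simp only: mult_cancel_left) simp
    hence "emb (shift_x y) * emb (C l') = emb (fps_const y) * emb (C l)" by (simp flip: emb_mult)
    moreover have "emb (fps_const y) = fps_const (fps_to_fls y)"
      by (rule fps_ext) simp
    moreover have "fps_to_fls y \<noteq> 0" using y0 by auto
    ultimately show ?thesis by (simp add: B_def mult.assoc flip: mult.assoc[of "fps_const (inverse _)" "fps_const _"])
  qed
  define n where "n i = int (ex l i) - int (ex l' i)" for i
  have "(\<Prod>i<r. quo i powi n i) * emb (C l') = emb (C l)"
    unfolding embC prod.distrib[symmetric]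
  proof (rule prod.cong[OF refl])
    fix i assume "i \<in> {..<r}"
    hence "quo i powi (n i + int (ex l' i)) = quo i powi n i * quo i powi int (ex l' i)"
      by (intro fps_power_int_add) (simp add: quo_nth_0)
    thus "quo i powi n i * quo i ^ ex l' i = quo i ^ ex l i" by (simp add: n_def)
  qed
  hence "(\<Prod>i<r. quo i powi n i) * emb (C l') = B * emb (C l')" using BC by simp
  moreover have "emb (C l') \<noteq> 0"
  proof -
    have "emb (C l') $ 0 = 1" unfolding embC by (intro fps_prod_nth_0) (simp add: quo_nth_0 fps_power_zeroth_eq_one)
    thus ?thesis by (metis fps_zero_nth zero_neq_one)
  qed
  ultimately have "(\<Prod>i<r. quo i powi n i) \<in> fps_over M" using BM by simp
  hence "\<forall>\<alpha>\<in>A. bet_prod (\<lambda>i. n i * int (m i \<alpha>)) \<in> fps_over ratfun"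
    using quo_relation[OF M(1)] by blast
  moreover have "\<exists>i<r. n i \<noteq> 0" using dist[OF l] by (simp add: n_def)
  ultimately show ?thesis by blast
qed

text \<open>The admissible exponent vectors form a saturated subgroup: descent extracts the n-th
  root up to p-power exponents, and closure of k(x) under p-th roots does the rest.\<close>

lemma bet_prod_over_saturated:
  assumes "bet_prod (\<lambda>i. e i * n) \<in> fps_over ratfun" "n \<noteq> 0"
  shows "bet_prod e \<in> fps_over ratfun"
proof -
  note K = is_subfield_ratfun[where 'a = "'p Fpbar"]
  have p: "prime CHAR('p Fpbar fls)" using prime_CHAR_Fpbar[where 'p = 'p] by simp
  have n: "bet_prod e powi n \<in> fps_over ratfun" using assms(1) unfolding bet_prod_scale .
  have "bet_prod e powi \<bar>n\<bar> \<in> fps_over ratfun"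
  proof (cases "n \<ge> 0")
    case False
    have "bet_prod e powi (n * (- 1)) = (bet_prod e powi n) powi (- 1)"
      by (rule fps_power_int_mult[OF bet_prod_nth_0])
    also have "\<dots> \<in> fps_over ratfun"
      by (rule fps_power_int_over[OF fps_power_int_nth_0[OF bet_prod_nth_0] K n])
    finally show ?thesis using False by simp
  qed (use n in simp)
  hence "bet_prod e ^ nat \<bar>n\<bar> \<in> fps_over ratfun" by (simp add: power_int_def)
  then obtain k where "\<forall>j. (bet_prod e $ j) ^ (CHAR('p Fpbar fls) ^ k) \<in> ratfun"
    using frobenius_descent'[OF p K bet_prod_nth_0, of "nat \<bar>n\<bar>"] assms(2) by auto
  thus ?thesis using ratfun_p_power_closed[OF prime_CHAR_Fpbar perfect_Fpbar] by (auto simp: fps_over_def)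
qed

lemma bet_prod_over_sum:
  assumes "finite T" "\<And>\<alpha>. \<alpha> \<in> T \<Longrightarrow> bet_prod (e \<alpha>) \<in> fps_over ratfun"
  shows "bet_prod (\<lambda>i. \<Sum>\<alpha>\<in>T. e \<alpha> i * t \<alpha>) \<in> fps_over ratfun"
  using assms
proof (induction T rule: finite_induct)
  case (insert x T)
  note K = is_subfield_ratfun[where 'a = "'p Fpbar"]
  have "bet_prod (e x) powi t x * bet_prod (\<lambda>i. \<Sum>\<alpha>\<in>T. e \<alpha> i * t \<alpha>) \<in> fps_over ratfun"
    using insert by (intro subring_mult is_subring_fps_over is_subfield_is_subring[OF K] fps_power_int_over K bet_prod_nth_0) auto
  thus ?case using insert.hyps by (simp add: bet_prod_add flip: bet_prod_scale)
qed (simp add: bet_prod_def subring_1 is_subring_fps_over is_subfield_is_subring is_subfield_ratfun)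

end

text \<open>Composition with f is injective, so the equation in k(f) can be read in k(X), where
  rational solutions are polynomials.\<close>

lemma artin_schreier_ratfun_in:
  fixes f :: "'p :: prime_card Fpbar poly"
  assumes f: "Polynomial.degree f > 0" and z: "z \<in> ratfun_in f" and eq: "z - z ^ CARD('p) = poly_fls (pcompose g f)"
  shows "\<exists>q. g = q - q ^ CARD('p)"
proof -
  obtain a b where ab: "b \<noteq> 0" "z = poly_fls (pcompose a f) / poly_fls (pcompose b f)"
    using z by (auto simp: ratfun_in_def)
  obtain P where P: "CARD('p) = Suc P" using prime_gt_0_nat[OF prime_card[where 'a = 'p]] by (cases "CARD('p)") auto
  define u v where "u = poly_fls (pcompose a f)" and "v = poly_fls (pcompose b f)"
  have inj: "pcompose x f = 0 \<longleftrightarrow> x = 0" for x :: "'p Fpbar poly" using f by (auto simp: pcompose_eq_0_iff)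
  have v: "v \<noteq> 0" using ab(1) by (simp add: v_def inj)
  have "u * v ^ P - u ^ Suc P = (z - z ^ Suc P) * v ^ Suc P"
    using v ab(2) by (simp add: u_def[symmetric] v_def[symmetric] power_divide left_diff_distrib)
  hence "poly_fls (pcompose (a * b ^ P - a ^ Suc P) f) = poly_fls (pcompose (g * b ^ Suc P) f)"
    using eq unfolding P pcompose_diff pcompose_mult pcompose_hom.hom_power by (simp add: u_def v_def del: power_Suc)
  hence "pcompose (a * b ^ P - a ^ Suc P - g * b ^ Suc P) f = 0" by (simp only: poly_fls_eq_iff pcompose_diff) simp
  hence "a * b ^ P - a ^ Suc P = g * b ^ Suc P" by (simp only: inj) simp
  thus ?thesis using artin_schreier_polynomial[OF ab(1), of a g] by (simp add: P)
qed

text \<open>Over k(x) the equation G - G^p = f may be solvable, namely for f = q - q^p. But \<beta>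
  satisfies its Frobenius equation already over k(f), and k(x) is finite over k(f), so descent puts
  a p^e-th power of G into k(f). There f is a free variable, and its p^e-th power has nonzero
  primitive part.\<close>

lemma bet_not_over_ratfun:
  fixes f :: "'p :: prime_card Fpbar poly"
  assumes f: "f \<noteq> 0" "poly f 0 = 0"
  shows "emb (ah_quot (fps_of_poly f) (1 + fps_X)) \<notin> fps_over ratfun"
proof
  define \<beta> where "\<beta> = emb (ah_quot (fps_of_poly f) (1 + fps_X))"
  assume "emb (ah_quot (fps_of_poly f) (1 + fps_X)) \<in> fps_over ratfun"
  hence \<beta>: "\<beta> \<in> fps_over ratfun" by (simp add: \<beta>_def)
  have deg: "Polynomial.degree f > 0"
  proof (rule ccontr)
    assume "\<not> Polynomial.degree f > 0"
    then obtain c where "f = [:c:]" using degree_eq_zeroE by blast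
    thus False using f by simp
  qed
  define K where "K = ratfun_in f"
  have K: "is_subfield K" unfolding K_def by (rule is_subfield_ratfun_in[OF deg])
  have const: "fls_const c \<in> K" for c
    using poly_fls_in_ratfun_in[of "[:c:]" f] by (simp add: K_def poly_fls_def fps_of_poly_const)
  have fK: "poly_fls f \<in> K" using poly_fls_in_ratfun_in[of "[:0, 1:]" f] by (simp add: K_def pcompose_pCons)
  define d where "d = Polynomial.degree f"
  \<comment> \<open>Coefficients of f(T) - f(x), a polynomial over k(f) with root T = x; the
    constant term is -f(x) because f(0) = 0.\<close>
  define c where "c l = (if l = 0 then - poly_fls f else fls_const (Polynomial.coeff f l))" for l
  have pf: "poly_fls g = (\<Sum>l\<le>n. fls_const (Polynomial.coeff g l) * fls_X ^ l)" if "Polynomial.degree g \<le> n"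
    for g :: "'p Fpbar poly" and n
  proof -
    have "g = (\<Sum>l\<le>n. Polynomial.smult (Polynomial.coeff g l) ([:0, 1:] ^ l))"
      using poly_as_sum_of_monoms'[OF that] by (simp add: monom_altdef)
    hence "poly_fls g = (\<Sum>l\<le>n. poly_fls (Polynomial.smult (Polynomial.coeff g l) ([:0, 1:] ^ l)))"
      by (metis poly_fls_sum)
    also have "\<dots> = (\<Sum>l\<le>n. fls_const (Polynomial.coeff g l) * fls_X ^ l)"
    proof (rule sum.cong[OF refl])
      fix l
      have "poly_fls (Polynomial.smult (Polynomial.coeff g l) ([:0, 1:] ^ l)) = poly_fls ([:Polynomial.coeff g l:] * [:0, 1:] ^ l)"
        by simp
      also have "\<dots> = fls_const (Polynomial.coeff g l) * fls_X ^ l"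
        by (simp only: poly_fls_simps) (simp add: poly_fls_def fps_of_poly_const)
      finally show "poly_fls (Polynomial.smult (Polynomial.coeff g l) ([:0, 1:] ^ l)) = fls_const (Polynomial.coeff g l) * fls_X ^ l" .
    qed
    finally show ?thesis .
  qed
  have "(\<Sum>l\<le>d. c l * fls_X ^ l) = (\<Sum>l\<le>d. fls_const (Polynomial.coeff f l) * fls_X ^ l - (if l = 0 then poly_fls f else 0))"
    using f(2) by (intro sum.cong refl) (auto simp: c_def poly_0_coeff_0)
  also have "\<dots> = 0" using pf[of f d] by (simp add: sum_subtractf d_def)
  finally have "\<exists>M. fin_over K M \<and> fls_X \<in> M"
    using f(1) deg fK const K
    by (intro fin_over_algebraic[OF K, of d c]) (auto simp: c_def d_def subring_uminus intro!: exI[of _ d])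
  then obtain M where M: "fin_over K M" "fls_X \<in> M" by blast
  have M': "is_subfield M" by (rule fin_over_subfield[OF K M(1)])
  have KM: "K \<subseteq> M" using M(1) by (simp add: fin_over_def)
  have "poly_fls g \<in> M" for g
    unfolding pf[OF order_refl] using KM const M
    by (intro subring_sum subring_mult subring_power is_subfield_is_subring M') auto
  hence "ratfun \<subseteq> M" using subfield_divide[OF M'] by (auto elim!: ratfunE)
  hence \<beta>M: "\<beta> \<in> fps_over M" using \<beta> fps_over_mono by blast
  have F0: "fps_of_poly f $ 0 = 0" using f(2) by (simp add: poly_0_coeff_0)
  have \<beta>0: "\<beta> $ 0 = 1" using ah_quot_nth_0[OF F0, of "1 + fps_X"] by (simp add: \<beta>_def)
  obtain H where H: "H \<in> fps_over K" "H $ 0 = 1" "\<beta> = H * fps_frob \<beta>"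
    using sim_ah_quot_shift_frob[OF K const F0] fK by (auto simp: sim_def \<beta>_def poly_fls_def)
  have p: "prime CHAR('p Fpbar fls)" using prime_CHAR_Fpbar[where 'p = 'p] by simp
  obtain n where n: "n > 0" "\<beta> ^ n \<in> fps_over K" using frobenius_descent[OF p K M(1) \<beta>M \<beta>0 H] by blast
  obtain e where e: "\<forall>j. (\<beta> $ j) ^ (CHAR('p Fpbar fls) ^ e) \<in> K" using frobenius_descent'[OF p K \<beta>0 n] by blast
  define G where "G = (ah_log :: 'p Fpbar fps) oo fps_of_poly f"
  define z where "z = fps_to_fls G ^ (CARD('p) ^ e)"
  have "\<beta> $ 1 = fps_to_fls G" by (simp add: \<beta>_def G_def ah_quot_first[OF F0, simplified])
  hence z: "z \<in> ratfun_in f" using e[rule_format, of 1] by (simp add: z_def K_def)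
  have "z - z ^ CARD('p) = (fps_to_fls G - fps_to_fls G ^ CARD('p)) ^ (CARD('p) ^ e)"
  proof -
    have "(x - y) ^ (CARD('p) ^ e) = x ^ (CARD('p) ^ e) - y ^ (CARD('p) ^ e)" for x y :: "'p Fpbar fls"
    proof -
      have "(x - y + y) ^ (CARD('p) ^ e) = (x - y) ^ (CARD('p) ^ e) + y ^ (CARD('p) ^ e)"
        by (rule freshmans_dream') (simp_all add: prime_card)
      thus ?thesis by (simp only: diff_add_cancel add_diff_cancel_right')
    qed
    thus ?thesis by (simp add: z_def mult.commute flip: power_mult)
  qed
  also have "fps_to_fls G - fps_to_fls G ^ CARD('p) = poly_fls f"
    using ah_log_compose_artin_schreier[OF F0] by (simp add: G_def poly_fls_def flip: fps_to_fls_power fps_to_fls_minus)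
  also have "poly_fls f ^ (CARD('p) ^ e) = poly_fls (pcompose ([:0, 1:] ^ (CARD('p) ^ e)) f)"
    by (simp add: pcompose_hom.hom_power pcompose_pCons)
  finally obtain q :: "'p Fpbar poly" where q: "[:0, 1:] ^ (CARD('p) ^ e) = q - q ^ CARD('p)"
    using artin_schreier_ratfun_in[OF deg z] by blast
  have "frob_primitive_part ([:0, 1:] ^ (CARD('p) ^ e) :: 'p Fpbar poly) = 0"
  proof (rule poly_eqI)
    fix i
    define D where "D = max (Polynomial.degree q) (Polynomial.degree ([:0, 1:] ^ (CARD('p) ^ e) :: 'p Fpbar poly))"
    have "Polynomial.degree ([:0, 1:] ^ (CARD('p) ^ e) :: 'p Fpbar poly) \<le> Suc D" by (simp add: D_def)
    from coeff_frob_primitive_part[OF this, of i]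
    show "Polynomial.coeff (frob_primitive_part ([:0, 1:] ^ (CARD('p) ^ e) :: 'p Fpbar poly)) i = Polynomial.coeff 0 i"
      using prim_coeff_artin_schreier[of i q D] by (simp add: q D_def)
  qed
  thus False using frob_primitive_part_X_power by blast
qed

section \<open>The arithmetic conditions\<close>

lemma of_int_eq_0_iff_CHAR_dvd: "(of_int k :: 'a :: ring_1) = 0 \<longleftrightarrow> int CHAR('a) dvd k"
proof -
  obtain n where "k = int n \<or> k = - int n" using int_cases2 by blast
  thus ?thesis by (auto simp: of_nat_eq_0_iff_char_dvd)
qed

text \<open>On series with constant term 1 the first coefficient is a homomorphism to the additive
  group.\<close>

lemma fps_prod_power_int_nth_1:
  fixes g :: "'i \<Rightarrow> 'a :: field fps"
  assumes "\<And>i. i \<in> I \<Longrightarrow> g i $ 0 = 1"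
  shows "(\<Prod>i\<in>I. g i powi e i) $ 1 = (\<Sum>i\<in>I. of_int (e i) * g i $ 1)"
proof -
  have mult: "(u * v) $ 1 = u $ 0 * v $ 1 + u $ 1 * v $ 0" for u v :: "'a fps"
    by (simp add: fps_mult_nth)
  have nat: "(h ^ n) $ 1 = of_nat n * h $ 1" if "h $ 0 = 1" for h :: "'a fps" and n
    by (induction n) (simp_all add: mult that fps_power_zeroth_eq_one algebra_simps)
  have "(h powi n) $ 1 = of_int n * h $ 1" if h: "h $ 0 = 1" for h :: "'a fps" and n
  proof (cases "n \<ge> 0")
    case True
    thus ?thesis by (simp add: power_int_def nat[OF h, simplified])
  next
    case False
    have "inverse h * h = 1" using h by (intro inverse_mult_eq_1) simp
    hence "(inverse h * h) $ 1 = 0" by simp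
    hence "inverse h $ 1 = - h $ 1" using h by (simp add: mult eq_neg_iff_add_eq_0 add.commute)
    thus ?thesis using False h nat[of "inverse h" "nat (- n)", simplified] by (simp add: power_int_def)
  qed
  with assms show ?thesis
  proof (induction I rule: infinite_finite_induct)
    case (insert x I)
    have "(\<Prod>i\<in>I. g i powi e i) $ 0 = 1"
      using insert.prems by (intro fps_prod_nth_0 fps_power_int_nth_0) auto
    thus ?case using insert by (simp add: mult fps_power_int_nth_0 add.commute)
  qed auto
qed

text \<open>Primitive coefficients are F_p-linear, once a common cut-off is fixed, and vanish on q -
  q^p.\<close>

lemma sum_primitive_parts_eq_0:
  fixes f :: "nat \<Rightarrow> 'p :: prime_card Fpbar poly"
  assumes "(\<Sum>i<r. Polynomial.smult (to_ac (a i)) (f i)) = q - q ^ CARD('p)"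
  shows "(\<Sum>i<r. Polynomial.smult (to_ac (a i)) (frob_primitive_part (f i))) = 0"
proof (rule poly_eqI)
  fix n
  define d where "d = Polynomial.degree q + (\<Sum>i<r. Polynomial.degree (f i))"
  have deg: "Polynomial.degree (f i) \<le> Suc d" if "i < r" for i
    using member_le_sum[of i "{..<r}" "\<lambda>i. Polynomial.degree (f i)"] that by (simp add: d_def)
  have "Polynomial.coeff (\<Sum>i<r. Polynomial.smult (to_ac (a i)) (frob_primitive_part (f i))) n =
    (\<Sum>i<r. if CARD('p) dvd n then 0 else prim_coeff (Suc d) (Polynomial.smult (to_ac (a i)) (f i)) n)"
    unfolding coeff_sum
    by (rule sum.cong[OF refl]) (simp add: coeff_frob_primitive_part[OF deg] prim_coeff_scale)
  also have "\<dots> = (if CARD('p) dvd n then 0 else prim_coeff (Suc d) (q - q ^ CARD('p)) n)"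
    by (simp flip: assms prim_coeff_sum)
  also have "\<dots> = 0" using prim_coeff_artin_schreier[of n q d] by (simp add: d_def)
  finally show "Polynomial.coeff (\<Sum>i<r. Polynomial.smult (to_ac (a i)) (frob_primitive_part (f i))) n = Polynomial.coeff 0 n"
    by simp
qed

context ah_family
begin

text \<open>The coefficient of v is z = sum of e_i G_i with G_i - G_i^p = f_i. As z lies in k(x),
  the sum of the e_i f_i has the form q - q^p with a polynomial q, which yields a relation between
  the primitive parts.\<close>

lemma bet_prod_over_imp_dvd:
  assumes indep: "Fp_lin_independent r (\<lambda>i. frob_primitive_part (f i))"
    and e: "bet_prod e \<in> fps_over ratfun" and i: "i < r"
  shows "int CARD('p) dvd e i"
proof -
  define G where "G i = (ah_log :: 'p Fpbar fps) oo fps_of_poly (f i)" for i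
  define z where "z = (\<Sum>i<r. of_int (e i) * G i)"
  have p: "prime CHAR('p Fpbar fps)" "CARD('p) = CHAR('p Fpbar fps)"
    using prime_CHAR_Fpbar[where 'p = 'p] by simp_all
  \<comment> \<open>Integers act through F_p, where each is represented by a natural number.\<close>
  have oi: "(of_int k :: 'p Fpbar fps) ^ CARD('p) = of_int k" for k
  proof -
    obtain j where "(of_int k :: 'p mod_ring) = of_nat j" using surj_of_nat_mod_ring[of "of_int k"] by blast
    hence "to_ac (of_int k :: 'p mod_ring) = to_ac (of_nat j)" by simp
    hence "(of_int k :: 'p Fpbar) = of_nat j" by simp
    hence "fps_const (of_int k :: 'p Fpbar) = fps_const (of_nat j)" by simp
    hence "(of_int k :: 'p Fpbar fps) = of_nat j" by (simp add: fps_of_int fps_of_nat)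
    thus ?thesis using of_nat_power_CHAR[OF p(1), of j] by simp
  qed
  have bet1: "bet i $ 1 = fps_to_fls (G i)" if "i < r" for i
    using ah_quot_first[OF f_nth_0[OF that]] by (simp add: bet_def G_def)
  have "bet_prod e $ 1 = (\<Sum>i<r. of_int (e i) * bet i $ 1)"
    unfolding bet_prod_def by (rule fps_prod_power_int_nth_1) (simp add: bet_nth_0)
  also have "\<dots> = fps_to_fls z"
    unfolding z_def fps_to_fls_sum by (rule sum.cong[OF refl]) (simp add: bet1[simplified] fls_times_fps_to_fls)
  finally have zr: "fps_to_fls z \<in> ratfun" using e by (metis fps_overD)
  define g where "g = (\<Sum>i<r. Polynomial.smult (to_ac (of_int (e i))) (f i))"
  have "z - z ^ CARD('p) = (\<Sum>i<r. of_int (e i) * (G i - G i ^ CARD('p)))"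
    unfolding z_def freshmans_dream_sum[OF p] power_mult_distrib oi
    by (simp add: sum_subtractf right_diff_distrib)
  also have "\<dots> = (\<Sum>i<r. of_int (e i) * fps_of_poly (f i))"
  proof (rule sum.cong[OF refl])
    fix i assume "i \<in> {..<r}"
    hence "fps_of_poly (f i) $ 0 = 0" by (intro f_nth_0) simp
    thus "of_int (e i) * (G i - G i ^ CARD('p)) = of_int (e i) * fps_of_poly (f i)"
      unfolding G_def by (simp only: ah_log_compose_artin_schreier)
  qed
  also have "\<dots> = fps_of_poly g"
    unfolding g_def fps_of_poly_sum
    by (rule sum.cong[OF refl]) (simp add: fps_of_poly_smult fps_of_int)
  finally have "fps_to_fls (z - z ^ CARD('p)) = poly_fls g" by (simp add: poly_fls_def)
  hence "fps_to_fls z - fps_to_fls z ^ CARD('p) = poly_fls (pcompose g [:0, 1:])"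
    by (simp add: fps_to_fls_power pcompose_idR)
  then obtain q where "g = q - q ^ CARD('p)"
    using artin_schreier_ratfun_in[OF _ zr] by auto
  hence "(\<Sum>i<r. Polynomial.smult (to_ac (of_int (e i))) (frob_primitive_part (f i))) = 0"
    unfolding g_def by (rule sum_primitive_parts_eq_0)
  hence "(of_int (e i) :: 'p mod_ring) = 0"
    using indep i unfolding Fp_lin_independent_iff by (elim allE[of _ "\<lambda>i. of_int (e i)"]) simp
  thus ?thesis by (simp add: of_int_eq_0_iff_CHAR_dvd)
qed

end

text \<open>Infinite descent: dividing a nonzero member of \<open>U\<close> by p stays in
  \<open>U\<close> and lowers the sum of absolute values.\<close>

lemma int_family_eq_0_of_dvd:
  fixes e :: "nat \<Rightarrow> int"
  assumes p: "p > 1" and U: "U e"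
    and dvd: "\<And>e i. U e \<Longrightarrow> i < r \<Longrightarrow> int p dvd e i"
    and div: "\<And>e e'. U e \<Longrightarrow> (\<And>i. i < r \<Longrightarrow> e i = e' i * int p) \<Longrightarrow> U e'"
  shows "\<forall>i<r. e i = 0"
  using U
proof (induction "\<Sum>i<r. nat \<bar>e i\<bar>" arbitrary: e rule: less_induct)
  case (less e)
  define e' where "e' i = e i div int p" for i
  have e': "e i = e' i * int p" if "i < r" for i using dvd[OF less.prems that] by (simp add: e'_def)
  have U': "U e'" using div[OF less.prems e'] by blast
  show ?case
  proof (rule ccontr)
    assume "\<not> (\<forall>i<r. e i = 0)"
    then obtain i where i: "i < r" "e i \<noteq> 0" by blast
    have lt: "nat \<bar>e' j\<bar> < nat \<bar>e j\<bar>" if "j < r" "e j \<noteq> 0" for j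
    proof -
      have "\<bar>e' j\<bar> > 0" using e'[OF that(1)] that(2) by auto
      hence "\<bar>e' j\<bar> * 1 < \<bar>e' j\<bar> * int p" using p by (intro mult_strict_left_mono) auto
      also have "\<dots> = \<bar>e j\<bar>" by (simp add: e'[OF that(1)] abs_mult)
      finally show ?thesis by simp
    qed
    have "(\<Sum>i<r. nat \<bar>e' i\<bar>) < (\<Sum>i<r. nat \<bar>e i\<bar>)"
    proof (rule sum_strict_mono_ex1)
      show "\<forall>j\<in>{..<r}. nat \<bar>e' j\<bar> \<le> nat \<bar>e j\<bar>"
      proof
        fix j assume "j \<in> {..<r}"
        thus "nat \<bar>e' j\<bar> \<le> nat \<bar>e j\<bar>" using lt[of j] e'[of j] p by (cases "e j = 0") auto
      qed
    qed (use lt[OF i] i in auto)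
    hence "\<forall>i<r. e' i = 0" using less.hyps U' by blast
    thus False using e'[OF i(1)] i by simp
  qed
qed

lemma finite_mspan:
  assumes "finite K" "finite B"
  shows "finite (mspan K B)"
proof (rule finite_subset)
  show "mspan K B \<subseteq> (\<lambda>c. \<Sum>b\<in>B. c b * b) ` (\<Pi>\<^sub>E b\<in>B. K)"
  proof
    fix z assume "z \<in> mspan K B"
    then obtain c where c: "\<forall>b\<in>B. c b \<in> K" "z = (\<Sum>b\<in>B. c b * b)" by (elim mspanE)
    have "z = (\<Sum>b\<in>B. restrict c B b * b)" unfolding c(2) by (rule sum.cong[OF refl]) simp
    thus "z \<in> (\<lambda>c. \<Sum>b\<in>B. c b * b) ` (\<Pi>\<^sub>E b\<in>B. K)"
      by (rule image_eqI[where x = "restrict c B"]) (use c(1) in auto)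
  qed
  show "finite ((\<lambda>c. \<Sum>b\<in>B. c b * b) ` (\<Pi>\<^sub>E b\<in>B. K))"
    using assms by (intro finite_imageI finite_PiE) auto
qed

text \<open>x lies in a finite ring, so its powers repeat; the least exponent is prime to p because
  1 has only one p-th root. Used to dispose of leading coefficients.\<close>

lemma Fpbar_root_of_unity:
  fixes x :: "'p :: prime_card Fpbar"
  assumes "x \<noteq> 0"
  shows "\<exists>N>0. x ^ N = 1 \<and> \<not> CARD('p) dvd N"
proof -
  define K where "K = range (to_ac :: 'p mod_ring \<Rightarrow> 'p Fpbar)"
  have K: "is_subfield K"
    unfolding is_subfield_def is_subring_def K_def
    by (auto simp flip: to_ac_diff to_ac_mult to_ac_inverse to_ac_1)
  obtain q :: "'p mod_ring poly" where q: "q \<noteq> 0" "poly (map_poly to_ac q) x = 0"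
    by (rule alg_closure_algebraic)
  define c where "c l = Polynomial.coeff (map_poly (to_ac :: 'p mod_ring \<Rightarrow> 'p Fpbar) q) l" for l
  have c: "c l = to_ac (Polynomial.coeff q l)" for l by (simp add: c_def coeff_map_poly)
  have "(\<Sum>l\<le>Polynomial.degree (map_poly (to_ac :: 'p mod_ring \<Rightarrow> 'p Fpbar) q). c l * x ^ l) = 0"
    using q(2) by (simp add: poly_altdef c_def)
  moreover have "Polynomial.degree (map_poly (to_ac :: 'p mod_ring \<Rightarrow> 'p Fpbar) q) = Polynomial.degree q"
    by (rule degree_map_poly) simp
  ultimately have "\<exists>M. fin_over K M \<and> x \<in> M"
    using q(1) by (intro fin_over_algebraic[OF K, of "Polynomial.degree q" c]) (auto simp: c K_def intro!: exI[of _ "Polynomial.degree q"])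
  then obtain M where M: "fin_over K M" "x \<in> M" by blast
  then obtain B where "finite B" "M = mspan K B" by (auto simp: fin_over_def)
  hence "finite M" using finite_mspan[of K B] by (simp add: K_def)
  moreover have "x ^ n \<in> M" for n using M by (intro subring_power) (auto simp: fin_over_def)
  ultimately have "finite (range (\<lambda>n. x ^ n))" by (intro finite_subset[of "range (\<lambda>n. x ^ n)" M]) auto
  hence "\<not> inj (\<lambda>n. x ^ n)" using finite_imageD infinite_UNIV_nat by blast
  then obtain a b where ab: "a < b" "x ^ a = x ^ b" unfolding inj_on_def by (metis linorder_neqE_nat)
  have "x ^ a * x ^ (b - a) = x ^ a * 1" unfolding power_add[symmetric] using ab by simp
  hence "x ^ (b - a) = 1" using assms by simp
  hence ex: "\<exists>N. N > 0 \<and> x ^ N = 1" using ab by (intro exI[of _ "b - a"]) simp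
  define N where "N = (LEAST N. N > 0 \<and> x ^ N = 1)"
  have N: "N > 0" "x ^ N = 1" using LeastI_ex[OF ex] by (simp_all add: N_def)
  have "\<not> CARD('p) dvd N"
  proof
    assume "CARD('p) dvd N"
    then obtain k where k: "N = CARD('p) * k" by blast
    have "(x ^ k) ^ (CARD('p) ^ 1) = 1" using N(2) by (simp add: k mult.commute flip: power_mult)
    moreover have "(1 :: 'p Fpbar) ^ (CARD('p) ^ 1) = 1" by simp
    ultimately have "x ^ k = 1" using frob_root_ex1[of 1 "1 :: 'p Fpbar"] by blast
    moreover have "k > 0" using N(1) k by (cases k) auto
    ultimately have "N \<le> k" unfolding N_def by (intro Least_le) simp
    moreover have "k * 1 < k * CARD('p)"
      using \<open>k > 0\<close> prime_gt_1_nat[OF prime_card[where 'a = 'p]] by (intro mult_strict_left_mono) auto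
    ultimately show False by (simp add: k mult.commute)
  qed
  thus ?thesis using N by blast
qed

text \<open>Elimination without division: a pivot row \<open>i1\<close> is cleared from the other
  rows, and the solution found for them is corrected at position \<open>q1\<close> so that it
  annihilates \<open>i1\<close> as well.\<close>

lemma dual_functional:
  fixes v :: "'i \<Rightarrow> 'q \<Rightarrow> int"
  assumes Q: "finite Q" and I: "finite I" "i0 \<in> I"
    and indep: "\<And>c. \<forall>q\<in>Q. (\<Sum>i\<in>I. c i * v i q) = 0 \<Longrightarrow> \<forall>i\<in>I. c i = 0"
  shows "\<exists>t D. D \<noteq> 0 \<and> (\<forall>i\<in>I. (\<Sum>q\<in>Q. v i q * t q) = (if i = i0 then D else 0))"
  using I indep
proof (induction "card I" arbitrary: I v rule: less_induct)
  case (less I v)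
  have nz: "\<exists>q\<in>Q. v i q \<noteq> 0" if i: "i \<in> I" for i
  proof (rule ccontr)
    assume "\<not> (\<exists>q\<in>Q. v i q \<noteq> 0)"
    hence "\<forall>q\<in>Q. (\<Sum>k\<in>I. (if k = i then 1 else 0) * v k q) = 0"
      by (auto simp: if_distrib[of "\<lambda>x. x * _"] sum.delta[OF less.prems(1)] cong: if_cong)
    from less.prems(3)[OF this] i show False by (auto split: if_splits)
  qed
  show ?case
  proof (cases "I = {i0}")
    case True
    obtain q where q: "q \<in> Q" "v i0 q \<noteq> 0" using nz less.prems(2) by blast
    have "(\<Sum>q'\<in>Q. v i0 q' * (if q' = q then 1 else 0)) = (\<Sum>q'\<in>Q. if q' = q then v i0 q else 0)"
      by (rule sum.cong) auto
    hence "(\<Sum>q'\<in>Q. v i0 q' * (if q' = q then 1 else 0)) = v i0 q" using q Q by simp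
    thus ?thesis using q True
      by (intro exI[of _ "\<lambda>q'. if q' = q then 1 else 0"] exI[of _ "v i0 q"]) simp
  next
    case False
    then obtain i1 where i1: "i1 \<in> I" "i1 \<noteq> i0" using less.prems(2) by blast
    obtain q1 where q1: "q1 \<in> Q" "v i1 q1 \<noteq> 0" using nz i1 by blast
    define P where "P = v i1 q1"
    define J where "J = I - {i1}"
    define w where "w i q = P * v i q - v i q1 * v i1 q" for i q
    have IJ: "I = insert i1 J" "i1 \<notin> J" "finite J" using i1 less.prems(1) by (auto simp: J_def)
    have "\<forall>i\<in>J. c i = 0" if c: "\<forall>q\<in>Q. (\<Sum>i\<in>J. c i * w i q) = 0" for c
    proof -
      define c' where "c' i = (if i = i1 then - (\<Sum>k\<in>J. c k * v k q1) else c i * P)" for i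
      have "(\<Sum>i\<in>I. c' i * v i q) = 0" if q: "q \<in> Q" for q
      proof -
        have "(\<Sum>i\<in>J. c' i * v i q) = (\<Sum>i\<in>J. c i * P * v i q)"
          by (rule sum.cong[OF refl]) (use IJ(2) in \<open>auto simp: c'_def\<close>)
        moreover have "(\<Sum>i\<in>J. c i * w i q) = (\<Sum>i\<in>J. c i * P * v i q) - (\<Sum>k\<in>J. c k * v k q1) * v i1 q"
        proof -
          have "(\<Sum>i\<in>J. c i * w i q) = (\<Sum>i\<in>J. c i * P * v i q - c i * v i q1 * v i1 q)"
            by (rule sum.cong[OF refl]) (simp add: w_def algebra_simps)
          thus ?thesis by (simp add: sum_subtractf sum_distrib_right)
        qed
        ultimately show ?thesis using c q IJ by (simp add: c'_def)
      qed
      from less.prems(3)[of c'] this have "\<forall>i\<in>I. c' i = 0" by blast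
      hence "c' i = 0" if "i \<in> J" for i using that IJ(1) by blast
      moreover have "c' i = c i * P" if "i \<in> J" for i using that IJ(2) by (auto simp: c'_def)
      ultimately show ?thesis using q1(2) by (auto simp: P_def)
    qed
    moreover have "card J < card I" using IJ by simp
    ultimately have "\<exists>t D. D \<noteq> 0 \<and> (\<forall>i\<in>J. (\<Sum>q\<in>Q. w i q * t q) = (if i = i0 then D else 0))"
      using IJ(3) i1 less.prems(2) by (intro less.hyps) (auto simp: J_def)
    then obtain t D where D: "D \<noteq> 0" and t: "\<And>i. i \<in> J \<Longrightarrow> (\<Sum>q\<in>Q. w i q * t q) = (if i = i0 then D else 0)"
      by blast
    define T where "T = (\<Sum>q\<in>Q. v i1 q * t q)"
    define t' where "t' q = P * t q - (if q = q1 then T else 0)" for q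
    have dot: "(\<Sum>q\<in>Q. x q * t' q) = P * (\<Sum>q\<in>Q. x q * t q) - x q1 * T" for x
    proof -
      have "(\<Sum>q\<in>Q. x q * t' q) = (\<Sum>q\<in>Q. P * (x q * t q) - (if q = q1 then x q1 * T else 0))"
        by (rule sum.cong[OF refl]) (auto simp: t'_def algebra_simps)
      thus ?thesis using q1 Q by (simp add: sum_subtractf sum_distrib_left)
    qed
    have "(\<Sum>q\<in>Q. v i q * t' q) = (if i = i0 then D else 0)" if "i \<in> I" for i
    proof (cases "i = i1")
      case True
      thus ?thesis using i1 by (simp add: dot T_def P_def)
    next
      case False
      hence "i \<in> J" using that IJ by blast
      have "(\<Sum>q\<in>Q. w i q * t q) = P * (\<Sum>q\<in>Q. v i q * t q) - v i q1 * T"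
        by (simp add: w_def T_def sum_subtractf sum_distrib_left algebra_simps)
      thus ?thesis using t[OF \<open>i \<in> J\<close>] by (simp add: dot)
    qed
    thus ?thesis using D by blast
  qed
qed

context ah_family
begin

text \<open>If c is orthogonal to all multiplicity vectors, the product of the f_i^(c_i) is a
  constant, and an exponent prime to p turns it into 1. The hypothesis then makes all c_i divisible
  by p, and infinite descent applies.\<close>

lemma multiplicities_independent:
  assumes hyp: "\<And>n :: nat \<Rightarrow> int. (\<Prod>i<r. Fraction_Field.Fract (f i) 1 powi n i) = 1 \<Longrightarrow> \<forall>i<r. int CARD('p) dvd n i"
    and c: "\<forall>\<alpha>\<in>A. (\<Sum>i<r. c i * int (m i \<alpha>)) = 0"
  shows "\<forall>i<r. c i = 0"
proof (rule int_family_eq_0_of_dvd[where p = "CARD('p)" and U = "\<lambda>c. \<forall>\<alpha>\<in>A. (\<Sum>i<r. c i * int (m i \<alpha>)) = 0"])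
  have P: "CARD('p) > 1" using prime_gt_1_nat[OF prime_card[where 'a = 'p]] by simp
  show "CARD('p) > 1" by fact
  show "\<forall>\<alpha>\<in>A. (\<Sum>i<r. e' i * int (m i \<alpha>)) = 0"
    if e: "\<forall>\<alpha>\<in>A. (\<Sum>i<r. e i * int (m i \<alpha>)) = 0" and e': "\<And>i. i < r \<Longrightarrow> e i = e' i * int CARD('p)" for e e'
  proof
    fix \<alpha> assume "\<alpha> \<in> A"
    have "(\<Sum>i<r. e i * int (m i \<alpha>)) = int CARD('p) * (\<Sum>i<r. e' i * int (m i \<alpha>))"
      unfolding sum_distrib_left by (rule sum.cong[OF refl]) (simp add: e')
    thus "(\<Sum>i<r. e' i * int (m i \<alpha>)) = 0" using e \<open>\<alpha> \<in> A\<close> P by simp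
  qed
  show "int CARD('p) dvd e j" if e: "\<forall>\<alpha>\<in>A. (\<Sum>i<r. e i * int (m i \<alpha>)) = 0" and j: "j < r" for e j
  proof -
    define l where "l i = Polynomial.lead_coeff (f i)" for i
    have "\<forall>i. \<exists>N. i < r \<longrightarrow> N > 0 \<and> l i ^ N = 1 \<and> \<not> CARD('p) dvd N"
      using Fpbar_root_of_unity nonzero by (metis l_def leading_coeff_0_iff)
    then obtain N where N: "\<And>i. i < r \<Longrightarrow> l i ^ N i = 1 \<and> \<not> CARD('p) dvd N i" by metis
    \<comment> \<open>One exponent for all leading coefficients; as a product of numbers prime to p
      it is prime to p.\<close>
    define NN where "NN = (\<Prod>i<r. N i)"
    have lN: "l i ^ NN = 1" if "i < r" for i
    proof -
      have "N i dvd NN" unfolding NN_def using that by (intro dvd_prodI) auto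
      then obtain k where "NN = N i * k" by blast
      thus ?thesis using N[OF that] by (simp add: power_mult)
    qed
    have pNN: "\<not> CARD('p) dvd NN"
      unfolding NN_def using N by (subst prime_dvd_prod_iff) (auto simp: prime_card)
    define T where "T = (to_fract :: 'p Fpbar poly \<Rightarrow> _)"
    have T: "T (a * b) = T a * T b" "T 1 = 1" for a b by (simp_all add: T_def)
    have Tpow: "T (a ^ k) = T a ^ k" for a k by (induction k) (simp_all add: T)
    have Tprod: "T (prod h B) = (\<Prod>b\<in>B. T (h b))" for h and B :: "'p Fpbar set"
      by (induction B rule: infinite_finite_induct) (simp_all add: T)
    have fT: "Fraction_Field.Fract (f i) 1 = T [:l i:] * (\<Prod>\<alpha>\<in>A. T [:- \<alpha>, 1:] ^ m i \<alpha>)" if "i < r" for i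
    proof -
      have "f i = [:l i:] * (\<Prod>\<alpha>\<in>A. [:- \<alpha>, 1:] ^ m i \<alpha>)"
        using factors[OF that] by (simp add: l_def)
      hence "T (f i) = T ([:l i:] * (\<Prod>\<alpha>\<in>A. [:- \<alpha>, 1:] ^ m i \<alpha>))" by (rule arg_cong)
      also have "\<dots> = T [:l i:] * (\<Prod>\<alpha>\<in>A. T [:- \<alpha>, 1:] ^ m i \<alpha>)" by (simp only: T Tprod Tpow)
      finally show ?thesis by (simp add: T_def Fract_conv_to_fract)
    qed
    define n where "n i = int NN * e i" for i
    have "(\<Prod>i<r. Fraction_Field.Fract (f i) 1 powi n i) = (\<Prod>i<r. \<Prod>\<alpha>\<in>A. T [:- \<alpha>, 1:] powi (n i * int (m i \<alpha>)))"
    proof (rule prod.cong[OF refl])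
      fix i assume "i \<in> {..<r}"
      hence i: "i < r" by simp
      have "T [:l i:] ^ NN = 1"
        unfolding Tpow[symmetric] using lN[OF i] T(2) by (simp add: poly_const_pow flip: one_pCons)
      hence "T [:l i:] powi n i = 1" by (simp add: n_def power_int_mult)
      moreover have "(\<Prod>\<alpha>\<in>B. T [:- \<alpha>, 1:] ^ m i \<alpha>) powi n i = (\<Prod>\<alpha>\<in>B. T [:- \<alpha>, 1:] powi (n i * int (m i \<alpha>)))"
        for B :: "'p Fpbar set"
        by (induction B rule: infinite_finite_induct)
          (simp_all add: power_int_mult_distrib power_int_mult mult.commute[of "n i"])
      ultimately show "Fraction_Field.Fract (f i) 1 powi n i = (\<Prod>\<alpha>\<in>A. T [:- \<alpha>, 1:] powi (n i * int (m i \<alpha>)))"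
        by (simp add: fT[OF i] power_int_mult_distrib)
    qed
    also have "\<dots> = (\<Prod>\<alpha>\<in>A. \<Prod>i<r. T [:- \<alpha>, 1:] powi (n i * int (m i \<alpha>)))" by (rule prod.swap)
    also have "\<dots> = (\<Prod>\<alpha>\<in>A. T [:- \<alpha>, 1:] powi (\<Sum>i<r. n i * int (m i \<alpha>)))"
    proof (rule prod.cong[OF refl])
      fix \<alpha>
      have "T [:- \<alpha>, 1:] \<noteq> 0" by (simp add: T_def)
      thus "(\<Prod>i<r. T [:- \<alpha>, 1:] powi (n i * int (m i \<alpha>))) = T [:- \<alpha>, 1:] powi (\<Sum>i<r. n i * int (m i \<alpha>))"
        by (induction r) (simp_all add: power_int_add)
    qed
    also have "\<dots> = 1"
    proof (rule prod.neutral, rule ballI)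
      fix \<alpha> assume "\<alpha> \<in> A"
      have "(\<Sum>i<r. n i * int (m i \<alpha>)) = int NN * (\<Sum>i<r. e i * int (m i \<alpha>))"
        by (simp add: n_def sum_distrib_left mult.assoc)
      thus "T [:- \<alpha>, 1:] powi (\<Sum>i<r. n i * int (m i \<alpha>)) = 1" using e \<open>\<alpha> \<in> A\<close> by simp
    qed
    finally have "(\<Prod>i<r. Fraction_Field.Fract (f i) 1 powi n i) = 1" .
    from hyp[OF this] j have "int CARD('p) dvd n j" by blast
    hence "int CARD('p) dvd int NN * e j" by (simp only: n_def)
    moreover have "prime (int CARD('p))" using prime_card[where 'a = 'p] by simp
    ultimately show ?thesis using pNN by (simp add: prime_dvd_mult_iff)
  qed
qed (use c in blast)

text \<open>The root \<alpha> = 0 is common to all f_i. Admissible exponent vectors are divisible by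
  p and saturated, hence zero, and m i 0 > 0.\<close>

lemma root_exponents_zero_1:
  assumes indep: "Fp_lin_independent r (\<lambda>i. frob_primitive_part (f i))"
    and n: "\<forall>\<alpha>\<in>A. bet_prod (\<lambda>i. n i * int (m i \<alpha>)) \<in> fps_over ratfun" and i: "i < r"
  shows "n i = 0"
proof -
  have P: "CARD('p) > 1" using prime_gt_1_nat[OF prime_card[where 'a = 'p]] by simp
  have "\<forall>i<r. n i * int (m i 0) = 0"
  proof (rule int_family_eq_0_of_dvd[OF P, where U = "\<lambda>e. bet_prod e \<in> fps_over ratfun"])
    show "bet_prod (\<lambda>i. n i * int (m i 0)) \<in> fps_over ratfun" using n root_mult[OF i] by blast
    show "int CARD('p) dvd e j" if "bet_prod e \<in> fps_over ratfun" "j < r" for e j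
      by (rule bet_prod_over_imp_dvd[OF indep that])
    show "bet_prod e' \<in> fps_over ratfun"
      if e: "bet_prod e \<in> fps_over ratfun" and e': "\<And>i. i < r \<Longrightarrow> e i = e' i * int CARD('p)" for e e'
    proof (rule bet_prod_over_saturated)
      have "bet_prod (\<lambda>i. e' i * int CARD('p)) = bet_prod e"
        unfolding bet_prod_def by (rule prod.cong[OF refl]) (simp add: e')
      thus "bet_prod (\<lambda>i. e' i * int CARD('p)) \<in> fps_over ratfun" using e by simp
    qed simp
  qed
  hence "n i * int (m i 0) = 0" using i by blast
  thus ?thesis using root_mult[OF i] by simp
qed

text \<open>A dual vector t combines the relations for the various \<alpha> so that all \<beta>_k
  with k \<noteq> i cancel; saturation then removes the exponent n_i D.\<close>

lemma root_exponents_zero_2: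
  assumes hyp: "\<And>n :: nat \<Rightarrow> int. (\<Prod>i<r. Fraction_Field.Fract (f i) 1 powi n i) = 1 \<Longrightarrow> \<forall>i<r. int CARD('p) dvd n i"
    and n: "\<forall>\<alpha>\<in>A. bet_prod (\<lambda>i. n i * int (m i \<alpha>)) \<in> fps_over ratfun" and i: "i < r"
  shows "n i = 0"
proof (rule ccontr)
  assume ni: "n i \<noteq> 0"
  have "\<exists>t D. D \<noteq> 0 \<and> (\<forall>k\<in>{..<r}. (\<Sum>\<alpha>\<in>A. int (m k \<alpha>) * t \<alpha>) = (if k = i then D else 0))"
    using multiplicities_independent[OF hyp] i by (intro dual_functional[OF finA]) auto
  then obtain t D where D: "D \<noteq> 0" and t: "\<And>k. k < r \<Longrightarrow> (\<Sum>\<alpha>\<in>A. int (m k \<alpha>) * t \<alpha>) = (if k = i then D else 0)"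
    by auto
  define \<delta> where "\<delta> k = (if k = i then 1 else 0 :: int)" for k
  have "bet_prod (\<lambda>k. \<Sum>\<alpha>\<in>A. n k * int (m k \<alpha>) * t \<alpha>) \<in> fps_over ratfun"
    using n by (intro bet_prod_over_sum finA) blast
  also have "bet_prod (\<lambda>k. \<Sum>\<alpha>\<in>A. n k * int (m k \<alpha>) * t \<alpha>) = bet_prod (\<lambda>k. \<delta> k * (n i * D))"
    unfolding bet_prod_def
  proof (rule prod.cong[OF refl])
    fix k assume "k \<in> {..<r}"
    hence "(\<Sum>\<alpha>\<in>A. n k * int (m k \<alpha>) * t \<alpha>) = n k * (if k = i then D else 0)"
      using t[of k] by (simp add: mult.assoc flip: sum_distrib_left)
    thus "bet k powi (\<Sum>\<alpha>\<in>A. n k * int (m k \<alpha>) * t \<alpha>) = bet k powi (\<delta> k * (n i * D))"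
      by (auto simp: \<delta>_def)
  qed
  finally have "bet_prod \<delta> \<in> fps_over ratfun"
    using D ni by (intro bet_prod_over_saturated[of \<delta> "n i * D"]) auto
  also have "bet_prod \<delta> = bet i"
  proof -
    have "bet_prod \<delta> = (\<Prod>k<r. if k = i then bet i else 1)"
      unfolding bet_prod_def by (rule prod.cong[OF refl]) (auto simp: \<delta>_def power_int_def)
    thus ?thesis using i by simp
  qed
  finally show False using bet_not_over_ratfun[OF nonzero root, of i] i by (simp add: bet_def)
qed

end

theorem theorem1p3:
  fixes f :: "nat \<Rightarrow> 'p :: prime_card mod_ring alg_closure poly" and r :: nat
  assumes "\<And>i. i < r \<Longrightarrow> [:0, 1:] dvd f i \<and> f i \<noteq> 0"
    and "Fp_lin_independent r (\<lambda>i. frob_primitive_part (f i)) \<or>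
      ((\<exists>i<r. frob_primitive_part (f i) \<noteq> 0) \<and>
       (\<forall>n :: nat \<Rightarrow> int.
          (\<Prod>i<r. Fraction_Field.Fract (f i) 1 powi n i) \<in> (\<lambda>h. h ^ CARD('p)) ` Fp_ratfuns \<longrightarrow>
          (\<forall>i<r. int CARD('p) dvd n i)))"
  shows "alg_independent (\<lambda>a :: 'p mod_ring poly. fps_of_poly (map_poly to_ac a)) r
    (\<lambda>i. artin_hasse_subst (f i))"
  unfolding alg_independent_def
proof (intro allI impI)
  fix Q :: "(nat \<Rightarrow>\<^sub>0 nat) \<Rightarrow>\<^sub>0 'p mod_ring poly"
  assume keys: "\<forall>l\<in>Poly_Mapping.keys Q. Poly_Mapping.keys l \<subseteq> {..<r}"
    and rel: "(\<Sum>l\<in>Poly_Mapping.keys Q. fps_of_poly (map_poly to_ac (Poly_Mapping.lookup Q l)) *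
      (\<Prod>i<r. artin_hasse_subst (f i) ^ Poly_Mapping.lookup l i)) = 0"
  have f: "f i \<noteq> 0" "poly (f i) 0 = 0" if "i < r" for i
    using assms(1)[OF that] poly_eq_0_iff_dvd[of "f i" 0] by auto
  \<comment> \<open>The multiplicities are chosen for all i before the common set A of roots is
    formed, which is why they must fit any larger set.\<close>
  have "\<forall>i. \<exists>m. i < r \<longrightarrow> finite {\<alpha>. m \<alpha> > 0} \<and> m 0 > 0 \<and>
    (\<forall>A. finite A \<longrightarrow> {\<alpha>. m \<alpha> > 0} \<subseteq> A \<longrightarrow>
      f i = Polynomial.smult (Polynomial.lead_coeff (f i)) (\<Prod>\<alpha>\<in>A. [:- \<alpha>, 1:] ^ m \<alpha>))"
  proof
    fix i
    show "\<exists>m. i < r \<longrightarrow> finite {\<alpha>. m \<alpha> > 0} \<and> m 0 > 0 \<and>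
      (\<forall>A. finite A \<longrightarrow> {\<alpha>. m \<alpha> > 0} \<subseteq> A \<longrightarrow>
        f i = Polynomial.smult (Polynomial.lead_coeff (f i)) (\<Prod>\<alpha>\<in>A. [:- \<alpha>, 1:] ^ m \<alpha>))"
    proof (cases "i < r")
      case True
      show ?thesis using poly_linear_factors[OF f(1)[OF True]] f(2)[OF True] by blast
    qed blast
  qed
  then obtain m where m: "\<forall>i. i < r \<longrightarrow> finite {\<alpha>. m i \<alpha> > 0} \<and> m i 0 > 0 \<and>
    (\<forall>A. finite A \<longrightarrow> {\<alpha>. m i \<alpha> > 0} \<subseteq> A \<longrightarrow>
      f i = Polynomial.smult (Polynomial.lead_coeff (f i)) (\<Prod>\<alpha>\<in>A. [:- \<alpha>, 1:] ^ m i \<alpha>))"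
    by (rule exE[OF choice])
  define A where "A = (\<Union>i<r. {\<alpha>. m i \<alpha> > 0})"
  interpret ah_family f r A m
  proof
    show A: "finite A" using m by (auto simp: A_def)
    fix i assume i: "i < r"
    have "{\<alpha>. m i \<alpha> > 0} \<subseteq> A" using i by (auto simp: A_def)
    thus "f i = Polynomial.smult (Polynomial.lead_coeff (f i)) (\<Prod>\<alpha>\<in>A. [:- \<alpha>, 1:] ^ m i \<alpha>)"
      using m i A by blast
    show "0 \<in> A \<and> m i 0 > 0" using m i by (auto simp: A_def)
    show "f i \<noteq> 0" "poly (f i) 0 = 0" using f[OF i] .
  qed
  show "Q = 0"
  proof (rule ccontr)
    assume "Q \<noteq> 0"
    hence ne: "Poly_Mapping.keys Q \<noteq> {}" by simp
    have "\<exists>n. (\<exists>i<r. n i \<noteq> 0) \<and> (\<forall>\<alpha>\<in>A. bet_prod (\<lambda>i. n i * int (m i \<alpha>)) \<in> fps_over ratfun)"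
    proof (rule relation_exponents[OF finite_keys ne _ _ _ rel])
      fix l assume l: "l \<in> Poly_Mapping.keys Q"
      have "map_poly (to_ac :: _ \<Rightarrow> 'p Fpbar) (Poly_Mapping.lookup Q l) \<noteq> 0"
        using l by (subst map_poly_eq_0_iff) (auto simp: in_keys_iff)
      thus "fps_of_poly (map_poly (to_ac :: _ \<Rightarrow> 'p Fpbar) (Poly_Mapping.lookup Q l)) \<noteq> 0" by simp
      show "fps_to_fls (fps_of_poly (map_poly (to_ac :: _ \<Rightarrow> 'p Fpbar) (Poly_Mapping.lookup Q l))) \<in> ratfun"
        using poly_fls_in_ratfun by (simp add: poly_fls_def)
      fix l' assume l': "l' \<in> Poly_Mapping.keys Q" "l \<noteq> l'"
      then obtain i where i: "Poly_Mapping.lookup l i \<noteq> Poly_Mapping.lookup l' i"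
        using poly_mapping_eqI[of l l'] by blast
      hence "i \<in> Poly_Mapping.keys l \<or> i \<in> Poly_Mapping.keys l'" by (auto simp: in_keys_iff)
      hence "i < r" using keys l l' by blast
      thus "\<exists>i<r. Poly_Mapping.lookup l i \<noteq> Poly_Mapping.lookup l' i" using i by blast
    qed
    then obtain n i where i: "i < r" "n i \<noteq> 0"
      and n: "\<forall>\<alpha>\<in>A. bet_prod (\<lambda>i. n i * int (m i \<alpha>)) \<in> fps_over ratfun" by blast
    from assms(2) show False
    proof
      assume "Fp_lin_independent r (\<lambda>i. frob_primitive_part (f i))"
      thus False using root_exponents_zero_1[OF _ n i(1)] i(2) by blast
    next
      assume h: "(\<exists>i<r. frob_primitive_part (f i) \<noteq> 0) \<and>
       (\<forall>n :: nat \<Rightarrow> int.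
          (\<Prod>i<r. Fraction_Field.Fract (f i) 1 powi n i) \<in> (\<lambda>h. h ^ CARD('p)) ` Fp_ratfuns \<longrightarrow>
          (\<forall>i<r. int CARD('p) dvd n i))"
      \<comment> \<open>Condition (2) is applied to monomials in the f_i that are equal to 1, the
        p-th power of 1.\<close>
      have "(1 :: 'p Fpbar poly fract) \<in> Fp_ratfuns"
        unfolding Fp_ratfuns_def
        by (intro CollectI exI[of _ 1]) (auto simp: One_fract_def)
      hence "(1 :: 'p Fpbar poly fract) \<in> (\<lambda>h. h ^ CARD('p)) ` Fp_ratfuns" by (rule rev_image_eqI) simp
      hence "\<forall>i<r. int CARD('p) dvd n' i" if "(\<Prod>i<r. Fraction_Field.Fract (f i) 1 powi n' i) = 1" for n' :: "nat \<Rightarrow> int"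
        using h that by simp
      thus False using root_exponents_zero_2[OF _ n i(1)] i(2) by blast
    qed
  qed
qed

end
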